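(* Let $A$ be a positive self-adjoint operator with compact inverse in a Hilbert space $H$, with eigenvalues $\{\lambda_n\}_{n=1}^\infty$ enumerated in non-decreasing order, and let $F:H\to H$ be globally Lipschitz with Lipschitz constant $L$ and $F(0)=0$. Assume that the numbers $L$, $\varepsilon\ge 0$ and $N\in\mathbb N$ satisfy $$\lambda_{N+1}-\lambda_N>2L,\qquad \frac1\varepsilon\ge 3\lambda_{N+1}+\lambda_N$$ (for $\varepsilon=0$ the second condition is regarded as satisfied). Then the equation $$\varepsilon\,\partial_t^2u+\partial_tu+Au=F(u)$$ possesses an $N$-dimensional inertial manifold $\mathcal M=\mathcal M_\varepsilon$, and this manifold is Lipschitz continuous with respect to $\varepsilon$ at $\varepsilon=0$.
   Context: Let $\{e_n\}$ be the complete orthonormal system of eigenvectors of $A$, $Ae_n=\lambda_ne_n$; $P_Nu=\sum_{n=1}^N(u,e_n)e_n$. For $s\in\mathbb R$, $H^s=D(A^{s/2})$ with $\|u\|_{H^s}^2=\sum_n\lambda_n^s(u,e_n)^2$. Phase space: $\mathcal E_\varepsilon=H^1\times H$ for $\varepsilon\neq0$ and $\mathcal E_0=H^1\times H^{-1}$, with norm $\|\xi_u\|^2_{\mathcal E_\varepsilon}=\varepsilon\|\partial_tu\|_H^2+\|\partial_tu\|_{H^{-1}}^2+\|u\|_{H^1}^2$, where $\xi_u=(u,\partial_tu)$. For $\varepsilon=0$ the phase space is identified with the invariant set $\{(u,v)\in\mathcal E_0:\ v=F(u)-Au\}$ (only $u|_{t=0}$ is prescribed for the parabolic problem). The equation is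 globally well posed and generates the semigroup $S_\varepsilon(t)\xi_0=\xi_u(t)$, $t\ge0$, where $u$ is the solution with $\xi_u(0)=\xi_0$. Inertial manifold (IM): an $N$-dimensional IM is a Lipschitz submanifold $\mathcal M\subset\mathcal E_\varepsilon$ with base $P_NH$ (the image of $P_NH$ under an injective Lipschitz map $P_NH\to\mathcal E_\varepsilon$ with Lipschitz left inverse) such that: (1) $S_\varepsilon(t)\mathcal M=\mathcal M$ for all $t\ge0$; (2) there are positive constants $C,\theta$ such that for every $\xi_0\in\mathcal E_\varepsilon$ there is $\bar\xi_0\in\mathcal M$ with $\|S_\varepsilon(t)\xi_0-S_\varepsilon(t)\bar\xi_0\|_{\mathcal E_\varepsilon}\le C\|\xi_0\|_{\mathcal E_\varepsilon}e^{-\theta t}$ for $t\ge0$. "Lipschitz continuous with respect to $\varepsilon$ at $\varepsilon=0$" means (for fixed $A,F,L,N$): the manifolds can be parameterized as $\mathcal M_\varepsilon=M_\varepsilon(P_NH)$ by injective Lipschitz maps $M_\varepsilon:P_NH\to\mathcal E_\varepsilon$ with Lipschitz left inverse so that $\|M_\varepsilon(p)-M_0(p)\|_{\mathcal E_\varepsilon}\le C\varepsilon\|p\|_H$ for all $p\in P_NH$, with $C$ independent of $\varepsilon$ and $p$. *)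

theory Defs
  imports "HOL-Analysis.Analysis"
begin

text \<open>
  Sequences are indexed from 0: \<open>e n\<close> and \<open>lam n\<close> stand for the eigenvector and the
  eigenvalue that are usually numbered \<open>n + 1\<close>.
\<close>

text \<open>
  An unbounded operator is a function \<open>A\<close> together with its domain \<open>D\<close>; the values of \<open>A\<close> outside
  \<open>D\<close> are irrelevant. The last conjunct says that the graph of the adjoint is the graph of \<open>A\<close>.
\<close>

definition self_adjoint_on :: "'a::real_inner set \<Rightarrow> ('a \<Rightarrow> 'a) \<Rightarrow> bool" where
  "self_adjoint_on D A \<longleftrightarrow>
     subspace D \<and> closure D = UNIV \<and>
     (\<forall>u\<in>D. \<forall>v\<in>D. A (u + v) = A u + A v) \<and>
     (\<forall>c. \<forall>u\<in>D. A (c *\<^sub>R u) = c *\<^sub>R A u) \<and>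
     (\<forall>v w. (\<forall>u\<in>D. A u \<bullet> v = u \<bullet> w) \<longleftrightarrow> v \<in> D \<and> A v = w)"

definition positive_on :: "'a::real_inner set \<Rightarrow> ('a \<Rightarrow> 'a) \<Rightarrow> bool" where
  "positive_on D A \<longleftrightarrow> (\<forall>u\<in>D. u \<noteq> 0 \<longrightarrow> A u \<bullet> u > 0)"

definition has_compact_inverse :: "'a::real_inner set \<Rightarrow> ('a \<Rightarrow> 'a) \<Rightarrow> bool" where
  "has_compact_inverse D A \<longleftrightarrow>
     bij_betw A D UNIV \<and> compact (closure (inv_into D A ` cball 0 1))"

definition complete_orthonormal :: "(nat \<Rightarrow> 'a::real_inner) \<Rightarrow> bool" where
  "complete_orthonormal e \<longleftrightarrow>
     (\<forall>m n. e m \<bullet> e n = (if m = n then 1 else 0)) \<and> closure (span (range e)) = UNIV"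

text \<open>
  All eigenvectors of \<open>A\<close>, with the eigenvalues repeated according to multiplicity and in
  non-decreasing order.
\<close>

definition eigensystem :: "'a::real_inner set \<Rightarrow> ('a \<Rightarrow> 'a) \<Rightarrow> (nat \<Rightarrow> 'a) \<Rightarrow> (nat \<Rightarrow> real) \<Rightarrow> bool" where
  "eigensystem D A e lam \<longleftrightarrow>
     complete_orthonormal e \<and> (\<forall>n. e n \<in> D \<and> A (e n) = lam n *\<^sub>R e n) \<and> mono lam"

definition proj :: "(nat \<Rightarrow> 'a::real_inner) \<Rightarrow> nat \<Rightarrow> 'a \<Rightarrow> 'a" where
  "proj e N u = (\<Sum>n<N. (u \<bullet> e n) *\<^sub>R e n)"

text \<open>
  Elements of the scale \<open>H\<^sup>s = D(A\<^sup>s\<^sup>/\<^sup>2)\<close>, which for negative \<open>s\<close> is a completion of \<open>H\<close>, are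
  represented by their sequences of Fourier coefficients with respect to \<open>e\<close>. A vector \<open>u\<close> of
  \<open>H\<close> is embedded into the scale by \<open>coeff e u\<close>. The value of \<open>Hs_norm\<close> is meaningful
  on \<open>Hs\<close> only.
\<close>

definition coeff :: "(nat \<Rightarrow> 'a::real_inner) \<Rightarrow> 'a \<Rightarrow> nat \<Rightarrow> real" where
  "coeff e u = (\<lambda>n. u \<bullet> e n)"

definition Hs :: "(nat \<Rightarrow> real) \<Rightarrow> real \<Rightarrow> (nat \<Rightarrow> real) set" where
  "Hs lam s = {a. summable (\<lambda>n. lam n powr s * (a n)\<^sup>2)}"

definition Hs_norm :: "(nat \<Rightarrow> real) \<Rightarrow> real \<Rightarrow> (nat \<Rightarrow> real) \<Rightarrow> real" where
  "Hs_norm lam s a = sqrt (\<Sum>n. lam n powr s * (a n)\<^sup>2)"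

text \<open>
  The element \<open>F(u) - v - A u\<close> of \<open>H\<^sup>-\<^sup>1\<close>, for \<open>u\<close> in \<open>H\<^sup>1\<close> and \<open>v\<close> in \<open>H\<^sup>-\<^sup>1\<close>; here \<open>A\<close> is
  extended to an operator from \<open>H\<^sup>1\<close> to \<open>H\<^sup>-\<^sup>1\<close>, so that it multiplies the \<open>n\<close>-th coefficient
  by \<open>lam n\<close>.
\<close>

definition residual ::
  "(nat \<Rightarrow> 'a::real_inner) \<Rightarrow> (nat \<Rightarrow> real) \<Rightarrow> ('a \<Rightarrow> 'a) \<Rightarrow> 'a \<Rightarrow> (nat \<Rightarrow> real) \<Rightarrow> nat \<Rightarrow> real" where
  "residual e lam F u v = (\<lambda>n. coeff e (F u) n - v n - lam n * coeff e u n)"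

text \<open>
  Phase points are pairs \<open>(u, v)\<close>, where \<open>v\<close> is the coefficient sequence of the time derivative of \<open>u\<close>.
  \<open>Hs lam 0\<close> is the image of \<open>H\<close> under \<open>coeff e\<close>.
\<close>

definition energy_space ::
  "(nat \<Rightarrow> 'a::real_inner) \<Rightarrow> (nat \<Rightarrow> real) \<Rightarrow> real \<Rightarrow> ('a \<times> (nat \<Rightarrow> real)) set" where
  "energy_space e lam \<epsilon> =
     {(u, v). coeff e u \<in> Hs lam 1 \<and> v \<in> (if \<epsilon> = 0 then Hs lam (-1) else Hs lam 0)}"

definition energy_norm ::
  "(nat \<Rightarrow> 'a::real_inner) \<Rightarrow> (nat \<Rightarrow> real) \<Rightarrow> real \<Rightarrow> 'a \<times> (nat \<Rightarrow> real) \<Rightarrow> real" where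
  "energy_norm e lam \<epsilon> \<xi> =
     sqrt (\<epsilon> * (Hs_norm lam 0 (snd \<xi>))\<^sup>2 + (Hs_norm lam (-1) (snd \<xi>))\<^sup>2
           + (Hs_norm lam 1 (coeff e (fst \<xi>)))\<^sup>2)"

definition phase_diff ::
  "'a::real_inner \<times> (nat \<Rightarrow> real) \<Rightarrow> 'a \<times> (nat \<Rightarrow> real) \<Rightarrow> 'a \<times> (nat \<Rightarrow> real)" where
  "phase_diff \<xi> \<eta> = (fst \<xi> - fst \<eta>, \<lambda>n. snd \<xi> n - snd \<eta> n)"

definition energy_dist ::
  "(nat \<Rightarrow> 'a::real_inner) \<Rightarrow> (nat \<Rightarrow> real) \<Rightarrow> real
     \<Rightarrow> 'a \<times> (nat \<Rightarrow> real) \<Rightarrow> 'a \<times> (nat \<Rightarrow> real) \<Rightarrow> real" where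
  "energy_dist e lam \<epsilon> \<xi> \<eta> = energy_norm e lam \<epsilon> (phase_diff \<xi> \<eta>)"

text \<open>For \<open>\<epsilon> = 0\<close> the phase space is the invariant set \<open>v = F(u) - A u\<close>.\<close>

definition phase_space ::
  "(nat \<Rightarrow> 'a::real_inner) \<Rightarrow> (nat \<Rightarrow> real) \<Rightarrow> ('a \<Rightarrow> 'a) \<Rightarrow> real \<Rightarrow> ('a \<times> (nat \<Rightarrow> real)) set" where
  "phase_space e lam F \<epsilon> =
     {(u, v) \<in> energy_space e lam \<epsilon>. \<epsilon> = 0 \<longrightarrow> residual e lam F u v = (\<lambda>_. 0)}"

text \<open>Differentiability at \<open>t\<close> (one-sided at \<open>0\<close>), in the norm of \<open>H\<^sup>s\<close>, of a curve on \<open>[0,\<infinity>)\<close>.\<close>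

definition has_Hs_derivative ::
  "(nat \<Rightarrow> real) \<Rightarrow> real \<Rightarrow> (real \<Rightarrow> nat \<Rightarrow> real) \<Rightarrow> (nat \<Rightarrow> real) \<Rightarrow> real \<Rightarrow> bool" where
  "has_Hs_derivative lam s x x' t \<longleftrightarrow>
     (\<forall>\<tau>\<ge>0. x \<tau> \<in> Hs lam s) \<and> x' \<in> Hs lam s \<and>
     ((\<lambda>\<tau>. Hs_norm lam s (\<lambda>n. (x \<tau> n - x t n) / (\<tau> - t) - x' n)) \<longlongrightarrow> 0) (at t within {0..})"

text \<open>
  Solutions on \<open>[0,\<infinity>)\<close> of \<open>\<epsilon> u'' + u' + A u = F(u)\<close>: the curve \<open>\<xi> = (u, u')\<close> is continuous with values
  in the energy space, and the equation holds in \<open>H\<^sup>-\<^sup>1\<close> in the form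
  \<open>(\<epsilon> u')' = F(u) - u' - A u\<close>; for \<open>\<epsilon> = 0\<close> the latter says \<open>u' = F(u) - A u\<close>.
\<close>

definition solution ::
  "(nat \<Rightarrow> 'a::real_inner) \<Rightarrow> (nat \<Rightarrow> real) \<Rightarrow> ('a \<Rightarrow> 'a) \<Rightarrow> real
     \<Rightarrow> (real \<Rightarrow> 'a \<times> (nat \<Rightarrow> real)) \<Rightarrow> bool" where
  "solution e lam F \<epsilon> \<xi> \<longleftrightarrow>
     (\<forall>t\<ge>0. \<xi> t \<in> energy_space e lam \<epsilon>) \<and>
     (\<forall>t\<ge>0. ((\<lambda>\<tau>. energy_dist e lam \<epsilon> (\<xi> \<tau>) (\<xi> t)) \<longlongrightarrow> 0) (at t within {0..})) \<and>
     (\<forall>t\<ge>0. has_Hs_derivative lam (-1) (\<lambda>\<tau>. coeff e (fst (\<xi> \<tau>))) (snd (\<xi> t)) t) \<and>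
     (\<forall>t\<ge>0. has_Hs_derivative lam (-1) (\<lambda>\<tau> n. \<epsilon> * snd (\<xi> \<tau>) n)
               (residual e lam F (fst (\<xi> t)) (snd (\<xi> t))) t)"

text \<open>
  The solution operator \<open>S\<^sub>\<epsilon>(t)\<close>; the description is proper because the problem is globally well
  posed on \<open>phase_space\<close>.
\<close>

definition semiflow ::
  "(nat \<Rightarrow> 'a::real_inner) \<Rightarrow> (nat \<Rightarrow> real) \<Rightarrow> ('a \<Rightarrow> 'a) \<Rightarrow> real \<Rightarrow> real
     \<Rightarrow> 'a \<times> (nat \<Rightarrow> real) \<Rightarrow> 'a \<times> (nat \<Rightarrow> real)" where
  "semiflow e lam F \<epsilon> t \<xi>0 = (THE \<eta>. \<exists>\<xi>. solution e lam F \<epsilon> \<xi> \<and> \<xi> 0 = \<xi>0 \<and> \<xi> t = \<eta>)"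

text \<open>
  Injective Lipschitz maps from \<open>P\<^sub>N H\<close> (with the norm of \<open>H\<close>) to the phase space that have a
  Lipschitz left inverse.
\<close>

definition lipschitz_param ::
  "(nat \<Rightarrow> 'a::real_inner) \<Rightarrow> (nat \<Rightarrow> real) \<Rightarrow> ('a \<Rightarrow> 'a) \<Rightarrow> nat \<Rightarrow> real
     \<Rightarrow> ('a \<Rightarrow> 'a \<times> (nat \<Rightarrow> real)) \<Rightarrow> bool" where
  "lipschitz_param e lam F N \<epsilon> m \<longleftrightarrow>
     m ` range (proj e N) \<subseteq> phase_space e lam F \<epsilon> \<and>
     inj_on m (range (proj e N)) \<and>
     (\<exists>K. \<forall>p\<in>range (proj e N). \<forall>q\<in>range (proj e N).
        energy_dist e lam \<epsilon> (m p) (m q) \<le> K * norm (p - q)) \<and>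
     (\<exists>R K. R ` energy_space e lam \<epsilon> \<subseteq> range (proj e N) \<and>
        (\<forall>\<xi>\<in>energy_space e lam \<epsilon>. \<forall>\<eta>\<in>energy_space e lam \<epsilon>.
           norm (R \<xi> - R \<eta>) \<le> K * energy_dist e lam \<epsilon> \<xi> \<eta>) \<and>
        (\<forall>p\<in>range (proj e N). R (m p) = p))"

definition inertial_manifold ::
  "(nat \<Rightarrow> 'a::real_inner) \<Rightarrow> (nat \<Rightarrow> real) \<Rightarrow> ('a \<Rightarrow> 'a) \<Rightarrow> nat \<Rightarrow> real
     \<Rightarrow> ('a \<times> (nat \<Rightarrow> real)) set \<Rightarrow> bool" where
  "inertial_manifold e lam F N \<epsilon> M \<longleftrightarrow>
     (\<exists>m. lipschitz_param e lam F N \<epsilon> m \<and> M = m ` range (proj e N)) \<and>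
     (\<forall>t\<ge>0. semiflow e lam F \<epsilon> t ` M = M) \<and>
     (\<exists>C>0. \<exists>\<theta>>0. \<forall>\<xi>0\<in>phase_space e lam F \<epsilon>. \<exists>\<eta>0\<in>M. \<forall>t\<ge>0.
        energy_dist e lam \<epsilon> (semiflow e lam F \<epsilon> t \<xi>0) (semiflow e lam F \<epsilon> t \<eta>0)
          \<le> C * energy_norm e lam \<epsilon> \<xi>0 * exp (- \<theta> * t))"

text \<open>
  Lipschitz continuity at \<open>\<epsilon> = 0\<close> of a family of manifolds given for \<open>\<epsilon> \<in> E\<close>, where \<open>0 \<in> E\<close>.
  Membership of the difference in the energy space makes its norm meaningful (the second
  component of \<open>m 0 p\<close> is a priori only in \<open>H\<^sup>-\<^sup>1\<close>).
\<close>

definition lipschitz_at_zero ::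
  "(nat \<Rightarrow> 'a::real_inner) \<Rightarrow> (nat \<Rightarrow> real) \<Rightarrow> ('a \<Rightarrow> 'a) \<Rightarrow> nat \<Rightarrow> real set
     \<Rightarrow> (real \<Rightarrow> ('a \<times> (nat \<Rightarrow> real)) set) \<Rightarrow> bool" where
  "lipschitz_at_zero e lam F N E M \<longleftrightarrow>
     (\<exists>m C. \<forall>\<epsilon>\<in>E. lipschitz_param e lam F N \<epsilon> (m \<epsilon>) \<and> M \<epsilon> = m \<epsilon> ` range (proj e N) \<and>
        (\<forall>p\<in>range (proj e N). phase_diff (m \<epsilon> p) (m 0 p) \<in> energy_space e lam \<epsilon> \<and>
           energy_dist e lam \<epsilon> (m \<epsilon> p) (m 0 p) \<le> C * \<epsilon> * norm p))"

end

theory Submission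
  imports Defs
begin

text \<open>
  The parameter of the equation is written \<open>eps\<close>. Along the eigenvectors the equation splits into scalar equations
  \<open>eps u'' + u' + l u = h\<close>, one for each eigenvalue \<open>l\<close>, which are coupled only by the
  coefficients \<open>h\<close> of \<open>F(u)\<close>. The proof rests on one quadratic form per mode.

  Let \<open>\<mu>\<close> be the middle and \<open>2 \<kappa>\<close> the length of the spectral gap, so that
  \<open>L < \<kappa>\<close>, let \<open>\<theta>\<close> be the smaller root of \<open>x - eps x\<^sup>2 = \<mu>\<close>, and put
  \<open>\<beta> = 1 - 2 eps \<theta>\<close>, \<open>y = v + \<theta> u\<close>, where \<open>v = u'\<close>. For the form
  \<open>Q = eps \<beta> y\<^sup>2 + 2 eps s y u + \<beta> (l - \<mu>) u\<^sup>2\<close>, a completion of squares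
  (\<open>cone_identity\<close>) gives along solutions
  \<open>Q' + 2 \<theta> Q = h\<^sup>2 - (h - \<beta> y - s u)\<^sup>2 - (\<beta>\<^sup>2 - 2 eps s) y\<^sup>2 - s (2 (l - \<mu>) - s) u\<^sup>2\<close>.
  Take \<open>s = \<sigma>\<close> above and \<open>s = - \<sigma>\<close> below the gap, with \<open>L < \<sigma> < \<kappa>\<close>. The last
  coefficient is then larger than \<open>\<sigma>\<^sup>2\<close>, and \<open>\<beta>\<^sup>2 - 2 eps s \<ge> 1 - 4 eps \<mu> - 2 eps \<sigma>\<close> is
  positive because the hypothesis on \<open>eps\<close> reads \<open>1 / eps \<ge> 4 \<mu> + 2 \<kappa>\<close>: this is where
  both hypotheses of the theorem enter. Summed over the modes of the difference of two
  solutions, whose forces satisfy \<open>\<Sum> h\<^sup>2 \<le> L\<^sup>2 \<Sum> u\<^sup>2\<close>, this yields a Lyapunov function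
  \<open>V\<close> with \<open>V' + 2 \<theta> V \<le> 0\<close> (\<open>cone_inequality\<close>). There is some room to spare, uniformly
  in \<open>eps\<close> down to and including \<open>eps = 0\<close>: the rate \<open>\<theta>\<close> may be changed by
  \<open>\<plusminus> \<eta>\<close>, \<open>V\<close> by \<open>\<plusminus> d E\<close> with the energy \<open>E\<close>, and a term with the square of the
  velocity is left over.

  Integrated over an interval, the inequality bounds solutions of a boundary value
  problem, in which the fast modes are prescribed at the left end and certain coordinates
  \<open>P\<close> of the \<open>N\<close> slow modes at the right end, by their forces in an exponentially
  weighted \<open>L\<^sup>2\<close> norm. The bound makes the nonlinear problem a contraction
  (\<open>nonlinear_bvp\<close>). Without slow modes, which is achieved by a negative \<open>\<mu>\<close>, it is the
  initial value problem; hence the semiflow exists. Letting the left end tend to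
  \<open>-\<infinity>\<close> produces the orbits on the whole line that grow backwards at most like
  \<open>exp (- \<theta> t)\<close>, one for each value of \<open>P\<close> at time \<open>0\<close> (\<open>ancient_exists\<close>). Their values
  at \<open>0\<close> form the manifold. It is Lipschitz since \<open>V + d E \<le> 0\<close> for the difference of
  two such orbits while \<open>V \<ge> d E - K |P|\<^sup>2\<close>; and it attracts because the orbits in it
  that have the same \<open>P\<close> as a given orbit at a large time \<open>T\<close> converge as
  \<open>T \<rightarrow> \<infinity>\<close> (\<open>exponential_tracking\<close>).

  For the dependence on \<open>eps\<close>, an orbit in the manifold is regarded as a solution of the
  parabolic problem with the additional force \<open>- eps u''\<close>. A time shift of such an orbit is
  another one, so that its difference quotients are controlled by the Lipschitz property,
  and the velocity term left over in the inequality bounds \<open>u''\<close> in \<open>L\<^sup>2\<close>. The cone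
  inequality with \<open>eps = 0\<close> and this force then compares the two manifolds
  (\<open>zero_energy_comparison\<close>). When \<open>eps\<close> is not small, it suffices to bound
  both orbits separately.
\<close>

section \<open>Orthonormal expansions\<close>

locale orthonormal_basis =
  fixes e :: "nat \<Rightarrow> 'a::{real_inner,complete_space}"
  assumes complete: "complete_orthonormal e"
begin

lemma inner_basis: "e m \<bullet> e n = (if m = n then 1 else 0)"
  using complete by (simp add: complete_orthonormal_def)

lemma inner_proj: "proj e m u \<bullet> e n = (if n < m then u \<bullet> e n else 0)"
  by (simp add: proj_def inner_sum_left inner_basis if_distrib cong: if_cong)

lemma proj_diff: "proj e m (u - x) = proj e m u - proj e m x"
  by (simp add: proj_def inner_diff_left scaleR_diff_left sum_subtractf)

lemma norm_sum_basis: "(norm (\<Sum>n\<in>I. a n *\<^sub>R e n))\<^sup>2 = (\<Sum>n\<in>I. (a n)\<^sup>2)" if "finite I"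
  unfolding power2_norm_eq_inner using that
  by (simp add: inner_sum_left inner_sum_right inner_basis
      if_distrib power2_eq_square cong: if_cong)

lemma norm_proj: "(norm (proj e m u))\<^sup>2 = (\<Sum>n<m. (u \<bullet> e n)\<^sup>2)"
  by (simp add: proj_def norm_sum_basis)

lemma norm_diff_proj: "(norm (u - proj e m u))\<^sup>2 = (norm u)\<^sup>2 - (\<Sum>n<m. (u \<bullet> e n)\<^sup>2)"
proof -
  have "u \<bullet> proj e m u = (\<Sum>n<m. (u \<bullet> e n)\<^sup>2)"
    by (simp add: proj_def inner_sum_right power2_eq_square)
  then show ?thesis
    using norm_proj[of m u]
    by (simp add: power2_norm_eq_inner inner_diff_left inner_diff_right inner_commute)
qed

lemma bessel: "(\<Sum>n<m. (u \<bullet> e n)\<^sup>2) \<le> (norm u)\<^sup>2"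
  using norm_diff_proj[of u m] by (metis diff_ge_0_iff_ge zero_le_power2)

lemma norm_diff_proj_le: "norm (u - proj e m u) \<le> norm u"
  by (rule power2_le_imp_le) (simp_all add: norm_diff_proj sum_nonneg)

lemma proj_eventually_id: "x \<in> span (range e) \<Longrightarrow> \<exists>m0. \<forall>m\<ge>m0. proj e m x = x"
proof (induction rule: span_induct_alt)
  case base
  then show ?case by (simp add: proj_def)
next
  case (step c x y)
  then obtain k m0 where x: "x = e k" and m0: "\<forall>m\<ge>m0. proj e m y = y" by auto
  have "proj e m (c *\<^sub>R x + y) = c *\<^sub>R x + y" if "m \<ge> max m0 (Suc k)" for m
  proof -
    have "proj e m (c *\<^sub>R x + y) = c *\<^sub>R proj e m x + proj e m y"
      by (simp add: proj_def inner_add_left scaleR_add_left sum.distrib scaleR_sum_right)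
    moreover have "proj e m x = x"
    proof -
      have "proj e m x = (\<Sum>n<m. if n = k then e n else 0)"
        unfolding proj_def by (rule sum.cong) (auto simp: x inner_basis)
      also have "\<dots> = x" using that by (simp add: x)
      finally show ?thesis .
    qed
    ultimately show ?thesis using m0 that by simp
  qed
  then show ?case by blast
qed

lemma proj_tendsto: "(\<lambda>m. proj e m u) \<longlonglongrightarrow> u"
proof (rule metric_LIMSEQ_I)
  fix r :: real assume "0 < r"
  have "u \<in> closure (span (range e))"
    using complete by (simp add: complete_orthonormal_def)
  then obtain x where x: "x \<in> span (range e)" "dist x u < r"
    using \<open>0 < r\<close> closure_approachable by blast
  obtain m0 where m0: "\<forall>m\<ge>m0. proj e m x = x" using proj_eventually_id[OF x(1)] by blast
  have "dist (proj e m u) u < r" if "m \<ge> m0" for m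
  proof -
    have "u - proj e m u = (u - x) - proj e m (u - x)" using m0 that by (simp add: proj_diff)
    then have "norm (u - proj e m u) \<le> norm (u - x)" using norm_diff_proj_le by metis
    then show ?thesis using x(2) by (simp add: dist_norm norm_minus_commute)
  qed
  then show "\<exists>m0. \<forall>m\<ge>m0. dist (proj e m u) u < r" by blast
qed

lemma parseval: "(\<lambda>n. (u \<bullet> e n)\<^sup>2) sums (norm u)\<^sup>2"
proof -
  have "(\<lambda>m. (norm (proj e m u))\<^sup>2) \<longlonglongrightarrow> (norm u)\<^sup>2"
    by (intro tendsto_intros proj_tendsto)
  then show ?thesis by (simp add: sums_def norm_proj)
qed

lemma eq_if_coeff_eq:
  assumes "\<And>n. u \<bullet> e n = x \<bullet> e n" shows "u = x"
proof -
  have "(\<lambda>n. 0) sums (norm (u - x))\<^sup>2"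
    using parseval[of "u - x"] assms by (simp add: inner_diff_left)
  then show ?thesis using sums_unique2 sums_zero by fastforce
qed

text \<open>
  Completeness of the space: a square summable sequence is a sequence of coefficients.
\<close>

lemma riesz_fischer:
  assumes a: "summable (\<lambda>n. (a n)\<^sup>2)"
  obtains u where "\<And>n. u \<bullet> e n = a n"
proof -
  define s where "s m = (\<Sum>n<m. a n *\<^sub>R e n)" for m
  have "Cauchy s"
  proof (rule CauchyI')
    fix r :: real assume "0 < r"
    then have "0 < r\<^sup>2" by simp
    then obtain M where M: "\<And>m n. m \<ge> M \<Longrightarrow> norm (sum (\<lambda>n. (a n)\<^sup>2) {m..<n}) < r\<^sup>2"
      using a unfolding summable_Cauchy by blast
    have "norm (s m - s n) < r" if "m \<ge> M" "m < n" for m n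
    proof -
      have "s n - s m = (\<Sum>k\<in>{m..<n}. a k *\<^sub>R e k)"
        using that sum_diff_nat_ivl[of 0 m n "\<lambda>k. a k *\<^sub>R e k"]
        by (simp add: s_def atLeast0LessThan)
      then have "(norm (s m - s n))\<^sup>2 = (\<Sum>k\<in>{m..<n}. (a k)\<^sup>2)"
        by (metis finite_atLeastLessThan norm_minus_commute norm_sum_basis)
      also have "\<dots> < r\<^sup>2" using M[OF that(1), of n] by (simp add: sum_nonneg)
      finally show ?thesis using \<open>0 < r\<close> by (simp add: power2_less_imp_less)
    qed
    then show "\<exists>M. \<forall>m\<ge>M. \<forall>n>m. dist (s m) (s n) < r" by (auto simp: dist_norm)
  qed
  then obtain u where u: "s \<longlonglongrightarrow> u" using Cauchy_convergent_iff convergent_def by blast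
  have "u \<bullet> e n = a n" for n
  proof -
    have "(\<lambda>m. s m \<bullet> e n) \<longlonglongrightarrow> u \<bullet> e n" by (intro tendsto_intros u)
    moreover have "\<forall>\<^sub>F m in sequentially. s m \<bullet> e n = a n"
      using eventually_gt_at_top[of n]
      by eventually_elim
        (simp add: s_def inner_sum_left inner_basis if_distrib cong: if_cong)
    ultimately show ?thesis
      using tendsto_unique[OF sequentially_bot] tendsto_eventually by metis
  qed
  then show ?thesis using that by blast
qed

text \<open>
  On a compact set the expansions converge uniformly. This turns estimates of finitely many
  modes into estimates in norm, with an error that is uniform in time along a curve.
\<close>

lemma uniform_tail:
  assumes "compact S" "0 < r"
  obtains m0 where "\<And>m u. m \<ge> m0 \<Longrightarrow> u \<in> S \<Longrightarrow> (norm u)\<^sup>2 - (\<Sum>n<m. (u \<bullet> e n)\<^sup>2) < r"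
proof -
  define q where "q = sqrt r / 2"
  have q: "0 < q" "(2 * q)\<^sup>2 = r" using assms by (simp_all add: q_def)
  obtain T where T: "finite T" "S \<subseteq> (\<Union>x\<in>T. ball x q)"
    using assms(1) q(1) unfolding compact_eq_totally_bounded by blast
  have "\<forall>x\<in>T. \<exists>m0. \<forall>m\<ge>m0. dist (proj e m x) x < q"
    using proj_tendsto q(1) by (meson metric_LIMSEQ_D)
  then obtain m where m: "\<And>x k. x \<in> T \<Longrightarrow> k \<ge> m x \<Longrightarrow> dist (proj e k x) x < q"
    by metis
  define m0 where "m0 = Max (insert 0 (m ` T))"
  have "(norm u)\<^sup>2 - (\<Sum>n<k. (u \<bullet> e n)\<^sup>2) < r" if k: "k \<ge> m0" and u: "u \<in> S" for k u
  proof -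
    obtain x where x: "x \<in> T" "dist x u < q" using T u by auto
    have "m x \<le> k" using k T(1) x(1) by (simp add: m0_def)
    then have 1: "norm (x - proj e k x) < q"
      using m[OF x(1)] by (simp add: dist_norm norm_minus_commute)
    have "u - proj e k u = (x - proj e k x) + ((u - x) - proj e k (u - x))"
      by (simp add: proj_diff)
    then have "norm (u - proj e k u) \<le> norm (x - proj e k x) + norm ((u - x) - proj e k (u - x))"
      by (metis norm_triangle_ineq)
    also have "\<dots> < q + q"
      using 1 norm_diff_proj_le[of "u - x" k] x(2) by (simp add: dist_norm norm_minus_commute)
    finally have "(norm (u - proj e k u))\<^sup>2 < (2 * q)\<^sup>2"
      by (intro power_strict_mono) auto
    then show ?thesis using q(2) by (simp add: norm_diff_proj)
  qed
  then show ?thesis using that by blast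
qed

end

section \<open>The quadratic form of a single mode\<close>

text \<open>
  The slow solution of \<open>eps u'' + u' + x u = 0\<close> decays at the rate \<open>slow_rate eps x\<close>, the
  smaller root of \<open>r - eps r\<^sup>2 = x\<close>. The usual formula for the root is rationalised so
  that it makes sense, and is continuous, at \<open>eps = 0\<close>.
\<close>

definition slow_rate :: "real \<Rightarrow> real \<Rightarrow> real" where
  "slow_rate eps x = 2 * x / (1 + sqrt (1 - 4 * eps * x))"

definition mode_energy :: "real \<Rightarrow> real \<Rightarrow> real \<Rightarrow> real \<Rightarrow> real" where
  "mode_energy eps l u v = eps * v\<^sup>2 + l * u\<^sup>2"

definition cone_form :: "real \<Rightarrow> real \<Rightarrow> real \<Rightarrow> real \<Rightarrow> real \<Rightarrow> real \<Rightarrow> real" where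
  "cone_form eps \<mu> s l u v =
     eps * (1 - 2 * eps * slow_rate eps \<mu>) * (v + slow_rate eps \<mu> * u)\<^sup>2
     + 2 * eps * s * (v + slow_rate eps \<mu> * u) * u
     + (1 - 2 * eps * slow_rate eps \<mu>) * (l - \<mu>) * u\<^sup>2"

text \<open>
  The time derivative of \<open>cone_form eps \<mu> s l u v\<close> along \<open>u' = v\<close>,
  \<open>(eps v)' = r = h - v - l u\<close>. It is arranged so that only the derivative of \<open>eps v\<close> occurs,
  because \<open>v\<close> need not be differentiable when \<open>eps = 0\<close>.
\<close>

definition cone_rate :: "real \<Rightarrow> real \<Rightarrow> real \<Rightarrow> real \<Rightarrow> real \<Rightarrow> real \<Rightarrow> real \<Rightarrow> real" where
  "cone_rate eps \<mu> s l u v h =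
     (let \<theta> = slow_rate eps \<mu>; \<beta> = 1 - 2 * eps * \<theta>; r = h - v - l * u in
      \<beta> * (2 * v * r + 2 * \<theta> * (eps * v\<^sup>2 + u * r) + 2 * eps * \<theta>\<^sup>2 * u * v)
      + 2 * s * (eps * v\<^sup>2 + u * r + 2 * eps * \<theta> * u * v) + 2 * \<beta> * (l - \<mu>) * u * v)"

text \<open>
  The coordinate that the fast solution of the homogeneous equation annihilates: with
  \<open>\<nu> = slow_rate eps l\<close> the equation factors, and \<open>p = slow_coord eps l u v\<close> satisfies the first
  order equation \<open>p' + \<nu> p = h\<close>. It is therefore the right quantity to prescribe at the end of
  an interval.
\<close>

definition slow_coord :: "real \<Rightarrow> real \<Rightarrow> real \<Rightarrow> real \<Rightarrow> real" where
  "slow_coord eps l u v = eps * v + (1 - eps * slow_rate eps l) * u"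

lemma slow_rate_beta:
  assumes "4 * eps * x \<le> 1" shows "1 - 2 * eps * slow_rate eps x = sqrt (1 - 4 * eps * x)"
proof -
  define S where "S = sqrt (1 - 4 * eps * x)"
  have S: "S \<ge> 0" "S\<^sup>2 = 1 - 4 * eps * x" using assms by (simp_all add: S_def)
  have "1 - 2 * eps * (2 * x / (1 + S)) = S"
    using S by (simp add: field_simps power2_eq_square)
  then show ?thesis by (simp add: slow_rate_def S_def)
qed

lemma slow_rate_eq:
  assumes "4 * eps * x \<le> 1" shows "slow_rate eps x - eps * (slow_rate eps x)\<^sup>2 = x"
proof -
  define S where "S = sqrt (1 - 4 * eps * x)"
  have S: "S \<ge> 0" using assms by (simp_all add: S_def)
  have "1 - eps * slow_rate eps x = (1 + S) / 2"
    using slow_rate_beta[OF assms] by (simp add: S_def)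
  moreover have "slow_rate eps x * ((1 + S) / 2) = x"
    unfolding slow_rate_def S_def[symmetric] using S by (simp add: field_simps)
  ultimately have "slow_rate eps x * (1 - eps * slow_rate eps x) = x" by (simp only:)
  then show ?thesis by (simp add: power2_eq_square algebra_simps)
qed

lemma abs_slow_rate:
  assumes "4 * eps * x \<le> 1" shows "\<bar>slow_rate eps x\<bar> \<le> 2 * \<bar>x\<bar>"
proof -
  define S where "S = sqrt (1 - 4 * eps * x)"
  have S: "S \<ge> 0" using assms by (simp_all add: S_def)
  have "2 * \<bar>x\<bar> / (1 + S) \<le> 2 * \<bar>x\<bar> / 1" using S by (intro frac_le) auto
  then show ?thesis unfolding slow_rate_def S_def[symmetric] using S by (simp add: abs_mult)
qed

lemma slow_rate_zero [simp]: "slow_rate 0 x = x"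
  by (simp add: slow_rate_def)

text \<open>
  Completion of squares. The equation \<open>\<theta> - eps \<theta>\<^sup>2 = \<mu>\<close> is what cancels the remaining
  mixed terms; hence \<open>2 \<theta>\<close> is the right rate.
\<close>

lemma cone_identity:
  assumes "4 * eps * \<mu> \<le> 1"
  defines "\<theta> \<equiv> slow_rate eps \<mu>"
  defines "\<beta> \<equiv> 1 - 2 * eps * \<theta>"
  shows "cone_rate eps \<mu> s l u v h + 2 * \<theta> * cone_form eps \<mu> s l u v =
    h\<^sup>2 - (h - \<beta> * (v + \<theta> * u) - s * u)\<^sup>2
      - (\<beta>\<^sup>2 - 2 * eps * s) * (v + \<theta> * u)\<^sup>2 - s * (2 * (l - \<mu>) - s) * u\<^sup>2"
proof -
  have mu: "\<mu> = \<theta> - eps * \<theta>\<^sup>2" using slow_rate_eq[OF assms(1)] by (simp add: \<theta>_def)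
  show ?thesis
    unfolding cone_rate_def cone_form_def Let_def \<theta>_def[symmetric] \<beta>_def
    unfolding mu
    by (simp add: power2_eq_square power3_eq_cube algebra_simps)
qed

text \<open>
  Here \<open>L\<close> is a bound for the forces, which is later slightly larger than the Lipschitz constant
  of \<open>F\<close>, \<open>\<kappa>\<close> is half of the gap, and \<open>\<sigma>\<close> lies between them. The last two parameters make the
  estimates uniform: \<open>epsm\<close> bounds \<open>eps\<close>, and \<open>b0\<close> is a lower bound for
  \<open>\<beta>\<^sup>2 - 2 eps \<sigma>\<close>.
\<close>

locale cone_params =
  fixes L \<mu> \<sigma> \<kappa> l0 epsm b0 :: real
  assumes L: "0 < L" "L < \<sigma>" and \<sigma>\<kappa>: "\<sigma> < \<kappa>" and l0: "0 < l0" and epsm: "0 \<le> epsm" and b0: "0 < b0"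
begin

definition admissible :: "real \<Rightarrow> real \<Rightarrow> real \<Rightarrow> bool" where
  "admissible eps l s \<longleftrightarrow> 0 \<le> eps \<and> eps \<le> epsm \<and> b0 \<le> 1 - 4 * eps * \<mu> - 2 * eps * \<sigma> \<and> l0 \<le> l \<and>
     (s = \<sigma> \<and> \<kappa> \<le> l - \<mu> \<or> s = - \<sigma> \<and> \<kappa> \<le> \<mu> - l)"

lemma \<sigma>_pos: "0 < \<sigma>" "0 < \<kappa>" using L \<sigma>\<kappa> by auto

lemma admissibleD:
  assumes "admissible eps l s"
  shows "0 \<le> eps" "eps \<le> epsm" "4 * eps * \<mu> \<le> 1" "b0 \<le> 1 - 4 * eps * \<mu> - 2 * eps * \<sigma>"
    "l0 \<le> l" "\<bar>s\<bar> = \<sigma>" "\<kappa> \<le> \<bar>l - \<mu>\<bar>" "s * (l - \<mu>) = \<sigma> * \<bar>l - \<mu>\<bar>"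
proof -
  note a = assms[unfolded admissible_def]
  show "0 \<le> eps" "eps \<le> epsm" "b0 \<le> 1 - 4 * eps * \<mu> - 2 * eps * \<sigma>" "l0 \<le> l" using a by auto
  have "0 \<le> eps * \<sigma>" using a \<sigma>_pos by auto
  then show "4 * eps * \<mu> \<le> 1" using a b0 by linarith
  show "\<bar>s\<bar> = \<sigma>" using a \<sigma>_pos by auto
  show "\<kappa> \<le> \<bar>l - \<mu>\<bar>" using a by auto
  show "s * (l - \<mu>) = \<sigma> * \<bar>l - \<mu>\<bar>" using a \<sigma>_pos by (auto simp: algebra_simps)
qed

lemma beta_bounds:
  assumes "admissible eps l s"
  defines "\<beta> \<equiv> 1 - 2 * eps * slow_rate eps \<mu>"
  shows "sqrt b0 \<le> \<beta>" "\<beta> \<le> sqrt (1 + 4 * epsm * \<bar>\<mu>\<bar>)" "0 < \<beta>" "\<beta>\<^sup>2 = 1 - 4 * eps * \<mu>"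
    "b0 + 2 * eps * \<sigma> \<le> \<beta>\<^sup>2" "b0 \<le> \<beta>\<^sup>2 - 2 * eps * s" "b0 \<le> \<beta>\<^sup>2"
proof -
  note a = admissibleD[OF assms(1)]
  have \<beta>: "\<beta> = sqrt (1 - 4 * eps * \<mu>)" unfolding \<beta>_def using a by (intro slow_rate_beta)
  show sq: "\<beta>\<^sup>2 = 1 - 4 * eps * \<mu>" using \<beta> a by simp
  have p: "0 \<le> eps * \<sigma>" using a \<sigma>_pos by auto
  then show "sqrt b0 \<le> \<beta>" unfolding \<beta> using a b0 by (intro real_sqrt_le_mono) linarith
  then show "0 < \<beta>" using b0 by (meson less_le_trans real_sqrt_gt_zero)
  show "b0 + 2 * eps * \<sigma> \<le> \<beta>\<^sup>2" unfolding sq using a by linarith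
  then show "b0 \<le> \<beta>\<^sup>2" using p by linarith
  have "eps * s \<le> eps * \<sigma>" using a by (intro mult_left_mono) auto
  then show "b0 \<le> \<beta>\<^sup>2 - 2 * eps * s" unfolding sq using a by linarith
  have "eps * (- \<mu>) \<le> eps * \<bar>\<mu>\<bar>" using a by (intro mult_left_mono) auto
  also have "\<dots> \<le> epsm * \<bar>\<mu>\<bar>" using a by (intro mult_right_mono) auto
  finally have "eps * (- \<mu>) \<le> epsm * \<bar>\<mu>\<bar>" .
  then show "\<beta> \<le> sqrt (1 + 4 * epsm * \<bar>\<mu>\<bar>)" unfolding \<beta> by (intro real_sqrt_le_mono) (auto simp: mult_ac)
qed

lemma theta_bound: "admissible eps l s \<Longrightarrow> \<bar>slow_rate eps \<mu>\<bar> \<le> 2 * \<bar>\<mu>\<bar>"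
  by (intro abs_slow_rate admissibleD)

text \<open>
  Outside the gap the distance to its middle is comparable to the eigenvalue; the next two
  lemmas give both directions.
\<close>

lemma l_le_gap:
  assumes "admissible eps l s" shows "l \<le> (1 + \<bar>\<mu>\<bar> / \<kappa>) * \<bar>l - \<mu>\<bar>"
proof -
  note a = admissibleD[OF assms(1)]
  have "\<bar>\<mu>\<bar> / \<kappa> * \<kappa> \<le> \<bar>\<mu>\<bar> / \<kappa> * \<bar>l - \<mu>\<bar>" using a \<sigma>_pos by (intro mult_left_mono) auto
  then have "\<bar>\<mu>\<bar> \<le> \<bar>\<mu>\<bar> / \<kappa> * \<bar>l - \<mu>\<bar>" using \<sigma>_pos by simp
  then show ?thesis by (simp add: distrib_right)
qed

lemma gap_le_l:
  assumes "admissible eps l s" shows "\<bar>l - \<mu>\<bar> \<le> (1 + \<bar>\<mu>\<bar> / l0) * l"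
proof -
  note a = admissibleD[OF assms(1)]
  have "\<bar>\<mu>\<bar> / l0 * l0 \<le> \<bar>\<mu>\<bar> / l0 * l" using a l0 by (intro mult_left_mono) auto
  then have "\<bar>\<mu>\<bar> \<le> \<bar>\<mu>\<bar> / l0 * l" using l0 by simp
  then show ?thesis using a l0 by (simp add: distrib_right)
qed

lemma usq_le:
  assumes "admissible eps l s" shows "u\<^sup>2 \<le> l * u\<^sup>2 / l0"
proof -
  have "l0 * u\<^sup>2 \<le> l * u\<^sup>2" using admissibleD[OF assms] by (intro mult_right_mono) auto
  then show ?thesis using l0 by (simp add: field_simps)
qed

lemma shift_sq_le:
  assumes "admissible eps l s"
  shows "(v + slow_rate eps \<mu> * u)\<^sup>2 \<le> 2 * v\<^sup>2 + 2 * (2 * \<bar>\<mu>\<bar>)\<^sup>2 * u\<^sup>2"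
    "v\<^sup>2 \<le> 2 * (v + slow_rate eps \<mu> * u)\<^sup>2 + 2 * (2 * \<bar>\<mu>\<bar>)\<^sup>2 * u\<^sup>2"
proof -
  let ?\<theta> = "slow_rate eps \<mu>"
  have "?\<theta>\<^sup>2 \<le> (2 * \<bar>\<mu>\<bar>)\<^sup>2" using power_mono[OF theta_bound[OF assms], of 2] by (simp only: power2_abs abs_ge_zero)
  then have 1: "?\<theta>\<^sup>2 * u\<^sup>2 \<le> (2 * \<bar>\<mu>\<bar>)\<^sup>2 * u\<^sup>2" by (intro mult_right_mono) auto
  have "(v + ?\<theta> * u)\<^sup>2 + (v - ?\<theta> * u)\<^sup>2 = 2 * v\<^sup>2 + 2 * (?\<theta>\<^sup>2 * u\<^sup>2)"
    by (simp add: power2_eq_square algebra_simps)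
  then show "(v + ?\<theta> * u)\<^sup>2 \<le> 2 * v\<^sup>2 + 2 * (2 * \<bar>\<mu>\<bar>)\<^sup>2 * u\<^sup>2"
    using 1 zero_le_power2[of "v - ?\<theta> * u"] by linarith
  have "2 * (v + ?\<theta> * u)\<^sup>2 + 2 * (?\<theta>\<^sup>2 * u\<^sup>2) = v\<^sup>2 + (v + 2 * ?\<theta> * u)\<^sup>2"
    by (simp add: power2_eq_square algebra_simps)
  then show "v\<^sup>2 \<le> 2 * (v + ?\<theta> * u)\<^sup>2 + 2 * (2 * \<bar>\<mu>\<bar>)\<^sup>2 * u\<^sup>2"
    using 1 zero_le_power2[of "v + 2 * ?\<theta> * u"] by linarith
qed

lemma cone_form_bounded:
  obtains K where "0 < K"
    "\<And>eps l s u v. admissible eps l s \<Longrightarrow> \<bar>cone_form eps \<mu> s l u v\<bar> \<le> K * mode_energy eps l u v"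
proof -
  define B T where "B = sqrt (1 + 4 * epsm * \<bar>\<mu>\<bar>)" and "T = 2 * (2 * \<bar>\<mu>\<bar>)\<^sup>2"
  define K1 where "K1 = epsm * ((B + \<sigma>) * T + \<sigma>) / l0 + B * (1 + \<bar>\<mu>\<bar> / l0)"
  have B: "0 \<le> B" "0 \<le> T" using epsm by (simp_all add: B_def T_def)
  have K1: "0 \<le> K1" using B epsm \<sigma>_pos l0 by (simp add: K1_def)
  have "\<bar>cone_form eps \<mu> s l u v\<bar> \<le> (2 * (B + \<sigma>) + K1) * mode_energy eps l u v"
    if adm: "admissible eps l s" for eps l s u v
  proof -
    note a = admissibleD[OF adm] and b = beta_bounds[OF adm]
    define y \<beta> where "y = v + slow_rate eps \<mu> * u" and "\<beta> = 1 - 2 * eps * slow_rate eps \<mu>"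
    have \<beta>: "0 < \<beta>" "\<beta> \<le> B" using b unfolding \<beta>_def B_def by auto
    have "0 \<le> (\<bar>y\<bar> - \<bar>u\<bar>)\<^sup>2" by simp
    then have yu: "2 * (\<bar>y\<bar> * \<bar>u\<bar>) \<le> y\<^sup>2 + u\<^sup>2"
      by (simp add: power2_diff)
    have "\<bar>cone_form eps \<mu> s l u v\<bar> \<le> \<bar>eps * \<beta> * y\<^sup>2\<bar> + \<bar>2 * eps * s * y * u\<bar> + \<bar>\<beta> * (l - \<mu>) * u\<^sup>2\<bar>"
      unfolding cone_form_def y_def[symmetric] \<beta>_def[symmetric] by linarith
    also have "\<dots> = eps * \<beta> * y\<^sup>2 + eps * \<sigma> * (2 * (\<bar>y\<bar> * \<bar>u\<bar>)) + \<beta> * (\<bar>l - \<mu>\<bar> * u\<^sup>2)"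
      using a \<beta> by (simp add: abs_mult)
    also have "\<dots> \<le> eps * B * y\<^sup>2 + eps * \<sigma> * (y\<^sup>2 + u\<^sup>2) + B * ((1 + \<bar>\<mu>\<bar> / l0) * l * u\<^sup>2)"
      using a \<beta> \<sigma>_pos yu gap_le_l[OF adm] l0
      by (intro add_mono mult_mono mult_nonneg_nonneg) auto
    also have "\<dots> = eps * ((B + \<sigma>) * y\<^sup>2 + \<sigma> * u\<^sup>2) + B * (1 + \<bar>\<mu>\<bar> / l0) * (l * u\<^sup>2)"
      by (simp add: algebra_simps)
    also have "\<dots> \<le> eps * ((B + \<sigma>) * (2 * v\<^sup>2 + T * u\<^sup>2) + \<sigma> * u\<^sup>2) + B * (1 + \<bar>\<mu>\<bar> / l0) * (l * u\<^sup>2)"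
      using shift_sq_le(1)[OF adm, of v u] a B \<sigma>_pos unfolding y_def T_def
      by (intro add_right_mono mult_left_mono) auto
    also have "\<dots> = 2 * (B + \<sigma>) * (eps * v\<^sup>2) + eps * (((B + \<sigma>) * T + \<sigma>) * u\<^sup>2) + B * (1 + \<bar>\<mu>\<bar> / l0) * (l * u\<^sup>2)"
      by (simp add: algebra_simps)
    also have "\<dots> \<le> 2 * (B + \<sigma>) * (eps * v\<^sup>2) + epsm * (((B + \<sigma>) * T + \<sigma>) * (l * u\<^sup>2 / l0))
        + B * (1 + \<bar>\<mu>\<bar> / l0) * (l * u\<^sup>2)"
      using usq_le[OF adm, of u] a B \<sigma>_pos epsm
      by (intro add_right_mono add_left_mono mult_mono) auto
    also have "\<dots> = 2 * (B + \<sigma>) * (eps * v\<^sup>2) + K1 * (l * u\<^sup>2)"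
      by (simp add: K1_def algebra_simps add_divide_distrib)
    also have "\<dots> \<le> (2 * (B + \<sigma>) + K1) * (eps * v\<^sup>2) + (2 * (B + \<sigma>) + K1) * (l * u\<^sup>2)"
      using K1 B \<sigma>_pos a l0 by (intro add_mono mult_right_mono) auto
    also have "\<dots> = (2 * (B + \<sigma>) + K1) * mode_energy eps l u v"
      by (simp add: mode_energy_def distrib_left)
    finally show ?thesis .
  qed
  moreover have "0 < 2 * (B + \<sigma>) + K1" using K1 B \<sigma>_pos by simp
  ultimately show ?thesis using that by blast
qed

text \<open>
  Both coefficients in \<open>cone_identity\<close> exceed what is needed: that of \<open>y\<^sup>2\<close> by \<open>b0\<close>, and that of
  \<open>u\<^sup>2\<close> by a multiple of the distance of \<open>l\<close> to the middle of the gap, since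
  \<open>s (2 (l - \<mu>) - s) = \<sigma> (2 |l - \<mu>| - \<sigma>)\<close> and \<open>|l - \<mu>| \<ge> \<kappa> > \<sigma>\<close>. The surplus dominates
  \<open>v\<^sup>2 + l u\<^sup>2\<close>.
\<close>

lemma cone_rate_exact:
  obtains \<delta> where "0 < \<delta>"
    "\<And>eps l s u v h. admissible eps l s \<Longrightarrow>
       cone_rate eps \<mu> s l u v h + 2 * slow_rate eps \<mu> * cone_form eps \<mu> s l u v
         \<le> h\<^sup>2 - \<sigma>\<^sup>2 * u\<^sup>2 - 2 * \<delta> * (v\<^sup>2 + l * u\<^sup>2)"
proof -
  define c1 where "c1 = 2 * \<sigma> * (1 - \<sigma> / \<kappa>) / (1 + \<bar>\<mu>\<bar> / \<kappa>)"
  have pos: "0 < 1 + \<bar>\<mu>\<bar> / \<kappa>" using \<sigma>_pos by (simp add: add_pos_nonneg)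
  have c1: "0 < c1" using \<sigma>_pos \<sigma>\<kappa> pos by (simp add: c1_def)
  define T where "T = 2 * (2 * \<bar>\<mu>\<bar>)\<^sup>2"
  have T: "0 \<le> T" by (simp add: T_def)
  define \<delta> where "\<delta> = min (b0 / 4) (c1 / (2 + 2 * T / l0))"
  have pos2: "0 < 2 + 2 * T / l0" using T l0 by (simp add: add_pos_nonneg)
  have \<delta>: "0 < \<delta>" "4 * \<delta> \<le> b0" "\<delta> * (2 + 2 * T / l0) \<le> c1"
  proof -
    show "0 < \<delta>" using b0 c1 pos2 by (simp add: \<delta>_def)
    show "4 * \<delta> \<le> b0" by (simp add: \<delta>_def)
    have "\<delta> \<le> c1 / (2 + 2 * T / l0)" by (simp add: \<delta>_def)
    then show "\<delta> * (2 + 2 * T / l0) \<le> c1" using pos2 by (simp only: pos_le_divide_eq)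
  qed
  have "cone_rate eps \<mu> s l u v h + 2 * slow_rate eps \<mu> * cone_form eps \<mu> s l u v
         \<le> h\<^sup>2 - \<sigma>\<^sup>2 * u\<^sup>2 - 2 * \<delta> * (v\<^sup>2 + l * u\<^sup>2)"
    if adm: "admissible eps l s" for eps l s u v h
  proof -
    note a = admissibleD[OF adm] and b = beta_bounds[OF adm]
    define y \<beta> D where "y = v + slow_rate eps \<mu> * u" and "\<beta> = 1 - 2 * eps * slow_rate eps \<mu>"
      and "D = \<bar>l - \<mu>\<bar>"
    have D: "\<kappa> \<le> D" "l \<le> (1 + \<bar>\<mu>\<bar> / \<kappa>) * D" using a l_le_gap[OF adm] by (auto simp: D_def)
    have ss: "s * (2 * (l - \<mu>) - s) = \<sigma>\<^sup>2 + 2 * \<sigma> * (D - \<sigma>)"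
    proof -
      have "s * s = \<sigma> * \<sigma>" using a(6) by (metis abs_mult_self_eq)
      then show ?thesis using a(8) by (simp add: D_def algebra_simps power2_eq_square)
    qed
    have "c1 * l \<le> c1 * ((1 + \<bar>\<mu>\<bar> / \<kappa>) * D)" using D c1 by (intro mult_left_mono) auto
    also have "\<dots> = 2 * \<sigma> * (D - \<sigma> * (D / \<kappa>))"
      using pos by (simp add: c1_def field_simps)
    also have "\<dots> \<le> 2 * \<sigma> * (D - \<sigma> * 1)"
      using D \<sigma>_pos by (intro mult_left_mono diff_mono) auto
    finally have cl: "c1 * l * u\<^sup>2 \<le> 2 * \<sigma> * (D - \<sigma>) * u\<^sup>2" by (intro mult_right_mono) auto
    have "v\<^sup>2 \<le> 2 * y\<^sup>2 + T * u\<^sup>2" using shift_sq_le(2)[OF adm, of v u] by (simp add: y_def T_def)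
    also have "\<dots> \<le> 2 * y\<^sup>2 + T * (l * u\<^sup>2 / l0)"
      using usq_le[OF adm, of u] T by (intro add_left_mono mult_left_mono) auto
    finally have "2 * \<delta> * (v\<^sup>2 + l * u\<^sup>2) \<le> 2 * \<delta> * (2 * y\<^sup>2 + T * (l * u\<^sup>2 / l0) + l * u\<^sup>2)"
      using \<delta> by (intro mult_left_mono) auto
    also have "\<dots> = 4 * \<delta> * y\<^sup>2 + \<delta> * (2 + 2 * T / l0) * (l * u\<^sup>2)" by (simp add: algebra_simps)
    also have "\<dots> \<le> b0 * y\<^sup>2 + c1 * (l * u\<^sup>2)"
      using \<delta> a l0 by (intro add_mono mult_right_mono) auto
    also have "\<dots> \<le> (\<beta>\<^sup>2 - 2 * eps * s) * y\<^sup>2 + 2 * \<sigma> * (D - \<sigma>) * u\<^sup>2"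
      using b cl by (intro add_mono mult_right_mono) (auto simp: \<beta>_def mult.assoc)
    finally have "2 * \<delta> * (v\<^sup>2 + l * u\<^sup>2) \<le> (\<beta>\<^sup>2 - 2 * eps * s) * y\<^sup>2 + 2 * \<sigma> * (D - \<sigma>) * u\<^sup>2" .
    moreover have "cone_rate eps \<mu> s l u v h + 2 * slow_rate eps \<mu> * cone_form eps \<mu> s l u v
       = h\<^sup>2 - (h - \<beta> * y - s * u)\<^sup>2 - (\<beta>\<^sup>2 - 2 * eps * s) * y\<^sup>2 - (\<sigma>\<^sup>2 + 2 * \<sigma> * (D - \<sigma>)) * u\<^sup>2"
      using cone_identity[OF a(3), of s l u v h] ss by (simp add: y_def \<beta>_def)
    ultimately show ?thesis
      using zero_le_power2[of "h - \<beta> * y - s * u"]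
        distrib_right[of "\<sigma>\<^sup>2" "2 * \<sigma> * (D - \<sigma>)" "u\<^sup>2"] by linarith
  qed
  then show ?thesis using \<delta> that by blast
qed

text \<open>
  The surplus absorbs a change of the rate by \<open>\<eta>\<close> and of the form by \<open>c\<close> times the
  energy. The factor \<open>k > 1\<close> in front of \<open>h\<^sup>2\<close> is paid for by \<open>L < \<sigma>\<close>.
\<close>

lemma cone_rate_perturbed:
  "\<exists>\<eta> \<delta> d k. 0 < \<eta> \<and> 0 < \<delta> \<and> 0 < d \<and> 0 < k \<and>
    (\<forall>eps l s u v h \<theta> c. admissible eps l s \<longrightarrow> \<bar>\<theta> - slow_rate eps \<mu>\<bar> \<le> \<eta> \<longrightarrow> \<bar>c\<bar> \<le> d \<longrightarrow>
       cone_rate eps \<mu> s l u v h + 2 * \<theta> * cone_form eps \<mu> s l u v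
         + c * (2 * v * (h - v) + 2 * \<theta> * mode_energy eps l u v)
         \<le> k * (h\<^sup>2 - L\<^sup>2 * u\<^sup>2) - \<delta> * (v\<^sup>2 + l * u\<^sup>2))"
proof -
  obtain K where K: "0 < K"
    "\<And>eps l s u v. admissible eps l s \<Longrightarrow> \<bar>cone_form eps \<mu> s l u v\<bar> \<le> K * mode_energy eps l u v"
    using cone_form_bounded by blast
  obtain \<delta> where \<delta>: "0 < \<delta>"
    "\<And>eps l s u v h. admissible eps l s \<Longrightarrow>
       cone_rate eps \<mu> s l u v h + 2 * slow_rate eps \<mu> * cone_form eps \<mu> s l u v
         \<le> h\<^sup>2 - \<sigma>\<^sup>2 * u\<^sup>2 - 2 * \<delta> * (v\<^sup>2 + l * u\<^sup>2)"
    using cone_rate_exact by blast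
  define m where "m = 1 + epsm"
  have m: "1 \<le> m" using epsm by (simp add: m_def)
  define \<eta> where "\<eta> = min 1 (\<delta> / (4 * K * m))"
  have \<eta>: "0 < \<eta>" "\<eta> \<le> 1" "4 * \<eta> * (K * m) \<le> \<delta>"
  proof -
    have Km: "0 < K * m" using K(1) m by simp
    then show "0 < \<eta>" using \<delta>(1) by (simp add: \<eta>_def mult.assoc)
    show "\<eta> \<le> 1" by (simp add: \<eta>_def)
    have "\<eta> \<le> \<delta> / (4 * (K * m))" by (simp add: \<eta>_def mult.assoc)
    then show "4 * \<eta> * (K * m) \<le> \<delta>" using Km by (simp add: pos_le_divide_eq mult_ac)
  qed
  define R where "R = 3 + 2 * (2 * \<bar>\<mu>\<bar> + 1) * m"
  have R: "0 < R" using m by (simp add: R_def add_pos_nonneg)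
  define d where "d = min (\<delta> / (2 * R)) (\<sigma>\<^sup>2 / L\<^sup>2 - 1)"
  have LS: "L\<^sup>2 < \<sigma>\<^sup>2" using L by (intro power_strict_mono) auto
  have d: "0 < d" "2 * (d * R) \<le> \<delta>" "(1 + d) * L\<^sup>2 \<le> \<sigma>\<^sup>2"
  proof -
    show "0 < d" using R \<delta>(1) LS L by (simp add: d_def)
    have "d \<le> \<delta> / (2 * R)" by (simp add: d_def)
    then show "2 * (d * R) \<le> \<delta>" using R by (simp add: field_simps)
    have "1 + d \<le> \<sigma>\<^sup>2 / L\<^sup>2" by (simp add: d_def)
    then show "(1 + d) * L\<^sup>2 \<le> \<sigma>\<^sup>2" using L by (simp add: field_simps)
  qed
  have "cone_rate eps \<mu> s l u v h + 2 * \<theta> * cone_form eps \<mu> s l u v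
         + c * (2 * v * (h - v) + 2 * \<theta> * mode_energy eps l u v)
         \<le> (1 + d) * (h\<^sup>2 - L\<^sup>2 * u\<^sup>2) - \<delta> * (v\<^sup>2 + l * u\<^sup>2)"
    if adm: "admissible eps l s" and th: "\<bar>\<theta> - slow_rate eps \<mu>\<bar> \<le> \<eta>" and c: "\<bar>c\<bar> \<le> d"
    for eps l s u v h \<theta> c
  proof -
    note a = admissibleD[OF adm]
    define V E where "V = cone_form eps \<mu> s l u v" and "E = mode_energy eps l u v"
    have lu: "0 \<le> l * u\<^sup>2" using a l0 by simp
    have E: "0 \<le> E" "E \<le> m * (v\<^sup>2 + l * u\<^sup>2)"
    proof -
      show "0 \<le> E" using a lu by (simp add: E_def mode_energy_def)
      have "eps * v\<^sup>2 \<le> m * v\<^sup>2" using a epsm by (intro mult_right_mono) (auto simp: m_def)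
      moreover have "1 * (l * u\<^sup>2) \<le> m * (l * u\<^sup>2)" using lu m by (intro mult_right_mono) auto
      ultimately show "E \<le> m * (v\<^sup>2 + l * u\<^sup>2)" by (simp add: E_def mode_energy_def distrib_left)
    qed
    define W where "W = v\<^sup>2 + l * u\<^sup>2"
    have W: "0 \<le> W" "E \<le> m * W" using lu E by (auto simp: W_def)
    have 1: "2 * (\<theta> - slow_rate eps \<mu>) * V \<le> \<delta> / 2 * W"
    proof -
      have "2 * (\<theta> - slow_rate eps \<mu>) * V \<le> 2 * (\<bar>\<theta> - slow_rate eps \<mu>\<bar> * \<bar>V\<bar>)"
        by (metis abs_ge_self abs_mult mult.assoc mult_left_mono zero_le_numeral)
      also have "\<dots> \<le> 2 * (\<eta> * (K * (m * W)))"
        using th K(2)[OF adm, of u v] W K(1) \<eta>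
        unfolding V_def[symmetric] E_def[symmetric]
        by (intro mult_left_mono mult_mono) (auto intro: order_trans[OF _ mult_left_mono])
      also have "\<dots> = (4 * \<eta> * (K * m)) / 2 * W" by simp
      also have "\<dots> \<le> \<delta> / 2 * W" using \<eta>(3) W by (intro mult_right_mono divide_right_mono) auto
      finally show ?thesis .
    qed
    have 2: "c * (2 * v * (h - v) + 2 * \<theta> * E) \<le> d * h\<^sup>2 + \<delta> / 2 * W"
    proof -
      have f1: "\<bar>2 * v * (h - v)\<bar> \<le> 3 * v\<^sup>2 + h\<^sup>2"
        using zero_le_power2[of "v + h"] zero_le_power2[of "v - h"]
        by (auto simp: power2_eq_square algebra_simps abs_le_iff) (use zero_le_square[of v] in linarith)+
      have f2: "v\<^sup>2 \<le> W" using lu by (simp add: W_def)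
      have "\<bar>\<theta>\<bar> \<le> 2 * \<bar>\<mu>\<bar> + 1" using th \<eta>(2) theta_bound[OF adm] by linarith
      then have "\<bar>\<theta>\<bar> * E \<le> (2 * \<bar>\<mu>\<bar> + 1) * (m * W)" using E W by (intro mult_mono) auto
      then have "2 * (\<bar>\<theta>\<bar> * E) \<le> 2 * ((2 * \<bar>\<mu>\<bar> + 1) * (m * W))"
        by (rule mult_left_mono) simp
      moreover have "\<bar>2 * \<theta> * E\<bar> = 2 * (\<bar>\<theta>\<bar> * E)" using E(1) by (simp add: abs_mult)
      ultimately have f3: "\<bar>2 * \<theta> * E\<bar> \<le> 2 * (2 * \<bar>\<mu>\<bar> + 1) * m * W" by (simp only: mult.assoc)
      have "\<bar>2 * v * (h - v) + 2 * \<theta> * E\<bar> \<le> \<bar>2 * v * (h - v)\<bar> + \<bar>2 * \<theta> * E\<bar>"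
        by (rule abs_triangle_ineq)
      also have "\<dots> \<le> (3 * v\<^sup>2 + h\<^sup>2) + 2 * (2 * \<bar>\<mu>\<bar> + 1) * m * W"
        by (rule add_mono[OF f1 f3])
      also have "\<dots> \<le> (3 * W + h\<^sup>2) + 2 * (2 * \<bar>\<mu>\<bar> + 1) * m * W"
        by (rule add_right_mono, rule add_right_mono, rule mult_left_mono[OF f2]) simp
      also have "\<dots> = h\<^sup>2 + R * W"
        unfolding R_def distrib_right[of 3] by (simp only: ac_simps)
      finally have "\<bar>2 * v * (h - v) + 2 * \<theta> * E\<bar> \<le> h\<^sup>2 + R * W" .
      then have "\<bar>c\<bar> * \<bar>2 * v * (h - v) + 2 * \<theta> * E\<bar> \<le> d * (h\<^sup>2 + R * W)"
        using c by (intro mult_mono) auto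
      moreover have "c * (2 * v * (h - v) + 2 * \<theta> * E) \<le> \<bar>c\<bar> * \<bar>2 * v * (h - v) + 2 * \<theta> * E\<bar>"
        by (metis abs_ge_self abs_mult)
      moreover have "(d * R) * W \<le> \<delta> / 2 * W" using d W by (intro mult_right_mono) auto
      ultimately show ?thesis by (simp add: distrib_left mult.assoc)
    qed
    have 3: "(1 + d) * L\<^sup>2 * u\<^sup>2 \<le> \<sigma>\<^sup>2 * u\<^sup>2" using d by (intro mult_right_mono) auto
    have 4: "cone_rate eps \<mu> s l u v h + 2 * slow_rate eps \<mu> * V \<le> h\<^sup>2 - \<sigma>\<^sup>2 * u\<^sup>2 - 2 * \<delta> * W"
      using \<delta>(2)[OF adm, of u v h] by (simp add: V_def W_def)
    have "cone_rate eps \<mu> s l u v h + 2 * \<theta> * V + c * (2 * v * (h - v) + 2 * \<theta> * E) =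
      (cone_rate eps \<mu> s l u v h + 2 * slow_rate eps \<mu> * V) + 2 * (\<theta> - slow_rate eps \<mu>) * V
        + c * (2 * v * (h - v) + 2 * \<theta> * E)" by (simp add: algebra_simps)
    also have "\<dots> \<le> (h\<^sup>2 - \<sigma>\<^sup>2 * u\<^sup>2 - 2 * \<delta> * W) + \<delta> / 2 * W + (d * h\<^sup>2 + \<delta> / 2 * W)"
      using 1 2 4 by (intro add_mono) auto
    also have "\<dots> = (1 + d) * h\<^sup>2 - \<sigma>\<^sup>2 * u\<^sup>2 - \<delta> * W" by (simp add: algebra_simps)
    also have "\<dots> \<le> (1 + d) * (h\<^sup>2 - L\<^sup>2 * u\<^sup>2) - \<delta> * W" using 3 by (simp add: algebra_simps)
    finally show ?thesis by (simp add: V_def E_def W_def)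
  qed
  moreover have "0 < 1 + d" using d by simp
  ultimately show ?thesis
    using \<eta>(1) \<delta>(1) d(1)
    by (intro exI[of _ \<eta>] exI[of _ \<delta>] exI[of _ d] exI[of _ "1 + d"] conjI allI impI)
qed

text \<open>
  For a fast mode the form is positive definite: in \<open>y\<close> and \<open>u\<close> its discriminant has the right
  sign because \<open>eps \<sigma>\<^sup>2 < \<beta>\<^sup>2 (l - \<mu>)\<close>.
\<close>

lemma cone_form_fast:
  obtains d where "0 < d" "\<And>eps l u v. admissible eps l \<sigma> \<Longrightarrow>
     d * mode_energy eps l u v \<le> cone_form eps \<mu> \<sigma> l u v"
proof -
  define T where "T = 2 * (2 * \<bar>\<mu>\<bar>)\<^sup>2"
  define R where "R = (epsm * T / l0 + 1) * (1 + \<bar>\<mu>\<bar> / \<kappa>)"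
  have T: "0 \<le> T" by (simp add: T_def)
  have R: "0 < R" unfolding R_def using T epsm l0 \<sigma>_pos by (intro mult_pos_pos add_nonneg_pos add_pos_nonneg) auto
  define d where "d = min (sqrt b0 / 8) (sqrt b0 / (3 * R))"
  have d: "0 < d" "8 * d \<le> sqrt b0" "3 * (d * R) \<le> sqrt b0"
    using R b0 by (auto simp: d_def min_def field_simps)
  have "d * mode_energy eps l u v \<le> cone_form eps \<mu> \<sigma> l u v"
    if adm: "admissible eps l \<sigma>" for eps l u v
  proof -
    note a = admissibleD[OF adm] and b = beta_bounds[OF adm]
    define y \<beta> D where "y = v + slow_rate eps \<mu> * u" and "\<beta> = 1 - 2 * eps * slow_rate eps \<mu>"
      and "D = l - \<mu>"
    have D: "\<kappa> \<le> D" using adm \<sigma>_pos by (auto simp: admissible_def D_def)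
    have \<beta>: "0 < \<beta>" "sqrt b0 \<le> \<beta>" "2 * eps * \<sigma> \<le> \<beta>\<^sup>2" using b b0 by (auto simp: \<beta>_def)
    have "2 * eps * \<sigma> * \<sigma> \<le> \<beta>\<^sup>2 * D" using \<beta> D \<sigma>\<kappa> \<sigma>_pos a by (intro mult_mono) auto
    then have 1: "eps * \<sigma>\<^sup>2 / \<beta> \<le> \<beta> * D / 2" using \<beta> by (simp add: field_simps power2_eq_square)
    have "0 \<le> eps * (3 / 4 * \<beta>) * (y + 4 / 3 * \<sigma> * u / \<beta>)\<^sup>2" using a \<beta> by simp
    also have "\<dots> = 3 / 4 * (eps * \<beta> * y\<^sup>2) + 2 * eps * \<sigma> * y * u + 4 / 3 * (eps * \<sigma>\<^sup>2 / \<beta>) * u\<^sup>2"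
      using \<beta> by (simp add: power2_eq_square field_simps)
    finally have 2: "0 \<le> 3 / 4 * (eps * \<beta> * y\<^sup>2) + 2 * eps * \<sigma> * y * u + 4 / 3 * (eps * \<sigma>\<^sup>2 / \<beta>) * u\<^sup>2" .
    have 3: "4 / 3 * (eps * \<sigma>\<^sup>2 / \<beta>) * u\<^sup>2 \<le> 4 / 3 * (\<beta> * D / 2) * u\<^sup>2"
      using 1 by (intro mult_right_mono mult_left_mono) auto
    have V: "cone_form eps \<mu> \<sigma> l u v = eps * \<beta> * y\<^sup>2 + 2 * eps * \<sigma> * y * u + \<beta> * D * u\<^sup>2"
      by (simp add: cone_form_def y_def \<beta>_def D_def)
    have 4: "\<beta> * (eps * y\<^sup>2) / 4 + \<beta> * (D * u\<^sup>2) / 3 \<le> cone_form eps \<mu> \<sigma> l u v"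
    proof -
      have "4 / 3 * (\<beta> * D / 2) * u\<^sup>2 = 2 / 3 * (\<beta> * D * u\<^sup>2)" by simp
      moreover have "\<beta> * (eps * y\<^sup>2) = eps * \<beta> * y\<^sup>2" "\<beta> * (D * u\<^sup>2) = \<beta> * D * u\<^sup>2" by simp_all
      ultimately show ?thesis using 2 3 unfolding V by linarith
    qed
    have "mode_energy eps l u v \<le> eps * (2 * y\<^sup>2 + T * u\<^sup>2) + l * u\<^sup>2"
      using shift_sq_le(2)[OF adm, of v u] a unfolding mode_energy_def y_def T_def
      by (intro add_right_mono mult_left_mono) auto
    also have "\<dots> \<le> 2 * (eps * y\<^sup>2) + epsm * (T * (l * u\<^sup>2 / l0)) + l * u\<^sup>2"
    proof -
      have "eps * (T * u\<^sup>2) \<le> epsm * (T * (l * u\<^sup>2 / l0))"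
        using usq_le[OF adm, of u] a T by (intro mult_mono) auto
      then show ?thesis by (simp add: distrib_left)
    qed
    also have "\<dots> = 2 * (eps * y\<^sup>2) + (epsm * T / l0 + 1) * (l * u\<^sup>2)" by (simp add: algebra_simps)
    also have "\<dots> \<le> 2 * (eps * y\<^sup>2) + (epsm * T / l0 + 1) * ((1 + \<bar>\<mu>\<bar> / \<kappa>) * D * u\<^sup>2)"
    proof -
      have "\<bar>l - \<mu>\<bar> = D" using D \<sigma>_pos by (simp add: D_def)
      then show ?thesis
        using l_le_gap[OF adm] T epsm l0 by (intro add_left_mono mult_left_mono mult_right_mono) auto
    qed
    also have "\<dots> = 2 * (eps * y\<^sup>2) + R * (D * u\<^sup>2)" by (simp add: R_def)
    finally have "d * mode_energy eps l u v \<le> d * (2 * (eps * y\<^sup>2) + R * (D * u\<^sup>2))"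
      using d by (intro mult_left_mono) auto
    also have "\<dots> = (8 * d) * (eps * y\<^sup>2) / 4 + (3 * (d * R)) * (D * u\<^sup>2) / 3" by (simp add: algebra_simps)
    also have "\<dots> \<le> \<beta> * (eps * y\<^sup>2) / 4 + \<beta> * (D * u\<^sup>2) / 3"
      using d \<beta> a D \<sigma>_pos by (intro add_mono divide_right_mono mult_right_mono) auto
    finally show ?thesis using 4 by linarith
  qed
  then show ?thesis using that d by blast
qed

text \<open>
  For a slow mode the rate \<open>\<nu>\<close> is real and below \<open>\<theta>\<close>. The factorisation
  \<open>l - \<mu> = - (\<theta> - \<nu>) (1 - eps (\<theta> + \<nu>))\<close> of the difference of the two quadratic
  equations bounds their distance from below.
\<close>

lemma slow_mode_facts:
  assumes adm: "admissible eps l (- \<sigma>)"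
  defines "\<theta> \<equiv> slow_rate eps \<mu>" and "\<nu> \<equiv> slow_rate eps l"
  defines "\<beta> \<equiv> 1 - 2 * eps * \<theta>" and "\<rho> \<equiv> \<theta> - \<nu>"
  defines "B \<equiv> \<beta> + eps * \<rho>"
  shows "4 * eps * l < 1" "0 < \<mu>" "0 < \<nu>" "\<beta> \<le> B" "B \<le> 1" "\<kappa> \<le> \<rho>" "\<rho> \<le> 2 * \<bar>\<mu>\<bar>" "l - \<mu> = - \<rho> * B"
proof -
  note a = admissibleD[OF adm] and b = beta_bounds[OF adm]
  have lm: "\<kappa> \<le> \<mu> - l" using adm \<sigma>_pos by (auto simp: admissible_def)
  show \<mu>: "0 < \<mu>" using lm \<sigma>_pos a l0 by linarith
  have el: "4 * eps * l \<le> 4 * eps * \<mu>" using lm \<sigma>_pos a by (intro mult_left_mono) auto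
  have b2: "0 < 1 - 4 * eps * \<mu>" using b(7) b(4) b0 by linarith
  then show l4: "4 * eps * l < 1" using el by linarith
  have Sl: "1 - 2 * eps * \<nu> = sqrt (1 - 4 * eps * l)" unfolding \<nu>_def using l4 by (intro slow_rate_beta) auto
  have S\<mu>: "\<beta> = sqrt (1 - 4 * eps * \<mu>)" unfolding \<beta>_def \<theta>_def using a by (intro slow_rate_beta)
  have el0: "0 \<le> eps * l" "0 \<le> eps * \<mu>" using a l0 \<mu> by auto
  have "\<beta> \<le> 1 - 2 * eps * \<nu>" unfolding Sl S\<mu> using el by (intro real_sqrt_le_mono) auto
  moreover have "2 * B = \<beta> + (1 - 2 * eps * \<nu>)" by (simp add: B_def \<beta>_def \<rho>_def algebra_simps)
  moreover have "1 - 2 * eps * \<nu> \<le> 1" unfolding Sl using el0 by auto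
  ultimately show B: "\<beta> \<le> B" "B \<le> 1" by linarith+
  have "l > 0" using a l0 by linarith
  moreover have "0 < 1 + sqrt (1 - 4 * eps * l)" using l4 by (simp add: add_pos_nonneg)
  ultimately show \<nu>: "0 < \<nu>" by (simp add: \<nu>_def slow_rate_def)
  have e: "\<theta> - eps * \<theta>\<^sup>2 = \<mu>" "\<nu> - eps * \<nu>\<^sup>2 = l"
    unfolding \<theta>_def \<nu>_def using a l4 by (auto intro: slow_rate_eq)
  then show d: "l - \<mu> = - \<rho> * B"
    unfolding e[symmetric] B_def \<beta>_def \<rho>_def by (simp add: power2_eq_square algebra_simps)
  show "\<rho> \<le> 2 * \<bar>\<mu>\<bar>" using theta_bound[OF adm] \<nu> by (simp add: \<rho>_def \<theta>_def)
  have B0: "0 < B" using B(1) b(3) by (simp add: \<beta>_def \<theta>_def)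
  have rB: "\<kappa> \<le> \<rho> * B" using d lm by linarith
  have "0 < \<rho>"
  proof (rule ccontr)
    assume "\<not> 0 < \<rho>"
    then have "\<rho> * B \<le> 0" using B0 by (simp add: mult_nonpos_nonneg)
    then show False using rB \<sigma>_pos by linarith
  qed
  then have "\<rho> * B \<le> \<rho> * 1" using B by (intro mult_left_mono) auto
  then show "\<kappa> \<le> \<rho>" using rB by linarith
qed

text \<open>
  For a slow mode the form is indefinite, and it is negative only through the slow coordinate
  \<open>p = eps y + B u\<close>. Substituting \<open>u = (p - eps y) / B\<close> leaves the coefficient
  \<open>eps (\<beta>\<^sup>2 + 2 eps \<sigma>) / B > 0\<close> of \<open>y\<^sup>2\<close>, and the mixed term is absorbed.
\<close>

lemma cone_form_slow:
  obtains d K where "0 < d" "0 < K" "\<And>eps l u v. admissible eps l (- \<sigma>) \<Longrightarrow>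
     d * mode_energy eps l u v - K * (slow_coord eps l u v)\<^sup>2 \<le> cone_form eps \<mu> (- \<sigma>) l u v"
proof -
  define T where "T = 2 * (2 * \<bar>\<mu>\<bar>)\<^sup>2"
  have T: "0 \<le> T" by (simp add: T_def)
  define Q where "Q = 2 * (epsm * T + \<bar>\<mu>\<bar>) / b0"
  have Q: "0 \<le> Q" using T epsm b0 by (simp add: Q_def)
  define R where "R = 2 * epsm * (2 * \<bar>\<mu>\<bar> + \<sigma>)\<^sup>2 / b0 + 2 * \<bar>\<mu>\<bar>"
  have R: "0 \<le> R" using epsm b0 by (simp add: R_def)
  define d where "d = b0 / (2 * (2 + Q * epsm))"
  have pos: "0 < 2 + Q * epsm" using Q epsm by (simp add: add_pos_nonneg)
  have d: "0 < d" "d * (2 + Q * epsm) = b0 / 2" using b0 pos by (auto simp: d_def field_simps)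
  define K where "K = d * Q + 2 * R / sqrt b0 + 1"
  have "d * mode_energy eps l u v - K * (slow_coord eps l u v)\<^sup>2 \<le> cone_form eps \<mu> (- \<sigma>) l u v"
    if adm: "admissible eps l (- \<sigma>)" for eps l u v
  proof -
    note a = admissibleD[OF adm] and b = beta_bounds[OF adm] and f = slow_mode_facts[OF adm]
    define \<theta> \<nu> where "\<theta> = slow_rate eps \<mu>" and "\<nu> = slow_rate eps l"
    define \<beta> \<rho> where "\<beta> = 1 - 2 * eps * \<theta>" and "\<rho> = \<theta> - \<nu>"
    define B y p where "B = \<beta> + eps * \<rho>" and "y = v + \<theta> * u" and "p = slow_coord eps l u v"
    note defs = \<theta>_def \<nu>_def \<beta>_def \<rho>_def B_def
    have \<beta>: "0 < \<beta>" "sqrt b0 \<le> \<beta>" "b0 \<le> \<beta>\<^sup>2" using b by (auto simp: \<beta>_def \<theta>_def)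
    have B: "\<beta> \<le> B" "B \<le> 1" "0 < B" "l - \<mu> = - \<rho> * B" "\<kappa> \<le> \<rho>" "\<rho> \<le> 2 * \<bar>\<mu>\<bar>"
      using f \<beta> by (auto simp: defs)
    have \<beta>1: "\<beta> \<le> 1" using B by linarith
    have p: "p = eps * y + B * u"
      by (simp add: p_def slow_coord_def y_def B_def \<beta>_def \<rho>_def \<nu>_def algebra_simps)
    define V where "V = cone_form eps \<mu> (- \<sigma>) l u v"
    have V: "V = eps * \<beta> * y\<^sup>2 - 2 * \<sigma> * eps * u * y - \<beta> * \<rho> * B * u\<^sup>2"
      using B(4) unfolding V_def cone_form_def \<theta>_def[symmetric] \<beta>_def[symmetric] y_def[symmetric]
      by simp
    (* Multiplied by B, since u enters through B u = p - eps y. *)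
    have VB: "V * B = eps * y\<^sup>2 * (\<beta>\<^sup>2 + 2 * \<sigma> * eps) + 2 * eps * (\<beta> * \<rho> - \<sigma>) * y * p - \<beta> * \<rho> * p\<^sup>2"
      unfolding V p B_def by (simp add: power2_eq_square algebra_simps)
    have y1: "0 \<le> eps * (\<beta> * y / 2 + 2 * (\<beta> * \<rho> - \<sigma>) * p / \<beta>)\<^sup>2" using a by simp
    have y2: "eps * (\<beta> * y / 2 + 2 * (\<beta> * \<rho> - \<sigma>) * p / \<beta>)\<^sup>2 =
        eps * \<beta>\<^sup>2 * y\<^sup>2 / 4 + 2 * eps * (\<beta> * \<rho> - \<sigma>) * y * p + 4 * eps * (\<beta> * \<rho> - \<sigma>)\<^sup>2 / \<beta>\<^sup>2 * p\<^sup>2"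
      using \<beta> by (simp add: power2_eq_square field_simps)
    have "(\<beta> * \<rho> - \<sigma>)\<^sup>2 \<le> (2 * \<bar>\<mu>\<bar> + \<sigma>)\<^sup>2"
    proof -
      have "\<beta> * \<rho> \<le> 1 * (2 * \<bar>\<mu>\<bar>)" using \<beta>1 B \<beta> \<sigma>_pos by (intro mult_mono) auto
      moreover have "0 \<le> \<beta> * \<rho>" using \<beta> B \<sigma>_pos by simp
      ultimately show ?thesis using \<sigma>_pos by (intro power2_le_iff_abs_le[THEN iffD2]) auto
    qed
    then have "eps * (\<beta> * \<rho> - \<sigma>)\<^sup>2 / \<beta>\<^sup>2 \<le> epsm * (2 * \<bar>\<mu>\<bar> + \<sigma>)\<^sup>2 / b0"
      using a \<beta> b0 by (intro frac_le mult_mono) auto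
    then have "4 * eps * (\<beta> * \<rho> - \<sigma>)\<^sup>2 / \<beta>\<^sup>2 * p\<^sup>2 \<le> 4 * (epsm * (2 * \<bar>\<mu>\<bar> + \<sigma>)\<^sup>2 / b0) * p\<^sup>2"
      by (intro mult_right_mono) auto
    moreover have "\<beta> * \<rho> * p\<^sup>2 \<le> 2 * \<bar>\<mu>\<bar> * p\<^sup>2"
    proof -
      have "\<beta> * \<rho> \<le> 1 * (2 * \<bar>\<mu>\<bar>)" using \<beta>1 B \<beta> \<sigma>_pos by (intro mult_mono) auto
      then show ?thesis by (intro mult_right_mono) auto
    qed
    moreover have "0 \<le> eps * y\<^sup>2 * (2 * \<sigma> * eps)" using a \<sigma>_pos by simp
    moreover have "0 \<le> eps * \<beta>\<^sup>2 * y\<^sup>2" using a by simp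
    moreover have "0 \<le> 2 * \<bar>\<mu>\<bar> * p\<^sup>2" by simp
    moreover have "2 * R * p\<^sup>2 = 4 * (epsm * (2 * \<bar>\<mu>\<bar> + \<sigma>)\<^sup>2 / b0) * p\<^sup>2 + 2 * (2 * \<bar>\<mu>\<bar> * p\<^sup>2)"
      by (simp add: R_def algebra_simps)
    moreover have "eps * y\<^sup>2 * (\<beta>\<^sup>2 + 2 * \<sigma> * eps) = eps * \<beta>\<^sup>2 * y\<^sup>2 + eps * y\<^sup>2 * (2 * \<sigma> * eps)"
      by (simp add: algebra_simps)
    ultimately have "eps * \<beta>\<^sup>2 * y\<^sup>2 / 2 - 2 * R * p\<^sup>2 \<le> V * B"
      using y1 unfolding VB y2 by linarith
    then have VB2: "eps * b0 * y\<^sup>2 / 2 - 2 * R * p\<^sup>2 \<le> V * B"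
    proof -
      have "eps * b0 * y\<^sup>2 \<le> eps * \<beta>\<^sup>2 * y\<^sup>2" using a \<beta> by (intro mult_right_mono mult_left_mono) auto
      then show ?thesis using \<open>_ \<le> V * B\<close> by linarith
    qed
    have b0s: "0 < sqrt b0" using b0 by simp
    define X where "X = eps * b0 * y\<^sup>2 / 2"
    have X: "0 \<le> X" using a b0 by (simp add: X_def)
    have 1: "X - 2 * R / sqrt b0 * p\<^sup>2 \<le> V"
    proof -
      have "(X - 2 * R / sqrt b0 * p\<^sup>2) * B \<le> V * B"
      proof -
        have "X * B \<le> X * 1" using X B by (intro mult_left_mono) auto
        moreover have "2 * R * p\<^sup>2 \<le> 2 * R / sqrt b0 * p\<^sup>2 * B"
        proof -
          have "2 * R * p\<^sup>2 / sqrt b0 * sqrt b0 \<le> 2 * R * p\<^sup>2 / sqrt b0 * B"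
            using R b0s \<beta> B by (intro mult_left_mono) auto
          then show ?thesis using b0s by simp
        qed
        ultimately show ?thesis using VB2 unfolding X_def[symmetric] left_diff_distrib by linarith
      qed
      then show ?thesis using B by simp
    qed
    have usq: "u\<^sup>2 \<le> 2 / b0 * (p\<^sup>2 + epsm * (eps * y\<^sup>2))"
    proof -
      have "(B * u)\<^sup>2 + (p + eps * y)\<^sup>2 = 2 * p\<^sup>2 + 2 * (eps * y)\<^sup>2"
        unfolding p by (simp add: power2_eq_square algebra_simps)
      then have "(B * u)\<^sup>2 \<le> 2 * p\<^sup>2 + 2 * (eps * y)\<^sup>2"
        using zero_le_power2[of "p + eps * y"] by linarith
      moreover have "(eps * y)\<^sup>2 \<le> epsm * (eps * y\<^sup>2)"
      proof -
        have "eps * (eps * y\<^sup>2) \<le> epsm * (eps * y\<^sup>2)" using a by (intro mult_right_mono) auto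
        moreover have "(eps * y)\<^sup>2 = eps * (eps * y\<^sup>2)" by (simp add: power2_eq_square)
        ultimately show ?thesis by (simp only:)
      qed
      moreover have "b0 * u\<^sup>2 \<le> (B * u)\<^sup>2"
      proof -
        have "b0 \<le> B\<^sup>2" using \<beta>(3) power_mono[OF B(1), of 2] \<beta>(1) by linarith
        then show ?thesis unfolding power_mult_distrib by (intro mult_right_mono) auto
      qed
      moreover have "b \<le> 2 * (q + r)" if "z \<le> 2 * q + 2 * w" "w \<le> r" "b \<le> z" for b q r w z :: real
        unfolding distrib_left using that by linarith
      ultimately have "b0 * u\<^sup>2 \<le> 2 * (p\<^sup>2 + epsm * (eps * y\<^sup>2))" by blast
      then show ?thesis using b0 by (simp add: field_simps)
    qed
    have lmu: "l \<le> \<bar>\<mu>\<bar>" using adm \<sigma>_pos by (auto simp: admissible_def)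
    have "mode_energy eps l u v \<le> eps * (2 * y\<^sup>2 + T * u\<^sup>2) + l * u\<^sup>2"
      using shift_sq_le(2)[OF adm, of v u] a unfolding mode_energy_def y_def T_def \<theta>_def
      by (intro add_right_mono mult_left_mono) auto
    also have "\<dots> = 2 * (eps * y\<^sup>2) + (eps * T + l) * u\<^sup>2" by (simp add: algebra_simps)
    also have "\<dots> \<le> 2 * (eps * y\<^sup>2) + (epsm * T + \<bar>\<mu>\<bar>) * (2 / b0 * (p\<^sup>2 + epsm * (eps * y\<^sup>2)))"
      using usq a T lmu epsm by (intro add_left_mono mult_mono add_mono mult_right_mono) auto
    also have "\<dots> = (2 + Q * epsm) * (eps * y\<^sup>2) + Q * p\<^sup>2" by (simp add: Q_def algebra_simps add_divide_distrib)
    finally have "d * mode_energy eps l u v \<le> d * ((2 + Q * epsm) * (eps * y\<^sup>2) + Q * p\<^sup>2)"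
      using d by (intro mult_left_mono) auto
    also have "\<dots> = d * (2 + Q * epsm) * (eps * y\<^sup>2) + d * Q * p\<^sup>2" by (simp add: algebra_simps)
    also have "\<dots> = X + d * Q * p\<^sup>2" unfolding d(2) X_def by simp
    finally have "d * mode_energy eps l u v \<le> X + d * Q * p\<^sup>2" .
    then have "d * mode_energy eps l u v - K * p\<^sup>2 \<le> X - 2 * R / sqrt b0 * p\<^sup>2"
      unfolding K_def distrib_right using zero_le_power2[of p] by linarith
    then show ?thesis using 1 unfolding p_def V_def by linarith
  qed
  moreover have "0 < K" using d Q R b0 by (simp add: K_def add_nonneg_pos)
  ultimately show ?thesis using that d by blast
qed

text \<open>
  On the line of slow solutions, \<open>v = - \<nu> u\<close>, the form is negative definite. Data on this line
  put differences into the negative cone.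
\<close>

lemma cone_form_slow_line:
  obtains d where "0 < d" "\<And>eps l u. admissible eps l (- \<sigma>) \<Longrightarrow>
     cone_form eps \<mu> (- \<sigma>) l u (- slow_rate eps l * u) \<le> - d * mode_energy eps l u (- slow_rate eps l * u)"
proof -
  define R where "R = epsm * (2 * \<bar>\<mu>\<bar>)\<^sup>2 + \<bar>\<mu>\<bar> + 1"
  have R: "0 < R" using epsm by (simp add: R_def add_nonneg_pos)
  define d where "d = b0 * \<kappa> / R"
  have d: "0 < d" "d * R = b0 * \<kappa>" using R b0 \<sigma>_pos by (auto simp: d_def)
  have "cone_form eps \<mu> (- \<sigma>) l u (- slow_rate eps l * u) \<le> - d * mode_energy eps l u (- slow_rate eps l * u)"
    if adm: "admissible eps l (- \<sigma>)" for eps l u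
  proof -
    note a = admissibleD[OF adm] and b = beta_bounds[OF adm] and f = slow_mode_facts[OF adm]
    define \<theta> \<nu> where "\<theta> = slow_rate eps \<mu>" and "\<nu> = slow_rate eps l"
    define \<beta> \<rho> where "\<beta> = 1 - 2 * eps * \<theta>" and "\<rho> = \<theta> - \<nu>"
    define B where "B = \<beta> + eps * \<rho>"
    note defs = \<theta>_def \<nu>_def \<beta>_def \<rho>_def B_def
    have B: "l - \<mu> = - \<rho> * B" "\<kappa> \<le> \<rho>" "\<rho> \<le> 2 * \<bar>\<mu>\<bar>" "0 < \<nu>" "b0 \<le> \<beta>\<^sup>2" "0 < \<mu>"
      using f b by (auto simp: defs)
    have "cone_form eps \<mu> (- \<sigma>) l u (- \<nu> * u) = eps * \<beta> * (- \<nu> * u + \<theta> * u)\<^sup>2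
       + 2 * eps * (- \<sigma>) * (- \<nu> * u + \<theta> * u) * u + \<beta> * (- \<rho> * B) * u\<^sup>2"
      using B(1) by (simp add: cone_form_def \<beta>_def \<theta>_def)
    also have "\<dots> = - (\<beta>\<^sup>2 * \<rho> + 2 * eps * \<sigma> * \<rho>) * u\<^sup>2"
      by (simp add: B_def \<rho>_def power2_eq_square algebra_simps)
    also have "\<dots> \<le> - (b0 * \<kappa>) * u\<^sup>2"
    proof -
      have "b0 * \<kappa> \<le> \<beta>\<^sup>2 * \<rho>" using B b0 \<sigma>_pos by (intro mult_mono) auto
      moreover have "0 \<le> 2 * eps * \<sigma> * \<rho>" using a B \<sigma>_pos by simp
      ultimately have "- (\<beta>\<^sup>2 * \<rho> + 2 * eps * \<sigma> * \<rho>) \<le> - (b0 * \<kappa>)" by linarith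
      then show ?thesis by (rule mult_right_mono) (rule zero_le_power2)
    qed
    finally have 1: "cone_form eps \<mu> (- \<sigma>) l u (- \<nu> * u) \<le> - (b0 * \<kappa>) * u\<^sup>2" .
    have "mode_energy eps l u (- \<nu> * u) = (eps * \<nu>\<^sup>2 + l) * u\<^sup>2"
      by (simp add: mode_energy_def power2_eq_square algebra_simps)
    also have "\<dots> \<le> R * u\<^sup>2"
    proof -
      have "\<nu> \<le> 2 * \<bar>\<mu>\<bar>" using B theta_bound[OF adm] \<sigma>_pos by (simp add: \<rho>_def \<theta>_def)
      then have "\<nu>\<^sup>2 \<le> (2 * \<bar>\<mu>\<bar>)\<^sup>2" using B by (intro power_mono) auto
      then have "eps * \<nu>\<^sup>2 \<le> epsm * (2 * \<bar>\<mu>\<bar>)\<^sup>2" using a by (intro mult_mono) auto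
      moreover have "l \<le> \<bar>\<mu>\<bar>" using adm \<sigma>_pos by (auto simp: admissible_def)
      ultimately show ?thesis unfolding R_def by (intro mult_right_mono) auto
    qed
    finally have "d * mode_energy eps l u (- \<nu> * u) \<le> d * (R * u\<^sup>2)" using d by (intro mult_left_mono) auto
    then have "d * mode_energy eps l u (- \<nu> * u) \<le> b0 * \<kappa> * u\<^sup>2" using d(2) by (simp add: mult.assoc[symmetric])
    then show ?thesis using 1 by (simp add: \<nu>_def)
  qed
  then show ?thesis using that d by blast
qed

end

text \<open>
  Everything that the rest of the proof needs to know about a single mode. The sign of \<open>s\<close> tells
  fast modes from slow ones.
\<close>

definition cone_bounds ::
  "real \<Rightarrow> real \<Rightarrow> real \<Rightarrow> real \<Rightarrow> real \<Rightarrow> real \<Rightarrow> real \<Rightarrow> real \<Rightarrow> real \<Rightarrow> real \<Rightarrow> bool" where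
  "cone_bounds L \<mu> \<eta> \<delta> d K k eps l s \<longleftrightarrow>
     (\<forall>u v. \<bar>cone_form eps \<mu> s l u v\<bar> \<le> K * mode_energy eps l u v) \<and>
     (\<forall>u v h \<theta> c. \<bar>\<theta> - slow_rate eps \<mu>\<bar> \<le> \<eta> \<longrightarrow> \<bar>c\<bar> \<le> d \<longrightarrow>
        cone_rate eps \<mu> s l u v h + 2 * \<theta> * cone_form eps \<mu> s l u v
          + c * (2 * v * (h - v) + 2 * \<theta> * mode_energy eps l u v)
          \<le> k * (h\<^sup>2 - L\<^sup>2 * u\<^sup>2) - \<delta> * (v\<^sup>2 + l * u\<^sup>2)) \<and>
     (0 < s \<longrightarrow> (\<forall>u v. d * mode_energy eps l u v \<le> cone_form eps \<mu> s l u v)) \<and>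
     (s < 0 \<longrightarrow> (\<forall>u v. d * mode_energy eps l u v - K * (slow_coord eps l u v)\<^sup>2
                        \<le> cone_form eps \<mu> s l u v) \<and>
        (\<forall>u. cone_form eps \<mu> s l u (- slow_rate eps l * u)
               \<le> - d * mode_energy eps l u (- slow_rate eps l * u)) \<and>
        4 * eps * l < 1 \<and> 0 < slow_rate eps l)"

lemma (in cone_params) cone_bounds_uniform:
  obtains \<eta> \<delta> d K k where "0 < \<eta>" "0 < \<delta>" "0 < d" "0 < K" "0 < k"
    "\<And>eps l s. admissible eps l s \<Longrightarrow> cone_bounds L \<mu> \<eta> \<delta> d K k eps l s"
proof -
  obtain K1 where K1: "0 < K1"
    "\<And>eps l s u v. admissible eps l s \<Longrightarrow> \<bar>cone_form eps \<mu> s l u v\<bar> \<le> K1 * mode_energy eps l u v"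
    using cone_form_bounded by blast
  obtain \<eta> \<delta> d1 k where c: "0 < \<eta>" "0 < \<delta>" "0 < d1" "0 < k"
    "\<forall>eps l s u v h \<theta> c. admissible eps l s \<longrightarrow> \<bar>\<theta> - slow_rate eps \<mu>\<bar> \<le> \<eta> \<longrightarrow> \<bar>c\<bar> \<le> d1 \<longrightarrow>
       cone_rate eps \<mu> s l u v h + 2 * \<theta> * cone_form eps \<mu> s l u v
         + c * (2 * v * (h - v) + 2 * \<theta> * mode_energy eps l u v)
         \<le> k * (h\<^sup>2 - L\<^sup>2 * u\<^sup>2) - \<delta> * (v\<^sup>2 + l * u\<^sup>2)"
    using cone_rate_perturbed by (elim exE conjE) (rule that)
  obtain d2 where d2: "0 < d2" "\<And>eps l u v. admissible eps l \<sigma> \<Longrightarrow>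
     d2 * mode_energy eps l u v \<le> cone_form eps \<mu> \<sigma> l u v"
    using cone_form_fast by blast
  obtain d3 K3 where d3: "0 < d3" "0 < K3" "\<And>eps l u v. admissible eps l (- \<sigma>) \<Longrightarrow>
     d3 * mode_energy eps l u v - K3 * (slow_coord eps l u v)\<^sup>2 \<le> cone_form eps \<mu> (- \<sigma>) l u v"
    using cone_form_slow by blast
  obtain d4 where d4: "0 < d4" "\<And>eps l u. admissible eps l (- \<sigma>) \<Longrightarrow>
     cone_form eps \<mu> (- \<sigma>) l u (- slow_rate eps l * u) \<le> - d4 * mode_energy eps l u (- slow_rate eps l * u)"
    using cone_form_slow_line by blast
  define d K where "d = min (min d1 d2) (min d3 d4)" and "K = max K1 K3"
  have d: "0 < d" "d \<le> d1" "d \<le> d2" "d \<le> d3" "d \<le> d4" using c d2 d3 d4 by (auto simp: d_def)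
  have K: "0 < K" "K1 \<le> K" "K3 \<le> K" using K1 by (auto simp: K_def)
  have "cone_bounds L \<mu> \<eta> \<delta> d K k eps l s" if adm: "admissible eps l s" for eps l s
  proof -
    note a = admissibleD[OF adm]
    have E: "0 \<le> mode_energy eps l u v" for u v using a l0 by (simp add: mode_energy_def)
    have 1: "\<bar>cone_form eps \<mu> s l u v\<bar> \<le> K * mode_energy eps l u v" for u v
      using K1(2)[OF adm, of u v] mult_right_mono[OF K(2) E[of u v]] by linarith
    have 2: "d * mode_energy eps l u v \<le> cone_form eps \<mu> s l u v" if "0 < s" for u v
    proof -
      have s: "s = \<sigma>" using a(6) that by simp
      show ?thesis using d2(2)[OF adm[unfolded s], of u v] mult_right_mono[OF d(3) E[of u v]]
        unfolding s by linarith
    qed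
    have 3: "d * mode_energy eps l u v - K * (slow_coord eps l u v)\<^sup>2 \<le> cone_form eps \<mu> s l u v" if "s < 0" for u v
    proof -
      have s: "s = - \<sigma>" using a(6) that by simp
      show ?thesis using d3(3)[OF adm[unfolded s], of u v] mult_right_mono[OF d(4) E[of u v]]
          mult_right_mono[OF K(3) zero_le_power2[of "slow_coord eps l u v"]]
        unfolding s by linarith
    qed
    have 4: "cone_form eps \<mu> s l u (- slow_rate eps l * u)
               \<le> - d * mode_energy eps l u (- slow_rate eps l * u)" if "s < 0" for u
    proof -
      have s: "s = - \<sigma>" using a(6) that by simp
      show ?thesis using d4(2)[OF adm[unfolded s], of u]
          mult_right_mono[OF d(5) E[of u "- slow_rate eps l * u"]]
        unfolding s minus_mult_left[symmetric] by linarith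
    qed
    have 6: "cone_rate eps \<mu> s l u v h + 2 * \<theta> * cone_form eps \<mu> s l u v
          + c * (2 * v * (h - v) + 2 * \<theta> * mode_energy eps l u v)
          \<le> k * (h\<^sup>2 - L\<^sup>2 * u\<^sup>2) - \<delta> * (v\<^sup>2 + l * u\<^sup>2)"
      if "\<bar>\<theta> - slow_rate eps \<mu>\<bar> \<le> \<eta>" "\<bar>c\<bar> \<le> d" for u v h \<theta> c
      using c(5)[rule_format, OF adm that(1) order_trans[OF that(2) d(2)]] .
    have 5: "4 * eps * l < 1" "0 < slow_rate eps l" if "s < 0"
    proof -
      have s: "s = - \<sigma>" using a(6) that by simp
      show "4 * eps * l < 1" "0 < slow_rate eps l" using slow_mode_facts[OF adm[unfolded s]] by simp_all
    qed
    show ?thesis unfolding cone_bounds_def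
      by (intro conjI allI impI)
        (rule 1 | (rule 6; assumption) | (rule 2, assumption) | (rule 3, assumption)
          | (rule 4, assumption) | (rule 5(1), assumption) | (rule 5(2), assumption))+
  qed
  then show ?thesis by (rule that[OF c(1,2) d(1) K(1) c(4)])
qed

section \<open>Modewise solutions and the cone inequality\<close>

text \<open>
  One mode of the equation, with the force \<open>h\<close>. For \<open>eps > 0\<close> the last conjunct is vacuous; for
  \<open>eps = 0\<close> it is the equation itself, and the second conjunct follows from it. This form treats
  both cases together.
\<close>

definition mode_eq ::
  "real \<Rightarrow> real \<Rightarrow> real set \<Rightarrow> (real \<Rightarrow> real) \<Rightarrow> (real \<Rightarrow> real) \<Rightarrow> (real \<Rightarrow> real) \<Rightarrow> bool" where
  "mode_eq eps l I u v h \<longleftrightarrow> (\<forall>t\<in>I.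
     (u has_real_derivative v t) (at t within I) \<and>
     ((\<lambda>\<tau>. eps * v \<tau>) has_real_derivative (h t - v t - l * u t)) (at t within I) \<and>
     (eps = 0 \<longrightarrow> h t - v t - l * u t = 0))"

lemma mode_eqD:
  assumes "mode_eq eps l I u v h" "t \<in> I"
  shows "(u has_real_derivative v t) (at t within I)"
    "((\<lambda>\<tau>. eps * v \<tau>) has_real_derivative (h t - v t - l * u t)) (at t within I)"
    "eps = 0 \<Longrightarrow> v t = h t - l * u t"
  using assms by (auto simp: mode_eq_def)

lemma mode_eq_subset: "mode_eq eps l I u v h \<Longrightarrow> J \<subseteq> I \<Longrightarrow> mode_eq eps l J u v h"
  unfolding mode_eq_def by (meson DERIV_subset subset_iff)

lemma mode_eq_cong:
  assumes "mode_eq eps l I u v h" "\<And>t. t \<in> I \<Longrightarrow> u' t = u t" "\<And>t. t \<in> I \<Longrightarrow> v' t = v t"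
    "\<And>t. t \<in> I \<Longrightarrow> h' t = h t"
  shows "mode_eq eps l I u' v' h'"
  unfolding mode_eq_def
proof (intro ballI conjI impI)
  fix t assume t: "t \<in> I"
  note d = mode_eqD[OF assms(1) t]
  show "(u' has_real_derivative v' t) (at t within I)"
    using has_field_derivative_transform_within[OF d(1) zero_less_one t, of u'] assms t by simp
  show "((\<lambda>\<tau>. eps * v' \<tau>) has_real_derivative (h' t - v' t - l * u' t)) (at t within I)"
    using has_field_derivative_transform_within[OF d(2) zero_less_one t, of "\<lambda>\<tau>. eps * v' \<tau>"] assms t by simp
  show "h' t - v' t - l * u' t = 0" if "eps = 0" using d(3)[OF that] assms t by simp
qed

lemma mode_eq_diff:
  assumes "mode_eq eps l I u1 v1 h1" "mode_eq eps l I u2 v2 h2"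
  shows "mode_eq eps l I (\<lambda>t. u1 t - u2 t) (\<lambda>t. v1 t - v2 t) (\<lambda>t. h1 t - h2 t)"
  unfolding mode_eq_def
proof (intro ballI conjI impI)
  fix t assume t: "t \<in> I"
  note d1 = mode_eqD[OF assms(1) t] and d2 = mode_eqD[OF assms(2) t]
  show "((\<lambda>t. u1 t - u2 t) has_real_derivative v1 t - v2 t) (at t within I)"
    by (rule DERIV_diff[OF d1(1) d2(1)])
  show "((\<lambda>\<tau>. eps * (v1 \<tau> - v2 \<tau>)) has_real_derivative
      h1 t - h2 t - (v1 t - v2 t) - l * (u1 t - u2 t)) (at t within I)"
    using DERIV_diff[OF d1(2) d2(2)] by (simp add: algebra_simps)
  show "h1 t - h2 t - (v1 t - v2 t) - l * (u1 t - u2 t) = 0" if "eps = 0"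
    using d1(3)[OF that] d2(3)[OF that] by (simp add: algebra_simps)
qed

text \<open>
  Products are differentiated without differentiating \<open>v\<close>: \<open>eps v\<^sup>2\<close> equals
  \<open>(eps v)\<^sup>2 / eps\<close> if \<open>eps > 0\<close> and vanishes if \<open>eps = 0\<close>.
\<close>

lemma mode_eq_products:
  assumes "mode_eq eps l I u v h" "t \<in> I"
  defines "r \<equiv> h t - v t - l * u t"
  shows "((\<lambda>\<tau>. eps * (v \<tau>)\<^sup>2) has_real_derivative 2 * v t * r) (at t within I)"
    "((\<lambda>\<tau>. eps * (u \<tau> * v \<tau>)) has_real_derivative eps * (v t)\<^sup>2 + u t * r) (at t within I)"
    "((\<lambda>\<tau>. (u \<tau>)\<^sup>2) has_real_derivative 2 * u t * v t) (at t within I)"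
proof -
  note d = mode_eqD[OF assms(1,2)]
  show "((\<lambda>\<tau>. (u \<tau>)\<^sup>2) has_real_derivative 2 * u t * v t) (at t within I)"
    by (auto intro!: derivative_eq_intros d(1) simp: power2_eq_square)
  have "((\<lambda>\<tau>. u \<tau> * (eps * v \<tau>)) has_real_derivative v t * (eps * v t) + r * u t) (at t within I)"
    using DERIV_mult[OF d(1,2)] by (simp add: r_def)
  moreover have "(\<lambda>\<tau>. u \<tau> * (eps * v \<tau>)) = (\<lambda>\<tau>. eps * (u \<tau> * v \<tau>))" by (auto simp: fun_eq_iff)
  ultimately show "((\<lambda>\<tau>. eps * (u \<tau> * v \<tau>)) has_real_derivative eps * (v t)\<^sup>2 + u t * r) (at t within I)"
    by (simp add: power2_eq_square mult.commute mult.left_commute)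
  show "((\<lambda>\<tau>. eps * (v \<tau>)\<^sup>2) has_real_derivative 2 * v t * r) (at t within I)"
  proof (cases "eps = 0")
    case True
    then show ?thesis using d(3) by (simp add: r_def)
  next
    case False
    have "((\<lambda>\<tau>. (eps * v \<tau>) * (eps * v \<tau>) / eps) has_real_derivative
        (r * (eps * v t) + r * (eps * v t)) / eps) (at t within I)"
      unfolding r_def by (rule DERIV_cdivide[OF DERIV_mult[OF d(2) d(2)]])
    moreover have "(\<lambda>\<tau>. (eps * v \<tau>) * (eps * v \<tau>) / eps) = (\<lambda>\<tau>. eps * (v \<tau>)\<^sup>2)"
      using False by (auto simp: fun_eq_iff power2_eq_square)
    moreover have "(r * (eps * v t) + r * (eps * v t)) / eps = 2 * v t * r"
      using False by (simp add: field_simps)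
    ultimately show ?thesis by (simp only:)
  qed
qed

lemma mode_energy_deriv:
  assumes "mode_eq eps l I u v h" "t \<in> I"
  shows "((\<lambda>\<tau>. mode_energy eps l (u \<tau>) (v \<tau>)) has_real_derivative 2 * v t * (h t - v t)) (at t within I)"
  unfolding mode_energy_def
  by (rule DERIV_cong[OF DERIV_add[OF mode_eq_products(1)[OF assms] DERIV_cmult[OF mode_eq_products(3)[OF assms]]]])
    (simp add: algebra_simps)

lemma cone_form_deriv:
  assumes "mode_eq eps l I u v h" "t \<in> I"
  shows "((\<lambda>\<tau>. cone_form eps \<mu> s l (u \<tau>) (v \<tau>)) has_real_derivative
    cone_rate eps \<mu> s l (u t) (v t) (h t)) (at t within I)"
proof -
  define \<theta> \<beta> where "\<theta> = slow_rate eps \<mu>" and "\<beta> = 1 - 2 * eps * \<theta>"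
  define r where "r = h t - v t - l * u t"
  note p = mode_eq_products[OF assms, folded r_def]
  have eq: "cone_form eps \<mu> s l (u \<tau>) (v \<tau>) = \<beta> * (eps * (v \<tau>)\<^sup>2) + (2 * \<beta> * \<theta> + 2 * s) * (eps * (u \<tau> * v \<tau>))
     + (eps * \<beta> * \<theta>\<^sup>2 + 2 * eps * s * \<theta> + \<beta> * (l - \<mu>)) * (u \<tau>)\<^sup>2" for \<tau>
    unfolding cone_form_def \<theta>_def[symmetric] \<beta>_def[symmetric]
    by (simp add: power2_eq_square algebra_simps)
  have rate: "cone_rate eps \<mu> s l (u t) (v t) (h t) =
      \<beta> * (2 * v t * r + 2 * \<theta> * (eps * (v t)\<^sup>2 + u t * r) + 2 * eps * \<theta>\<^sup>2 * u t * v t)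
      + 2 * s * (eps * (v t)\<^sup>2 + u t * r + 2 * eps * \<theta> * u t * v t) + 2 * \<beta> * (l - \<mu>) * u t * v t"
    by (simp only: cone_rate_def Let_def \<theta>_def \<beta>_def r_def)
  show ?thesis unfolding eq rate
    by (rule DERIV_cong[OF DERIV_add[OF DERIV_add[OF DERIV_cmult[OF p(1)] DERIV_cmult[OF p(2)]]
          DERIV_cmult[OF p(3)]]])
      (simp add: power2_eq_square algebra_simps)
qed

lemma weighted_cone_deriv:
  assumes "mode_eq eps l I u v h" "t \<in> I"
  shows "((\<lambda>\<tau>. exp (2 * \<theta> * \<tau>) * (cone_form eps \<mu> s l (u \<tau>) (v \<tau>) + c * mode_energy eps l (u \<tau>) (v \<tau>)))
    has_real_derivative exp (2 * \<theta> * t) *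
      (cone_rate eps \<mu> s l (u t) (v t) (h t) + 2 * \<theta> * cone_form eps \<mu> s l (u t) (v t)
       + c * (2 * v t * (h t - v t) + 2 * \<theta> * mode_energy eps l (u t) (v t)))) (at t within I)"
proof -
  have e: "((\<lambda>\<tau>. exp (2 * \<theta> * \<tau>)) has_real_derivative 2 * \<theta> * exp (2 * \<theta> * t)) (at t within I)"
    by (auto intro!: derivative_eq_intros)
  show ?thesis
    by (rule DERIV_cong[OF DERIV_mult[OF e DERIV_add[OF cone_form_deriv[OF assms]
            DERIV_cmult[OF mode_energy_deriv[OF assms]]]]]) (simp add: algebra_simps)
qed

lemma nonincreasing_within:
  fixes f :: "real \<Rightarrow> real"
  assumes "a \<le> b" "\<And>t. t \<in> {a..b} \<Longrightarrow> (f has_real_derivative f' t) (at t within {a..b})"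
    "\<And>t. t \<in> {a..b} \<Longrightarrow> f' t \<le> 0"
  shows "f b \<le> f a"
proof (cases "a = b")
  case False
  then have "a < b" using assms(1) by simp
  moreover have "continuous_on {a..b} f"
    using assms(2) DERIV_continuous_on by blast
  moreover have "\<exists>y. (f has_real_derivative y) (at x) \<and> y \<le> 0" if "a < x" "x < b" for x
    using assms(2)[of x] assms(3)[of x] that at_within_Icc_at[of a x b] by auto
  ultimately show ?thesis
    using DERIV_nonpos_imp_decreasing_open[of a b f] by auto
qed simp

lemma mode_energy_nonneg: "0 \<le> eps \<Longrightarrow> 0 \<le> l \<Longrightarrow> 0 \<le> mode_energy eps l u v"
  by (simp add: mode_energy_def)

text \<open>
  The damping term absorbs the force: \<open>2 v (h - v) \<le> h\<^sup>2\<close>.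
\<close>

lemma energy_growth:
  assumes "finite J" "a \<le> b" "continuous_on {a..b} B"
    "\<And>n. n \<in> J \<Longrightarrow> mode_eq eps (l n) {a..b} (u n) (v n) (h n)"
    "\<And>t. t \<in> {a..b} \<Longrightarrow> (\<Sum>n\<in>J. (h n t)\<^sup>2) \<le> B t"
  shows "(\<Sum>n\<in>J. mode_energy eps (l n) (u n b) (v n b)) \<le>
    (\<Sum>n\<in>J. mode_energy eps (l n) (u n a) (v n a)) + integral {a..b} B"
proof -
  define f where "f t = (\<Sum>n\<in>J. mode_energy eps (l n) (u n t) (v n t)) - integral {a..t} B" for t
  have "f b \<le> f a"
  proof (rule nonincreasing_within[OF assms(2)])
    fix t assume t: "t \<in> {a..b}"
    show "(f has_real_derivative (\<Sum>n\<in>J. 2 * v n t * (h n t - v n t)) - B t) (at t within {a..b})"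
      unfolding f_def
      by (intro DERIV_diff DERIV_sum mode_energy_deriv integral_has_real_derivative assms(3,4) t)
    have "2 * v n t * (h n t - v n t) \<le> (h n t)\<^sup>2" for n
    proof -
      have "(h n t)\<^sup>2 = 2 * v n t * (h n t - v n t) + ((h n t - v n t)\<^sup>2 + (v n t)\<^sup>2)"
        by (simp add: power2_eq_square algebra_simps)
      then show ?thesis using zero_le_power2[of "v n t"] zero_le_power2[of "h n t - v n t"] by linarith
    qed
    then have "(\<Sum>n\<in>J. 2 * v n t * (h n t - v n t)) \<le> (\<Sum>n\<in>J. (h n t)\<^sup>2)" by (rule sum_mono)
    then show "(\<Sum>n\<in>J. 2 * v n t * (h n t - v n t)) - B t \<le> 0" using assms(5)[OF t] by linarith
  qed
  then show ?thesis by (simp add: f_def algebra_simps)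
qed

locale semilinear = orthonormal_basis e for e :: "nat \<Rightarrow> 'a::{real_inner,complete_space}" +
  fixes lam :: "nat \<Rightarrow> real" and F :: "'a \<Rightarrow> 'a" and L :: real
  assumes lam_mono: "mono lam" and lam_pos: "0 < lam 0"
    and F_lip: "L-lipschitz_on UNIV F" and F_zero: "F 0 = 0"
begin

lemma lam0_le: "lam 0 \<le> lam n" using lam_mono by (simp add: monoD)
lemma lam_gt0: "0 < lam n" using lam0_le[of n] lam_pos by linarith

text \<open>
  Phase points are pairs as in \<open>phase_space\<close>. The energy \<open>E\<close> controls \<open>eps |v|\<^sup>2\<close> in \<open>H\<close> and \<open>u\<close>
  in \<open>H\<^sup>1\<close>; the part of the norm in \<open>H\<^sup>-\<^sup>1\<close> is recovered from it on the phase space. As the sum is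
  meaningful only when it converges, \<open>fin_en\<close> accompanies it.
\<close>

definition en :: "real \<Rightarrow> 'a \<times> (nat \<Rightarrow> real) \<Rightarrow> nat \<Rightarrow> real" where
  "en eps x n = mode_energy eps (lam n) (fst x \<bullet> e n) (snd x n)"

definition fin_en :: "real \<Rightarrow> 'a \<times> (nat \<Rightarrow> real) \<Rightarrow> bool" where
  "fin_en eps x \<longleftrightarrow> summable (en eps x)"

definition E :: "real \<Rightarrow> 'a \<times> (nat \<Rightarrow> real) \<Rightarrow> real" where
  "E eps x = (\<Sum>n. en eps x n)"

lemma L_nonneg: "0 \<le> L" using F_lip lipschitz_on_nonneg by blast

lemma F_diff: "norm (F x - F y) \<le> L * norm (x - y)"
  using lipschitz_onD[OF F_lip, of x y] by (simp add: dist_norm)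

lemma F_continuous: "continuous_on S F"
  using F_lip lipschitz_on_continuous_on lipschitz_on_subset by blast

lemma fst_phase_diff [simp]: "fst (phase_diff x y) = fst x - fst y"
  and snd_phase_diff [simp]: "snd (phase_diff x y) n = snd x n - snd y n"
  by (simp_all add: phase_diff_def)

lemma en_nonneg: "0 \<le> eps \<Longrightarrow> 0 \<le> en eps x n"
  using lam_gt0[of n] by (simp add: en_def mode_energy_def)

lemma E_nonneg: "0 \<le> eps \<Longrightarrow> fin_en eps x \<Longrightarrow> 0 \<le> E eps x"
  unfolding E_def fin_en_def by (intro suminf_nonneg en_nonneg)

lemma sum_en_le_E: "0 \<le> eps \<Longrightarrow> fin_en eps x \<Longrightarrow> finite J \<Longrightarrow> sum (en eps x) J \<le> E eps x"
  unfolding E_def fin_en_def by (intro sum_le_suminf) (auto simp: en_nonneg)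

lemma sq_triangle: "(p - r :: real)\<^sup>2 \<le> 2 * (p - q)\<^sup>2 + 2 * (q - r)\<^sup>2"
proof -
  have "2 * (p - q)\<^sup>2 + 2 * (q - r)\<^sup>2 = (p - r)\<^sup>2 + (p - 2 * q + r)\<^sup>2"
    by (simp add: power2_eq_square algebra_simps)
  then show ?thesis using zero_le_power2[of "p - 2 * q + r"] by linarith
qed

lemma en_triangle:
  assumes "0 \<le> eps"
  shows "en eps (phase_diff x z) n \<le> 2 * en eps (phase_diff x y) n + 2 * en eps (phase_diff y z) n"
proof -
  have "eps * (snd x n - snd z n)\<^sup>2 \<le> eps * (2 * (snd x n - snd y n)\<^sup>2 + 2 * (snd y n - snd z n)\<^sup>2)"
    using assms by (intro mult_left_mono sq_triangle)
  moreover have "lam n * (fst x \<bullet> e n - fst z \<bullet> e n)\<^sup>2 \<le>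
      lam n * (2 * (fst x \<bullet> e n - fst y \<bullet> e n)\<^sup>2 + 2 * (fst y \<bullet> e n - fst z \<bullet> e n)\<^sup>2)"
    using lam_gt0[of n] by (intro mult_left_mono sq_triangle) auto
  ultimately show ?thesis
    by (simp add: en_def mode_energy_def inner_diff_left algebra_simps)
qed

lemma fin_en_triangle:
  assumes "0 \<le> eps" "fin_en eps (phase_diff x y)" "fin_en eps (phase_diff y z)"
  shows "fin_en eps (phase_diff x z)"
    "E eps (phase_diff x z) \<le> 2 * E eps (phase_diff x y) + 2 * E eps (phase_diff y z)"
proof -
  have s: "summable (\<lambda>n. 2 * en eps (phase_diff x y) n + 2 * en eps (phase_diff y z) n)"
    using assms by (intro summable_add summable_mult) (auto simp: fin_en_def)
  show f: "fin_en eps (phase_diff x z)" unfolding fin_en_def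
    by (rule summable_comparison_test'[OF s, of 0]) (simp add: assms en_triangle en_nonneg)
  have "E eps (phase_diff x z) \<le> (\<Sum>n. 2 * en eps (phase_diff x y) n + 2 * en eps (phase_diff y z) n)"
    unfolding E_def using f s assms(1) by (intro suminf_le en_triangle) (auto simp: fin_en_def)
  also have "\<dots> = 2 * E eps (phase_diff x y) + 2 * E eps (phase_diff y z)"
    unfolding E_def using assms(2,3) by (simp add: fin_en_def suminf_add[symmetric] suminf_mult summable_mult)
  finally show "E eps (phase_diff x z) \<le> 2 * E eps (phase_diff x y) + 2 * E eps (phase_diff y z)" .
qed

lemma en_phase_diff_commute: "en eps (phase_diff x y) = en eps (phase_diff y x)"
  by (auto simp: fun_eq_iff en_def mode_energy_def inner_diff_left power2_commute)

lemma E_phase_diff_commute: "E eps (phase_diff x y) = E eps (phase_diff y x)"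
  by (simp add: E_def en_phase_diff_commute)

definition origin :: "'a \<times> (nat \<Rightarrow> real)" where "origin = (0, \<lambda>n. 0)"

lemma phase_diff_origin [simp]: "phase_diff x origin = x"
  by (simp add: phase_diff_def origin_def)

lemma en_origin [simp]: "en eps (phase_diff origin x) = en eps x"
  using en_phase_diff_commute[of eps origin x] by simp

lemma fin_en_diff:
  assumes "0 \<le> eps" "fin_en eps x" "fin_en eps y"
  shows "fin_en eps (phase_diff x y)" "E eps (phase_diff x y) \<le> 2 * E eps x + 2 * E eps y"
  using fin_en_triangle[of eps x origin y] assms by (simp_all add: fin_en_def E_def)

lemma norm_sq_le_E:
  assumes "0 \<le> eps" "fin_en eps x" shows "lam 0 * (norm (fst x))\<^sup>2 \<le> E eps x"
proof -
  have "(\<lambda>n. lam 0 * (fst x \<bullet> e n)\<^sup>2) sums (lam 0 * (norm (fst x))\<^sup>2)"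
    by (intro sums_mult parseval)
  moreover have "lam 0 * (fst x \<bullet> e n)\<^sup>2 \<le> en eps x n" for n
  proof -
    have "lam 0 * (fst x \<bullet> e n)\<^sup>2 \<le> lam n * (fst x \<bullet> e n)\<^sup>2"
      by (intro mult_right_mono lam0_le) auto
    then show ?thesis using assms(1) by (simp add: en_def mode_energy_def add_increasing)
  qed
  ultimately show ?thesis
    using assms(2) unfolding E_def fin_en_def by (meson sums_le summable_sums)
qed

text \<open>
  A solution with the prescribed force \<open>f\<close>, described mode by mode; \<open>orbit_on\<close> below is the case
  \<open>f = F(u)\<close>. Section ``Solutions and modewise orbits'' identifies orbits with solutions.
\<close>

definition traj :: "real \<Rightarrow> real set \<Rightarrow> (real \<Rightarrow> 'a \<times> (nat \<Rightarrow> real)) \<Rightarrow> (real \<Rightarrow> 'a) \<Rightarrow> bool" where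
  "traj eps I \<xi> f \<longleftrightarrow> continuous_on I (\<lambda>t. fst (\<xi> t)) \<and> (\<forall>t\<in>I. fin_en eps (\<xi> t)) \<and>
     (\<forall>n. mode_eq eps (lam n) I (\<lambda>t. fst (\<xi> t) \<bullet> e n) (\<lambda>t. snd (\<xi> t) n) (\<lambda>t. f t \<bullet> e n))"

lemma trajD:
  assumes "traj eps I \<xi> f"
  shows "continuous_on I (\<lambda>t. fst (\<xi> t))" "t \<in> I \<Longrightarrow> fin_en eps (\<xi> t)"
    "mode_eq eps (lam n) I (\<lambda>t. fst (\<xi> t) \<bullet> e n) (\<lambda>t. snd (\<xi> t) n) (\<lambda>t. f t \<bullet> e n)"
  using assms by (auto simp: traj_def)

lemma traj_subset: "traj eps I \<xi> f \<Longrightarrow> J \<subseteq> I \<Longrightarrow> traj eps J \<xi> f"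
  unfolding traj_def by (meson continuous_on_subset mode_eq_subset subset_iff)

abbreviation orbit_on :: "real \<Rightarrow> real set \<Rightarrow> (real \<Rightarrow> 'a \<times> (nat \<Rightarrow> real)) \<Rightarrow> bool" where
  "orbit_on eps I \<xi> \<equiv> traj eps I \<xi> (\<lambda>t. F (fst (\<xi> t)))"

end

text \<open>
  A splitting into \<open>N\<close> slow and infinitely many fast modes with cone estimates that are uniform for
  \<open>eps \<in> Eps\<close>. The strict inequality between \<open>L\<close> and \<open>\<Lambda>\<close> later gives a contraction and
  leaves room for additional forces.
\<close>

locale cone_system = semilinear e lam F L
  for e :: "nat \<Rightarrow> 'a::{real_inner,complete_space}" and lam F L +
  fixes Eps :: "real set" and N :: nat and \<mu> \<Lambda> \<eta> \<delta> d K k :: real and s :: "nat \<Rightarrow> real"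
  assumes L_less: "L < \<Lambda>"
    and pos: "0 < \<eta>" "0 < \<delta>" "0 < d" "0 < K" "0 < k"
    and sgn: "n < N \<Longrightarrow> s n < 0" "N \<le> n \<Longrightarrow> 0 < s n"
    and Eps_nonneg: "eps \<in> Eps \<Longrightarrow> 0 \<le> eps"
    and bounds: "eps \<in> Eps \<Longrightarrow> cone_bounds \<Lambda> \<mu> \<eta> \<delta> d K k eps (lam n) (s n)"
begin

definition cf :: "real \<Rightarrow> 'a \<times> (nat \<Rightarrow> real) \<Rightarrow> nat \<Rightarrow> real" where
  "cf eps x n = cone_form eps \<mu> (s n) (lam n) (fst x \<bullet> e n) (snd x n)"

text \<open>
  The Lyapunov function. It bounds the energy from below up to the slow coordinates \<open>P\<close>
  (\<open>V_lower\<close>), so a difference with \<open>P = 0\<close> has \<open>V \<ge> d E\<close>, and one with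
  \<open>V + d E \<le> 0\<close> is controlled by \<open>P\<close>.
\<close>

definition V :: "real \<Rightarrow> 'a \<times> (nat \<Rightarrow> real) \<Rightarrow> real" where
  "V eps x = (\<Sum>n. cf eps x n)"

definition P :: "real \<Rightarrow> 'a \<times> (nat \<Rightarrow> real) \<Rightarrow> nat \<Rightarrow> real" where
  "P eps x n = slow_coord eps (lam n) (fst x \<bullet> e n) (snd x n)"

lemma cf_abs_le: "eps \<in> Eps \<Longrightarrow> \<bar>cf eps x n\<bar> \<le> K * en eps x n"
  using bounds[of eps n] by (simp add: cone_bounds_def cf_def en_def)

lemma cf_summable: "eps \<in> Eps \<Longrightarrow> fin_en eps x \<Longrightarrow> summable (cf eps x)"
  unfolding fin_en_def
  by (rule summable_comparison_test'[OF summable_mult[of _ K], of _ 0]) (auto intro: cf_abs_le)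

lemma V_abs_le:
  assumes "eps \<in> Eps" "fin_en eps x" shows "\<bar>V eps x\<bar> \<le> K * E eps x"
proof -
  have s: "summable (\<lambda>n. K * en eps x n)" using assms(2) by (simp add: fin_en_def summable_mult)
  have sa: "summable (\<lambda>n. \<bar>cf eps x n\<bar>)"
    by (rule summable_comparison_test'[OF s, of 0]) (auto intro: cf_abs_le assms)
  have "\<bar>V eps x\<bar> \<le> (\<Sum>n. \<bar>cf eps x n\<bar>)" unfolding V_def by (rule summable_rabs[OF sa])
  also have "\<dots> \<le> (\<Sum>n. K * en eps x n)" by (intro suminf_le sa s cf_abs_le assms)
  also have "\<dots> = K * E eps x" unfolding E_def using assms(2) by (simp add: suminf_mult fin_en_def)
  finally show ?thesis .
qed

lemma V_lower:
  assumes "eps \<in> Eps" "fin_en eps x"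
  shows "d * E eps x - K * (\<Sum>n<N. (P eps x n)\<^sup>2) \<le> V eps x"
proof -
  define p where "p = (\<lambda>n. if n < N then K * (P eps x n)\<^sup>2 else 0)"
  have p: "p sums (K * (\<Sum>n<N. (P eps x n)\<^sup>2))"
    using sums_If_finite_set[of "{..<N}" "\<lambda>n. K * (P eps x n)\<^sup>2"]
    by (simp add: p_def sum_distrib_left lessThan_iff)
  have en: "(\<lambda>n. d * en eps x n) sums (d * E eps x)"
    using assms(2) unfolding E_def fin_en_def by (intro sums_mult summable_sums)
  have le: "d * en eps x n - p n \<le> cf eps x n" for n
    using bounds[OF assms(1), of n] sgn[of n]
    by (cases "n < N") (auto simp: cone_bounds_def cf_def en_def p_def P_def)
  show ?thesis
    using sums_le[OF le sums_diff[OF en p]] cf_summable[OF assms] summable_sums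
    unfolding V_def by blast
qed

text \<open>
  The differential inequality for \<open>V + c E\<close> in integrated form. The modes are summed up to \<open>m\<close>, where
  the derivative exists, and \<open>m\<close> tends to infinity afterwards. Since the sum of \<open>u\<^sup>2\<close> over the modes
  enters with the negative sign \<open>- \<Lambda>\<^sup>2\<close>, a lower bound for it that is uniform in time is required;
  this is \<open>uniform_tail\<close>. The force is only known by a bound \<open>H\<close> for its partial sums, as the force
  \<open>- eps u''\<close> of the last part of the proof is not known to take values in \<open>H\<close>.
\<close>

lemma cone_inequality:
  fixes u v h :: "real \<Rightarrow> nat \<Rightarrow> real" and W :: "real \<Rightarrow> 'a"
  assumes eps: "eps \<in> Eps" and ab: "a \<le> b"
    and modes: "\<And>n. mode_eq eps (lam n) {a..b} (\<lambda>t. fst (w t) \<bullet> e n) (\<lambda>t. snd (w t) n) (\<lambda>t. h t n)"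
    and cont: "continuous_on {a..b} (\<lambda>t. fst (w t))"
    and fin: "fin_en eps (w a)" "fin_en eps (w b)"
    and \<theta>: "\<bar>\<theta> - slow_rate eps \<mu>\<bar> \<le> \<eta>" and c: "\<bar>c\<bar> \<le> d"
    and H: "\<And>m t. t \<in> {a..b} \<Longrightarrow> (\<Sum>n<m. (h t n)\<^sup>2) \<le> H m t" "\<And>m. continuous_on {a..b} (H m)"
    and B: "\<And>m. integral {a..b} (\<lambda>t. exp (2 * \<theta> * t) * (H m t - \<Lambda>\<^sup>2 * (norm (fst (w t)))\<^sup>2)) \<le> B"
    and vcont: "\<And>n. n < M \<Longrightarrow> continuous_on {a..b} (\<lambda>t. snd (w t) n)"
  shows "exp (2 * \<theta> * b) * (V eps (w b) + c * E eps (w b))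
      + \<delta> * integral {a..b} (\<lambda>t. exp (2 * \<theta> * t) * (\<Sum>n<M. (snd (w t) n)\<^sup>2))
    \<le> exp (2 * \<theta> * a) * (V eps (w a) + c * E eps (w a)) + k * B"
proof -
  define Z where "Z m t = exp (2 * \<theta> * t) * (\<Sum>n<m. cf eps (w t) n + c * en eps (w t) n)" for m t
  define X where "X = exp (2 * \<theta> * b) * (V eps (w b) + c * E eps (w b))"
  define Y where "Y = exp (2 * \<theta> * a) * (V eps (w a) + c * E eps (w a))"
  define D where "D = \<delta> * integral {a..b} (\<lambda>t. exp (2 * \<theta> * t) * (\<Sum>n<M. (snd (w t) n)\<^sup>2))"
  have lim: "(\<lambda>m. Z m t) \<longlonglongrightarrow> exp (2 * \<theta> * t) * (V eps (w t) + c * E eps (w t))" if "fin_en eps (w t)" for t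
  proof -
    have "(\<lambda>n. cf eps (w t) n + c * en eps (w t) n) sums (V eps (w t) + c * E eps (w t))"
      unfolding V_def E_def using that cf_summable[OF eps that]
      by (intro sums_add sums_mult summable_sums) (auto simp: fin_en_def)
    then show ?thesis unfolding Z_def sums_def by (intro tendsto_intros)
  qed
  obtain C where C: "\<And>t. t \<in> {a..b} \<Longrightarrow> exp (2 * \<theta> * t) \<le> C" "0 < C"
  proof -
    have "compact ((\<lambda>t. exp (2 * \<theta> * t)) ` {a..b})"
      by (intro compact_continuous_image continuous_intros compact_Icc)
    then have "bdd_above ((\<lambda>t. exp (2 * \<theta> * t)) ` {a..b})"
      by (simp add: bounded_imp_bdd_above compact_imp_bounded)
    then obtain C where C: "\<forall>y\<in>(\<lambda>t. exp (2 * \<theta> * t)) ` {a..b}. y \<le> C" unfolding bdd_above_def by blast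
    show ?thesis
    proof (rule that[of "max C 1"])
      show "exp (2 * \<theta> * t) \<le> max C 1" if "t \<in> {a..b}" for t 
        using bspec[OF C imageI[OF that]] by (simp add: le_max_iff_disj)
    qed simp
  qed
  have key: "X + D \<le> Y + k * B + r" if r: "0 < r" for r
  proof -
    define q where "q = r / (k * \<Lambda>\<^sup>2 * C * (b - a + 1))"
    have LL: "0 < \<Lambda>" using L_less L_nonneg by linarith
    have q: "0 < q" using r pos LL C ab by (simp add: q_def)
    have qr: "k * \<Lambda>\<^sup>2 * C * q * (b - a) \<le> r"
    proof -
      have "k * \<Lambda>\<^sup>2 * C * q * (b - a + 1) = r"
        using pos LL C ab by (simp add: q_def)
      moreover have "0 \<le> k * \<Lambda>\<^sup>2 * C * q" using pos LL C q by simp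
      ultimately show ?thesis by (simp add: distrib_left)
    qed
    have "compact ((\<lambda>t. fst (w t)) ` {a..b})" by (intro compact_continuous_image cont compact_Icc)
    then obtain m0 where m0: "\<And>m x. m \<ge> m0 \<Longrightarrow> x \<in> (\<lambda>t. fst (w t)) ` {a..b} \<Longrightarrow>
        (norm x)\<^sup>2 - (\<Sum>n<m. (x \<bullet> e n)\<^sup>2) < q"
      using uniform_tail[OF _ q] by blast
    have fin_m: "Z m b + D \<le> Z m a + k * B + r" if m: "m \<ge> m0" "m \<ge> M" for m
    proof -
      define g1 where "g1 = (\<lambda>t. exp (2 * \<theta> * t) * (\<Sum>n<M. (snd (w t) n)\<^sup>2))"
      define g2 where "g2 = (\<lambda>t. exp (2 * \<theta> * t) * (H m t - \<Lambda>\<^sup>2 * (norm (fst (w t)))\<^sup>2))"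
      have g: "continuous_on {a..b} g1" "continuous_on {a..b} g2"
        unfolding g1_def g2_def by (auto intro!: continuous_intros vcont H(2) cont)
      define f where "f t = Z m t + \<delta> * integral {a..t} g1 - k * integral {a..t} g2 - k * \<Lambda>\<^sup>2 * C * q * t" for t
      define Q where "Q n t = cone_rate eps \<mu> (s n) (lam n) (fst (w t) \<bullet> e n) (snd (w t) n) (h t n)
          + 2 * \<theta> * cf eps (w t) n
          + c * (2 * snd (w t) n * (h t n - snd (w t) n) + 2 * \<theta> * en eps (w t) n)" for n t
      have "f b \<le> f a"
      proof (rule nonincreasing_within[OF ab])
        fix t assume t: "t \<in> {a..b}"
        have Zd: "(Z m has_real_derivative (\<Sum>n<m. exp (2 * \<theta> * t) * Q n t)) (at t within {a..b})"
          unfolding Z_def sum_distrib_left Q_def cf_def en_def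
          by (intro DERIV_sum weighted_cone_deriv modes t)
        show "(f has_real_derivative (\<Sum>n<m. exp (2 * \<theta> * t) * Q n t) + \<delta> * g1 t - k * g2 t
            - k * \<Lambda>\<^sup>2 * C * q) (at t within {a..b})"
          unfolding f_def
          by (rule DERIV_cong[OF DERIV_diff[OF DERIV_diff[OF DERIV_add[OF Zd
                  DERIV_cmult[OF integral_has_real_derivative[OF g(1) t]]]
                  DERIV_cmult[OF integral_has_real_derivative[OF g(2) t]]]
                  DERIV_cmult_Id]]) simp
        define x where "x = exp (2 * \<theta> * t)"
        define U where "U = (\<Sum>n<m. (fst (w t) \<bullet> e n)\<^sup>2)"
        define R where "R = (norm (fst (w t)))\<^sup>2"
        define VV where "VV = (\<Sum>n<M. (snd (w t) n)\<^sup>2)"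
        have x: "0 \<le> x" "x \<le> C" using C t by (auto simp: x_def)
        have Q: "Q n t \<le> k * ((h t n)\<^sup>2 - \<Lambda>\<^sup>2 * (fst (w t) \<bullet> e n)\<^sup>2) - \<delta> * (snd (w t) n)\<^sup>2" for n
        proof -
          have "Q n t \<le> k * ((h t n)\<^sup>2 - \<Lambda>\<^sup>2 * (fst (w t) \<bullet> e n)\<^sup>2)
              - \<delta> * ((snd (w t) n)\<^sup>2 + lam n * (fst (w t) \<bullet> e n)\<^sup>2)"
            unfolding Q_def cf_def en_def using bounds[OF eps, of n] \<theta> c by (simp add: cone_bounds_def)
          also have "\<dots> \<le> k * ((h t n)\<^sup>2 - \<Lambda>\<^sup>2 * (fst (w t) \<bullet> e n)\<^sup>2) - \<delta> * (snd (w t) n)\<^sup>2"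
            using pos(2) lam_gt0[of n] by (simp add: mult_left_mono)
          finally show ?thesis .
        qed
        have "(\<Sum>n<m. Q n t) \<le> (\<Sum>n<m. k * ((h t n)\<^sup>2 - \<Lambda>\<^sup>2 * (fst (w t) \<bullet> e n)\<^sup>2) - \<delta> * (snd (w t) n)\<^sup>2)"
          by (intro sum_mono Q)
        also have "\<dots> = k * ((\<Sum>n<m. (h t n)\<^sup>2) - \<Lambda>\<^sup>2 * U) - \<delta> * (\<Sum>n<m. (snd (w t) n)\<^sup>2)"
          by (simp only: U_def sum_distrib_left sum_subtractf right_diff_distrib)
        also have "\<dots> \<le> k * (H m t - \<Lambda>\<^sup>2 * (R - q)) - \<delta> * VV"
        proof -
          have "R - q \<le> U" using m0[OF m(1), of "fst (w t)"] t by (auto simp: U_def R_def)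
          moreover have "VV \<le> (\<Sum>n<m. (snd (w t) n)\<^sup>2)"
            unfolding VV_def using m(2) by (intro sum_mono2) auto
          ultimately show ?thesis
            using H(1)[OF t, of m] pos by (intro diff_mono mult_left_mono) auto
        qed
        finally have "x * (\<Sum>n<m. Q n t) \<le> x * (k * (H m t - \<Lambda>\<^sup>2 * (R - q)) - \<delta> * VV)"
          using x by (intro mult_left_mono)
        also have "\<dots> = k * g2 t - \<delta> * g1 t + k * \<Lambda>\<^sup>2 * q * x"
          by (simp add: g1_def g2_def x_def R_def VV_def algebra_simps)
        also have "\<dots> \<le> k * g2 t - \<delta> * g1 t + k * \<Lambda>\<^sup>2 * q * C"
          using x pos q by (intro add_left_mono mult_left_mono) auto
        finally have "x * (\<Sum>n<m. Q n t) \<le> k * g2 t - \<delta> * g1 t + k * \<Lambda>\<^sup>2 * q * C" .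
        moreover have "k * \<Lambda>\<^sup>2 * q * C = k * \<Lambda>\<^sup>2 * C * q" by (simp only: mult_ac)
        moreover have "(\<Sum>n<m. exp (2 * \<theta> * t) * Q n t) = x * (\<Sum>n<m. Q n t)"
          by (simp only: x_def sum_distrib_left)
        ultimately show "(\<Sum>n<m. exp (2 * \<theta> * t) * Q n t) + \<delta> * g1 t - k * g2 t - k * \<Lambda>\<^sup>2 * C * q \<le> 0"
          by linarith
      qed
      then have "Z m b + D - k * integral {a..b} g2 - k * \<Lambda>\<^sup>2 * C * q * b \<le> Z m a - k * \<Lambda>\<^sup>2 * C * q * a"
        by (simp add: f_def D_def g1_def)
      moreover have "k * integral {a..b} g2 \<le> k * B"
        using B[of m] pos unfolding g2_def by (intro mult_left_mono) auto
      ultimately show ?thesis using qr by (simp add: right_diff_distrib)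
    qed
    have "(\<lambda>m. Z m b + D) \<longlonglongrightarrow> X + D" "(\<lambda>m. Z m a + k * B + r) \<longlonglongrightarrow> Y + k * B + r"
      using lim[OF fin(1)] lim[OF fin(2)] by (auto simp: X_def Y_def intro!: tendsto_intros)
    then show ?thesis by (rule LIMSEQ_le) (use fin_m in \<open>auto intro!: exI[of _ "max m0 M"]\<close>)
  qed
  show ?thesis using field_le_epsilon[of "X + D" "Y + k * B"] key by (simp add: X_def Y_def D_def)
qed

lemma mode_velocity_continuous:
  assumes "mode_eq eps l I u v h" "continuous_on I h" shows "continuous_on I v"
proof (cases "eps = 0")
  case True
  have "continuous_on I (\<lambda>t. h t - l * u t)"
    using mode_eqD(1)[OF assms(1)] DERIV_continuous_on by (intro continuous_intros assms(2)) blast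
  then show ?thesis using mode_eqD(3)[OF assms(1) _ True] by (metis (no_types, lifting) continuous_on_cong)
next
  case False
  have "continuous_on I (\<lambda>t. eps * v t)" 
    by (rule DERIV_continuous_on) (rule mode_eqD(2)[OF assms(1)])
  then have "continuous_on I (\<lambda>t. (1 / eps) * (eps * v t))" by (rule continuous_on_mult_left)
  then show ?thesis using False by simp
qed

lemma cone_inequality_traj:
  assumes eps: "eps \<in> Eps" and ab: "a \<le> b"
    and \<xi>: "traj eps {a..b} \<xi> f" and \<zeta>: "traj eps {a..b} \<zeta> g"
    and fg: "continuous_on {a..b} f" "continuous_on {a..b} g"
    and \<theta>: "\<bar>\<theta> - slow_rate eps \<mu>\<bar> \<le> \<eta>" and c: "\<bar>c\<bar> \<le> d"
  defines "w \<equiv> \<lambda>t. phase_diff (\<xi> t) (\<zeta> t)"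
  shows "exp (2 * \<theta> * b) * (V eps (w b) + c * E eps (w b))
      + \<delta> * integral {a..b} (\<lambda>t. exp (2 * \<theta> * t) * (\<Sum>n<M. (snd (w t) n)\<^sup>2))
    \<le> exp (2 * \<theta> * a) * (V eps (w a) + c * E eps (w a))
      + k * integral {a..b} (\<lambda>t. exp (2 * \<theta> * t) * ((norm (f t - g t))\<^sup>2 - \<Lambda>\<^sup>2 * (norm (fst (w t)))\<^sup>2))"
proof (rule cone_inequality[where h = "\<lambda>t n. f t \<bullet> e n - g t \<bullet> e n" and H = "\<lambda>m t. (norm (f t - g t))\<^sup>2",
      OF eps ab _ _ _ _ \<theta> c])
  have modes: "mode_eq eps (lam n) {a..b} (\<lambda>t. fst (w t) \<bullet> e n) (\<lambda>t. snd (w t) n) (\<lambda>t. f t \<bullet> e n - g t \<bullet> e n)" for n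
    using mode_eq_diff[OF trajD(3)[OF \<xi>] trajD(3)[OF \<zeta>]] by (simp add: w_def inner_diff_left)
  then show "mode_eq eps (lam n) {a..b} (\<lambda>t. fst (w t) \<bullet> e n) (\<lambda>t. snd (w t) n) (\<lambda>t. f t \<bullet> e n - g t \<bullet> e n)" for n .
  show "continuous_on {a..b} (\<lambda>t. fst (w t))"
    unfolding w_def fst_phase_diff by (intro continuous_intros trajD[OF \<xi>] trajD[OF \<zeta>])
  show "fin_en eps (w a)" "fin_en eps (w b)"
    unfolding w_def using ab by (auto intro!: fin_en_diff Eps_nonneg eps trajD[OF \<xi>] trajD[OF \<zeta>])
  show "(\<Sum>n<m. (f t \<bullet> e n - g t \<bullet> e n)\<^sup>2) \<le> (norm (f t - g t))\<^sup>2" for m t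
    using bessel[of "f t - g t" m] by (simp add: inner_diff_left)
  show "continuous_on {a..b} (\<lambda>t. (norm (f t - g t))\<^sup>2)" by (intro continuous_intros fg)
  show "continuous_on {a..b} (\<lambda>t. snd (w t) n)" if "n < M" for n
    by (rule mode_velocity_continuous[OF modes]) (intro continuous_intros fg)
qed simp

text \<open>
  For two orbits the forces are absorbed because \<open>L < \<Lambda>\<close>.
\<close>

lemma cone_inequality_orbits:
  assumes eps: "eps \<in> Eps" and ab: "a \<le> b"
    and \<xi>: "orbit_on eps {a..b} \<xi>" and \<zeta>: "orbit_on eps {a..b} \<zeta>"
    and \<theta>: "\<bar>\<theta> - slow_rate eps \<mu>\<bar> \<le> \<eta>" and c: "\<bar>c\<bar> \<le> d"
  defines "w \<equiv> \<lambda>t. phase_diff (\<xi> t) (\<zeta> t)"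
  shows "exp (2 * \<theta> * b) * (V eps (w b) + c * E eps (w b))
      + \<delta> * integral {a..b} (\<lambda>t. exp (2 * \<theta> * t) * (\<Sum>n<M. (snd (w t) n)\<^sup>2))
    \<le> exp (2 * \<theta> * a) * (V eps (w a) + c * E eps (w a))"
proof -
  define f g where "f = (\<lambda>t. F (fst (\<xi> t)))" and "g = (\<lambda>t. F (fst (\<zeta> t)))"
  have fg: "continuous_on {a..b} f" "continuous_on {a..b} g"
    unfolding f_def g_def
    by (intro continuous_on_compose2[OF F_continuous[of UNIV]] trajD(1)[OF \<xi>] trajD(1)[OF \<zeta>] subset_UNIV)+
  have "exp (2 * \<theta> * t) * ((norm (f t - g t))\<^sup>2 - \<Lambda>\<^sup>2 * (norm (fst (w t)))\<^sup>2) \<le> 0" for t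
  proof -
    have "norm (f t - g t) \<le> \<Lambda> * norm (fst (w t))"
      using F_diff[of "fst (\<xi> t)" "fst (\<zeta> t)"] mult_right_mono[of L \<Lambda> "norm (fst (w t))"] L_less
      by (simp add: f_def g_def w_def)
    then have "(norm (f t - g t))\<^sup>2 \<le> (\<Lambda> * norm (fst (w t)))\<^sup>2" by (intro power_mono) auto
    then show ?thesis by (simp add: power_mult_distrib mult_nonneg_nonpos)
  qed
  then have "integral {a..b} (\<lambda>t. exp (2 * \<theta> * t) * ((norm (f t - g t))\<^sup>2 - \<Lambda>\<^sup>2 * (norm (fst (w t)))\<^sup>2))
      \<le> integral {a..b} (\<lambda>t. 0)"
    unfolding w_def fst_phase_diff
    by (intro integral_le integrable_continuous_interval continuous_intros fg trajD(1)[OF \<xi>] trajD(1)[OF \<zeta>]) auto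
  then have "k * integral {a..b} (\<lambda>t. exp (2 * \<theta> * t) * ((norm (f t - g t))\<^sup>2 - \<Lambda>\<^sup>2 * (norm (fst (w t)))\<^sup>2)) \<le> 0"
    using pos by (simp add: mult_nonneg_nonpos)
  moreover have "traj eps {a..b} \<xi> f" "traj eps {a..b} \<zeta> g" using \<xi> \<zeta> by (simp_all add: f_def g_def)
  from cone_inequality_traj[OF eps ab this fg \<theta> c, of M] show ?thesis
    using calculation unfolding w_def by linarith
qed

lemma cone_monotone:
  assumes eps: "eps \<in> Eps" and ab: "a \<le> b"
    and \<xi>: "orbit_on eps {a..b} \<xi>" and \<zeta>: "orbit_on eps {a..b} \<zeta>"
    and \<theta>: "\<bar>\<theta> - slow_rate eps \<mu>\<bar> \<le> \<eta>" and c: "\<bar>c\<bar> \<le> d"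
  defines "w \<equiv> \<lambda>t. phase_diff (\<xi> t) (\<zeta> t)"
  shows "exp (2 * \<theta> * b) * (V eps (w b) + c * E eps (w b)) \<le> exp (2 * \<theta> * a) * (V eps (w a) + c * E eps (w a))"
  using cone_inequality_orbits[OF assms(1-6), of 0] by (simp add: w_def)

end

section \<open>Scalar initial and boundary value problems\<close>

lemma linear_ode:
  fixes h :: "real \<Rightarrow> real"
  assumes "continuous_on {a..b} h" "t0 \<in> {a..b}"
  obtains y where "y t0 = y0"
    "\<And>t. t \<in> {a..b} \<Longrightarrow> (y has_real_derivative h t - c * y t) (at t within {a..b})"
proof -
  define g where "g = (\<lambda>t. exp (c * t) * h t)"
  have g: "continuous_on {a..b} g" unfolding g_def by (intro continuous_intros assms)
  define K where "K = exp (c * t0) * y0 - integral {a..t0} g"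
  define y where "y = (\<lambda>t. exp (- c * t) * (K + integral {a..t} g))"
  show ?thesis
  proof (rule that)
    show "y t0 = y0" by (simp add: y_def K_def mult.assoc[symmetric] exp_add[symmetric])
    fix t assume t: "t \<in> {a..b}"
    have e: "((\<lambda>t. exp (- c * t)) has_real_derivative - c * exp (- c * t)) (at t within {a..b})"
      by (auto intro!: derivative_eq_intros)
    have "((\<lambda>t. K + integral {a..t} g) has_real_derivative 0 + g t) (at t within {a..b})"
      by (intro DERIV_add DERIV_const integral_has_real_derivative g t)
    from DERIV_mult[OF e this]
    have "(y has_real_derivative - c * exp (- c * t) * (K + integral {a..t} g)
        + (0 + g t) * exp (- c * t)) (at t within {a..b})" unfolding y_def .
    moreover have "g t * exp (- c * t) = h t"
    proof -
      have "exp (c * t) * exp (- c * t) = 1" by (simp add: exp_add[symmetric])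
      then show ?thesis by (simp add: g_def algebra_simps)
    qed
    ultimately show "(y has_real_derivative h t - c * y t) (at t within {a..b})"
      by (simp add: y_def algebra_simps)
  qed
qed

text \<open>
  The functions cosh and sinh/identity, or their trigonometric or degenerate counterparts,
  according to the sign of \<open>\<Delta>\<close>.
\<close>

lemma fundamental_system:
  obtains C S :: "real \<Rightarrow> real" where "C 0 = 1" "S 0 = 0"
    "\<And>t. (S has_real_derivative C t) (at t)" "\<And>t. (C has_real_derivative \<Delta> * S t) (at t)"
    "\<And>t. (C t)\<^sup>2 - \<Delta> * (S t)\<^sup>2 = 1"
proof -
  consider "\<Delta> > 0" | "\<Delta> = 0" | "\<Delta> < 0" by linarith
  then show ?thesis
  proof cases
    case 1
    define r where "r = sqrt \<Delta>"
    have r: "r > 0" "\<Delta> = r * r" using 1 by (auto simp: r_def)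
    show ?thesis
    proof (rule that[of "\<lambda>t. cosh (r * t)" "\<lambda>t. sinh (r * t) / r"])
      show "((\<lambda>t. sinh (r * t) / r) has_real_derivative cosh (r * t)) (at t)" for t
        using r by (auto intro!: derivative_eq_intros)
      show "((\<lambda>t. cosh (r * t)) has_real_derivative \<Delta> * (sinh (r * t) / r)) (at t)" for t
        using r by (auto intro!: derivative_eq_intros)
      show "(cosh (r * t))\<^sup>2 - \<Delta> * (sinh (r * t) / r)\<^sup>2 = 1" for t
        using r cosh_square_eq[of "r * t"] by (simp add: power2_eq_square)
    qed auto
  next
    case 2
    show ?thesis
      by (rule that[of "\<lambda>t. 1" "\<lambda>t. t"]) (use 2 in \<open>auto intro!: derivative_eq_intros\<close>)
  next
    case 3
    define r where "r = sqrt (- \<Delta>)"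
    have r: "r > 0" "\<Delta> = - (r * r)" using 3 by (auto simp: r_def)
    show ?thesis
    proof (rule that[of "\<lambda>t. cos (r * t)" "\<lambda>t. sin (r * t) / r"])
      show "((\<lambda>t. sin (r * t) / r) has_real_derivative cos (r * t)) (at t)" for t
        using r by (auto intro!: derivative_eq_intros)
      show "((\<lambda>t. cos (r * t)) has_real_derivative \<Delta> * (sin (r * t) / r)) (at t)" for t
        using r by (auto intro!: derivative_eq_intros)
      show "(cos (r * t))\<^sup>2 - \<Delta> * (sin (r * t) / r)\<^sup>2 = 1" for t
        using r sin_cos_squared_add[of "r * t"] by (simp add: power2_eq_square)
    qed auto
  qed
qed

text \<open>
  Variation of constants.
\<close>

lemma forced_oscillator:
  fixes g :: "real \<Rightarrow> real"
  assumes g: "continuous_on {a..b} g" and ab: "a \<le> b"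
  obtains z w where "z a = z0" "w a = w0"
    "\<And>t. t \<in> {a..b} \<Longrightarrow> (z has_real_derivative w t) (at t within {a..b})"
    "\<And>t. t \<in> {a..b} \<Longrightarrow> (w has_real_derivative \<Delta> * z t + g t) (at t within {a..b})"
proof -
  obtain C0 S0 :: "real \<Rightarrow> real" where CS: "C0 0 = 1" "S0 0 = 0"
    "\<And>t. (S0 has_real_derivative C0 t) (at t)" "\<And>t. (C0 has_real_derivative \<Delta> * S0 t) (at t)"
    "\<And>t. (C0 t)\<^sup>2 - \<Delta> * (S0 t)\<^sup>2 = 1" using fundamental_system[of \<Delta>] by metis
  define C S where "C t = C0 (t - a)" and "S t = S0 (t - a)" for t
  have S: "(S has_real_derivative C t) (at t within A)" for t A
    using DERIV_chain2[OF CS(3) DERIV_diff[OF DERIV_ident DERIV_const], of a t UNIV]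
    unfolding S_def[abs_def] C_def by (simp add: has_field_derivative_at_within)
  have C: "(C has_real_derivative \<Delta> * S t) (at t within A)" for t A
    using DERIV_chain2[OF CS(4) DERIV_diff[OF DERIV_ident DERIV_const], of a t UNIV]
    unfolding C_def[abs_def] S_def by (simp add: has_field_derivative_at_within)
  have id: "C t * C t - \<Delta> * (S t * S t) = 1" for t
    using CS(5)[of "t - a"] by (simp add: C_def S_def power2_eq_square)
  have cont: "continuous_on {a..b} C" "continuous_on {a..b} S"
    by (rule DERIV_continuous_on, rule C) (rule DERIV_continuous_on, rule S)
  define p q where "p = (\<lambda>t. w0 + integral {a..t} (\<lambda>s. C s * g s))"
    and "q = (\<lambda>t. - z0 + integral {a..t} (\<lambda>s. S s * g s))"
  have p: "(p has_real_derivative C t * g t) (at t within {a..b})" if "t \<in> {a..b}" for t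
    unfolding p_def
    by (rule DERIV_cong[OF DERIV_add[OF DERIV_const integral_has_real_derivative[OF continuous_on_mult[OF cont(1) g] that]]]) simp
  have q: "(q has_real_derivative S t * g t) (at t within {a..b})" if "t \<in> {a..b}" for t
    unfolding q_def
    by (rule DERIV_cong[OF DERIV_add[OF DERIV_const integral_has_real_derivative[OF continuous_on_mult[OF cont(2) g] that]]]) simp
  show ?thesis
  proof (rule that[of "\<lambda>t. S t * p t - C t * q t" "\<lambda>t. C t * p t - \<Delta> * S t * q t"])
    show "S a * p a - C a * q a = z0" "C a * p a - \<Delta> * S a * q a = w0"
      by (simp_all add: S_def C_def CS p_def q_def)
    fix t assume t: "t \<in> {a..b}"
    show "((\<lambda>t. S t * p t - C t * q t) has_real_derivative C t * p t - \<Delta> * S t * q t) (at t within {a..b})"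
      by (rule DERIV_cong[OF DERIV_diff[OF DERIV_mult[OF S p[OF t]] DERIV_mult[OF C q[OF t]]]])
        (simp add: algebra_simps)
    have gid: "g t = C t * C t * g t - \<Delta> * (S t * S t) * g t"
      using arg_cong[OF id[of t], of "\<lambda>x. x * g t"] by (simp add: left_diff_distrib)
    show "((\<lambda>t. C t * p t - \<Delta> * S t * q t) has_real_derivative \<Delta> * (S t * p t - C t * q t) + g t) (at t within {a..b})"
      by (rule DERIV_cong[OF DERIV_diff[OF DERIV_mult[OF C p[OF t]] DERIV_mult[OF DERIV_cmult[OF S] q[OF t]]]])
        (subst (3) gid, simp add: algebra_simps)
  qed
qed

text \<open>
  For \<open>eps > 0\<close> the substitution \<open>u(t) = exp (- t / (2 eps)) z(t)\<close> removes the damping.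
\<close>

lemma mode_initial_value:
  fixes h :: "real \<Rightarrow> real"
  assumes h: "continuous_on {a..b} h" and ab: "a \<le> b" and eps: "0 \<le> eps"
  obtains u v where "mode_eq eps l {a..b} u v h" "u a = u0" "0 < eps \<Longrightarrow> v a = v0"
proof (cases "eps = 0")
  case True
  obtain y where y: "y a = u0"
    "\<And>t. t \<in> {a..b} \<Longrightarrow> (y has_real_derivative h t - l * y t) (at t within {a..b})"
    using linear_ode[OF h, of a u0 l] ab by auto
  show ?thesis
  proof (rule that)
    show "mode_eq eps l {a..b} y (\<lambda>t. h t - l * y t) h" using y(2) True by (auto simp: mode_eq_def)
  qed (use y True in auto)
next
  case False
  then have eps: "0 < eps" using assms by simp
  define \<gamma> where "\<gamma> = 1 / (2 * eps)"
  have \<gamma>: "2 * eps * \<gamma> = 1" using eps by (simp add: \<gamma>_def)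
  define \<Delta> where "\<Delta> = \<gamma>\<^sup>2 - l / eps"
  have \<Delta>: "eps * \<Delta> = \<gamma> / 2 - l" using eps by (simp add: \<Delta>_def \<gamma>_def power2_eq_square field_simps)
  define g where "g = (\<lambda>t. exp (\<gamma> * (t - a)) * h t / eps)"
  have "continuous_on {a..b} g" unfolding g_def using eps by (intro continuous_intros h) auto
  then obtain z w where zw: "z a = u0" "w a = v0 + \<gamma> * u0"
    "\<And>t. t \<in> {a..b} \<Longrightarrow> (z has_real_derivative w t) (at t within {a..b})"
    "\<And>t. t \<in> {a..b} \<Longrightarrow> (w has_real_derivative \<Delta> * z t + g t) (at t within {a..b})"
    using forced_oscillator[of a b g u0 "v0 + \<gamma> * u0" \<Delta>] ab by metis
  define E where "E = (\<lambda>t. exp (- \<gamma> * (t - a)))"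
  have E: "(E has_real_derivative - \<gamma> * E t) (at t within A)" for t A
    unfolding E_def by (auto intro!: derivative_eq_intros)
  show ?thesis
  proof (rule that[of "\<lambda>t. E t * z t" "\<lambda>t. E t * (w t - \<gamma> * z t)"])
    show "E a * z a = u0" "E a * (w a - \<gamma> * z a) = v0" using zw by (simp_all add: E_def)
    show "mode_eq eps l {a..b} (\<lambda>t. E t * z t) (\<lambda>t. E t * (w t - \<gamma> * z t)) h"
      unfolding mode_eq_def
    proof (intro ballI conjI impI)
      fix t assume t: "t \<in> {a..b}"
      show "((\<lambda>t. E t * z t) has_real_derivative E t * (w t - \<gamma> * z t)) (at t within {a..b})"
        by (rule DERIV_cong[OF DERIV_mult[OF E zw(3)[OF t]]]) (simp add: algebra_simps)
      have Eg: "eps * (E t * g t) = h t"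
      proof -
        have "E t * exp (\<gamma> * (t - a)) = 1" by (simp add: E_def exp_add[symmetric])
        then show ?thesis using eps by (simp add: g_def mult.assoc[symmetric])
      qed
      have "((\<lambda>t. eps * (E t * (w t - \<gamma> * z t))) has_real_derivative
         eps * (- \<gamma> * E t * (w t - \<gamma> * z t) + (\<Delta> * z t + g t - \<gamma> * w t) * E t)) (at t within {a..b})"
        by (intro DERIV_cmult DERIV_mult E DERIV_diff zw t)
      moreover have "eps * (- \<gamma> * E t * (w t - \<gamma> * z t) + (\<Delta> * z t + g t - \<gamma> * w t) * E t)
        = eps * (E t * g t) + (eps * \<Delta>) * (z t * E t) - (2 * eps * \<gamma>) * (E t * w t) + (2 * eps * \<gamma>) * \<gamma> / 2 * (E t * z t)"
        by (simp add: algebra_simps)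
      moreover have "h t + (\<gamma> / 2 - l) * (z t * E t) - 1 * (E t * w t) + 1 * \<gamma> / 2 * (E t * z t)
        = h t - E t * (w t - \<gamma> * z t) - l * (E t * z t)"
        by (simp add: field_simps)
      ultimately show "((\<lambda>t. eps * (E t * (w t - \<gamma> * z t))) has_real_derivative
         h t - E t * (w t - \<gamma> * z t) - l * (E t * z t)) (at t within {a..b})"
        by (simp only: Eg \<Delta> \<gamma>)
    qed (use False in auto)
  qed
qed

text \<open>
  For \<open>eps > 0\<close> the slow coordinate \<open>p\<close> and the fast one \<open>q = v + \<nu> u\<close> satisfy two decoupled
  first order equations. The first is solved backwards from the right end, and the second forwards
  from \<open>q = 0\<close>, which is the condition at the left end. The two coordinates are independent because
  \<open>1 - 2 eps \<nu> > 0\<close>, that is, \<open>4 eps l < 1\<close>.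
\<close>

lemma mode_boundary_value:
  fixes h :: "real \<Rightarrow> real"
  assumes h: "continuous_on {a..b} h" and ab: "a \<le> b" and eps: "0 \<le> eps" and l: "4 * eps * l < 1"
  obtains u v where "mode_eq eps l {a..b} u v h" "slow_coord eps l (u b) (v b) = p"
    "0 < eps \<Longrightarrow> v a = - slow_rate eps l * u a"
proof (cases "eps = 0")
  case True
  obtain y where y: "y b = p"
    "\<And>t. t \<in> {a..b} \<Longrightarrow> (y has_real_derivative h t - l * y t) (at t within {a..b})"
    using linear_ode[OF h, of b p l] ab by auto
  show ?thesis
  proof (rule that)
    show "mode_eq eps l {a..b} y (\<lambda>t. h t - l * y t) h" using y(2) True by (auto simp: mode_eq_def)
  qed (use y True in \<open>auto simp: slow_coord_def\<close>)
next
  case False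
  then have eps: "0 < eps" using assms by simp
  define \<nu> where "\<nu> = slow_rate eps l"
  define D where "D = 1 - 2 * eps * \<nu>"
  have "D = sqrt (1 - 4 * eps * l)" unfolding D_def \<nu>_def using l by (intro slow_rate_beta) auto
  then have D: "0 < D" using l by simp
  have leq: "l = \<nu> * (1 - eps * \<nu>)"
    using slow_rate_eq[of eps l] l by (simp add: \<nu>_def power2_eq_square algebra_simps)
  obtain y where y: "y b = p"
    "\<And>t. t \<in> {a..b} \<Longrightarrow> (y has_real_derivative h t - \<nu> * y t) (at t within {a..b})"
    using linear_ode[OF h, of b p \<nu>] ab by auto
  have "continuous_on {a..b} (\<lambda>t. h t / eps)" using eps by (intro continuous_intros h) auto
  then obtain q where q: "q a = 0"
    "\<And>t. t \<in> {a..b} \<Longrightarrow> (q has_real_derivative h t / eps - (1 - eps * \<nu>) / eps * q t) (at t within {a..b})"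
    using linear_ode[of a b "\<lambda>t. h t / eps" a 0 "(1 - eps * \<nu>) / eps"] ab by auto
  define u v where "u = (\<lambda>t. (y t - eps * q t) / D)" and "v = (\<lambda>t. ((1 - eps * \<nu>) * q t - \<nu> * y t) / D)"
  have "mode_eq eps l {a..b} u v h"
    unfolding mode_eq_def
  proof (intro ballI conjI impI)
    fix t assume t: "t \<in> {a..b}"
    have "(u has_real_derivative (h t - \<nu> * y t - eps * (h t / eps - (1 - eps * \<nu>) / eps * q t)) / D) (at t within {a..b})"
      unfolding u_def by (intro DERIV_cdivide DERIV_diff DERIV_cmult y q t)
    moreover have "h t - \<nu> * y t - eps * (h t / eps - (1 - eps * \<nu>) / eps * q t) = (1 - eps * \<nu>) * q t - \<nu> * y t"
      using eps by (simp add: field_simps)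
    ultimately show "(u has_real_derivative v t) (at t within {a..b})" by (simp only: v_def)
    have "((\<lambda>t. eps * v t) has_real_derivative
       eps * (((1 - eps * \<nu>) * (h t / eps - (1 - eps * \<nu>) / eps * q t) - \<nu> * (h t - \<nu> * y t)) / D)) (at t within {a..b})"
      unfolding v_def by (intro DERIV_cdivide DERIV_diff DERIV_cmult y q t)
    moreover have "eps * (((1 - eps * \<nu>) * (h t / eps - (1 - eps * \<nu>) / eps * q t) - \<nu> * (h t - \<nu> * y t)) / D)
        = h t - v t - l * u t"
    proof -
      have "eps * ((1 - eps * \<nu>) * (h t / eps - (1 - eps * \<nu>) / eps * q t)) = (1 - eps * \<nu>) * (h t - (1 - eps * \<nu>) * q t)"
        using eps by (simp add: field_simps)
      then have "eps * ((1 - eps * \<nu>) * (h t / eps - (1 - eps * \<nu>) / eps * q t) - \<nu> * (h t - \<nu> * y t))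
          = (1 - eps * \<nu>) * (h t - (1 - eps * \<nu>) * q t) - eps * (\<nu> * (h t - \<nu> * y t))"
        by (simp only: right_diff_distrib)
      also have "\<dots> = D * h t - ((1 - eps * \<nu>) * q t - \<nu> * y t) - l * (y t - eps * q t)"
        unfolding leq D_def by (simp add: algebra_simps)
      finally have "eps * (((1 - eps * \<nu>) * (h t / eps - (1 - eps * \<nu>) / eps * q t) - \<nu> * (h t - \<nu> * y t)) / D)
          = (D * h t - ((1 - eps * \<nu>) * q t - \<nu> * y t) - l * (y t - eps * q t)) / D"
        by (simp only: times_divide_eq_right)
      also have "\<dots> = h t - v t - l * u t" using D by (simp add: u_def v_def diff_divide_distrib right_diff_distrib)
      finally show ?thesis .
    qed
    ultimately show "((\<lambda>t. eps * v t) has_real_derivative h t - v t - l * u t) (at t within {a..b})" by simp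
  qed (use False in auto)
  moreover have "slow_coord eps l (u b) (v b) = p"
  proof -
    have "slow_coord eps l (u b) (v b) = (D * y b) / D"
      unfolding slow_coord_def \<nu>_def[symmetric] u_def v_def D_def
      by (simp add: add_divide_distrib[symmetric] algebra_simps)
    then show ?thesis using D y by simp
  qed
  moreover have "v a = - slow_rate eps l * u a" using q by (simp add: u_def v_def \<nu>_def)
  ultimately show ?thesis using that by blast
qed

section \<open>Solving the nonlinear boundary value problem\<close>

context semilinear begin

text \<open>
  Uniform smallness of the tail of the energy in time, from \<open>energy_growth\<close> and the smallness of the
  tail of the force on a compact interval.
\<close>

lemma energy_tail:
  fixes u v :: "nat \<Rightarrow> real \<Rightarrow> real"
  assumes eps: "0 \<le> eps" and ab: "a \<le> b" and f: "continuous_on {a..b} f"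
    and modes: "\<And>n. mode_eq eps (lam n) {a..b} (u n) (v n) (\<lambda>t. f t \<bullet> e n)"
    and fin: "summable (\<lambda>n. mode_energy eps (lam n) (u n a) (v n a))" and r: "0 < r"
  obtains m where "\<And>t M. t \<in> {a..b} \<Longrightarrow> (\<Sum>n\<in>{m..<M}. mode_energy eps (lam n) (u n t) (v n t)) < r"
proof -
  obtain m1 where m1: "\<And>m n. m \<ge> m1 \<Longrightarrow>
      norm (sum (\<lambda>n. mode_energy eps (lam n) (u n a) (v n a)) {m..<n}) < r / 2"
    using fin r unfolding summable_Cauchy by (meson half_gt_zero)
  define q where "q = r / (2 * (b - a + 1))"
  have q: "0 < q" "(b - a) * q < r / 2" using r ab by (simp_all add: q_def field_simps)
  have "compact (f ` {a..b})" by (intro compact_continuous_image f compact_Icc)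
  then obtain m2 where m2: "\<And>m x. m \<ge> m2 \<Longrightarrow> x \<in> f ` {a..b} \<Longrightarrow> (norm x)\<^sup>2 - (\<Sum>n<m. (x \<bullet> e n)\<^sup>2) < q"
    using uniform_tail[OF _ q(1)] by blast
  define m where "m = max m1 m2"
  have "(\<Sum>n\<in>{m..<M}. mode_energy eps (lam n) (u n t) (v n t)) < r" if t: "t \<in> {a..b}" for t M
  proof (cases "m \<le> M")
    case True
    have h: "(\<Sum>n\<in>{m..<M}. (f \<tau> \<bullet> e n)\<^sup>2) \<le> q" if \<tau>: "\<tau> \<in> {a..b}" for \<tau>
    proof -
      have "(\<Sum>n\<in>{m..<M}. (f \<tau> \<bullet> e n)\<^sup>2) = (\<Sum>n<M. (f \<tau> \<bullet> e n)\<^sup>2) - (\<Sum>n<m. (f \<tau> \<bullet> e n)\<^sup>2)"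
        using sum_diff_nat_ivl[of 0 m M "\<lambda>n. (f \<tau> \<bullet> e n)\<^sup>2"] True by (simp add: atLeast0LessThan)
      also have "\<dots> \<le> (norm (f \<tau>))\<^sup>2 - (\<Sum>n<m. (f \<tau> \<bullet> e n)\<^sup>2)" using bessel[of "f \<tau>" M] by simp
      also have "\<dots> < q" using \<tau> by (intro m2) (auto simp: m_def)
      finally show ?thesis by simp
    qed
    have "(\<Sum>n\<in>{m..<M}. mode_energy eps (lam n) (u n t) (v n t)) \<le>
      (\<Sum>n\<in>{m..<M}. mode_energy eps (lam n) (u n a) (v n a)) + integral {a..t} (\<lambda>_. q)"
      using t h by (intro energy_growth[where h = "\<lambda>n t. f t \<bullet> e n"] mode_eq_subset[OF modes]) auto
    also have "integral {a..t} (\<lambda>_. q) \<le> (b - a) * q"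
      using t q by (simp add: mult_right_mono)
    also have "(\<Sum>n\<in>{m..<M}. mode_energy eps (lam n) (u n a) (v n a)) \<le> r / 2"
      using m1[of m M] by (auto simp: m_def abs_less_iff)
    finally show ?thesis using q by linarith
  next
    case False
    then show ?thesis using r by simp
  qed
  then show ?thesis using that by blast
qed

text \<open>
  Uniformly small tails make the partial sums of the modes converge to a continuous curve.
\<close>

lemma assemble_traj:
  fixes u v :: "nat \<Rightarrow> real \<Rightarrow> real"
  assumes eps: "0 \<le> eps" and ab: "a \<le> b" and f: "continuous_on {a..b} f"
    and modes: "\<And>n. mode_eq eps (lam n) {a..b} (u n) (v n) (\<lambda>t. f t \<bullet> e n)"
    and fin: "summable (\<lambda>n. mode_energy eps (lam n) (u n a) (v n a))"
  obtains \<xi> where "traj eps {a..b} \<xi> f" "\<And>t n. t \<in> {a..b} \<Longrightarrow> fst (\<xi> t) \<bullet> e n = u n t"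
    "\<And>t n. snd (\<xi> t) n = v n t"
proof -
  have nn: "0 \<le> mode_energy eps (lam n) x y" for n x y
    using eps lam_gt0[of n] by (simp add: mode_energy_nonneg)
  have le: "lam 0 * (u n t)\<^sup>2 \<le> mode_energy eps (lam n) (u n t) (v n t)" for n t
    using eps mult_right_mono[OF lam0_le[of n], of "(u n t)\<^sup>2"] by (simp add: mode_energy_def add_increasing)
  have sm: "summable (\<lambda>n. mode_energy eps (lam n) (u n t) (v n t))" if t: "t \<in> {a..b}" for t
    unfolding summable_Cauchy
  proof (intro allI impI)
    fix r :: real assume "0 < r"
    then obtain m where m: "\<And>t M. t \<in> {a..b} \<Longrightarrow> (\<Sum>n\<in>{m..<M}. mode_energy eps (lam n) (u n t) (v n t)) < r"
      using energy_tail[OF eps ab f modes fin] by blast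
    have "norm (\<Sum>n\<in>{k..<M}. mode_energy eps (lam n) (u n t) (v n t)) < r" if "k \<ge> m" for k M
    proof -
      have "(\<Sum>n\<in>{k..<M}. mode_energy eps (lam n) (u n t) (v n t)) \<le> (\<Sum>n\<in>{m..<M}. mode_energy eps (lam n) (u n t) (v n t))"
        using that by (intro sum_mono2) (auto simp: nn)
      moreover have "0 \<le> (\<Sum>n\<in>{k..<M}. mode_energy eps (lam n) (u n t) (v n t))" by (intro sum_nonneg nn)
      ultimately show ?thesis using m[OF t, of M] by simp
    qed
    then show "\<exists>N. \<forall>m\<ge>N. \<forall>M. norm (\<Sum>n\<in>{m..<M}. mode_energy eps (lam n) (u n t) (v n t)) < r" by blast
  qed
  have "\<exists>U. \<forall>n. U \<bullet> e n = u n t" if t: "t \<in> {a..b}" for t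
  proof -
    have "summable (\<lambda>n. 1 / lam 0 * mode_energy eps (lam n) (u n t) (v n t))" by (intro summable_mult sm t)
    moreover have "norm ((u n t)\<^sup>2) \<le> 1 / lam 0 * mode_energy eps (lam n) (u n t) (v n t)" for n
      using le[of n t] lam_pos by (simp add: field_simps)
    ultimately have "summable (\<lambda>n. (u n t)\<^sup>2)" by (rule summable_comparison_test'[where N = 0])
    then show ?thesis using riesz_fischer by metis
  qed
  then obtain U where U: "\<And>t n. t \<in> {a..b} \<Longrightarrow> U t \<bullet> e n = u n t" by metis
  define \<xi> where "\<xi> t = (U t, \<lambda>n. v n t)" for t
  have cont: "continuous_on {a..b} U"
  proof (rule uniform_limit_theorem)
    show "\<forall>\<^sub>F m in sequentially. continuous_on {a..b} (\<lambda>t. proj e m (U t))"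
    proof (intro always_eventually allI)
      fix m
      have "continuous_on {a..b} (\<lambda>t. \<Sum>n<m. u n t *\<^sub>R e n)"
        by (intro continuous_intros DERIV_continuous_on[OF mode_eqD(1)[OF modes]])
      then show "continuous_on {a..b} (\<lambda>t. proj e m (U t))"
        by (rule continuous_on_eq) (simp add: proj_def U)
    qed
    show "uniform_limit {a..b} (\<lambda>m t. proj e m (U t)) U sequentially"
      unfolding uniform_limit_sequentially_iff
    proof (intro allI impI)
      fix r' :: real assume r': "0 < r'"
      define r where "r = r' / 2"
      have r: "0 < r" "r < r'" using r' by (simp_all add: r_def)
      then have "0 < lam 0 * r\<^sup>2" using lam_pos by simp
      then obtain m where m: "\<And>t M. t \<in> {a..b} \<Longrightarrow>
          (\<Sum>n\<in>{m..<M}. mode_energy eps (lam n) (u n t) (v n t)) < lam 0 * r\<^sup>2"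
        using energy_tail[OF eps ab f modes fin] by blast
      have "dist (proj e k (U t)) (U t) \<le> r" if "k \<ge> m" "t \<in> {a..b}" for k t
      proof -
        have "(\<lambda>M. \<Sum>n<M. (U t \<bullet> e n)\<^sup>2) \<longlonglongrightarrow> (norm (U t))\<^sup>2" using parseval[of "U t"] by (simp add: sums_def)
        moreover have "(\<Sum>n<M. (U t \<bullet> e n)\<^sup>2) \<le> (\<Sum>n<k. (U t \<bullet> e n)\<^sup>2) + r\<^sup>2" if "M \<ge> k" for M
        proof -
          have "lam 0 * (\<Sum>n\<in>{k..<M}. (U t \<bullet> e n)\<^sup>2) \<le> (\<Sum>n\<in>{k..<M}. mode_energy eps (lam n) (u n t) (v n t))"
            unfolding sum_distrib_left using U[OF \<open>t \<in> _\<close>] le by (intro sum_mono) auto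
          also have "\<dots> \<le> (\<Sum>n\<in>{m..<M}. mode_energy eps (lam n) (u n t) (v n t))"
            using \<open>k \<ge> m\<close> by (intro sum_mono2) (auto simp: nn)
          also have "\<dots> < lam 0 * r\<^sup>2" by (rule m[OF \<open>t \<in> _\<close>])
          finally have "(\<Sum>n\<in>{k..<M}. (U t \<bullet> e n)\<^sup>2) \<le> r\<^sup>2" using lam_pos by simp
          moreover have "(\<Sum>n\<in>{k..<M}. (U t \<bullet> e n)\<^sup>2) = (\<Sum>n<M. (U t \<bullet> e n)\<^sup>2) - (\<Sum>n<k. (U t \<bullet> e n)\<^sup>2)"
            using sum_diff_nat_ivl[of 0 k M "\<lambda>n. (U t \<bullet> e n)\<^sup>2"] that by (simp add: atLeast0LessThan)
          ultimately show ?thesis by simp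
        qed
        ultimately have "(norm (U t))\<^sup>2 \<le> (\<Sum>n<k. (U t \<bullet> e n)\<^sup>2) + r\<^sup>2"
          by (intro LIMSEQ_le_const2) auto
        then have "(norm (U t - proj e k (U t)))\<^sup>2 \<le> r\<^sup>2" by (simp add: norm_diff_proj)
        then have "norm (U t - proj e k (U t)) \<le> r" by (rule power2_le_imp_le) (use r in simp)
        then show ?thesis by (simp add: dist_norm norm_minus_commute)
      qed
      then show "\<exists>N. \<forall>k\<ge>N. \<forall>t\<in>{a..b}. dist (proj e k (U t)) (U t) < r'"
        using r(2) by (meson le_less_trans)
    qed
  qed simp
  have "traj eps {a..b} \<xi> f"
    unfolding traj_def
  proof (intro conjI ballI allI)
    show "continuous_on {a..b} (\<lambda>t. fst (\<xi> t))" using cont by (simp add: \<xi>_def)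
    show "fin_en eps (\<xi> t)" if "t \<in> {a..b}" for t
    proof -
      have "en eps (\<xi> t) = (\<lambda>n. mode_energy eps (lam n) (u n t) (v n t))"
        using U[OF that] by (simp add: fun_eq_iff en_def \<xi>_def)
      then show ?thesis using sm[OF that] by (simp add: fin_en_def)
    qed
    show "mode_eq eps (lam n) {a..b} (\<lambda>t. fst (\<xi> t) \<bullet> e n) (\<lambda>t. snd (\<xi> t) n) (\<lambda>t. f t \<bullet> e n)" for n
      by (rule mode_eq_cong[OF modes]) (auto simp: \<xi>_def U)
  qed
  then show ?thesis using that U by (simp add: \<xi>_def)
qed

end

lemma geometric_cauchy:
  fixes x :: "nat \<Rightarrow> 'a::{real_inner,complete_space}"
  assumes r: "0 \<le> r" "r < 1" and A: "0 \<le> A" and step: "\<And>n. norm (x (Suc n) - x n) \<le> A * r ^ n"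
  obtains l where "\<And>n. norm (l - x n) \<le> A * r ^ n / (1 - r)"
proof -
  have fin: "norm (x (n + j) - x n) \<le> A * r ^ n * (1 - r ^ j) / (1 - r)" for n j
  proof (induction j)
    case (Suc j)
    have "norm (x (n + Suc j) - x n) \<le> norm (x (Suc (n + j)) - x (n + j)) + norm (x (n + j) - x n)"
      using norm_triangle_ineq[of "x (Suc (n + j)) - x (n + j)" "x (n + j) - x n"] by simp
    also have "\<dots> \<le> A * r ^ (n + j) + A * r ^ n * (1 - r ^ j) / (1 - r)"
      using step[of "n + j"] Suc by (rule add_mono)
    also have "\<dots> = A * r ^ n * (1 - r ^ Suc j) / (1 - r)"
      using r by (simp add: field_simps power_add)
    finally show ?case .
  qed simp
  have le: "norm (x (n + j) - x n) \<le> A * r ^ n / (1 - r)" for n j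
  proof -
    have "A * r ^ n * (1 - r ^ j) \<le> A * r ^ n * 1"
      using A r by (intro mult_left_mono) auto
    then have "A * r ^ n * (1 - r ^ j) / (1 - r) \<le> A * r ^ n / (1 - r)"
      using r by (intro divide_right_mono) auto
    then show ?thesis using fin[of n j] by linarith
  qed
  have lim0: "(\<lambda>n. A * r ^ n / (1 - r)) \<longlonglongrightarrow> A * 0 / (1 - r)"
    using r by (intro tendsto_intros LIMSEQ_power_zero) auto
  have "Cauchy x"
  proof (rule CauchyI')
    fix q :: real assume "0 < q"
    then have "\<forall>\<^sub>F n in sequentially. A * r ^ n / (1 - r) < q"
      using lim0 by (intro order_tendstoD(2)) auto
    then obtain M where M: "\<And>n. n \<ge> M \<Longrightarrow> A * r ^ n / (1 - r) < q"
      by (auto simp: eventually_sequentially)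
    have "dist (x m) (x n) < q" if "m \<ge> M" "n > m" for m n
      using le[of m "n - m"] M[OF that(1)] that by (simp add: dist_norm norm_minus_commute)
    then show "\<exists>M. \<forall>m\<ge>M. \<forall>n>m. dist (x m) (x n) < q" by blast
  qed
  then obtain l where l: "x \<longlonglongrightarrow> l" using Cauchy_convergent_iff convergent_def by blast
  have "norm (l - x n) \<le> A * r ^ n / (1 - r)" for n
  proof (rule LIMSEQ_le_const2)
    show "(\<lambda>j. norm (x (j + n) - x n)) \<longlonglongrightarrow> norm (l - x n)"
      using LIMSEQ_ignore_initial_segment[OF l, of n] by (intro tendsto_intros)
    show "\<exists>M. \<forall>j\<ge>M. norm (x (j + n) - x n) \<le> A * r ^ n / (1 - r)"
      using le[of n] by (metis add.commute)
  qed
  then show ?thesis using that by blast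
qed

context cone_system begin

text \<open>
  The boundary conditions: data \<open>x\<close> for the fast modes at time \<open>a\<close>, the slow coordinates \<open>p\<close> at
  time \<open>b\<close>, and, if \<open>eps > 0\<close>, slow modes that start on the line of slow solutions. For \<open>eps = 0\<close> a
  slow mode is a first order equation, for which \<open>p\<close> alone suffices.
\<close>

definition bc :: "real \<Rightarrow> real \<Rightarrow> real \<Rightarrow> 'a \<times> (nat \<Rightarrow> real) \<Rightarrow> (nat \<Rightarrow> real)
    \<Rightarrow> (real \<Rightarrow> 'a \<times> (nat \<Rightarrow> real)) \<Rightarrow> bool" where
  "bc eps a b x p \<xi> \<longleftrightarrow>
     (\<forall>n\<ge>N. fst (\<xi> a) \<bullet> e n = fst x \<bullet> e n \<and> (0 < eps \<longrightarrow> snd (\<xi> a) n = snd x n)) \<and>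
     (\<forall>n<N. (0 < eps \<longrightarrow> snd (\<xi> a) n = - slow_rate eps (lam n) * (fst (\<xi> a) \<bullet> e n)) \<and> P eps (\<xi> b) n = p n)"

lemma slow_modes: "eps \<in> Eps \<Longrightarrow> n < N \<Longrightarrow> 4 * eps * lam n < 1 \<and> 0 < slow_rate eps (lam n)"
  using bounds[of eps n] sgn[of n] by (simp add: cone_bounds_def)

lemma linear_bvp:
  assumes eps: "eps \<in> Eps" and ab: "a \<le> b" and f: "continuous_on {a..b} f" and x: "fin_en eps x"
  obtains \<xi> where "traj eps {a..b} \<xi> f" "bc eps a b x p \<xi>"
proof -
  have fn: "continuous_on {a..b} (\<lambda>t. f t \<bullet> e n)" for n by (intro continuous_intros f)
  define R where "R n u v \<longleftrightarrow> mode_eq eps (lam n) {a..b} u v (\<lambda>t. f t \<bullet> e n) \<and>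
      (N \<le> n \<longrightarrow> u a = fst x \<bullet> e n \<and> (0 < eps \<longrightarrow> v a = snd x n)) \<and>
      (n < N \<longrightarrow> (0 < eps \<longrightarrow> v a = - slow_rate eps (lam n) * u a) \<and> slow_coord eps (lam n) (u b) (v b) = p n)"
    for n u v
  have "\<exists>u v. R n u v" for n
  proof (cases "n < N")
    case True
    show ?thesis
      by (rule mode_boundary_value[OF fn ab Eps_nonneg[OF eps], of "lam n" n "p n"])
        (use slow_modes[OF eps True] True in \<open>auto simp: R_def\<close>)
  next
    case False
    show ?thesis
      by (rule mode_initial_value[OF fn ab Eps_nonneg[OF eps], of "lam n" n "fst x \<bullet> e n" "snd x n"])
        (use False in \<open>auto simp: R_def\<close>)
  qed
  then obtain u v where R: "\<And>n. R n (u n) (v n)" by metis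
  have uv: "\<And>n. mode_eq eps (lam n) {a..b} (u n) (v n) (\<lambda>t. f t \<bullet> e n)"
      "\<And>n. N \<le> n \<Longrightarrow> u n a = fst x \<bullet> e n \<and> (0 < eps \<longrightarrow> v n a = snd x n)"
      "\<And>n. n < N \<Longrightarrow> (0 < eps \<longrightarrow> v n a = - slow_rate eps (lam n) * u n a) \<and> slow_coord eps (lam n) (u n b) (v n b) = p n"
    using R unfolding R_def by blast+
  have "summable (\<lambda>n. mode_energy eps (lam n) (u n a) (v n a))"
  proof (rule summable_comparison_test'[where N = N])
    show "summable (en eps x)" using x by (simp add: fin_en_def)
    fix n assume "N \<le> n"
    then have "mode_energy eps (lam n) (u n a) (v n a) = en eps x n"
      using uv(2)[of n] Eps_nonneg[OF eps] by (cases "eps = 0") (auto simp: en_def mode_energy_def)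
    then show "norm (mode_energy eps (lam n) (u n a) (v n a)) \<le> en eps x n"
      using en_nonneg[OF Eps_nonneg[OF eps], of x n] by simp
  qed
  then obtain \<xi> where \<xi>: "traj eps {a..b} \<xi> f" "\<And>t n. t \<in> {a..b} \<Longrightarrow> fst (\<xi> t) \<bullet> e n = u n t"
    "\<And>t n. snd (\<xi> t) n = v n t"
    using assemble_traj[OF Eps_nonneg[OF eps] ab f uv(1)] by blast
  have "bc eps a b x p \<xi>" unfolding bc_def P_def using uv(2,3) \<xi>(2,3) ab by auto
  then show ?thesis using that \<xi>(1) by blast
qed

lemma cone_form_zero [simp]: "cone_form eps \<mu> z l 0 0 = 0"
  by (simp add: cone_form_def)

text \<open>
  The difference of two solutions of the boundary value problem starts in the negative cone, by
  \<open>cone_form_slow_line\<close>. At the right end \<open>P\<close> agrees and \<open>V \<ge> 0\<close>. These are the signs that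
  remove the boundary terms from the cone inequality.
\<close>

lemma bc_start:
  assumes eps: "eps \<in> Eps" and f: "fin_en eps w"
    and fast: "\<And>n. N \<le> n \<Longrightarrow> fst w \<bullet> e n = 0 \<and> (0 < eps \<longrightarrow> snd w n = 0)"
    and slow: "\<And>n. n < N \<Longrightarrow> 0 < eps \<Longrightarrow> snd w n = - slow_rate eps (lam n) * (fst w \<bullet> e n)"
  shows "V eps w + d * E eps w \<le> 0"
proof -
  have "cf eps w n + d * en eps w n \<le> 0" for n
  proof (cases "n < N")
    case True
    then have b: "cone_form eps \<mu> (s n) (lam n) u (- slow_rate eps (lam n) * u)
               \<le> - d * mode_energy eps (lam n) u (- slow_rate eps (lam n) * u)" for u
      using bounds[OF eps, of n] sgn(1)[of n] by (simp add: cone_bounds_def)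
    show ?thesis
    proof (cases "eps = 0")
      case True
      then show ?thesis using b[of "fst w \<bullet> e n"]
        by (simp add: cf_def en_def cone_form_def mode_energy_def)
    next
      case False
      then show ?thesis using b[of "fst w \<bullet> e n"] slow[OF True] Eps_nonneg[OF eps]
        by (simp add: cf_def en_def)
    qed
  next
    case False
    then show ?thesis using fast[of n] Eps_nonneg[OF eps]
      by (cases "eps = 0") (auto simp: cf_def en_def cone_form_def mode_energy_def)
  qed
  moreover have "(\<lambda>n. cf eps w n + d * en eps w n) sums (V eps w + d * E eps w)"
    unfolding V_def E_def using f cf_summable[OF eps f]
    by (intro sums_add sums_mult summable_sums) (auto simp: fin_en_def)
  ultimately show ?thesis by (rule sums_le[OF _ _ sums_zero])
qed

lemma slow_coord_diff: "slow_coord eps l (u - u') (v - v') = slow_coord eps l u v - slow_coord eps l u' v'"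
  by (simp add: slow_coord_def algebra_simps)

lemma P_diff: "P eps (phase_diff x y) n = P eps x n - P eps y n"
  by (simp add: P_def slow_coord_diff inner_diff_left)

lemma V_ge_if_P_eq:
  assumes "eps \<in> Eps" "fin_en eps (phase_diff x y)" "\<And>n. n < N \<Longrightarrow> P eps x n = P eps y n"
  shows "d * E eps (phase_diff x y) \<le> V eps (phase_diff x y)"
  using V_lower[OF assms(1,2)] assms(3) by (simp add: P_diff)

definition weighted_sq :: "real \<Rightarrow> real \<Rightarrow> real \<Rightarrow> (real \<Rightarrow> 'a) \<Rightarrow> real" where
  "weighted_sq eps a b g = integral {a..b} (\<lambda>t. exp (2 * slow_rate eps \<mu> * t) * (norm (g t))\<^sup>2)"

text \<open>
  The cone inequality with rate \<open>\<theta>\<close> gives the factor \<open>1 / \<Lambda>\<close> for the weighted \<open>L\<^sup>2\<close> norm and a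
  bound of the energy at time \<open>a\<close>; \<open>energy_growth\<close> turns the latter into a pointwise bound.
\<close>

lemma bvp_stability:
  assumes eps: "eps \<in> Eps" and ab: "a \<le> b"
  shows "\<exists>C>0. \<forall>\<xi> \<zeta> f g x p. traj eps {a..b} \<xi> f \<longrightarrow> traj eps {a..b} \<zeta> g \<longrightarrow>
       bc eps a b x p \<xi> \<longrightarrow> bc eps a b x p \<zeta> \<longrightarrow>
       continuous_on {a..b} f \<longrightarrow> continuous_on {a..b} g \<longrightarrow>
       \<Lambda>\<^sup>2 * weighted_sq eps a b (\<lambda>t. fst (\<xi> t) - fst (\<zeta> t)) \<le> weighted_sq eps a b (\<lambda>t. f t - g t) \<and>
       (\<forall>t\<in>{a..b}. (norm (fst (\<xi> t) - fst (\<zeta> t)))\<^sup>2 \<le> C * weighted_sq eps a b (\<lambda>t. f t - g t))"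
proof -
  define \<theta> where "\<theta> = slow_rate eps \<mu>"
  define I where I_weighted: "I = weighted_sq eps a b"
  have I_def: "I g = integral {a..b} (\<lambda>t. exp (2 * \<theta> * t) * (norm (g t))\<^sup>2)" for g
    by (simp add: I_weighted weighted_sq_def \<theta>_def)
  define c0 where "c0 = exp (- (2 * \<bar>\<theta>\<bar> * (\<bar>a\<bar> + \<bar>b\<bar>)))"
  have c0: "0 < c0" "\<And>t. t \<in> {a..b} \<Longrightarrow> c0 \<le> exp (2 * \<theta> * t)"
  proof -
    fix t assume t: "t \<in> {a..b}"
    have "\<bar>\<theta> * t\<bar> \<le> \<bar>\<theta>\<bar> * (\<bar>a\<bar> + \<bar>b\<bar>)" unfolding abs_mult using t by (intro mult_left_mono) auto
    then show "c0 \<le> exp (2 * \<theta> * t)" unfolding c0_def by simp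
  qed (simp add: c0_def)
  define ea where "ea = exp (2 * \<theta> * a)"
  have ea: "0 < ea" by (simp add: ea_def)
  define C where "C = (k / (d * ea) + 1 / c0) / lam 0"
  have C: "0 < C" using pos ea c0 lam_pos by (simp add: C_def add_pos_pos)
  show ?thesis
  proof (intro exI[of _ C] conjI C allI impI)
    fix \<xi> \<zeta> f g x p
    assume tr: "traj eps {a..b} \<xi> f" "traj eps {a..b} \<zeta> g" and bcs: "bc eps a b x p \<xi>" "bc eps a b x p \<zeta>"
      and fg: "continuous_on {a..b} f" "continuous_on {a..b} g"
    define w where "w = (\<lambda>t. phase_diff (\<xi> t) (\<zeta> t))"
    have fin: "fin_en eps (w t)" if "t \<in> {a..b}" for t
      unfolding w_def using that by (intro fin_en_diff Eps_nonneg eps trajD[OF tr(1)] trajD[OF tr(2)])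
    have wc: "continuous_on {a..b} (\<lambda>t. fst (w t))"
      unfolding w_def fst_phase_diff by (intro continuous_intros trajD(1)[OF tr(1)] trajD(1)[OF tr(2)])
    have start: "V eps (w a) + d * E eps (w a) \<le> 0"
      using bcs ab by (intro bc_start[OF eps fin]) (auto simp: bc_def w_def inner_diff_left algebra_simps)
    have Ea: "0 \<le> E eps (w a)" using ab by (intro E_nonneg Eps_nonneg eps fin) auto
    have Eb: "0 \<le> E eps (w b)" using ab by (intro E_nonneg Eps_nonneg eps fin) auto
    have "d * E eps (w b) \<le> V eps (w b)"
      unfolding w_def using fin[of b] bcs ab by (intro V_ge_if_P_eq eps) (auto simp: bc_def w_def)
    moreover have "0 \<le> d * E eps (w b)"
      using Eb pos by simp
    ultimately have Vb: "0 \<le> V eps (w b)" by linarith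
    define I1 I2 where "I1 = I (\<lambda>t. f t - g t)" and "I2 = I (\<lambda>t. fst (w t))"
    have I2: "0 \<le> I2" unfolding I2_def I_def
      by (intro integral_nonneg integrable_continuous_interval continuous_intros wc) auto
    have I1: "0 \<le> I1" unfolding I1_def I_def
      by (intro integral_nonneg integrable_continuous_interval continuous_intros fg) auto
    have split: "integral {a..b} (\<lambda>t. exp (2 * \<theta> * t) * ((norm (f t - g t))\<^sup>2 - \<Lambda>\<^sup>2 * (norm (fst (w t)))\<^sup>2))
        = I1 - \<Lambda>\<^sup>2 * I2"
    proof -
      have "integral {a..b} (\<lambda>t. exp (2 * \<theta> * t) * (norm (f t - g t))\<^sup>2
            - \<Lambda>\<^sup>2 * (exp (2 * \<theta> * t) * (norm (fst (w t)))\<^sup>2)) = I1 - integral {a..b} (\<lambda>t. \<Lambda>\<^sup>2 * (exp (2 * \<theta> * t) * (norm (fst (w t)))\<^sup>2))"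
        unfolding I1_def I_def
        by (intro integral_diff integrable_continuous_interval continuous_intros fg wc)
      also have "integral {a..b} (\<lambda>t. \<Lambda>\<^sup>2 * (exp (2 * \<theta> * t) * (norm (fst (w t)))\<^sup>2)) = \<Lambda>\<^sup>2 * I2"
        unfolding I2_def I_def by (rule integral_mult_right)
      finally show ?thesis by (simp add: algebra_simps)
    qed
    have main: "exp (2 * \<theta> * b) * V eps (w b) \<le> ea * V eps (w a) + k * (I1 - \<Lambda>\<^sup>2 * I2)"
      using cone_inequality_traj[OF eps ab tr fg, of \<theta> 0 0] pos split
      by (simp add: \<theta>_def w_def ea_def)
    moreover have "0 \<le> exp (2 * \<theta> * b) * V eps (w b)" using Vb by simp
    ultimately have m2: "- (ea * V eps (w a)) \<le> k * (I1 - \<Lambda>\<^sup>2 * I2)" by linarith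
    have "ea * (d * E eps (w a)) \<le> - (ea * V eps (w a))"
      using start ea mult_left_mono[of "d * E eps (w a)" "- V eps (w a)" ea] by simp
    then have m3: "ea * (d * E eps (w a)) \<le> k * (I1 - \<Lambda>\<^sup>2 * I2)" using m2 by linarith
    moreover have "0 \<le> ea * (d * E eps (w a))" using ea pos Ea by simp
    ultimately have "0 \<le> k * (I1 - \<Lambda>\<^sup>2 * I2)" by linarith
    then have first: "\<Lambda>\<^sup>2 * I2 \<le> I1" using pos by (simp add: zero_le_mult_iff)
    have "0 \<le> \<Lambda>\<^sup>2 * I2" using I2 by simp
    then have "k * (I1 - \<Lambda>\<^sup>2 * I2) \<le> k * I1" using pos by (intro mult_left_mono) auto
    then have "(d * ea) * E eps (w a) \<le> k * I1" using m3 by (simp add: mult_ac)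
    then have Ea2: "E eps (w a) \<le> k / (d * ea) * I1" using pos ea by (simp add: field_simps)
    have "(norm (fst (w t)))\<^sup>2 \<le> C * I1" if t: "t \<in> {a..b}" for t
    proof -
      have modes: "mode_eq eps (lam n) {a..t} (\<lambda>t. fst (w t) \<bullet> e n) (\<lambda>t. snd (w t) n) (\<lambda>t. f t \<bullet> e n - g t \<bullet> e n)" for n
        by (rule mode_eq_subset[where I = "{a..b}"])
          (use mode_eq_diff[OF trajD(3)[OF tr(1)] trajD(3)[OF tr(2)]] t in \<open>auto simp: w_def inner_diff_left\<close>)
      have part: "(\<Sum>n<m. en eps (w t) n) \<le> k / (d * ea) * I1 + I1 / c0" for m
      proof -
        have "(\<Sum>n<m. en eps (w t) n) \<le> (\<Sum>n<m. en eps (w a) n) + integral {a..t} (\<lambda>t. (norm (f t - g t))\<^sup>2)"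
          unfolding en_def
        proof (rule energy_growth[OF _ _ _ modes])
          show "continuous_on {a..t} (\<lambda>t. (norm (f t - g t))\<^sup>2)"
            using t by (intro continuous_intros continuous_on_subset[OF fg(1)] continuous_on_subset[OF fg(2)]) auto
          show "(\<Sum>n<m. (f \<tau> \<bullet> e n - g \<tau> \<bullet> e n)\<^sup>2) \<le> (norm (f \<tau> - g \<tau>))\<^sup>2" for \<tau>
            using bessel[of "f \<tau> - g \<tau>" m] by (simp add: inner_diff_left)
        qed (use t in auto)
        also have "(\<Sum>n<m. en eps (w a) n) \<le> E eps (w a)"
          using ab by (intro sum_en_le_E Eps_nonneg eps fin) auto
        also have "integral {a..t} (\<lambda>t. (norm (f t - g t))\<^sup>2) \<le> integral {a..b} (\<lambda>t. (norm (f t - g t))\<^sup>2)"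
          using t by (intro integral_subset_le integrable_continuous_interval continuous_intros
              continuous_on_subset[OF fg(1)] continuous_on_subset[OF fg(2)]) auto
        also have "\<dots> \<le> integral {a..b} (\<lambda>t. 1 / c0 * (exp (2 * \<theta> * t) * (norm (f t - g t))\<^sup>2))"
        proof (intro integral_le integrable_continuous_interval continuous_intros fg)
          fix t assume "t \<in> {a..b}"
          then have "c0 * (norm (f t - g t))\<^sup>2 \<le> exp (2 * \<theta> * t) * (norm (f t - g t))\<^sup>2"
            by (intro mult_right_mono c0) auto
          then show "(norm (f t - g t))\<^sup>2 \<le> 1 / c0 * (exp (2 * \<theta> * t) * (norm (f t - g t))\<^sup>2)"
            using c0(1) by (simp add: field_simps)
        qed
        also have "\<dots> = I1 / c0" unfolding I1_def I_def by simp
        finally show ?thesis using Ea2 by linarith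
      qed
      have "E eps (w t) \<le> k / (d * ea) * I1 + I1 / c0"
        unfolding E_def using fin[OF t] part by (intro suminf_le_const) (auto simp: fin_en_def)
      then have "lam 0 * (norm (fst (w t)))\<^sup>2 \<le> (k / (d * ea) + 1 / c0) * I1"
        using norm_sq_le_E[OF Eps_nonneg[OF eps] fin[OF t]] by (simp add: distrib_right)
      then show ?thesis using lam_pos by (simp add: C_def field_simps)
    qed
    then show "\<forall>t\<in>{a..b}. (norm (fst (\<xi> t) - fst (\<zeta> t)))\<^sup>2 \<le> C * weighted_sq eps a b (\<lambda>t. f t - g t)"
      by (simp add: I1_def w_def I_weighted)
    show "\<Lambda>\<^sup>2 * weighted_sq eps a b (\<lambda>t. fst (\<xi> t) - fst (\<zeta> t)) \<le> weighted_sq eps a b (\<lambda>t. f t - g t)"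
      using first by (simp add: I1_def I2_def w_def I_weighted)
  qed
qed

text \<open>
  The map that sends \<open>u\<close> to the solution with force \<open>F(u)\<close> contracts the weighted \<open>L\<^sup>2\<close> norm with
  factor \<open>L / \<Lambda> < 1\<close>. The limit of the iterates has to be a
  continuous curve; that they converge uniformly follows from the pointwise part of \<open>bvp_stability\<close>.
\<close>

theorem nonlinear_bvp:
  assumes eps: "eps \<in> Eps" and ab: "a \<le> b" and x: "fin_en eps x"
  obtains \<xi> where "orbit_on eps {a..b} \<xi>" "bc eps a b x p \<xi>"
proof -
  define \<theta> where "\<theta> = slow_rate eps \<mu>"
  define I where I_weighted: "I = weighted_sq eps a b"
  have I_def: "I g = integral {a..b} (\<lambda>t. exp (2 * \<theta> * t) * (norm (g t))\<^sup>2)" for g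
    by (simp add: I_weighted weighted_sq_def \<theta>_def)
  obtain C where C: "0 < C"
    "\<forall>\<xi> \<zeta> f g x p. traj eps {a..b} \<xi> f \<longrightarrow> traj eps {a..b} \<zeta> g \<longrightarrow>
       bc eps a b x p \<xi> \<longrightarrow> bc eps a b x p \<zeta> \<longrightarrow>
       continuous_on {a..b} f \<longrightarrow> continuous_on {a..b} g \<longrightarrow>
       \<Lambda>\<^sup>2 * I (\<lambda>t. fst (\<xi> t) - fst (\<zeta> t)) \<le> I (\<lambda>t. f t - g t) \<and>
       (\<forall>t\<in>{a..b}. (norm (fst (\<xi> t) - fst (\<zeta> t)))\<^sup>2 \<le> C * I (\<lambda>t. f t - g t))"
    using bvp_stability[OF eps ab, folded I_weighted] by (elim exE conjE) (rule that)
  (* The linear solution operator; S is its composition with F. *)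
  define T where "T f = (SOME \<xi>. traj eps {a..b} \<xi> f \<and> bc eps a b x p \<xi>)" for f
  have T: "traj eps {a..b} (T f) f" "bc eps a b x p (T f)" if "continuous_on {a..b} f" for f
  proof -
    have "\<exists>\<xi>. traj eps {a..b} \<xi> f \<and> bc eps a b x p \<xi>" using linear_bvp[OF eps ab that x] by metis
    then have "traj eps {a..b} (T f) f \<and> bc eps a b x p (T f)" unfolding T_def by (rule someI_ex)
    then show "traj eps {a..b} (T f) f" "bc eps a b x p (T f)" by auto
  qed
  define S where "S u = (\<lambda>t. fst (T (\<lambda>t. F (u t)) t))" for u
  define U where "U = rec_nat (\<lambda>_. 0) (\<lambda>_. S)"
  have U_Suc: "U (Suc j) = S (U j)" for j by (simp add: U_def)
  have Fc: "continuous_on {a..b} (\<lambda>t. F (u t))" if "continuous_on {a..b} u" for u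
    by (intro continuous_on_compose2[OF F_continuous[of UNIV] that]) auto
  have Uc: "continuous_on {a..b} (U j)" for j
  proof (induction j)
    case 0 show ?case by (simp add: U_def continuous_on_const)
  next
    case (Suc j) show ?case unfolding U_Suc S_def by (rule trajD(1)[OF T(1)[OF Fc[OF Suc]]])
  qed
  have Ile: "I (\<lambda>t. F (u t) - F (u' t)) \<le> L\<^sup>2 * I (\<lambda>t. u t - u' t)"
    if "continuous_on {a..b} u" "continuous_on {a..b} u'" for u u'
  proof -
    have "I (\<lambda>t. F (u t) - F (u' t)) \<le> integral {a..b} (\<lambda>t. L\<^sup>2 * (exp (2 * \<theta> * t) * (norm (u t - u' t))\<^sup>2))"
      unfolding I_def
    proof (intro integral_le integrable_continuous_interval continuous_intros Fc that)
      fix t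
      have "(norm (F (u t) - F (u' t)))\<^sup>2 \<le> (L * norm (u t - u' t))\<^sup>2" by (intro power_mono F_diff) auto
      then have "exp (2 * \<theta> * t) * (norm (F (u t) - F (u' t)))\<^sup>2 \<le> exp (2 * \<theta> * t) * (L * norm (u t - u' t))\<^sup>2"
        by (intro mult_left_mono) auto
      then show "exp (2 * \<theta> * t) * (norm (F (u t) - F (u' t)))\<^sup>2 \<le> L\<^sup>2 * (exp (2 * \<theta> * t) * (norm (u t - u' t))\<^sup>2)"
        by (simp add: power_mult_distrib mult_ac)
    qed
    then show ?thesis by (simp add: I_def)
  qed
  have TT: "\<Lambda>\<^sup>2 * I (\<lambda>t. S u t - S u' t) \<le> L\<^sup>2 * I (\<lambda>t. u t - u' t)"
     "t \<in> {a..b} \<Longrightarrow> (norm (S u t - S u' t))\<^sup>2 \<le> C * (L\<^sup>2 * I (\<lambda>t. u t - u' t))"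
    if u: "continuous_on {a..b} u" "continuous_on {a..b} u'" for u u' t
  proof -
    note c = C(2)[rule_format, OF T(1)[OF Fc[OF u(1)]] T(1)[OF Fc[OF u(2)]] T(2)[OF Fc[OF u(1)]] T(2)[OF Fc[OF u(2)]] Fc[OF u(1)] Fc[OF u(2)]]
    show "\<Lambda>\<^sup>2 * I (\<lambda>t. S u t - S u' t) \<le> L\<^sup>2 * I (\<lambda>t. u t - u' t)"
      unfolding S_def using c Ile[OF u] by linarith
    have "C * I (\<lambda>t. F (u t) - F (u' t)) \<le> C * (L\<^sup>2 * I (\<lambda>t. u t - u' t))"
      using C(1) Ile[OF u] by (intro mult_left_mono) auto
    then show "(norm (S u t - S u' t))\<^sup>2 \<le> C * (L\<^sup>2 * I (\<lambda>t. u t - u' t))" if "t \<in> {a..b}"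
      unfolding S_def using c that by (meson order_trans)
  qed
  have \<Lambda>: "0 < \<Lambda>" using L_less L_nonneg by linarith
  define r where "r = L / \<Lambda>"
  have r: "0 \<le> r" "r < 1" using L_less L_nonneg \<Lambda> by (auto simp: r_def)
  have rL: "L\<^sup>2 = \<Lambda>\<^sup>2 * r\<^sup>2" using \<Lambda> by (simp add: r_def power_divide)
  define D0 where "D0 = I (\<lambda>t. U 1 t - U 0 t)"
  have Inn: "0 \<le> I g" if "continuous_on {a..b} g" for g
    unfolding I_def by (intro integral_nonneg integrable_continuous_interval continuous_intros that) auto
  have D0: "0 \<le> D0" unfolding D0_def by (intro Inn continuous_intros Uc)
  have D: "I (\<lambda>t. U (Suc j) t - U j t) \<le> D0 * (r ^ j)\<^sup>2" for j
  proof (induction j)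
    case (Suc j)
    have "\<Lambda>\<^sup>2 * I (\<lambda>t. U (Suc (Suc j)) t - U (Suc j) t) \<le> \<Lambda>\<^sup>2 * (r\<^sup>2 * I (\<lambda>t. U (Suc j) t - U j t))"
      using TT(1)[OF Uc[of "Suc j"] Uc[of j]] unfolding rL by (simp only: U_Suc mult.assoc)
    then have "I (\<lambda>t. U (Suc (Suc j)) t - U (Suc j) t) \<le> r\<^sup>2 * I (\<lambda>t. U (Suc j) t - U j t)"
      using \<Lambda> by simp
    also have "\<dots> \<le> r\<^sup>2 * (D0 * (r ^ j)\<^sup>2)" using Suc by (intro mult_left_mono) auto
    also have "\<dots> = D0 * (r ^ Suc j)\<^sup>2" by (simp add: power_mult_distrib)
    finally show ?case .
  qed (simp add: D0_def)
  define A where "A = sqrt (C * (L\<^sup>2 * D0))"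
  have A: "0 \<le> A" "A\<^sup>2 = C * (L\<^sup>2 * D0)" using C D0 by (auto simp: A_def)
  have step: "norm (U (Suc (Suc j)) t - U (Suc j) t) \<le> A * r ^ j" if t: "t \<in> {a..b}" for j t
  proof (rule power2_le_imp_le)
    have "(norm (U (Suc (Suc j)) t - U (Suc j) t))\<^sup>2 \<le> C * (L\<^sup>2 * I (\<lambda>t. U (Suc j) t - U j t))"
      using TT(2)[OF Uc[of "Suc j"] Uc[of j] t] by (simp only: U_Suc)
    also have "\<dots> \<le> C * (L\<^sup>2 * (D0 * (r ^ j)\<^sup>2))" using C D by (intro mult_left_mono) auto
    also have "\<dots> = (A * r ^ j)\<^sup>2" using A(2) by (simp add: power_mult_distrib mult_ac)
    finally show "(norm (U (Suc (Suc j)) t - U (Suc j) t))\<^sup>2 \<le> (A * r ^ j)\<^sup>2" .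
  qed (use A r in simp)
  have "\<exists>l. \<forall>j. norm (l - U (Suc j) t) \<le> A * r ^ j / (1 - r)" if t: "t \<in> {a..b}" for t
    using geometric_cauchy[of r A "\<lambda>j. U (Suc j) t"] r A step[OF t] by metis
  then obtain u where u: "\<And>t j. t \<in> {a..b} \<Longrightarrow> norm (u t - U (Suc j) t) \<le> A * r ^ j / (1 - r)"
    by metis
  define q where "q j = A * r ^ j / (1 - r)" for j
  have q: "q \<longlonglongrightarrow> 0"
  proof -
    have "(\<lambda>n. A * r ^ n / (1 - r)) \<longlonglongrightarrow> A * 0 / (1 - r)"
      using r by (intro tendsto_intros LIMSEQ_power_zero) auto
    then show ?thesis by (simp add: q_def[abs_def])
  qed
  have uc: "continuous_on {a..b} u"
  proof (rule uniform_limit_theorem)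
    show "\<forall>\<^sub>F j in sequentially. continuous_on {a..b} (U (Suc j))" using Uc by simp
    show "uniform_limit {a..b} (\<lambda>j. U (Suc j)) u sequentially"
    proof (rule uniform_limitI)
      fix z :: real assume "0 < z"
      then have "\<forall>\<^sub>F j in sequentially. q j < z" using q by (intro order_tendstoD(2)) auto
      then show "\<forall>\<^sub>F j in sequentially. \<forall>t\<in>{a..b}. dist (U (Suc j) t) (u t) < z"
      proof eventually_elim
        fix j assume "q j < z"
        moreover have "dist (U (Suc j) t) (u t) \<le> q j" if "t \<in> {a..b}" for t
          unfolding q_def using u[OF that] by (subst dist_commute) (simp only: dist_norm)
        ultimately show "\<forall>t\<in>{a..b}. dist (U (Suc j) t) (u t) < z" using le_less_trans by blast
      qed
    qed
  qed simp
  define \<xi> where "\<xi> = T (\<lambda>t. F (u t))"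
  have fix_u: "fst (\<xi> t) = u t" if t: "t \<in> {a..b}" for t
  proof -
    define c1 where "c1 = integral {a..b} (\<lambda>t. exp (2 * \<theta> * t))"
    have Iq: "I (\<lambda>t. u t - U (Suc j) t) \<le> c1 * (q j)\<^sup>2" for j
    proof -
      have "I (\<lambda>t. u t - U (Suc j) t) \<le> integral {a..b} (\<lambda>t. exp (2 * \<theta> * t) * (q j)\<^sup>2)"
        unfolding I_def
      proof (intro integral_le integrable_continuous_interval continuous_intros uc Uc)
        fix t assume "t \<in> {a..b}"
        then have "(norm (u t - U (Suc j) t))\<^sup>2 \<le> (q j)\<^sup>2"
          using u by (intro power_mono) (auto simp: q_def)
        then show "exp (2 * \<theta> * t) * (norm (u t - U (Suc j) t))\<^sup>2 \<le> exp (2 * \<theta> * t) * (q j)\<^sup>2"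
          by (intro mult_left_mono) auto
      qed
      then show ?thesis by (simp add: c1_def)
    qed
    have lim1: "(\<lambda>j. fst (\<xi> t) - U (Suc (Suc j)) t) \<longlonglongrightarrow> 0"
    proof (rule Lim_null_comparison)
      show "\<forall>\<^sub>F j in sequentially. norm (fst (\<xi> t) - U (Suc (Suc j)) t) \<le> sqrt (C * (L\<^sup>2 * (c1 * (q j)\<^sup>2)))"
      proof (intro always_eventually allI)
        fix j
        have "(norm (fst (\<xi> t) - U (Suc (Suc j)) t))\<^sup>2 \<le> C * (L\<^sup>2 * I (\<lambda>t. u t - U (Suc j) t))"
          using TT(2)[OF uc Uc[of "Suc j"] t] by (simp only: U_Suc \<xi>_def S_def)
        also have "\<dots> \<le> C * (L\<^sup>2 * (c1 * (q j)\<^sup>2))" using C(1) Iq[of j] by (intro mult_left_mono) auto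
        finally show "norm (fst (\<xi> t) - U (Suc (Suc j)) t) \<le> sqrt (C * (L\<^sup>2 * (c1 * (q j)\<^sup>2)))"
          by (rule real_le_rsqrt)
      qed
      have "(\<lambda>j. sqrt (C * (L\<^sup>2 * (c1 * (q j)\<^sup>2)))) \<longlonglongrightarrow> sqrt (C * (L\<^sup>2 * (c1 * 0\<^sup>2)))"
        by (intro tendsto_intros q)
      then show "(\<lambda>j. sqrt (C * (L\<^sup>2 * (c1 * (q j)\<^sup>2)))) \<longlonglongrightarrow> 0" by simp
    qed
    have lim2: "(\<lambda>j. u t - U (Suc (Suc j)) t) \<longlonglongrightarrow> 0"
    proof (rule Lim_null_comparison)
      show "\<forall>\<^sub>F j in sequentially. norm (u t - U (Suc (Suc j)) t) \<le> q (Suc j)"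
        unfolding q_def by (intro always_eventually allI u[OF t])
      show "(\<lambda>j. q (Suc j)) \<longlonglongrightarrow> 0" using q by (rule LIMSEQ_Suc)
    qed
    have "(\<lambda>j. (fst (\<xi> t) - U (Suc (Suc j)) t) - (u t - U (Suc (Suc j)) t)) \<longlonglongrightarrow> 0 - 0"
      by (intro tendsto_diff lim1 lim2)
    then have "(\<lambda>j::nat. fst (\<xi> t) - u t) \<longlonglongrightarrow> 0" by simp
    then show ?thesis using LIMSEQ_unique[OF tendsto_const] by fastforce
  qed
  have t1: "traj eps {a..b} \<xi> (\<lambda>t. F (u t))" and b1: "bc eps a b x p \<xi>"
    unfolding \<xi>_def by (intro T Fc uc)+
  have "orbit_on eps {a..b} \<xi>"
    unfolding traj_def
  proof (intro conjI ballI allI)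
    show "continuous_on {a..b} (\<lambda>t. fst (\<xi> t))" by (rule trajD(1)[OF t1])
    show "fin_en eps (\<xi> t)" if "t \<in> {a..b}" for t by (rule trajD(2)[OF t1 that])
    show "mode_eq eps (lam n) {a..b} (\<lambda>t. fst (\<xi> t) \<bullet> e n) (\<lambda>t. snd (\<xi> t) n) (\<lambda>t. F (fst (\<xi> t)) \<bullet> e n)" for n
      by (rule mode_eq_cong[OF trajD(3)[OF t1]]) (auto simp: fix_u)
  qed
  then show ?thesis using that b1 by blast
qed

end

section \<open>The phase space\<close>

context semilinear begin

abbreviation X :: "real \<Rightarrow> ('a \<times> (nat \<Rightarrow> real)) set" where "X eps \<equiv> phase_space e lam F eps"

definition dual_sq :: "(nat \<Rightarrow> real) \<Rightarrow> real" where "dual_sq a = (\<Sum>n. (a n)\<^sup>2 / lam n)"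

lemma energy_space_mem: "x \<in> energy_space e lam eps \<longleftrightarrow>
    coeff e (fst x) \<in> Hs lam 1 \<and> snd x \<in> (if eps = 0 then Hs lam (-1) else Hs lam 0)"
  by (cases x) (simp add: energy_space_def)

lemma phase_space_mem: "x \<in> X eps \<longleftrightarrow>
    x \<in> energy_space e lam eps \<and> (eps = 0 \<longrightarrow> residual e lam F (fst x) (snd x) = (\<lambda>_. 0))"
  by (cases x) (simp add: phase_space_def)

lemma lam_powr: "lam n powr 0 = 1" "lam n powr 1 = lam n" "lam n powr (- 1) * c = c / lam n"
  using lam_gt0[of n] by (simp_all add: powr_minus field_simps)

lemma Hs_iff:
  "a \<in> Hs lam 0 \<longleftrightarrow> summable (\<lambda>n. (a n)\<^sup>2)"
  "a \<in> Hs lam 1 \<longleftrightarrow> summable (\<lambda>n. lam n * (a n)\<^sup>2)"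
  "a \<in> Hs lam (- 1) \<longleftrightarrow> summable (\<lambda>n. (a n)\<^sup>2 / lam n)"
  using lam_powr(1,2) unfolding Hs_def mem_Collect_eq lam_powr(3) by simp_all

lemma Hs_norm_sq:
  "a \<in> Hs lam 0 \<Longrightarrow> (Hs_norm lam 0 a)\<^sup>2 = (\<Sum>n. (a n)\<^sup>2)"
  "a \<in> Hs lam 1 \<Longrightarrow> (Hs_norm lam 1 a)\<^sup>2 = (\<Sum>n. lam n * (a n)\<^sup>2)"
  "a \<in> Hs lam (- 1) \<Longrightarrow> (Hs_norm lam (- 1) a)\<^sup>2 = dual_sq a"
proof -
  show "(Hs_norm lam 0 a)\<^sup>2 = (\<Sum>n. (a n)\<^sup>2)" if "a \<in> Hs lam 0"
    using that unfolding Hs_iff Hs_norm_def lam_powr by (simp add: suminf_nonneg)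
  show "(Hs_norm lam 1 a)\<^sup>2 = (\<Sum>n. lam n * (a n)\<^sup>2)" if "a \<in> Hs lam 1"
    using that lam_gt0 unfolding Hs_iff Hs_norm_def lam_powr by (simp add: suminf_nonneg less_imp_le)
  show "(Hs_norm lam (- 1) a)\<^sup>2 = dual_sq a" if "a \<in> Hs lam (- 1)"
    using that lam_gt0 unfolding Hs_iff Hs_norm_def lam_powr(3) dual_sq_def
    by (simp add: suminf_nonneg less_imp_le)
qed

lemma dual_le: "(a::real)\<^sup>2 / lam n \<le> a\<^sup>2 / lam 0"
  using lam0_le[of n] lam_pos by (intro divide_left_mono) (auto intro: mult_pos_pos lam_gt0)

lemma sq_combination: "(c * p - c * q - r :: real)\<^sup>2 \<le> 3 * c\<^sup>2 * p\<^sup>2 + 3 * c\<^sup>2 * q\<^sup>2 + 3 * r\<^sup>2"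
proof -
  have three: "(x - y - z)\<^sup>2 \<le> 3 * x\<^sup>2 + 3 * y\<^sup>2 + 3 * z\<^sup>2" for x y z :: real
  proof -
    have "3 * x\<^sup>2 + 3 * y\<^sup>2 + 3 * z\<^sup>2 = (x - y - z)\<^sup>2 + ((x + y)\<^sup>2 + (x + z)\<^sup>2 + (y - z)\<^sup>2)"
      by (simp add: power2_eq_square algebra_simps)
    then show ?thesis
      using zero_le_power2[of "x + y"] zero_le_power2[of "x + z"] zero_le_power2[of "y - z"] by linarith
  qed
  show ?thesis using three[of "c * p" "c * q" r] by (simp add: power_mult_distrib)
qed

lemma Hs_dual_combination:
  assumes "a \<in> Hs lam (- 1)" "b \<in> Hs lam (- 1)" "c \<in> Hs lam (- 1)"
  shows "(\<lambda>n. r * a n - r * b n - c n) \<in> Hs lam (- 1)"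
proof -
  have "summable (\<lambda>n. 3 * r\<^sup>2 * ((a n)\<^sup>2 / lam n) + 3 * r\<^sup>2 * ((b n)\<^sup>2 / lam n) + 3 * ((c n)\<^sup>2 / lam n))"
    using assms unfolding Hs_iff by (intro summable_add summable_mult)
  moreover have "norm ((r * a n - r * b n - c n)\<^sup>2 / lam n)
      \<le> 3 * r\<^sup>2 * ((a n)\<^sup>2 / lam n) + 3 * r\<^sup>2 * ((b n)\<^sup>2 / lam n) + 3 * ((c n)\<^sup>2 / lam n)" for n
    using divide_right_mono[OF sq_combination[of r "a n" "b n" "c n"], of "lam n"] lam_gt0[of n]
    by (simp add: add_divide_distrib)
  ultimately show ?thesis unfolding Hs_iff by (rule summable_comparison_test'[where N = 0])
qed

lemma coeff_in_dual: "coeff e u \<in> Hs lam (- 1)"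
proof -
  have "summable (\<lambda>n. 1 / lam 0 * (u \<bullet> e n)\<^sup>2)" using parseval[of u] by (intro summable_mult) (rule sums_summable)
  then show ?thesis unfolding Hs_iff
    by (rule summable_comparison_test'[where N = 0]) (use dual_le lam_gt0 in \<open>simp add: coeff_def less_imp_le\<close>)
qed

lemma energy_space_iff:
  assumes "0 \<le> eps"
  shows "x \<in> energy_space e lam eps \<longleftrightarrow> fin_en eps x \<and> snd x \<in> Hs lam (- 1)"
proof (cases "eps = 0")
  case True
  then show ?thesis
    by (auto simp: energy_space_mem Hs_iff fin_en_def en_def[abs_def] mode_energy_def coeff_def)
next
  case False
  then have eps: "0 < eps" using assms by simp
  show ?thesis
  proof
    assume "x \<in> energy_space e lam eps"
    then have s: "summable (\<lambda>n. lam n * (fst x \<bullet> e n)\<^sup>2)" "summable (\<lambda>n. (snd x n)\<^sup>2)"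
      using False by (auto simp: energy_space_mem Hs_iff coeff_def)
    have "fin_en eps x" unfolding fin_en_def en_def[abs_def] mode_energy_def
      by (intro summable_add summable_mult s)
    moreover have "snd x \<in> Hs lam (- 1)" unfolding Hs_iff
      by (rule summable_comparison_test'[OF summable_mult[OF s(2), of "1 / lam 0"], of 0])
        (use dual_le lam_gt0 in \<open>simp add: less_imp_le\<close>)
    ultimately show "fin_en eps x \<and> snd x \<in> Hs lam (- 1)" ..
  next
    assume "fin_en eps x \<and> snd x \<in> Hs lam (- 1)"
    then have s: "summable (en eps x)" by (simp add: fin_en_def)
    have "summable (\<lambda>n. lam n * (fst x \<bullet> e n)\<^sup>2)"
      by (rule summable_comparison_test'[OF s, of 0])
        (use eps lam_gt0 in \<open>simp add: en_def mode_energy_def abs_mult less_imp_le\<close>)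
    moreover have "summable (\<lambda>n. (snd x n)\<^sup>2)"
      by (rule summable_comparison_test'[OF summable_mult[OF s, of "1 / eps"], of 0])
        (use eps lam_gt0 in \<open>simp add: en_def mode_energy_def add_divide_distrib less_imp_le\<close>)
    ultimately show "x \<in> energy_space e lam eps"
      using False by (auto simp: energy_space_mem Hs_iff coeff_def)
  qed
qed

lemma energy_spaceD:
  assumes "0 \<le> eps" "x \<in> energy_space e lam eps"
  shows "fin_en eps x" "snd x \<in> Hs lam (- 1)"
  using assms energy_space_iff by auto

lemma X_subset: "x \<in> X eps \<Longrightarrow> x \<in> energy_space e lam eps"
  by (auto simp: phase_space_mem)

lemma energy_space_diff:
  assumes "0 \<le> eps" "x \<in> energy_space e lam eps" "y \<in> energy_space e lam eps"
  shows "phase_diff x y \<in> energy_space e lam eps"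
proof -
  have "(\<lambda>n. 1 * snd x n - 1 * snd y n - 0) \<in> Hs lam (- 1)"
    using energy_spaceD(2)[OF assms(1)] assms(2,3) by (intro Hs_dual_combination) (auto simp: Hs_iff)
  moreover have "snd (phase_diff x y) = (\<lambda>n. 1 * snd x n - 1 * snd y n - 0)" by auto
  ultimately show ?thesis
    unfolding energy_space_iff[OF assms(1)]
    using fin_en_diff[OF assms(1) energy_spaceD(1)[OF assms(1,2)] energy_spaceD(1)[OF assms(1,3)]] by simp
qed

lemma energy_norm_sq:
  assumes "0 \<le> eps" "x \<in> energy_space e lam eps"
  shows "(energy_norm e lam eps x)\<^sup>2 = E eps x + dual_sq (snd x)"
proof -
  have d: "snd x \<in> Hs lam (- 1)" and c: "coeff e (fst x) \<in> Hs lam 1"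
    using energy_spaceD[OF assms] assms(2) by (auto simp: energy_space_mem)
  have nn: "0 \<le> eps * (Hs_norm lam 0 (snd x))\<^sup>2 + (Hs_norm lam (-1) (snd x))\<^sup>2
           + (Hs_norm lam 1 (coeff e (fst x)))\<^sup>2" using assms by simp
  have "eps * (Hs_norm lam 0 (snd x))\<^sup>2 + (Hs_norm lam 1 (coeff e (fst x)))\<^sup>2 = E eps x"
  proof (cases "eps = 0")
    case True
    then show ?thesis using Hs_norm_sq(2)[OF c] by (simp add: E_def en_def mode_energy_def coeff_def)
  next
    case False
    then have v: "snd x \<in> Hs lam 0" using assms(2) by (auto simp: energy_space_mem)
    show ?thesis unfolding Hs_norm_sq(1)[OF v] Hs_norm_sq(2)[OF c] E_def en_def mode_energy_def
      using v c unfolding Hs_iff coeff_def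
      by (simp add: suminf_add[symmetric] suminf_mult summable_mult)
  qed
  then show ?thesis unfolding energy_norm_def using nn Hs_norm_sq(3)[OF d] by simp
qed

lemma dual_sq_nonneg: "a \<in> Hs lam (- 1) \<Longrightarrow> 0 \<le> dual_sq a"
  using lam_gt0 unfolding dual_sq_def Hs_iff by (intro suminf_nonneg) (auto simp: less_imp_le)

lemma E_le_energy_norm_sq:
  assumes "0 \<le> eps" "x \<in> energy_space e lam eps" shows "E eps x \<le> (energy_norm e lam eps x)\<^sup>2"
  using energy_norm_sq[OF assms] dual_sq_nonneg energy_spaceD(2)[OF assms] by simp

lemma energy_dist_sq:
  assumes "0 \<le> eps" "x \<in> energy_space e lam eps" "y \<in> energy_space e lam eps"
  shows "(energy_dist e lam eps x y)\<^sup>2 = E eps (phase_diff x y) + dual_sq (\<lambda>n. snd x n - snd y n)"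
  using energy_norm_sq[OF assms(1) energy_space_diff[OF assms]] by (simp add: energy_dist_def phase_diff_def)

lemma energy_dist_nonneg: "0 \<le> eps \<Longrightarrow> 0 \<le> energy_dist e lam eps x y" "0 \<le> eps \<Longrightarrow> 0 \<le> energy_norm e lam eps x"
  by (simp_all add: energy_dist_def energy_norm_def)

lemma X_zero_residual: "x \<in> X 0 \<Longrightarrow> snd x n = F (fst x) \<bullet> e n - lam n * (fst x \<bullet> e n)"
  by (auto simp: phase_space_mem residual_def coeff_def fun_eq_iff algebra_simps dest: spec[of _ n])

text \<open>
  On the phase space the norm of \<open>H\<^sup>-\<^sup>1\<close> is dominated by the energy: trivially if \<open>eps > 0\<close>, and
  through \<open>v = F(u) - A u\<close> if \<open>eps = 0\<close>. The constant may depend on \<open>eps\<close>, and so may those of the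
  inertial manifold for fixed \<open>eps\<close>.
\<close>

lemma dual_sq_le:
  assumes "0 \<le> eps"
  obtains C where "0 < C" "\<And>x y. x \<in> X eps \<Longrightarrow> y \<in> X eps \<Longrightarrow>
    dual_sq (\<lambda>n. snd x n - snd y n) \<le> C * E eps (phase_diff x y)"
proof (cases "eps = 0")
  case False
  then have eps: "0 < eps" using assms by simp
  show ?thesis
  proof (rule that[of "1 / (eps * lam 0)"])
    show "0 < 1 / (eps * lam 0)" using eps lam_pos by simp
    fix x y assume "x \<in> X eps" "y \<in> X eps"
    then have D: "phase_diff x y \<in> energy_space e lam eps" by (intro energy_space_diff assms X_subset)
    note d = energy_spaceD[OF assms D]
    have "dual_sq (\<lambda>n. snd x n - snd y n) \<le> (\<Sum>n. 1 / (eps * lam 0) * en eps (phase_diff x y) n)"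
      unfolding dual_sq_def
    proof (rule suminf_le)
      show "(snd x n - snd y n)\<^sup>2 / lam n \<le> 1 / (eps * lam 0) * en eps (phase_diff x y) n" for n
      proof -
        have "eps * (snd x n - snd y n)\<^sup>2 \<le> en eps (phase_diff x y) n"
          using lam_gt0[of n] by (simp add: en_def mode_energy_def)
        then have "1 / (eps * lam 0) * (eps * (snd x n - snd y n)\<^sup>2) \<le> 1 / (eps * lam 0) * en eps (phase_diff x y) n"
          using eps lam_pos by (intro mult_left_mono) auto
        moreover have "1 / (eps * lam 0) * (eps * (snd x n - snd y n)\<^sup>2) = (snd x n - snd y n)\<^sup>2 / lam 0"
          using eps by simp
        ultimately show ?thesis using dual_le[of "snd x n - snd y n" n] by linarith
      qed
      show "summable (\<lambda>n. (snd x n - snd y n)\<^sup>2 / lam n)" using d(2) unfolding Hs_iff by simp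
      show "summable (\<lambda>n. 1 / (eps * lam 0) * en eps (phase_diff x y) n)"
        using d(1) unfolding fin_en_def by (rule summable_mult)
    qed
    then show "dual_sq (\<lambda>n. snd x n - snd y n) \<le> 1 / (eps * lam 0) * E eps (phase_diff x y)"
      by (simp only: suminf_mult[OF d(1)[unfolded fin_en_def]] E_def)
  qed
next
  case True
  define C where "C = 2 * L\<^sup>2 / (lam 0)\<^sup>2 + 2"
  show ?thesis
  proof (rule that[of C])
    show "0 < C" by (simp add: C_def add_nonneg_pos)
    fix x y assume x: "x \<in> X eps" and y: "y \<in> X eps"
    then have D: "phase_diff x y \<in> energy_space e lam eps" by (intro energy_space_diff assms X_subset)
    note d = energy_spaceD[OF assms D]
    define g where "g = F (fst x) - F (fst y)"
    have s: "(\<lambda>n. 2 / lam 0 * (g \<bullet> e n)\<^sup>2 + 2 * en eps (phase_diff x y) n)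
        sums (2 / lam 0 * (norm g)\<^sup>2 + 2 * E eps (phase_diff x y))"
      unfolding E_def using d(1) by (intro sums_add sums_mult parseval summable_sums) (simp add: fin_en_def)
    have "(snd x n - snd y n)\<^sup>2 / lam n \<le> 2 / lam 0 * (g \<bullet> e n)\<^sup>2 + 2 * en eps (phase_diff x y) n" for n
    proof -
      define z where "z = lam n * (fst x \<bullet> e n - fst y \<bullet> e n)"
      have v: "snd x n - snd y n = g \<bullet> e n - z"
        using X_zero_residual[of x n] X_zero_residual[of y n] x y True
        by (simp add: g_def z_def inner_diff_left algebra_simps)
      have "(g \<bullet> e n - z)\<^sup>2 \<le> 2 * (g \<bullet> e n)\<^sup>2 + 2 * z\<^sup>2" using sq_triangle[of "g \<bullet> e n" z 0] by simp
      then have "(g \<bullet> e n - z)\<^sup>2 / lam n \<le> (2 * (g \<bullet> e n)\<^sup>2 + 2 * z\<^sup>2) / lam n"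
        using lam_gt0[of n] by (intro divide_right_mono) auto
      also have "\<dots> = 2 * ((g \<bullet> e n)\<^sup>2 / lam n) + 2 * (z\<^sup>2 / lam n)" by (simp add: add_divide_distrib)
      also have "z\<^sup>2 / lam n = en eps (phase_diff x y) n"
        using lam_gt0[of n] True
        by (simp add: z_def en_def mode_energy_def inner_diff_left power2_eq_square)
      also have "2 * ((g \<bullet> e n)\<^sup>2 / lam n) \<le> 2 / lam 0 * (g \<bullet> e n)\<^sup>2"
        using dual_le[of "g \<bullet> e n" n] by simp
      finally show ?thesis unfolding v by simp
    qed
    then have "dual_sq (\<lambda>n. snd x n - snd y n) \<le> 2 / lam 0 * (norm g)\<^sup>2 + 2 * E eps (phase_diff x y)"
      unfolding dual_sq_def using d(2) unfolding Hs_iff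
      by (intro sums_le[OF _ summable_sums s]) simp_all
    also have "2 / lam 0 * (norm g)\<^sup>2 \<le> 2 * L\<^sup>2 / (lam 0)\<^sup>2 * E eps (phase_diff x y)"
    proof -
      have "(norm g)\<^sup>2 \<le> (L * norm (fst x - fst y))\<^sup>2" unfolding g_def by (intro power_mono F_diff) auto
      also have "\<dots> = L\<^sup>2 / lam 0 * (lam 0 * (norm (fst x - fst y))\<^sup>2)"
        using lam_pos by (simp add: power_mult_distrib)
      also have "\<dots> \<le> L\<^sup>2 / lam 0 * E eps (phase_diff x y)"
        using norm_sq_le_E[OF assms d(1)] lam_pos by (intro mult_left_mono) auto
      finally have "2 / lam 0 * (norm g)\<^sup>2 \<le> 2 / lam 0 * (L\<^sup>2 / lam 0 * E eps (phase_diff x y))"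
        using lam_pos by (intro mult_left_mono) auto
      then show ?thesis by (simp add: power2_eq_square)
    qed
    finally show "dual_sq (\<lambda>n. snd x n - snd y n) \<le> C * E eps (phase_diff x y)"
      by (simp add: C_def distrib_right)
  qed
qed

lemma energy_dist_le:
  assumes "0 \<le> eps"
  obtains C where "0 < C" "\<And>x y. x \<in> X eps \<Longrightarrow> y \<in> X eps \<Longrightarrow>
    (energy_dist e lam eps x y)\<^sup>2 \<le> C * E eps (phase_diff x y)"
proof -
  obtain C where C: "0 < C" "\<And>x y. x \<in> X eps \<Longrightarrow> y \<in> X eps \<Longrightarrow>
    dual_sq (\<lambda>n. snd x n - snd y n) \<le> C * E eps (phase_diff x y)" using dual_sq_le[OF assms] by blast
  show ?thesis
  proof (rule that[of "1 + C"])
    fix x y assume "x \<in> X eps" "y \<in> X eps"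
    then show "(energy_dist e lam eps x y)\<^sup>2 \<le> (1 + C) * E eps (phase_diff x y)"
      using energy_dist_sq[OF assms X_subset X_subset, of x y] C(2)[of x y] by (simp add: distrib_right)
  qed (use C in simp)
qed

lemma X_eqI:
  assumes "0 \<le> eps" "x \<in> X eps" "y \<in> X eps" "E eps (phase_diff x y) \<le> 0"
  shows "x = y"
proof -
  have D: "fin_en eps (phase_diff x y)"
    by (rule energy_spaceD(1)[OF assms(1) energy_space_diff[OF assms(1) X_subset[OF assms(2)] X_subset[OF assms(3)]]])
  have "lam 0 * (norm (fst x - fst y))\<^sup>2 \<le> 0" using norm_sq_le_E[OF assms(1) D] assms(4) by simp
  then have f: "fst x = fst y" using lam_pos by (simp add: mult_le_0_iff)
  have "snd x n = snd y n" for n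
  proof (cases "eps = 0")
    case True
    then show ?thesis using X_zero_residual[of x n] X_zero_residual[of y n] assms(2,3) f by simp
  next
    case False
    have "sum (en eps (phase_diff x y)) {n} \<le> E eps (phase_diff x y)" by (rule sum_en_le_E[OF assms(1) D]) simp
    then have "eps * (snd x n - snd y n)\<^sup>2 \<le> 0" using assms(4) f by (simp add: en_def mode_energy_def)
    then show ?thesis using False assms(1) by (simp add: mult_le_0_iff)
  qed
  then show ?thesis using f by (simp add: prod_eq_iff fun_eq_iff)
qed

lemma in_X_if:
  assumes "0 \<le> eps" and f: "fin_en eps x"
    and zero: "\<And>n. eps = 0 \<Longrightarrow> snd x n = F (fst x) \<bullet> e n - lam n * (fst x \<bullet> e n)"
  shows "x \<in> X eps"
proof -
  show ?thesis
  proof (cases "eps = 0")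
    case False
    then have "eps > 0" using assms by simp
    have "summable (\<lambda>n. (snd x n)\<^sup>2 / lam n)"
    proof (rule summable_comparison_test'[where N = 0])
      show "summable (\<lambda>n. 1 / (eps * lam 0) * en eps x n)" using f by (simp add: fin_en_def summable_mult)
      fix n
      have "(snd x n)\<^sup>2 / lam n \<le> (snd x n)\<^sup>2 / lam 0" by (rule dual_le)
      also have "\<dots> = 1 / (eps * lam 0) * (eps * (snd x n)\<^sup>2)" using \<open>eps > 0\<close> by simp
      also have "\<dots> \<le> 1 / (eps * lam 0) * en eps x n"
        using \<open>eps > 0\<close> lam_pos lam_gt0[of n] by (intro mult_left_mono) (auto simp: en_def mode_energy_def)
      finally show "norm ((snd x n)\<^sup>2 / lam n) \<le> 1 / (eps * lam 0) * en eps x n"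
        using lam_gt0[of n] by simp
    qed
    then have "x \<in> energy_space e lam eps" using f by (simp add: energy_space_iff[OF assms(1)] Hs_iff)
    then show ?thesis using False by (auto simp: phase_space_mem)
  next
    case True
    define g where "g = F (fst x)"
    have v: "snd x n = g \<bullet> e n - lam n * (fst x \<bullet> e n)" for n
      using zero[OF True] by (simp add: g_def)
    have "summable (\<lambda>n. (snd x n)\<^sup>2 / lam n)"
    proof (rule summable_comparison_test'[where N = 0])
      show "summable (\<lambda>n. 2 / lam 0 * (g \<bullet> e n)\<^sup>2 + 2 * en eps x n)"
        using f sums_summable[OF parseval[of g]] by (intro summable_add summable_mult) (simp_all add: fin_en_def)
      fix n
      define z where "z = lam n * (fst x \<bullet> e n)"
      have "(g \<bullet> e n - z)\<^sup>2 \<le> 2 * (g \<bullet> e n)\<^sup>2 + 2 * z\<^sup>2" using sq_triangle[of "g \<bullet> e n" z 0] by simp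
      then have "(g \<bullet> e n - z)\<^sup>2 / lam n \<le> (2 * (g \<bullet> e n)\<^sup>2 + 2 * z\<^sup>2) / lam n"
        using lam_gt0[of n] by (intro divide_right_mono) auto
      also have "\<dots> = 2 * ((g \<bullet> e n)\<^sup>2 / lam n) + 2 * (z\<^sup>2 / lam n)" by (simp add: add_divide_distrib)
      also have "z\<^sup>2 / lam n = en eps x n"
        using lam_gt0[of n] True by (simp add: z_def en_def mode_energy_def power2_eq_square)
      also have "2 * ((g \<bullet> e n)\<^sup>2 / lam n) \<le> 2 / lam 0 * (g \<bullet> e n)\<^sup>2"
        using dual_le[of "g \<bullet> e n" n] by simp
      finally show "norm ((snd x n)\<^sup>2 / lam n) \<le> 2 / lam 0 * (g \<bullet> e n)\<^sup>2 + 2 * en eps x n"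
        using lam_gt0[of n] by (simp add: v z_def)
    qed
    then have "x \<in> energy_space e lam eps" using f by (simp add: energy_space_iff[OF assms(1)] Hs_iff)
    moreover have "residual e lam F (fst x) (snd x) = (\<lambda>_. 0)"
      by (simp add: residual_def coeff_def v g_def fun_eq_iff)
    ultimately show ?thesis by (auto simp: phase_space_mem)
  qed
qed

lemma orbit_in_X:
  assumes "0 \<le> eps" "orbit_on eps I \<xi>" "t \<in> I"
  shows "\<xi> t \<in> X eps"
  using mode_eqD(3)[OF trajD(3)[OF assms(2)] assms(3)]
  by (intro in_X_if assms(1) trajD(2)[OF assms(2,3)]) simp

section \<open>Solutions and modewise orbits\<close>

lemma orbit_cong:
  assumes "orbit_on eps I \<xi>" "\<And>t. t \<in> I \<Longrightarrow> \<zeta> t = \<xi> t" shows "orbit_on eps I \<zeta>"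
  unfolding traj_def
proof (intro conjI ballI allI)
  show "continuous_on I (\<lambda>t. fst (\<zeta> t))"
    using trajD(1)[OF assms(1)] assms(2) by (simp cong: continuous_on_cong)
  show "fin_en eps (\<zeta> t)" if "t \<in> I" for t using trajD(2)[OF assms(1) that] assms(2)[OF that] by simp
  show "mode_eq eps (lam n) I (\<lambda>t. fst (\<zeta> t) \<bullet> e n) (\<lambda>t. snd (\<zeta> t) n) (\<lambda>t. F (fst (\<zeta> t)) \<bullet> e n)" for n
    by (rule mode_eq_cong[OF trajD(3)[OF assms(1)]]) (auto simp: assms(2))
qed

text \<open>
  Being an orbit is a local property. This allows to glue the orbits on bounded intervals together.
\<close>

lemma orbit_local:
  assumes "\<And>t. t \<in> I \<Longrightarrow> \<exists>J. open J \<and> t \<in> J \<and> orbit_on eps (I \<inter> J) \<xi>"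
  shows "orbit_on eps I \<xi>"
proof -
  have loc: "\<exists>J. at t within I = at t within (I \<inter> J) \<and> t \<in> I \<inter> J \<and> orbit_on eps (I \<inter> J) \<xi>" if t: "t \<in> I" for t
  proof -
    obtain J where J: "open J" "t \<in> J" "orbit_on eps (I \<inter> J) \<xi>" using assms[OF t] by blast
    have "at t within I = at t within (I \<inter> J)" by (rule at_within_nhd[OF J(2,1)]) auto
    then show ?thesis using J t by blast
  qed
  show ?thesis
    unfolding traj_def
  proof (intro conjI ballI allI)
    show "continuous_on I (\<lambda>t. fst (\<xi> t))"
      unfolding continuous_on_def
    proof
      fix t assume "t \<in> I"
      then obtain J where J: "at t within I = at t within (I \<inter> J)" "t \<in> I \<inter> J" "orbit_on eps (I \<inter> J) \<xi>"
        using loc by blast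
      then show "((\<lambda>t. fst (\<xi> t)) \<longlongrightarrow> fst (\<xi> t)) (at t within I)"
        using trajD(1)[OF J(3)] unfolding continuous_on_def J(1) by blast
    qed
    show "fin_en eps (\<xi> t)" if "t \<in> I" for t
      using loc[OF that] trajD(2) by blast
    show "mode_eq eps (lam n) I (\<lambda>t. fst (\<xi> t) \<bullet> e n) (\<lambda>t. snd (\<xi> t) n) (\<lambda>t. F (fst (\<xi> t)) \<bullet> e n)" for n
      unfolding mode_eq_def
    proof
      fix t assume "t \<in> I"
      then obtain J where J: "at t within I = at t within (I \<inter> J)" "t \<in> I \<inter> J" "orbit_on eps (I \<inter> J) \<xi>"
        using loc by blast
      note m = mode_eqD[OF trajD(3)[OF J(3), of n] J(2)]
      show "((\<lambda>t. fst (\<xi> t) \<bullet> e n) has_real_derivative snd (\<xi> t) n) (at t within I) \<and>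
         ((\<lambda>\<tau>. eps * snd (\<xi> \<tau>) n) has_real_derivative
          F (fst (\<xi> t)) \<bullet> e n - snd (\<xi> t) n - lam n * (fst (\<xi> t) \<bullet> e n)) (at t within I) \<and>
         (eps = 0 \<longrightarrow> F (fst (\<xi> t)) \<bullet> e n - snd (\<xi> t) n - lam n * (fst (\<xi> t) \<bullet> e n) = 0)"
        unfolding J(1) using m by simp
    qed
  qed
qed

lemma orbit_shift:
  assumes "orbit_on eps ((\<lambda>t. t + \<tau>) ` I) \<xi>" shows "orbit_on eps I (\<lambda>t. \<xi> (t + \<tau>))"
  unfolding traj_def
proof (intro conjI ballI allI)
  show "continuous_on I (\<lambda>t. fst (\<xi> (t + \<tau>)))"
    by (rule continuous_on_compose2[OF trajD(1)[OF assms], of I "\<lambda>t. t + \<tau>"]) (auto intro!: continuous_intros)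
  show "fin_en eps (\<xi> (t + \<tau>))" if "t \<in> I" for t using trajD(2)[OF assms] that by blast
  have d: "((\<lambda>t. t + \<tau>) has_real_derivative 1) (at t within I)" for t
    by (auto intro!: derivative_eq_intros)
  have ch: "((\<lambda>t. g (t + \<tau>)) has_real_derivative g') (at t within I)"
    if "(g has_real_derivative g') (at (t + \<tau>) within ((\<lambda>t. t + \<tau>) ` I))" for g g' t
    using DERIV_image_chain[OF that d] by (simp add: o_def)
  show "mode_eq eps (lam n) I (\<lambda>t. fst (\<xi> (t + \<tau>)) \<bullet> e n) (\<lambda>t. snd (\<xi> (t + \<tau>)) n) (\<lambda>t. F (fst (\<xi> (t + \<tau>))) \<bullet> e n)" for n
    unfolding mode_eq_def
  proof (intro ballI conjI impI)
    fix t assume "t \<in> I"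
    then have "t + \<tau> \<in> (\<lambda>t. t + \<tau>) ` I" by blast
    note m = mode_eqD[OF trajD(3)[OF assms, of n] this]
    show "((\<lambda>t. fst (\<xi> (t + \<tau>)) \<bullet> e n) has_real_derivative snd (\<xi> (t + \<tau>)) n) (at t within I)"
      by (rule ch[OF m(1)])
    show "((\<lambda>t. eps * snd (\<xi> (t + \<tau>)) n) has_real_derivative
       F (fst (\<xi> (t + \<tau>))) \<bullet> e n - snd (\<xi> (t + \<tau>)) n - lam n * (fst (\<xi> (t + \<tau>)) \<bullet> e n)) (at t within I)"
      by (rule ch[OF m(2)])
    show "F (fst (\<xi> (t + \<tau>))) \<bullet> e n - snd (\<xi> (t + \<tau>)) n - lam n * (fst (\<xi> (t + \<tau>)) \<bullet> e n) = 0" if "eps = 0"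
      using m(3)[OF that] by simp
  qed
qed

lemma orbit_force_continuous: "orbit_on eps I \<xi> \<Longrightarrow> continuous_on I (\<lambda>t. F (fst (\<xi> t)))"
  by (rule continuous_on_compose2[OF F_continuous[of UNIV] trajD(1)]) auto

lemma orbit_E_continuous_Icc:
  assumes eps: "0 \<le> eps" and ab: "a \<le> b" and \<xi>: "orbit_on eps {a..b} \<xi>" and t: "t \<in> {a..b}"
  shows "((\<lambda>\<tau>. E eps (phase_diff (\<xi> \<tau>) (\<xi> t))) \<longlongrightarrow> 0) (at t within {a..b})"
proof (rule tendstoI)
  fix r :: real assume r: "0 < r"
  have fin: "summable (\<lambda>n. mode_energy eps (lam n) (fst (\<xi> a) \<bullet> e n) (snd (\<xi> a) n))"
    using trajD(2)[OF \<xi>, of a] ab by (simp add: fin_en_def en_def[abs_def])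
  have "0 < r / 8" using r by simp
  then obtain m where m: "\<And>t M. t \<in> {a..b} \<Longrightarrow>
      (\<Sum>n\<in>{m..<M}. mode_energy eps (lam n) (fst (\<xi> t) \<bullet> e n) (snd (\<xi> t) n)) < r / 8"
    using energy_tail[OF eps ab orbit_force_continuous[OF \<xi>], where u = "\<lambda>n t. fst (\<xi> t) \<bullet> e n" and v = "\<lambda>n t. snd (\<xi> t) n",
        OF trajD(3)[OF \<xi>] fin] by blast
  define g where "g \<tau> = (\<Sum>n<m. en eps (phase_diff (\<xi> \<tau>) (\<xi> t)) n)" for \<tau>
  have gt: "g t = 0" by (simp add: g_def en_def mode_energy_def)
  have "continuous_on {a..b} (\<lambda>\<tau>. en eps (phase_diff (\<xi> \<tau>) (\<xi> t)) n)" for n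
  proof -
    have "continuous_on {a..b} (\<lambda>t. F (fst (\<xi> t)) \<bullet> e n)"
      by (intro continuous_intros orbit_force_continuous[OF \<xi>])
    moreover note trajD(3)[OF \<xi>, of n]
    ultimately have v: "continuous_on {a..b} (\<lambda>t. snd (\<xi> t) n)"
    proof (cases "eps = 0")
      case True
      have "continuous_on {a..b} (\<lambda>t. F (fst (\<xi> t)) \<bullet> e n - lam n * (fst (\<xi> t) \<bullet> e n))"
        by (intro continuous_intros orbit_force_continuous[OF \<xi>] trajD(1)[OF \<xi>])
      then show ?thesis
        by (rule continuous_on_eq) (use mode_eqD(3)[OF trajD(3)[OF \<xi>] _ True] in simp)
    next
      case False
      have "continuous_on {a..b} (\<lambda>t. eps * snd (\<xi> t) n)"
        by (rule DERIV_continuous_on) (rule mode_eqD(2)[OF trajD(3)[OF \<xi>]])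
      then have "continuous_on {a..b} (\<lambda>t. (1 / eps) * (eps * snd (\<xi> t) n))" by (rule continuous_on_mult_left)
      then show ?thesis using False by simp
    qed
    show ?thesis unfolding en_def mode_energy_def fst_phase_diff snd_phase_diff
      by (intro continuous_intros v trajD(1)[OF \<xi>])
  qed
  then have "continuous_on {a..b} g" unfolding g_def by (intro continuous_intros)
  then have "(g \<longlongrightarrow> 0) (at t within {a..b})" using t gt unfolding continuous_on_def by force
  then have "\<forall>\<^sub>F \<tau> in at t within {a..b}. g \<tau> < r / 4" using r by (intro order_tendstoD(2)) auto
  moreover have "\<forall>\<^sub>F \<tau> in at t within {a..b}. \<tau> \<in> {a..b}" by (simp add: eventually_at_filter)
  ultimately show "\<forall>\<^sub>F \<tau> in at t within {a..b}. dist (E eps (phase_diff (\<xi> \<tau>) (\<xi> t))) 0 < r"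
  proof eventually_elim
    fix \<tau> assume g: "g \<tau> < r / 4" and \<tau>: "\<tau> \<in> {a..b}"
    have f: "fin_en eps (phase_diff (\<xi> \<tau>) (\<xi> t))" by (intro fin_en_diff eps trajD(2)[OF \<xi>] \<tau> t)
    have "(\<Sum>n<M. en eps (phase_diff (\<xi> \<tau>) (\<xi> t)) n) \<le> 3 * r / 4" for M
    proof -
      have "(\<Sum>n<M. en eps (phase_diff (\<xi> \<tau>) (\<xi> t)) n) \<le> (\<Sum>n\<in>{..<m} \<union> {m..<M}. en eps (phase_diff (\<xi> \<tau>) (\<xi> t)) n)"
        by (intro sum_mono2 en_nonneg eps) auto
      also have "\<dots> = g \<tau> + (\<Sum>n\<in>{m..<M}. en eps (phase_diff (\<xi> \<tau>) (\<xi> t)) n)"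
        unfolding g_def by (intro sum.union_disjoint) auto
      also have "(\<Sum>n\<in>{m..<M}. en eps (phase_diff (\<xi> \<tau>) (\<xi> t)) n) \<le> (\<Sum>n\<in>{m..<M}. 2 * en eps (\<xi> \<tau>) n + 2 * en eps (\<xi> t) n)"
        using en_triangle[OF eps, of "\<xi> \<tau>" "\<xi> t" _ origin] by (intro sum_mono) simp
      also have "\<dots> = 2 * (\<Sum>n\<in>{m..<M}. en eps (\<xi> \<tau>) n) + 2 * (\<Sum>n\<in>{m..<M}. en eps (\<xi> t) n)"
        by (simp add: sum.distrib sum_distrib_left)
      finally show ?thesis using m[OF \<tau>, of M] m[OF t, of M] g unfolding en_def by linarith
    qed
    then have "E eps (phase_diff (\<xi> \<tau>) (\<xi> t)) \<le> 3 * r / 4"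
      unfolding E_def using f by (intro suminf_le_const) (auto simp: fin_en_def)
    then show "dist (E eps (phase_diff (\<xi> \<tau>) (\<xi> t))) 0 < r" using E_nonneg[OF eps f] r by simp
  qed
qed

lemma orbit_E_continuous:
  assumes eps: "0 \<le> eps" and \<xi>: "orbit_on eps {0..} \<xi>" and t: "0 \<le> t"
  shows "((\<lambda>\<tau>. E eps (phase_diff (\<xi> \<tau>) (\<xi> t))) \<longlongrightarrow> 0) (at t within {0..})"
proof -
  have "at t within {0..} = at t within {0..t + 1}"
    by (rule at_within_nhd[where S = "{..<t + 1}"]) auto
  then show ?thesis
    using orbit_E_continuous_Icc[OF eps _ traj_subset[OF \<xi>], of 0 "t + 1" t] t by simp
qed

text \<open>
  If all modes are differentiable and the derivatives form a continuous curve in \<open>H\<^sup>-\<^sup>1\<close>, then the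
  curve is differentiable in \<open>H\<^sup>-\<^sup>1\<close>. The mean value theorem is applied to the pairing of the curve
  with the error \<open>z\<close> of the difference quotient, so that one intermediate time serves all modes.
\<close>

lemma Hs_derivative_if_modes:
  assumes d: "\<And>n t. 0 \<le> t \<Longrightarrow> ((\<lambda>\<tau>. x \<tau> n) has_real_derivative y t n) (at t within {0..})"
    and H: "\<And>t. 0 \<le> t \<Longrightarrow> x t \<in> Hs lam (- 1)" "\<And>t. 0 \<le> t \<Longrightarrow> y t \<in> Hs lam (- 1)" and t: "0 \<le> t"
    and c: "((\<lambda>\<tau>. dual_sq (\<lambda>n. y \<tau> n - y t n)) \<longlongrightarrow> 0) (at t within {0..})"
  shows "has_Hs_derivative lam (- 1) x (y t) t"
  unfolding has_Hs_derivative_def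
proof (intro conjI allI impI H t tendstoI)
  fix r :: real assume r: "0 < r"
  define q where "q = (r / 2)\<^sup>2"
  have q: "0 < q" using r by (simp add: q_def)
  have "\<forall>\<^sub>F \<tau> in at t within {0..}. dual_sq (\<lambda>n. y \<tau> n - y t n) < q"
    using c q by (intro order_tendstoD(2)) auto
  then obtain \<rho> where \<rho>: "0 < \<rho>" "\<And>\<tau>. 0 \<le> \<tau> \<Longrightarrow> \<tau> \<noteq> t \<Longrightarrow> dist \<tau> t < \<rho> \<Longrightarrow> dual_sq (\<lambda>n. y \<tau> n - y t n) < q"
    unfolding eventually_at by auto
  have S: "dual_sq (\<lambda>n. y \<tau> n - y t n) \<le> q" if "0 \<le> \<tau>" "dist \<tau> t < \<rho>" for \<tau>
    using \<rho>(2)[of \<tau>] that q by (cases "\<tau> = t") (auto simp: dual_sq_def less_imp_le)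
  have "dist (Hs_norm lam (- 1) (\<lambda>n. (x \<tau> n - x t n) / (\<tau> - t) - y t n)) 0 < r"
    if \<tau>: "0 \<le> \<tau>" "\<tau> \<noteq> t" "dist \<tau> t < \<rho>" for \<tau>
  proof -
    define z where "z n = (x \<tau> n - x t n) / (\<tau> - t) - y t n" for n
    have zH: "z \<in> Hs lam (- 1)"
    proof -
      have z: "z = (\<lambda>n. 1 / (\<tau> - t) * x \<tau> n - 1 / (\<tau> - t) * x t n - y t n)"
        by (simp add: z_def fun_eq_iff diff_divide_distrib)
      show ?thesis unfolding z by (rule Hs_dual_combination[OF H(1)[OF \<tau>(1)] H(1)[OF t] H(2)[OF t]])
    qed
    have "(\<Sum>n<M. (z n)\<^sup>2 / lam n) \<le> q" for M
    proof -
      define \<phi> where "\<phi> s = (\<Sum>n<M. z n / lam n * (x s n - s * y t n))" for s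
      define a b where "a = min \<tau> t" and "b = max \<tau> t"
      have ab: "a < b" "0 \<le> a" using \<tau> t by (auto simp: a_def b_def)
      have \<phi>d: "(\<phi> has_real_derivative (\<Sum>n<M. z n / lam n * (y s n - y t n))) (at s within {0..})" if "0 \<le> s" for s
        unfolding \<phi>_def
        by (intro DERIV_sum DERIV_cmult DERIV_diff d that) (auto intro!: derivative_eq_intros)
      have "continuous_on {a..b} \<phi>"
        using DERIV_continuous_on[of "{0..}" \<phi>] \<phi>d continuous_on_subset[of "{0..}" \<phi> "{a..b}"] ab by fastforce
      moreover have "(\<phi> has_derivative (*) (\<Sum>n<M. z n / lam n * (y s n - y t n))) (at s)" if "a < s" "s < b" for s
      proof -
        have "at s within {0..} = at s within UNIV"
          by (rule at_within_nhd[where S = "{0<..}"]) (use that ab in auto)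
        then show ?thesis using \<phi>d[of s] that ab by (simp add: has_field_derivative_def)
      qed
      ultimately obtain s where s: "a < s" "s < b"
        "\<phi> b - \<phi> a = (\<Sum>n<M. z n / lam n * (y s n - y t n)) * (b - a)"
        using mvt[OF ab(1), of \<phi> "\<lambda>s. (*) (\<Sum>n<M. z n / lam n * (y s n - y t n))"] by blast
      have "\<phi> \<tau> - \<phi> t = (\<tau> - t) * (\<Sum>n<M. z n / lam n * (y s n - y t n))"
        using s(3) by (auto simp: a_def b_def min_def max_def algebra_simps split: if_splits)
      moreover have "\<phi> \<tau> - \<phi> t = (\<tau> - t) * (\<Sum>n<M. (z n)\<^sup>2 / lam n)"
      proof -
        have zz: "(\<tau> - t) * z n = (x \<tau> n - x t n) - (\<tau> - t) * y t n" for n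
        proof -
          have "(\<tau> - t) * ((x \<tau> n - x t n) / (\<tau> - t)) = x \<tau> n - x t n" using \<tau> by simp
          then show ?thesis by (simp only: z_def right_diff_distrib)
        qed
        have "\<phi> \<tau> - \<phi> t = (\<Sum>n<M. z n / lam n * ((\<tau> - t) * z n))"
          unfolding zz \<phi>_def sum_subtractf[symmetric]
          by (intro sum.cong refl) (simp add: algebra_simps)
        also have "\<dots> = (\<tau> - t) * (\<Sum>n<M. (z n)\<^sup>2 / lam n)"
          unfolding sum_distrib_left by (intro sum.cong) (simp_all add: power2_eq_square)
        finally show ?thesis .
      qed
      ultimately have eq: "(\<Sum>n<M. (z n)\<^sup>2 / lam n) = (\<Sum>n<M. z n / lam n * (y s n - y t n))" using \<tau> by simp
      have s0: "0 \<le> s" "dist s t < \<rho>" using s ab \<tau> by (auto simp: a_def b_def dist_real_def)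
      have sH: "summable (\<lambda>n. (y s n - y t n)\<^sup>2 / lam n)"
      proof -
        have "(\<lambda>n. 1 * y s n - 1 * y t n - 0) \<in> Hs lam (- 1)"
          by (rule Hs_dual_combination[OF H(2)[OF s0(1)] H(2)[OF t]]) (simp add: Hs_iff)
        then show ?thesis by (simp add: Hs_iff)
      qed
      have "(\<Sum>n<M. z n / lam n * (y s n - y t n)) \<le> (\<Sum>n<M. 1 / 2 * ((z n)\<^sup>2 / lam n) + 1 / 2 * ((y s n - y t n)\<^sup>2 / lam n))"
      proof (rule sum_mono)
        fix n
        have "0 \<le> (z n - (y s n - y t n))\<^sup>2 / (2 * lam n)" using lam_gt0[of n] by simp
        also have "\<dots> = 1 / 2 * ((z n)\<^sup>2 / lam n) + 1 / 2 * ((y s n - y t n)\<^sup>2 / lam n) - z n / lam n * (y s n - y t n)"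
          using lam_gt0[of n] by (simp add: field_simps power2_eq_square)
        finally show "z n / lam n * (y s n - y t n) \<le> 1 / 2 * ((z n)\<^sup>2 / lam n) + 1 / 2 * ((y s n - y t n)\<^sup>2 / lam n)" by simp
      qed
      also have "\<dots> = 1 / 2 * (\<Sum>n<M. (z n)\<^sup>2 / lam n) + 1 / 2 * (\<Sum>n<M. (y s n - y t n)\<^sup>2 / lam n)"
        by (simp only: sum.distrib sum_distrib_left)
      also have "(\<Sum>n<M. (y s n - y t n)\<^sup>2 / lam n) \<le> dual_sq (\<lambda>n. y s n - y t n)"
        unfolding dual_sq_def using lam_gt0 by (intro sum_le_suminf sH) (auto simp: less_imp_le)
      finally show ?thesis using eq S[OF s0] by linarith
    qed
    then have "dual_sq z \<le> q" unfolding dual_sq_def using zH by (intro suminf_le_const) (auto simp: Hs_iff)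
    then have "(Hs_norm lam (- 1) z)\<^sup>2 \<le> (r / 2)\<^sup>2" using Hs_norm_sq(3)[OF zH] by (simp add: q_def)
    then have "\<bar>Hs_norm lam (- 1) z\<bar> \<le> \<bar>r / 2\<bar>" by (simp only: abs_le_square_iff)
    then show ?thesis using r unfolding z_def by simp
  qed
  then show "\<forall>\<^sub>F \<tau> in at t within {0..}. dist (Hs_norm lam (- 1) (\<lambda>n. (x \<tau> n - x t n) / (\<tau> - t) - y t n)) 0 < r"
    unfolding eventually_at using \<rho>(1) by auto
qed

lemma modes_if_Hs_derivative:
  assumes "has_Hs_derivative lam (- 1) x x' t" "0 \<le> t"
  shows "((\<lambda>\<tau>. x \<tau> n) has_real_derivative x' n) (at t within {0..})"
proof -
  have H: "\<And>\<tau>. 0 \<le> \<tau> \<Longrightarrow> x \<tau> \<in> Hs lam (- 1)" "x' \<in> Hs lam (- 1)"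
    and lim: "((\<lambda>\<tau>. Hs_norm lam (- 1) (\<lambda>n. (x \<tau> n - x t n) / (\<tau> - t) - x' n)) \<longlongrightarrow> 0) (at t within {0..})"
    using assms(1) by (auto simp: has_Hs_derivative_def)
  have "((\<lambda>\<tau>. (x \<tau> n - x t n) / (\<tau> - t) - x' n) \<longlongrightarrow> 0) (at t within {0..})"
  proof (rule Lim_null_comparison)
    have "\<forall>\<^sub>F \<tau> in at t within {0..}. 0 \<le> \<tau>" by (simp add: eventually_at_filter)
    then show "\<forall>\<^sub>F \<tau> in at t within {0..}. norm ((x \<tau> n - x t n) / (\<tau> - t) - x' n) \<le>
        sqrt (lam n) * Hs_norm lam (- 1) (\<lambda>n. (x \<tau> n - x t n) / (\<tau> - t) - x' n)"
    proof eventually_elim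
      fix \<tau> :: real assume \<tau>: "0 \<le> \<tau>"
      define z where "z n = (x \<tau> n - x t n) / (\<tau> - t) - x' n" for n
      have z: "z = (\<lambda>n. 1 / (\<tau> - t) * x \<tau> n - 1 / (\<tau> - t) * x t n - x' n)"
        by (simp add: z_def fun_eq_iff diff_divide_distrib)
      have zH: "z \<in> Hs lam (- 1)"
        unfolding z by (rule Hs_dual_combination[OF H(1)[OF \<tau>] H(1)[OF assms(2)] H(2)])
      have "(\<Sum>n\<in>{n}. (z n)\<^sup>2 / lam n) \<le> dual_sq z"
        unfolding dual_sq_def using lam_gt0 zH by (intro sum_le_suminf) (auto simp: less_imp_le Hs_iff)
      then have "(z n)\<^sup>2 \<le> lam n * (Hs_norm lam (- 1) z)\<^sup>2"
        using Hs_norm_sq(3)[OF zH] lam_gt0[of n] by (simp add: field_simps)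
      then have "(z n)\<^sup>2 \<le> (sqrt (lam n) * Hs_norm lam (- 1) z)\<^sup>2"
        using lam_gt0[of n] by (simp add: power_mult_distrib less_imp_le)
      then have "\<bar>z n\<bar> \<le> \<bar>sqrt (lam n) * Hs_norm lam (- 1) z\<bar>" by (simp only: abs_le_square_iff)
      moreover have "0 \<le> sqrt (lam n) * Hs_norm lam (- 1) z"
        unfolding Hs_norm_def using zH lam_gt0 by (intro mult_nonneg_nonneg real_sqrt_ge_zero suminf_nonneg)
          (auto simp: Hs_def less_imp_le)
      ultimately show "norm ((x \<tau> n - x t n) / (\<tau> - t) - x' n) \<le>
        sqrt (lam n) * Hs_norm lam (- 1) (\<lambda>n. (x \<tau> n - x t n) / (\<tau> - t) - x' n)"
        unfolding z_def by simp
    qed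
    show "((\<lambda>\<tau>. sqrt (lam n) * Hs_norm lam (- 1) (\<lambda>n. (x \<tau> n - x t n) / (\<tau> - t) - x' n)) \<longlongrightarrow> 0) (at t within {0..})"
      by (rule tendsto_mult_right_zero[OF lim])
  qed
  then have "((\<lambda>\<tau>. (x \<tau> n - x t n) / (\<tau> - t)) \<longlongrightarrow> x' n) (at t within {0..})" by (simp add: LIM_zero_iff)
  then show ?thesis by (simp add: has_field_derivative_iff)
qed

end

context semilinear begin

text \<open>
  A derivative in \<open>H\<^sup>-\<^sup>1\<close> is in particular a derivative of every coefficient.
\<close>

lemma solution_imp_orbit:
  assumes eps: "0 \<le> eps" and sol: "solution e lam F eps \<xi>"
  shows "orbit_on eps {0..} \<xi>"
proof -
  have mem: "\<xi> t \<in> energy_space e lam eps" if "0 \<le> t" for t using sol that by (auto simp: solution_def)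
  have m1: "((\<lambda>\<tau>. fst (\<xi> \<tau>) \<bullet> e n) has_real_derivative snd (\<xi> t) n) (at t within {0..})" if t: "0 \<le> t" for t n
  proof -
    have "has_Hs_derivative lam (-1) (\<lambda>\<tau>. coeff e (fst (\<xi> \<tau>))) (snd (\<xi> t)) t"
      using sol t by (auto simp: solution_def)
    from modes_if_Hs_derivative[OF this t, of n] show ?thesis by (simp add: coeff_def)
  qed
  have m2: "((\<lambda>\<tau>. eps * snd (\<xi> \<tau>) n) has_real_derivative F (fst (\<xi> t)) \<bullet> e n - snd (\<xi> t) n - lam n * (fst (\<xi> t) \<bullet> e n))
      (at t within {0..})" if t: "0 \<le> t" for t n
  proof -
    have "has_Hs_derivative lam (-1) (\<lambda>\<tau> n. eps * snd (\<xi> \<tau>) n) (residual e lam F (fst (\<xi> t)) (snd (\<xi> t))) t"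
      using sol t by (auto simp: solution_def)
    from modes_if_Hs_derivative[OF this t, of n] show ?thesis by (simp add: residual_def coeff_def)
  qed
  show ?thesis unfolding traj_def
  proof (intro conjI ballI allI)
    show "fin_en eps (\<xi> t)" if "t \<in> {0..}" for t using energy_spaceD(1)[OF eps mem] that by simp
    show "mode_eq eps (lam n) {0..} (\<lambda>t. fst (\<xi> t) \<bullet> e n) (\<lambda>t. snd (\<xi> t) n) (\<lambda>t. F (fst (\<xi> t)) \<bullet> e n)" for n
      unfolding mode_eq_def
    proof (intro ballI conjI impI)
      fix t :: real assume t: "t \<in> {0..}"
      then have t0: "0 \<le> t" by simp
      show "((\<lambda>\<tau>. fst (\<xi> \<tau>) \<bullet> e n) has_real_derivative snd (\<xi> t) n) (at t within {0..})" by (rule m1[OF t0])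
      show "((\<lambda>\<tau>. eps * snd (\<xi> \<tau>) n) has_real_derivative F (fst (\<xi> t)) \<bullet> e n - snd (\<xi> t) n - lam n * (fst (\<xi> t) \<bullet> e n))
        (at t within {0..})" by (rule m2[OF t0])
      assume "eps = 0"
      then have "((\<lambda>\<tau>. 0) \<longlongrightarrow> F (fst (\<xi> t)) \<bullet> e n - snd (\<xi> t) n - lam n * (fst (\<xi> t) \<bullet> e n)) (at t within {0..})"
        using m2[OF t0, of n] by (simp add: has_field_derivative_iff)
      then have "((\<lambda>\<tau>. 0) \<longlongrightarrow> F (fst (\<xi> t)) \<bullet> e n - snd (\<xi> t) n - lam n * (fst (\<xi> t) \<bullet> e n)) (at_right t)"
        by (rule tendsto_mono[rotated]) (use t0 in \<open>auto intro!: at_le\<close>)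
      then show "F (fst (\<xi> t)) \<bullet> e n - snd (\<xi> t) n - lam n * (fst (\<xi> t) \<bullet> e n) = 0"
        using tendsto_unique[OF trivial_limit_at_right_real tendsto_const] by metis
    qed
    show "continuous_on {0..} (\<lambda>t. fst (\<xi> t))"
      unfolding continuous_on_def
    proof
      fix t :: real assume "t \<in> {0..}"
      then have t: "0 \<le> t" by simp
      have lim: "((\<lambda>\<tau>. energy_dist e lam eps (\<xi> \<tau>) (\<xi> t)) \<longlongrightarrow> 0) (at t within {0..})"
        using sol t by (auto simp: solution_def)
      have "((\<lambda>\<tau>. fst (\<xi> \<tau>) - fst (\<xi> t)) \<longlongrightarrow> 0) (at t within {0..})"
      proof (rule Lim_null_comparison)
        have "\<forall>\<^sub>F \<tau> in at t within {0..}. 0 \<le> \<tau>" by (simp add: eventually_at_filter)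
        then show "\<forall>\<^sub>F \<tau> in at t within {0..}. norm (fst (\<xi> \<tau>) - fst (\<xi> t)) \<le>
            1 / sqrt (lam 0) * energy_dist e lam eps (\<xi> \<tau>) (\<xi> t)"
        proof eventually_elim
          fix \<tau> :: real assume \<tau>: "0 \<le> \<tau>"
          note D = energy_space_diff[OF eps mem[OF \<tau>] mem[OF t]]
          have "lam 0 * (norm (fst (\<xi> \<tau>) - fst (\<xi> t)))\<^sup>2 \<le> (energy_dist e lam eps (\<xi> \<tau>) (\<xi> t))\<^sup>2"
            using norm_sq_le_E[OF eps energy_spaceD(1)[OF eps D]] E_le_energy_norm_sq[OF eps D]
            by (simp add: energy_dist_def)
          then have "(norm (fst (\<xi> \<tau>) - fst (\<xi> t)))\<^sup>2 \<le> (1 / sqrt (lam 0) * energy_dist e lam eps (\<xi> \<tau>) (\<xi> t))\<^sup>2"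
            using lam_pos by (simp add: power_mult_distrib power_divide field_simps)
          then show "norm (fst (\<xi> \<tau>) - fst (\<xi> t)) \<le> 1 / sqrt (lam 0) * energy_dist e lam eps (\<xi> \<tau>) (\<xi> t)"
            by (rule power2_le_imp_le) (use energy_dist_nonneg[OF eps] lam_pos in simp)
        qed
        show "((\<lambda>\<tau>. 1 / sqrt (lam 0) * energy_dist e lam eps (\<xi> \<tau>) (\<xi> t)) \<longlongrightarrow> 0) (at t within {0..})"
          by (rule tendsto_mult_right_zero[OF lim])
      qed
      then show "((\<lambda>t. fst (\<xi> t)) \<longlongrightarrow> fst (\<xi> t)) (at t within {0..})" by (simp add: LIM_zero_iff)
    qed
  qed
qed

text \<open>
  The energy is continuous along an orbit, by uniform smallness of the tails; hence \<open>u'\<close> and the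
  residual are continuous in \<open>H\<^sup>-\<^sup>1\<close>, and the modes may be differentiated together.
\<close>

lemma orbit_imp_solution:
  assumes eps: "0 \<le> eps" and \<xi>: "orbit_on eps {0..} \<xi>"
  shows "solution e lam F eps \<xi>"
proof -
  have X: "\<xi> t \<in> X eps" if "0 \<le> t" for t using orbit_in_X[OF eps \<xi>] that by simp
  note mem = X_subset[OF X]
  obtain C where C: "0 < C" "\<And>x y. x \<in> X eps \<Longrightarrow> y \<in> X eps \<Longrightarrow>
    (energy_dist e lam eps x y)\<^sup>2 \<le> C * E eps (phase_diff x y)" using energy_dist_le[OF eps] by blast
  have lim: "((\<lambda>\<tau>. (energy_dist e lam eps (\<xi> \<tau>) (\<xi> t))\<^sup>2) \<longlongrightarrow> 0) (at t within {0..})" if t: "0 \<le> t" for t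
  proof (rule Lim_null_comparison)
    have "\<forall>\<^sub>F \<tau> in at t within {0..}. 0 \<le> \<tau>" by (simp add: eventually_at_filter)
    then show "\<forall>\<^sub>F \<tau> in at t within {0..}. norm ((energy_dist e lam eps (\<xi> \<tau>) (\<xi> t))\<^sup>2) \<le> C * E eps (phase_diff (\<xi> \<tau>) (\<xi> t))"
      by eventually_elim (use C(2)[OF X X] t in simp)
    show "((\<lambda>\<tau>. C * E eps (phase_diff (\<xi> \<tau>) (\<xi> t))) \<longlongrightarrow> 0) (at t within {0..})"
      by (rule tendsto_mult_right_zero[OF orbit_E_continuous[OF eps \<xi> t]])
  qed
  have dual: "snd (\<xi> t) \<in> Hs lam (- 1)" if "0 \<le> t" for t by (rule energy_spaceD(2)[OF eps mem[OF that]])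
  have Edist: "E eps (phase_diff (\<xi> \<tau>) (\<xi> t)) \<le> (energy_dist e lam eps (\<xi> \<tau>) (\<xi> t))\<^sup>2"
    "dual_sq (\<lambda>n. snd (\<xi> \<tau>) n - snd (\<xi> t) n) \<le> (energy_dist e lam eps (\<xi> \<tau>) (\<xi> t))\<^sup>2"
    "0 \<le> dual_sq (\<lambda>n. snd (\<xi> \<tau>) n - snd (\<xi> t) n)"
    "(\<lambda>n. snd (\<xi> \<tau>) n - snd (\<xi> t) n) \<in> Hs lam (- 1)"
    "fin_en eps (phase_diff (\<xi> \<tau>) (\<xi> t))"
    if "0 \<le> \<tau>" "0 \<le> t" for \<tau> t
  proof -
    note D = energy_space_diff[OF eps mem[OF that(1)] mem[OF that(2)]]
    show H: "(\<lambda>n. snd (\<xi> \<tau>) n - snd (\<xi> t) n) \<in> Hs lam (- 1)"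
      using energy_spaceD(2)[OF eps D] by (simp add: phase_diff_def)
    show f: "fin_en eps (phase_diff (\<xi> \<tau>) (\<xi> t))" by (rule energy_spaceD(1)[OF eps D])
    show n: "0 \<le> dual_sq (\<lambda>n. snd (\<xi> \<tau>) n - snd (\<xi> t) n)" by (rule dual_sq_nonneg[OF H])
    show "E eps (phase_diff (\<xi> \<tau>) (\<xi> t)) \<le> (energy_dist e lam eps (\<xi> \<tau>) (\<xi> t))\<^sup>2"
      "dual_sq (\<lambda>n. snd (\<xi> \<tau>) n - snd (\<xi> t) n) \<le> (energy_dist e lam eps (\<xi> \<tau>) (\<xi> t))\<^sup>2"
      using energy_dist_sq[OF eps mem[OF that(1)] mem[OF that(2)]] n E_nonneg[OF eps f] by linarith+
  qed
  define R where "R t n = F (fst (\<xi> t)) \<bullet> e n - snd (\<xi> t) n - lam n * (fst (\<xi> t) \<bullet> e n)" for t n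
  have Rres: "residual e lam F (fst (\<xi> t)) (snd (\<xi> t)) = R t" for t
    by (simp add: residual_def coeff_def R_def fun_eq_iff)
  have R: "summable (\<lambda>n. (R \<tau> n - R t n)\<^sup>2 / lam n)"
     "dual_sq (\<lambda>n. R \<tau> n - R t n) \<le> (3 * L\<^sup>2 / (lam 0)\<^sup>2 + 6) * (energy_dist e lam eps (\<xi> \<tau>) (\<xi> t))\<^sup>2"
    if \<tau>: "0 \<le> \<tau>" "0 \<le> t" for \<tau> t
  proof -
    define g where "g = F (fst (\<xi> \<tau>)) - F (fst (\<xi> t))"
    let ?D = "phase_diff (\<xi> \<tau>) (\<xi> t)"
    note ed = Edist[OF \<tau>]
    have s: "(\<lambda>n. 3 / lam 0 * (g \<bullet> e n)\<^sup>2 + 3 * ((snd (\<xi> \<tau>) n - snd (\<xi> t) n)\<^sup>2 / lam n) + 3 * en eps ?D n)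
        sums (3 / lam 0 * (norm g)\<^sup>2 + 3 * dual_sq (\<lambda>n. snd (\<xi> \<tau>) n - snd (\<xi> t) n) + 3 * E eps ?D)"
      unfolding E_def dual_sq_def using ed(4,5) unfolding Hs_iff fin_en_def
      by (intro sums_add sums_mult parseval summable_sums)
    have le: "(R \<tau> n - R t n)\<^sup>2 / lam n \<le> 3 / lam 0 * (g \<bullet> e n)\<^sup>2 + 3 * ((snd (\<xi> \<tau>) n - snd (\<xi> t) n)\<^sup>2 / lam n) + 3 * en eps ?D n" for n
    proof -
      define z where "z = lam n * (fst (\<xi> \<tau>) \<bullet> e n - fst (\<xi> t) \<bullet> e n)"
      define v where "v = snd (\<xi> \<tau>) n - snd (\<xi> t) n"
      have "R \<tau> n - R t n = 1 * (g \<bullet> e n) - 1 * v - z"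
        by (simp add: R_def g_def z_def v_def inner_diff_left algebra_simps)
      then have "(R \<tau> n - R t n)\<^sup>2 \<le> 3 * (g \<bullet> e n)\<^sup>2 + 3 * v\<^sup>2 + 3 * z\<^sup>2"
        using sq_combination[of 1 "g \<bullet> e n" v z] by simp
      then have "(R \<tau> n - R t n)\<^sup>2 / lam n \<le> (3 * (g \<bullet> e n)\<^sup>2 + 3 * v\<^sup>2 + 3 * z\<^sup>2) / lam n"
        using lam_gt0[of n] by (intro divide_right_mono) auto
      also have "\<dots> = 3 * ((g \<bullet> e n)\<^sup>2 / lam n) + 3 * (v\<^sup>2 / lam n) + 3 * (z\<^sup>2 / lam n)"
        by (simp add: add_divide_distrib)
      also have "z\<^sup>2 / lam n = lam n * (fst (\<xi> \<tau>) \<bullet> e n - fst (\<xi> t) \<bullet> e n)\<^sup>2"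
        using lam_gt0[of n] by (simp add: z_def power2_eq_square)
      also have "3 * \<dots> \<le> 3 * en eps ?D n"
        using eps by (simp add: en_def mode_energy_def inner_diff_left)
      also have "3 * ((g \<bullet> e n)\<^sup>2 / lam n) \<le> 3 / lam 0 * (g \<bullet> e n)\<^sup>2"
        using dual_le[of "g \<bullet> e n" n] by simp
      finally show ?thesis by (simp add: v_def)
    qed
    show sm: "summable (\<lambda>n. (R \<tau> n - R t n)\<^sup>2 / lam n)"
      by (rule summable_comparison_test'[OF sums_summable[OF s], of 0])
        (use le lam_gt0 in \<open>simp add: less_imp_le\<close>)
    have "dual_sq (\<lambda>n. R \<tau> n - R t n) \<le> 3 / lam 0 * (norm g)\<^sup>2 + 3 * dual_sq (\<lambda>n. snd (\<xi> \<tau>) n - snd (\<xi> t) n) + 3 * E eps ?D"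
      unfolding dual_sq_def[of "\<lambda>n. R \<tau> n - R t n"] by (rule sums_le[OF le summable_sums[OF sm] s])
    also have "3 / lam 0 * (norm g)\<^sup>2 \<le> 3 * L\<^sup>2 / (lam 0)\<^sup>2 * E eps ?D"
    proof -
      have "(norm g)\<^sup>2 \<le> (L * norm (fst (\<xi> \<tau>) - fst (\<xi> t)))\<^sup>2" unfolding g_def by (intro power_mono F_diff) auto
      also have "\<dots> = L\<^sup>2 / lam 0 * (lam 0 * (norm (fst (\<xi> \<tau>) - fst (\<xi> t)))\<^sup>2)"
        using lam_pos by (simp add: power_mult_distrib)
      also have "\<dots> \<le> L\<^sup>2 / lam 0 * E eps ?D"
        using norm_sq_le_E[OF eps ed(5)] lam_pos by (intro mult_left_mono) auto
      finally have "3 / lam 0 * (norm g)\<^sup>2 \<le> 3 / lam 0 * (L\<^sup>2 / lam 0 * E eps ?D)"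
        using lam_pos by (intro mult_left_mono) auto
      then show ?thesis by (simp add: power2_eq_square)
    qed
    also have "3 * L\<^sup>2 / (lam 0)\<^sup>2 * E eps ?D \<le> 3 * L\<^sup>2 / (lam 0)\<^sup>2 * (energy_dist e lam eps (\<xi> \<tau>) (\<xi> t))\<^sup>2"
      using ed(1) by (intro mult_left_mono) auto
    finally show "dual_sq (\<lambda>n. R \<tau> n - R t n) \<le> (3 * L\<^sup>2 / (lam 0)\<^sup>2 + 6) * (energy_dist e lam eps (\<xi> \<tau>) (\<xi> t))\<^sup>2"
      using ed(1,2) unfolding distrib_right by linarith
  qed
  have RH: "R t \<in> Hs lam (- 1)" if t: "0 \<le> t" for t
  proof -
    define g where "g = F (fst (\<xi> t))"
    have "(\<lambda>n. lam n * (fst (\<xi> t) \<bullet> e n)) \<in> Hs lam (- 1)"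
    proof -
      have "summable (\<lambda>n. en eps (\<xi> t) n)" using energy_spaceD(1)[OF eps mem[OF t]] by (simp add: fin_en_def)
      moreover have "norm ((lam n * (fst (\<xi> t) \<bullet> e n))\<^sup>2 / lam n) \<le> en eps (\<xi> t) n" for n
      proof -
        have "(lam n * (fst (\<xi> t) \<bullet> e n))\<^sup>2 / lam n = lam n * (fst (\<xi> t) \<bullet> e n)\<^sup>2"
          using lam_gt0[of n] by (simp add: power2_eq_square)
        then show ?thesis using lam_gt0[of n] eps by (simp add: en_def mode_energy_def)
      qed
      ultimately show ?thesis unfolding Hs_iff by (rule summable_comparison_test'[where N = 0])
    qed
    from Hs_dual_combination[OF coeff_in_dual[of g] dual[OF t] this, of 1]
    show ?thesis by (simp add: R_def[abs_def] g_def coeff_def)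
  qed
  have sl: "((\<lambda>\<tau>. dual_sq (\<lambda>n. z \<tau> n - z t n)) \<longlongrightarrow> 0) (at t within {0..})"
    if t: "0 \<le> t" and z: "\<And>\<tau>. 0 \<le> \<tau> \<Longrightarrow> dual_sq (\<lambda>n. z \<tau> n - z t n) \<le> A * (energy_dist e lam eps (\<xi> \<tau>) (\<xi> t))\<^sup>2"
      and nn: "\<And>\<tau>. 0 \<le> \<tau> \<Longrightarrow> 0 \<le> dual_sq (\<lambda>n. z \<tau> n - z t n)" for z t A
  proof (rule Lim_null_comparison)
    have "\<forall>\<^sub>F \<tau> in at t within {0..}. 0 \<le> \<tau>" by (simp add: eventually_at_filter)
    then show "\<forall>\<^sub>F \<tau> in at t within {0..}. norm (dual_sq (\<lambda>n. z \<tau> n - z t n)) \<le> A * (energy_dist e lam eps (\<xi> \<tau>) (\<xi> t))\<^sup>2"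
      by eventually_elim (use z nn in simp)
    show "((\<lambda>\<tau>. A * (energy_dist e lam eps (\<xi> \<tau>) (\<xi> t))\<^sup>2) \<longlongrightarrow> 0) (at t within {0..})"
      by (rule tendsto_mult_right_zero[OF lim[OF t]])
  qed
  show ?thesis
    unfolding solution_def
  proof (intro conjI allI impI)
    fix t :: real assume t: "0 \<le> t"
    show "\<xi> t \<in> energy_space e lam eps" by (rule mem[OF t])
    have "((\<lambda>\<tau>. sqrt ((energy_dist e lam eps (\<xi> \<tau>) (\<xi> t))\<^sup>2)) \<longlongrightarrow> sqrt 0) (at t within {0..})"
      by (intro tendsto_intros lim t)
    then show "((\<lambda>\<tau>. energy_dist e lam eps (\<xi> \<tau>) (\<xi> t)) \<longlongrightarrow> 0) (at t within {0..})"
      using energy_dist_nonneg(1)[OF eps] by simp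
    show "has_Hs_derivative lam (-1) (\<lambda>\<tau>. coeff e (fst (\<xi> \<tau>))) (snd (\<xi> t)) t"
    proof (rule Hs_derivative_if_modes[where y = "\<lambda>\<tau>. snd (\<xi> \<tau>)"])
      show "((\<lambda>\<tau>. coeff e (fst (\<xi> \<tau>)) n) has_real_derivative snd (\<xi> t) n) (at t within {0..})" if "0 \<le> t" for n t
        using mode_eqD(1)[OF trajD(3)[OF \<xi>, of n]] that by (simp add: coeff_def)
      show "((\<lambda>\<tau>. dual_sq (\<lambda>n. snd (\<xi> \<tau>) n - snd (\<xi> t) n)) \<longlongrightarrow> 0) (at t within {0..})"
        by (rule sl[where A = 1]) (use Edist t in auto)
    qed (use t coeff_in_dual dual in auto)
    show "has_Hs_derivative lam (-1) (\<lambda>\<tau> n. eps * snd (\<xi> \<tau>) n) (residual e lam F (fst (\<xi> t)) (snd (\<xi> t))) t"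
      unfolding Rres
    proof (rule Hs_derivative_if_modes[where y = R])
      show "((\<lambda>\<tau>. eps * snd (\<xi> \<tau>) n) has_real_derivative R t n) (at t within {0..})" if "0 \<le> t" for n t
        using mode_eqD(2)[OF trajD(3)[OF \<xi>, of n]] that by (simp add: R_def)
      show "(\<lambda>n. eps * snd (\<xi> t) n) \<in> Hs lam (- 1)" if "0 \<le> t" for t
        using Hs_dual_combination[OF dual[OF that], of "\<lambda>n. 0" "\<lambda>n. 0" eps] by (simp add: Hs_iff)
      show "((\<lambda>\<tau>. dual_sq (\<lambda>n. R \<tau> n - R t n)) \<longlongrightarrow> 0) (at t within {0..})"
      proof (rule sl[OF t R(2)])
        show "0 \<le> dual_sq (\<lambda>n. R \<tau> n - R t n)" if "0 \<le> \<tau>" for \<tau>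
          by (rule dual_sq_nonneg) (use R(1)[OF that t] in \<open>simp add: Hs_iff\<close>)
      qed (use t in auto)
    qed (use t RH in auto)
  qed
qed

end

text \<open>
  The properties of the modewise orbits from which well-posedness follows: existence on bounded
  intervals and continuous dependence.
\<close>

locale semilinear_flow = semilinear e lam F L
  for e :: "nat \<Rightarrow> 'a::{real_inner,complete_space}" and lam F L +
  fixes eps :: real
  assumes eps: "0 \<le> eps"
    and local_exist: "x \<in> X eps \<Longrightarrow> 0 \<le> T \<Longrightarrow> \<exists>\<xi>. orbit_on eps {0..T} \<xi> \<and> \<xi> 0 = x"
    and dependence: "\<exists>C \<kappa>. 0 < C \<and> (\<forall>a b \<xi> \<zeta>. a \<le> b \<longrightarrow> orbit_on eps {a..b} \<xi> \<longrightarrow> orbit_on eps {a..b} \<zeta> \<longrightarrow>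
       E eps (phase_diff (\<xi> b) (\<zeta> b)) \<le> C * exp (\<kappa> * (b - a)) * E eps (phase_diff (\<xi> a) (\<zeta> a)))"
begin

lemma E_refl [simp]: "E eps (phase_diff x x) = 0"
  by (simp add: E_def en_def mode_energy_def)

lemma orbit_unique:
  assumes "a \<le> t" "orbit_on eps {a..t} \<xi>" "orbit_on eps {a..t} \<zeta>" "\<xi> a = \<zeta> a"
  shows "\<xi> t = \<zeta> t"
proof -
  obtain C \<kappa> where "E eps (phase_diff (\<xi> t) (\<zeta> t)) \<le> C * exp (\<kappa> * (t - a)) * E eps (phase_diff (\<xi> a) (\<zeta> a))"
    using dependence assms by blast
  then have "E eps (phase_diff (\<xi> t) (\<zeta> t)) \<le> 0" using assms(4) by simp
  then show ?thesis using assms by (intro X_eqI[OF eps] orbit_in_X[OF eps assms(2)] orbit_in_X[OF eps assms(3)]) auto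
qed

lemma global_exist:
  assumes "x \<in> X eps" obtains \<xi> where "orbit_on eps {0..} \<xi>" "\<xi> 0 = x"
proof -
  have "\<forall>j::nat. \<exists>\<xi>. orbit_on eps {0..real j} \<xi> \<and> \<xi> 0 = x" using local_exist[OF assms] by simp
  then obtain \<zeta> where "\<forall>j::nat. orbit_on eps {0..real j} (\<zeta> j) \<and> \<zeta> j 0 = x" by (elim choice[THEN exE])
  then have \<zeta>: "\<And>j::nat. orbit_on eps {0..real j} (\<zeta> j)" "\<And>j::nat. \<zeta> j 0 = x" by simp_all
  define \<xi> where "\<xi> t = \<zeta> (nat \<lceil>t\<rceil>) t" for t
  have eq: "\<xi> t = \<zeta> j t" if "t \<in> {0..real j}" for t j
  proof -
    define i where "i = nat \<lceil>t\<rceil>"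
    have i: "t \<le> real i" unfolding i_def by linarith
    have "\<zeta> i t = \<zeta> j t"
      by (rule orbit_unique[of 0]) (use that i \<zeta> in \<open>auto intro!: traj_subset[OF \<zeta>(1)]\<close>)
    then show ?thesis by (simp add: \<xi>_def i_def)
  qed
  have "orbit_on eps {0..} \<xi>"
  proof (rule orbit_local)
    fix t :: real assume "t \<in> {0..}"
    define j where "j = nat \<lceil>t\<rceil> + 1"
    have j: "t < real j" unfolding j_def by linarith
    have "orbit_on eps ({0..} \<inter> {..<real j}) (\<zeta> j)" by (rule traj_subset[OF \<zeta>(1)]) auto
    then have "orbit_on eps ({0..} \<inter> {..<real j}) \<xi>" by (rule orbit_cong) (auto intro!: eq)
    then show "\<exists>J. open J \<and> t \<in> J \<and> orbit_on eps ({0..} \<inter> J) \<xi>" using j by (intro exI[of _ "{..<real j}"]) auto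
  qed
  moreover have "\<xi> 0 = x" using eq[of 0 0] \<zeta>(2) by simp
  ultimately show ?thesis using that by blast
qed

abbreviation S :: "real \<Rightarrow> 'a \<times> (nat \<Rightarrow> real) \<Rightarrow> 'a \<times> (nat \<Rightarrow> real)" where
  "S \<equiv> semiflow e lam F eps"

text \<open>
  The description that defines \<open>semiflow\<close> is proper: solutions are orbits, and orbits are unique.
\<close>

lemma semiflow_eq:
  assumes "orbit_on eps {0..} \<xi>" "0 \<le> t" shows "S t (\<xi> 0) = \<xi> t"
  unfolding semiflow_def
proof (rule the_equality)
  show "\<exists>\<zeta>. solution e lam F eps \<zeta> \<and> \<zeta> 0 = \<xi> 0 \<and> \<zeta> t = \<xi> t"
    using orbit_imp_solution[OF eps assms(1)] by blast
next
  fix y assume "\<exists>\<zeta>. solution e lam F eps \<zeta> \<and> \<zeta> 0 = \<xi> 0 \<and> \<zeta> t = y"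
  then obtain \<zeta> where \<zeta>: "solution e lam F eps \<zeta>" "\<zeta> 0 = \<xi> 0" "\<zeta> t = y" by blast
  have "orbit_on eps {0..} \<zeta>" by (rule solution_imp_orbit[OF eps \<zeta>(1)])
  then have "\<zeta> t = \<xi> t"
    by (rule orbit_unique[OF assms(2) traj_subset traj_subset[OF assms(1)]]) (use \<zeta>(2) in auto)
  then show "y = \<xi> t" using \<zeta>(3) by simp
qed

lemma semiflow_orbit:
  assumes "x \<in> X eps" shows "orbit_on eps {0..} (\<lambda>t. S t x)" "S 0 x = x"
proof -
  obtain \<xi> where \<xi>: "orbit_on eps {0..} \<xi>" "\<xi> 0 = x" using global_exist[OF assms] by blast
  have eq: "S t x = \<xi> t" if "0 \<le> t" for t using semiflow_eq[OF \<xi>(1) that] \<xi>(2) by simp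
  show "orbit_on eps {0..} (\<lambda>t. S t x)" by (rule orbit_cong[OF \<xi>(1)]) (auto simp: eq)
  show "S 0 x = x" using eq[of 0] \<xi>(2) by simp
qed

lemma semiflow_in: "x \<in> X eps \<Longrightarrow> 0 \<le> t \<Longrightarrow> S t x \<in> X eps"
  using orbit_in_X[OF eps semiflow_orbit(1)] by simp

lemma semiflow_interval:
  assumes "orbit_on eps {a..b} \<xi>" "a \<le> b" shows "S (b - a) (\<xi> a) = \<xi> b"
proof -
  have x: "\<xi> a \<in> X eps" using orbit_in_X[OF eps assms(1)] assms(2) by simp
  have "(\<lambda>t. t + a) ` {0..b - a} = {a..b}" by simp
  then have h1: "orbit_on eps {0..b - a} (\<lambda>t. \<xi> (t + a))" using assms(1) by (intro orbit_shift) simp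
  have h2: "orbit_on eps {0..b - a} (\<lambda>t. S t (\<xi> a))" by (rule traj_subset[OF semiflow_orbit(1)[OF x]]) auto
  have "S (b - a) (\<xi> a) = \<xi> (b - a + a)"
    by (rule orbit_unique[OF _ h2 h1]) (use assms(2) semiflow_orbit(2)[OF x] in simp_all)
  then show ?thesis by simp
qed

lemma semiflow_add:
  assumes "x \<in> X eps" "0 \<le> s" "0 \<le> t" shows "S (s + t) x = S t (S s x)"
  using semiflow_interval[OF traj_subset[OF semiflow_orbit(1)[OF assms(1)]], of s "s + t"] assms by simp

lemma origin_in: "origin \<in> X eps"
  by (simp add: phase_space_mem energy_space_iff[OF eps] fin_en_def en_def[abs_def] mode_energy_def
      origin_def Hs_iff residual_def coeff_def F_zero)

lemma semiflow_origin:
  assumes "0 \<le> t" shows "S t origin = origin"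
proof -
  have "orbit_on eps {0..} (\<lambda>t. origin)"
    unfolding traj_def mode_eq_def
    using energy_spaceD(1)[OF eps X_subset[OF origin_in]] by (auto simp: origin_def F_zero)
  from semiflow_eq[OF this assms] show ?thesis .
qed

lemma semiflow_dependence:
  obtains C \<kappa> where "0 < C" "\<And>x y t. x \<in> X eps \<Longrightarrow> y \<in> X eps \<Longrightarrow> 0 \<le> t \<Longrightarrow>
    E eps (phase_diff (S t x) (S t y)) \<le> C * exp (\<kappa> * t) * E eps (phase_diff x y)"
proof -
  obtain C \<kappa> where C: "0 < C" "\<forall>a b \<xi> \<zeta>. a \<le> b \<longrightarrow> orbit_on eps {a..b} \<xi> \<longrightarrow> orbit_on eps {a..b} \<zeta> \<longrightarrow>
       E eps (phase_diff (\<xi> b) (\<zeta> b)) \<le> C * exp (\<kappa> * (b - a)) * E eps (phase_diff (\<xi> a) (\<zeta> a))"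
    using dependence by (elim exE conjE) (rule that)
  show ?thesis
  proof (rule that[OF C(1)])
    fix x y and t :: real assume x: "x \<in> X eps" and y: "y \<in> X eps" and t: "0 \<le> t"
    have "orbit_on eps {0..t} (\<lambda>t. S t x)" "orbit_on eps {0..t} (\<lambda>t. S t y)"
      by (rule traj_subset[OF semiflow_orbit(1)[OF x]] traj_subset[OF semiflow_orbit(1)[OF y]]; simp)+
    from C(2)[rule_format, OF t this] show "E eps (phase_diff (S t x) (S t y)) \<le> C * exp (\<kappa> * t) * E eps (phase_diff x y)"
      using semiflow_orbit(2)[OF x] semiflow_orbit(2)[OF y] by simp
  qed
qed

end

context cone_system begin

lemma dependence_if_no_slow_modes:
  assumes "N = 0" "eps \<in> Eps" "a \<le> b" "orbit_on eps {a..b} \<xi>" "orbit_on eps {a..b} \<zeta>"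
  shows "E eps (phase_diff (\<xi> b) (\<zeta> b)) \<le> K / d * exp (- 2 * slow_rate eps \<mu> * (b - a)) * E eps (phase_diff (\<xi> a) (\<zeta> a))"
proof -
  define \<theta> where "\<theta> = slow_rate eps \<mu>"
  define Ea Eb where "Ea = E eps (phase_diff (\<xi> a) (\<zeta> a))" and "Eb = E eps (phase_diff (\<xi> b) (\<zeta> b))"
  have f: "fin_en eps (phase_diff (\<xi> t) (\<zeta> t))" if "t \<in> {a..b}" for t
    by (intro fin_en_diff Eps_nonneg assms(2) trajD(2)[OF assms(4)] trajD(2)[OF assms(5)] that)
  have "d * Eb \<le> V eps (phase_diff (\<xi> b) (\<zeta> b))"
    using V_lower[OF assms(2) f[of b]] assms(1,3) by (simp add: Eb_def)
  then have "exp (2 * \<theta> * b) * (d * Eb) \<le> exp (2 * \<theta> * b) * V eps (phase_diff (\<xi> b) (\<zeta> b))"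
    by (intro mult_left_mono) auto
  also have "\<dots> \<le> exp (2 * \<theta> * a) * V eps (phase_diff (\<xi> a) (\<zeta> a))"
    using cone_monotone[OF assms(2-5), of \<theta> 0] pos by (simp add: \<theta>_def)
  also have "\<dots> \<le> exp (2 * \<theta> * a) * (K * Ea)"
    using V_abs_le[OF assms(2) f[of a]] assms(3) by (intro mult_left_mono) (auto simp: Ea_def)
  finally have "exp (2 * \<theta> * b) * (d * Eb) \<le> exp (2 * \<theta> * a) * (K * Ea)" .
  moreover have "exp (- 2 * \<theta> * (b - a)) * exp (2 * \<theta> * b) = exp (2 * \<theta> * a)"
    by (simp add: exp_add[symmetric] algebra_simps)
  ultimately have "exp (2 * \<theta> * b) * (d * Eb) \<le> exp (2 * \<theta> * b) * (exp (- 2 * \<theta> * (b - a)) * (K * Ea))"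
    by (simp add: mult_ac)
  then have "d * Eb \<le> exp (- 2 * \<theta> * (b - a)) * (K * Ea)" by simp
  then have "Eb \<le> K / d * exp (- 2 * \<theta> * (b - a)) * Ea" using pos by (simp add: field_simps)
  then show ?thesis by (simp add: Ea_def Eb_def \<theta>_def)
qed

text \<open>
  Without slow modes the boundary value problem is the initial value problem, and \<open>V\<close> is comparable
  to the energy. So \<open>nonlinear_bvp\<close> gives existence and the cone inequality gives continuous
  dependence.
\<close>

lemma flow_if_no_slow_modes:
  assumes N: "N = 0" and eps: "eps \<in> Eps" shows "semilinear_flow e lam F L eps"
proof
  show "0 \<le> eps" by (rule Eps_nonneg[OF eps])
  show "\<exists>\<xi>. orbit_on eps {0..T} \<xi> \<and> \<xi> 0 = x" if x: "x \<in> X eps" and T: "0 \<le> T" for x T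
  proof -
    obtain \<xi> where \<xi>: "orbit_on eps {0..T} \<xi>" "bc eps 0 T x (\<lambda>_. 0) \<xi>"
      using nonlinear_bvp[OF eps T energy_spaceD(1)[OF Eps_nonneg[OF eps] X_subset[OF x]]] by blast
    have b: "fst (\<xi> 0) \<bullet> e n = fst x \<bullet> e n" "0 < eps \<Longrightarrow> snd (\<xi> 0) n = snd x n" for n
      using \<xi>(2)[unfolded bc_def] N by simp_all
    have f: "fst (\<xi> 0) = fst x" by (rule eq_if_coeff_eq) (rule b(1))
    have "snd (\<xi> 0) n = snd x n" for n
    proof (cases "eps = 0")
      case True
      have "\<xi> 0 \<in> X eps" using orbit_in_X[OF Eps_nonneg[OF eps] \<xi>(1)] T by simp
      then show ?thesis using X_zero_residual[of "\<xi> 0" n] X_zero_residual[of x n] x True f by simp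
    next
      case False
      then show ?thesis using Eps_nonneg[OF eps] by (intro b(2)) simp
    qed
    then show ?thesis using f \<xi>(1) by (auto simp: prod_eq_iff fun_eq_iff)
  qed
  have "0 < K / d" using pos by simp
  then show "\<exists>C \<kappa>. 0 < C \<and> (\<forall>a b \<xi> \<zeta>. a \<le> b \<longrightarrow> orbit_on eps {a..b} \<xi> \<longrightarrow> orbit_on eps {a..b} \<zeta> \<longrightarrow>
       E eps (phase_diff (\<xi> b) (\<zeta> b)) \<le> C * exp (\<kappa> * (b - a)) * E eps (phase_diff (\<xi> a) (\<zeta> a)))"
    using dependence_if_no_slow_modes[OF N eps]
    by (intro exI[of _ "K / d"] exI[of _ "- 2 * slow_rate eps \<mu>"]) auto
qed

end

section \<open>Semiflows with an invariant cone field\<close>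

lemma exp_decay_tendsto:
  fixes q :: real assumes q: "0 < q" shows "(\<lambda>n. c * exp (- (q * real n))) \<longlonglongrightarrow> 0"
proof -
  have "(\<lambda>n. exp (- q) ^ n) \<longlonglongrightarrow> 0" using q by (intro LIMSEQ_power_zero) simp
  moreover have "exp (- q) ^ n = exp (- (q * real n))" for n
    by (simp add: exp_of_nat_mult[symmetric] mult.commute)
  ultimately have "(\<lambda>n. exp (- (q * real n))) \<longlonglongrightarrow> 0" by simp
  then show ?thesis by (rule tendsto_mult_right_zero)
qed

lemma le_if_exp_decay:
  fixes x y :: real
  assumes q: "0 < q" and le: "\<And>n::nat. M \<le> n \<Longrightarrow> x \<le> y + c * exp (- (q * real n))"
  shows "x \<le> y"
proof -
  have "(\<lambda>n. y + c * exp (- (q * real n))) \<longlonglongrightarrow> y + 0"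
    by (intro tendsto_add tendsto_const exp_decay_tendsto q)
  then have "(\<lambda>n. y + c * exp (- (q * real n))) \<longlonglongrightarrow> y" by simp
  then show ?thesis by (rule LIMSEQ_le_const) (use le in blast)
qed

lemma le_divide_factor:
  fixes d :: real
  assumes "0 < d" "d * E \<le> x * (K * Y)" shows "E \<le> K / d * x * Y"
  using assms by (simp add: field_simps)

lemma exp_cancel:
  fixes a b c z :: real
  assumes "a + b = c" shows "exp a * (exp b * z) = z * exp c"
  unfolding assms[symmetric] exp_add by (simp only: mult_ac)

text \<open>
  The construction of the manifold uses of the semiflow only what is listed here. \<open>Ed\<close> plays the
  role of a squared distance, which explains the factor \<open>2\<close> in the triangle inequality;
  \<open>Vd x y\<close> is the Lyapunov function of the difference, \<open>reach\<close> is the boundary value problem, and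
  \<open>V_comp\<close> compares \<open>Vd x y\<close> and \<open>Vd y orig\<close> when \<open>x\<close> is small against \<open>y\<close>.
\<close>

locale cone_semiflow =
  fixes X :: "'x set" and S :: "real \<Rightarrow> 'x \<Rightarrow> 'x" and Ed Vd :: "'x \<Rightarrow> 'x \<Rightarrow> real"
    and Pc :: "'x \<Rightarrow> nat \<Rightarrow> real" and orig :: 'x and N :: nat and \<theta> \<eta> d K :: real
  assumes S_in: "x \<in> X \<Longrightarrow> 0 \<le> t \<Longrightarrow> S t x \<in> X"
    and S_0: "x \<in> X \<Longrightarrow> S 0 x = x"
    and S_add: "x \<in> X \<Longrightarrow> 0 \<le> s \<Longrightarrow> 0 \<le> t \<Longrightarrow> S (s + t) x = S t (S s x)"
    and o_in: "orig \<in> X" and S_o: "0 \<le> t \<Longrightarrow> S t orig = orig"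
    and Ed_nonneg: "x \<in> X \<Longrightarrow> y \<in> X \<Longrightarrow> 0 \<le> Ed x y"
    and Ed_refl: "Ed x x = 0"
    and Ed_sym: "Ed x y = Ed y x"
    and Ed_triangle: "x \<in> X \<Longrightarrow> y \<in> X \<Longrightarrow> z \<in> X \<Longrightarrow> Ed x z \<le> 2 * Ed x y + 2 * Ed y z"
    and Ed_eq: "x \<in> X \<Longrightarrow> y \<in> X \<Longrightarrow> Ed x y \<le> 0 \<Longrightarrow> x = y"
    and complete: "(\<And>n. a n \<in> X) \<Longrightarrow> (\<And>r. 0 < r \<Longrightarrow> \<exists>M. \<forall>m\<ge>M. \<forall>n\<ge>m. Ed (a m) (a n) < r) \<Longrightarrow>
       \<exists>y\<in>X. (\<lambda>n::nat. Ed (a n) y) \<longlonglongrightarrow> 0"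
    and V_bound: "x \<in> X \<Longrightarrow> y \<in> X \<Longrightarrow> \<bar>Vd x y\<bar> \<le> K * Ed x y"
    and V_low: "x \<in> X \<Longrightarrow> y \<in> X \<Longrightarrow> d * Ed x y - K * (\<Sum>n<N. (Pc x n - Pc y n)\<^sup>2) \<le> Vd x y"
    and P_bound: "x \<in> X \<Longrightarrow> y \<in> X \<Longrightarrow> (\<Sum>n<N. (Pc x n - Pc y n)\<^sup>2) \<le> K * Ed x y"
    and V_comp: "x \<in> X \<Longrightarrow> y \<in> X \<Longrightarrow> Vd x y \<le> Vd y orig + d / 2 * Ed y orig + K * Ed x orig"
    and cone: "x \<in> X \<Longrightarrow> y \<in> X \<Longrightarrow> 0 \<le> t \<Longrightarrow> \<bar>\<theta>' - \<theta>\<bar> \<le> \<eta> \<Longrightarrow> \<bar>c\<bar> \<le> d \<Longrightarrow>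
       exp (2 * \<theta>' * t) * (Vd (S t x) (S t y) + c * Ed (S t x) (S t y)) \<le> Vd x y + c * Ed x y"
    and dependence: "0 \<le> t \<Longrightarrow> \<exists>C>0. \<forall>x\<in>X. \<forall>y\<in>X. Ed (S t x) (S t y) \<le> C * Ed x y"
    and reach: "0 \<le> t \<Longrightarrow> \<exists>x\<in>X. Vd x orig + d * Ed x orig \<le> 0 \<and> (\<forall>n<N. Pc (S t x) n = p n)"
    and pos: "0 < \<eta>" "0 < d" "0 < K" "\<eta> < \<theta>"
begin

text \<open>
  The orbits on the whole line that make up the manifold. Backwards in time the
  slow modes grow more slowly than \<open>exp (- \<theta> t)\<close> and the fast ones faster, so the bound selects the
  slow ones.
\<close>

definition ancient :: "(real \<Rightarrow> 'x) \<Rightarrow> bool" where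
  "ancient \<xi> \<longleftrightarrow> (\<forall>t. \<xi> t \<in> X) \<and> (\<forall>t s. 0 \<le> s \<longrightarrow> S s (\<xi> t) = \<xi> (t + s)) \<and>
     (\<exists>C. \<forall>t\<le>0. Ed (\<xi> t) orig \<le> C * exp (- (2 * \<theta> * t)))"

lemma ancientD: "ancient \<xi> \<Longrightarrow> \<xi> t \<in> X" "ancient \<xi> \<Longrightarrow> 0 \<le> s \<Longrightarrow> S s (\<xi> t) = \<xi> (t + s)"
  by (auto simp: ancient_def)

lemma ancient_o: "ancient (\<lambda>t. orig)"
  unfolding ancient_def using o_in S_o Ed_refl by (auto intro!: exI[of _ 0])

lemma ancient_shift:
  assumes \<xi>: "ancient \<xi>" and \<tau>: "0 \<le> \<tau>" shows "ancient (\<lambda>t. \<xi> (t - \<tau>))"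
proof -
  obtain C where C: "\<And>t. t \<le> 0 \<Longrightarrow> Ed (\<xi> t) orig \<le> C * exp (- (2 * \<theta> * t))" using \<xi> by (auto simp: ancient_def)
  have "Ed (\<xi> (t - \<tau>)) orig \<le> (C * exp (2 * \<theta> * \<tau>)) * exp (- (2 * \<theta> * t))" if "t \<le> 0" for t
  proof -
    have "exp (- (2 * \<theta> * (t - \<tau>))) = exp (2 * \<theta> * \<tau>) * exp (- (2 * \<theta> * t))"
      by (simp add: exp_add[symmetric] algebra_simps)
    then show ?thesis using C[of "t - \<tau>"] that \<tau> by (simp add: mult.assoc)
  qed
  moreover have "S s (\<xi> (t - \<tau>)) = \<xi> (t + s - \<tau>)" if "0 \<le> s" for s t
    using ancientD(2)[OF \<xi> that, of "t - \<tau>"] by (simp add: algebra_simps)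
  ultimately show ?thesis unfolding ancient_def using ancientD(1)[OF \<xi>] by blast
qed

lemma ancient_shift_forward:
  assumes \<xi>: "ancient \<xi>" and \<tau>: "0 \<le> \<tau>" shows "ancient (\<lambda>t. \<xi> (t + \<tau>))"
proof -
  obtain C where C: "\<And>t. t \<le> 0 \<Longrightarrow> Ed (\<xi> t) orig \<le> C * exp (- (2 * \<theta> * t))" using \<xi> by (auto simp: ancient_def)
  obtain B where B: "0 < B" "\<forall>x\<in>X. \<forall>y\<in>X. Ed (S \<tau> x) (S \<tau> y) \<le> B * Ed x y" using dependence[OF \<tau>] by blast
  have "Ed (\<xi> (t + \<tau>)) orig \<le> (B * C) * exp (- (2 * \<theta> * t))" if "t \<le> 0" for t
  proof -
    have "Ed (S \<tau> (\<xi> t)) (S \<tau> orig) \<le> B * Ed (\<xi> t) orig" using B(2) ancientD(1)[OF \<xi>] o_in by blast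
    also have "\<dots> \<le> B * (C * exp (- (2 * \<theta> * t)))" using B(1) C[OF that] by (intro mult_left_mono) auto
    finally show ?thesis using ancientD(2)[OF \<xi> \<tau>] S_o[OF \<tau>] by (simp add: mult.assoc)
  qed
  moreover have "S s (\<xi> (t + \<tau>)) = \<xi> (t + s + \<tau>)" if "0 \<le> s" for s t
    using ancientD(2)[OF \<xi> that, of "t + \<tau>"] by (simp add: algebra_simps)
  ultimately show ?thesis unfolding ancient_def using ancientD(1)[OF \<xi>] by blast
qed

lemma cone_negative_preserved:
  assumes "x \<in> X" "y \<in> X" "0 \<le> t" "Vd x y + d * Ed x y \<le> 0"
  shows "Vd (S t x) (S t y) + d * Ed (S t x) (S t y) \<le> 0"
proof -
  have "exp (2 * \<theta> * t) * (Vd (S t x) (S t y) + d * Ed (S t x) (S t y)) \<le> 0"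
    using cone[OF assms(1-3), of \<theta> d] pos assms(4) by simp
  then show ?thesis by (simp add: mult_le_0_iff not_le)
qed

text \<open>
  If the slow coordinates meet at time \<open>t\<close>, then \<open>V \<ge> d E\<close> at that time, and the monotonicity of
  \<open>exp (2 \<theta> s) (V - d E)\<close> carries this back to all earlier times.
\<close>

lemma cone_positive_preserved:
  assumes "x \<in> X" "y \<in> X" "0 \<le> s" "s \<le> t" and P: "\<And>n. n < N \<Longrightarrow> Pc (S t x) n = Pc (S t y) n"
  shows "d * Ed (S s x) (S s y) \<le> Vd (S s x) (S s y)"
proof -
  have X: "S s x \<in> X" "S s y \<in> X" "S t x \<in> X" "S t y \<in> X" using assms by (auto intro: S_in)
  have t: "S t x = S (t - s) (S s x)" "S t y = S (t - s) (S s y)"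
    using S_add[of x s "t - s"] S_add[of y s "t - s"] assms by simp_all
  have "d * Ed (S t x) (S t y) \<le> Vd (S t x) (S t y)" using V_low[OF X(3,4)] P by simp
  then have "0 \<le> exp (2 * \<theta> * (t - s)) * (Vd (S t x) (S t y) + (- d) * Ed (S t x) (S t y))" by simp
  also have "\<dots> \<le> Vd (S s x) (S s y) + (- d) * Ed (S s x) (S s y)"
    unfolding t using pos assms by (intro cone X) auto
  finally show ?thesis by simp
qed

text \<open>
  In the negative cone \<open>- V\<close> and the energy are comparable, and the rate \<open>\<theta> - \<eta>\<close> limits the
  backward growth.
\<close>

lemma growth_in_negative_cone:
  assumes "x \<in> X" "y \<in> X" "0 \<le> t" "Vd x y + d * Ed x y \<le> 0"
  shows "Ed x y \<le> K / d * exp (2 * (\<theta> - \<eta>) * t) * Ed (S t x) (S t y)"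
proof -
  have X: "S t x \<in> X" "S t y \<in> X" using assms by (auto intro: S_in)
  have "exp (2 * (\<theta> - \<eta>) * t) * Vd (S t x) (S t y) \<le> Vd x y"
    using cone[OF assms(1-3), of "\<theta> - \<eta>" 0] pos by simp
  moreover have "- (K * Ed (S t x) (S t y)) \<le> Vd (S t x) (S t y)" using V_bound[OF X] by linarith
  then have "exp (2 * (\<theta> - \<eta>) * t) * (- (K * Ed (S t x) (S t y))) \<le> exp (2 * (\<theta> - \<eta>) * t) * Vd (S t x) (S t y)"
    by (intro mult_left_mono) auto
  ultimately have "d * Ed x y \<le> exp (2 * (\<theta> - \<eta>) * t) * (K * Ed (S t x) (S t y))" using assms(4) by simp
  then show ?thesis using pos by (simp add: field_simps)
qed

lemma Lipschitz_in_negative_cone: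
  assumes "x \<in> X" "y \<in> X" "Vd x y + d * Ed x y \<le> 0"
  shows "Ed x y \<le> K / d * (\<Sum>n<N. (Pc x n - Pc y n)\<^sup>2)"
proof -
  have "0 \<le> d * Ed x y" using Ed_nonneg[OF assms(1,2)] pos by simp
  then have "d * Ed x y \<le> K * (\<Sum>n<N. (Pc x n - Pc y n)\<^sup>2)" using V_low[OF assms(1,2)] assms(3) by linarith
  then show ?thesis using pos by (simp add: field_simps)
qed

text \<open>
  In the positive cone \<open>V\<close> and the energy are comparable, and the rate \<open>\<theta> + \<eta>\<close> gives decay.
\<close>

lemma decay_if_P_meets:
  assumes "x \<in> X" "y \<in> X" "0 \<le> s" "s \<le> t" and P: "\<And>n. n < N \<Longrightarrow> Pc (S t x) n = Pc (S t y) n"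
  shows "Ed (S s x) (S s y) \<le> K / d * exp (- (2 * (\<theta> + \<eta>) * s)) * Ed x y"
proof -
  have "exp (2 * (\<theta> + \<eta>) * s) * (d * Ed (S s x) (S s y)) \<le> exp (2 * (\<theta> + \<eta>) * s) * Vd (S s x) (S s y)"
    by (intro mult_left_mono cone_positive_preserved[OF assms]) auto
  also have "\<dots> \<le> Vd x y" using cone[OF assms(1-3), of "\<theta> + \<eta>" 0] pos by simp
  also have "\<dots> \<le> K * Ed x y" using V_bound[OF assms(1,2)] by linarith
  finally have "exp (2 * (\<theta> + \<eta>) * s) * (d * Ed (S s x) (S s y)) \<le> K * Ed x y" .
  then have "exp (- (2 * (\<theta> + \<eta>) * s)) * (exp (2 * (\<theta> + \<eta>) * s) * (d * Ed (S s x) (S s y)))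
      \<le> exp (- (2 * (\<theta> + \<eta>) * s)) * (K * Ed x y)" by (intro mult_left_mono) auto
  moreover have "exp (- (2 * (\<theta> + \<eta>) * s)) * (exp (2 * (\<theta> + \<eta>) * s) * z) = z" for z
    using exp_cancel[of "- (2 * (\<theta> + \<eta>) * s)" "2 * (\<theta> + \<eta>) * s" 0 z] by simp
  ultimately have "d * Ed (S s x) (S s y) \<le> exp (- (2 * (\<theta> + \<eta>) * s)) * (K * Ed x y)" by (simp only:)
  then show ?thesis by (rule le_divide_factor[OF pos(2)])
qed

text \<open>
  With the rate \<open>\<theta> + \<eta>\<close> the weight beats the growth that \<open>ancient\<close> allows, so the boundary term
  at time \<open>-n\<close> disappears as \<open>n\<close> tends to infinity.
\<close>

lemma ancient_negative:
  assumes \<xi>: "ancient \<xi>" and \<zeta>: "ancient \<zeta>"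
  shows "Vd (\<xi> t) (\<zeta> t) + d * Ed (\<xi> t) (\<zeta> t) \<le> 0"
proof -
  obtain C1 where C1: "\<And>t. t \<le> 0 \<Longrightarrow> Ed (\<xi> t) orig \<le> C1 * exp (- (2 * \<theta> * t))" using \<xi> by (auto simp: ancient_def)
  obtain C2 where C2: "\<And>t. t \<le> 0 \<Longrightarrow> Ed (\<zeta> t) orig \<le> C2 * exp (- (2 * \<theta> * t))" using \<zeta> by (auto simp: ancient_def)
  define A where "A = Vd (\<xi> t) (\<zeta> t) + d * Ed (\<xi> t) (\<zeta> t)"
  note x = ancientD(1)[OF \<xi>] and z = ancientD(1)[OF \<zeta>]
  have le: "A * exp (2 * (\<theta> + \<eta>) * t) \<le> 0 + (K + d) * (2 * (C1 + C2)) * exp (- (2 * \<eta> * real n))"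
    if n: "nat \<lceil>\<bar>t\<bar>\<rceil> \<le> n" for n
  proof -
    have nt: "0 \<le> t + real n" using n by linarith
    have "exp (2 * (\<theta> + \<eta>) * (t + real n)) * A \<le> Vd (\<xi> (- real n)) (\<zeta> (- real n)) + d * Ed (\<xi> (- real n)) (\<zeta> (- real n))"
      using cone[OF x z nt, of "\<theta> + \<eta>" d "- real n" "- real n"] pos
        ancientD(2)[OF \<xi> nt, of "- real n"] ancientD(2)[OF \<zeta> nt, of "- real n"] by (simp add: A_def)
    also have "\<dots> \<le> (K + d) * Ed (\<xi> (- real n)) (\<zeta> (- real n))"
      using V_bound[OF x z, of "- real n" "- real n"] by (simp add: distrib_right)
    also have "\<dots> \<le> (K + d) * (2 * (C1 + C2) * exp (2 * \<theta> * real n))"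
    proof (intro mult_left_mono)
      have "Ed (\<xi> (- real n)) (\<zeta> (- real n)) \<le> 2 * Ed (\<xi> (- real n)) orig + 2 * Ed orig (\<zeta> (- real n))"
        by (intro Ed_triangle x z o_in)
      also have "\<dots> \<le> 2 * (C1 * exp (2 * \<theta> * real n)) + 2 * (C2 * exp (2 * \<theta> * real n))"
        using C1[of "- real n"] C2[of "- real n"] Ed_sym[of orig] by (intro add_mono mult_left_mono) auto
      finally show "Ed (\<xi> (- real n)) (\<zeta> (- real n)) \<le> 2 * (C1 + C2) * exp (2 * \<theta> * real n)"
        by (simp add: algebra_simps)
    qed (use pos in simp)
    finally have F1: "exp (- (2 * (\<theta> + \<eta>) * real n)) * (exp (2 * (\<theta> + \<eta>) * (t + real n)) * A) \<le>
        exp (- (2 * (\<theta> + \<eta>) * real n)) * ((K + d) * (2 * (C1 + C2) * exp (2 * \<theta> * real n)))"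
      by (intro mult_left_mono) auto
    have F2: "exp (- (2 * (\<theta> + \<eta>) * real n)) * (exp (2 * (\<theta> + \<eta>) * (t + real n)) * A) = A * exp (2 * (\<theta> + \<eta>) * t)"
      by (rule exp_cancel) (simp add: algebra_simps)
    have F3: "exp (- (2 * (\<theta> + \<eta>) * real n)) * ((K + d) * (2 * (C1 + C2) * exp (2 * \<theta> * real n)))
        = (K + d) * (2 * (C1 + C2)) * exp (- (2 * \<eta> * real n))"
    proof -
      have "exp (- (2 * (\<theta> + \<eta>) * real n)) * exp (2 * \<theta> * real n) = exp (- (2 * \<eta> * real n))"
        by (simp add: exp_add[symmetric] algebra_simps)
      then show ?thesis by (simp only: mult_ac)
    qed
    show ?thesis using F1 unfolding F2 F3 by (simp only: add_0)
  qed
  have "A * exp (2 * (\<theta> + \<eta>) * t) \<le> 0"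
    by (rule le_if_exp_decay[where M = "nat \<lceil>\<bar>t\<bar>\<rceil>" and q = "2 * \<eta>", OF _ le]) (use pos in simp_all)
  then show ?thesis by (simp add: A_def mult_le_0_iff not_le)
qed

lemma ancient_Lipschitz:
  assumes "ancient \<xi>" "ancient \<zeta>"
  shows "Ed (\<xi> t) (\<zeta> t) \<le> K / d * (\<Sum>n<N. (Pc (\<xi> t) n - Pc (\<zeta> t) n)\<^sup>2)"
  by (intro Lipschitz_in_negative_cone ancientD(1) assms ancient_negative)

lemma ancient_growth:
  assumes "ancient \<xi>" "ancient \<zeta>" "t \<le> 0"
  shows "Ed (\<xi> t) (\<zeta> t) \<le> K / d * exp (- (2 * (\<theta> - \<eta>) * t)) * Ed (\<xi> 0) (\<zeta> 0)"
  using growth_in_negative_cone[OF ancientD(1)[OF assms(1)] ancientD(1)[OF assms(2)] _ ancient_negative[OF assms(1,2)], of "- t" t]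
    ancientD(2)[OF assms(1), of "- t" t] ancientD(2)[OF assms(2), of "- t" t] assms(3) by simp

text \<open>
  Orbits on \<open>[-T, 0]\<close> that start in the negative cone and end with slow coordinates \<open>p\<close>. Two of them
  meet in \<open>P\<close> at time \<open>0\<close>, so their difference decays at the rate \<open>\<theta> + \<eta>\<close>, whereas both are
  at most of size \<open>exp ((\<theta> - \<eta>) T)\<close> at time \<open>-T\<close>: they form a Cauchy sequence on every bounded
  interval as \<open>T\<close> tends to infinity.
\<close>

theorem ancient_exists:
  obtains \<xi> where "ancient \<xi>" "\<And>n. n < N \<Longrightarrow> Pc (\<xi> 0) n = p n"
proof -
  have "\<forall>T::nat. \<exists>x. x \<in> X \<and> Vd x orig + d * Ed x orig \<le> 0 \<and> (\<forall>n<N. Pc (S (real T) x) n = p n)"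
    using reach[where p = p] by (meson of_nat_0_le_iff)
  then obtain x where x: "\<And>T::nat. x T \<in> X" "\<And>T. Vd (x T) orig + d * Ed (x T) orig \<le> 0"
    "\<And>T n. n < N \<Longrightarrow> Pc (S (real T) (x T)) n = p n" by metis
  define q where "q = (\<Sum>n<N. (p n - Pc orig n)\<^sup>2)"
  define c where "c = K / d"
  have c: "0 < c" using pos by (simp add: c_def)
  have q: "0 \<le> q" by (simp add: q_def sum_nonneg)
  define y where "y T t = S (t + real T) (x T)" for T :: nat and t :: real
  have yX: "y T t \<in> X" if "0 \<le> t + real T" for T t unfolding y_def by (intro S_in x that)
  have ySh: "S s (y T t) = y T (t + s)" if "0 \<le> t + real T" "0 \<le> s" for T t s
    using S_add[OF x(1) that, of T] by (simp add: y_def algebra_simps)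
  have yneg: "Vd (y T t) orig + d * Ed (y T t) orig \<le> 0" if "0 \<le> t + real T" for T t
    using cone_negative_preserved[OF x(1) o_in that x(2), of T] S_o[OF that] by (simp add: y_def)
  have yP: "Pc (y T 0) n = p n" if "n < N" for T n using x(3)[OF that] by (simp add: y_def)
  have yE: "Ed (y T t) orig \<le> c * c * q * exp (- (2 * (\<theta> - \<eta>) * t))" if "0 \<le> t + real T" "t \<le> 0" for T t
  proof -
    have "Ed (y T t) orig \<le> c * exp (2 * (\<theta> - \<eta>) * (- t)) * Ed (S (- t) (y T t)) (S (- t) orig)"
      unfolding c_def using that by (intro growth_in_negative_cone yX o_in yneg) auto
    also have "S (- t) (y T t) = y T 0" using ySh[OF that(1), of "- t"] that by simp
    also have "S (- t) orig = orig" using that by (intro S_o) simp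
    also have "Ed (y T 0) orig \<le> c * q"
      using Lipschitz_in_negative_cone[OF yX[of 0 T] o_in yneg[of 0 T]] yP by (simp add: c_def q_def)
    finally show ?thesis using c by (simp add: mult_ac mult_left_mono)
  qed
  have cauchy: "Ed (y T t) (y T' t) \<le> 4 * c * c * c * q * exp (- (2 * (\<theta> + \<eta>) * t)) * exp (- (4 * \<eta> * real T))"
    if T: "T \<le> T'" and t: "0 \<le> t + real T" "t \<le> 0" for T T' t
  proof -
    define z where "z = y T' (- real T)"
    have zX: "z \<in> X" using T unfolding z_def by (intro yX) simp
    have z0: "S (real T) z = y T' 0" unfolding z_def using T by (subst ySh) auto
    have zt: "S (t + real T) z = y T' t" unfolding z_def using T t by (subst ySh) (auto simp: algebra_simps)
    have x0: "S (real T) (x T) = y T 0" by (simp add: y_def)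
    have "Ed (S (t + real T) (x T)) (S (t + real T) z) \<le> c * exp (- (2 * (\<theta> + \<eta>) * (t + real T))) * Ed (x T) z"
      unfolding c_def using t z0 x0 yP by (intro decay_if_P_meets[of _ _ _ "real T"] x zX) auto
    also have "Ed (x T) z \<le> 2 * Ed (x T) orig + 2 * Ed orig z" by (intro Ed_triangle x zX o_in)
    also have "\<dots> \<le> 4 * (c * c * q * exp (2 * (\<theta> - \<eta>) * real T))"
    proof -
      have "x T = y T (- real T)" using S_0[OF x(1)] by (simp add: y_def)
      then have "Ed (x T) orig \<le> c * c * q * exp (2 * (\<theta> - \<eta>) * real T)" using yE[where T = T and t = "- real T"] by simp
      moreover have "Ed orig z \<le> c * c * q * exp (2 * (\<theta> - \<eta>) * real T)"
        using yE[where T = T' and t = "- real T"] T Ed_sym[of orig z] by (simp add: z_def)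
      ultimately show ?thesis by simp
    qed
    finally have "Ed (y T t) (y T' t) \<le> c * exp (- (2 * (\<theta> + \<eta>) * (t + real T))) * (4 * (c * c * q * exp (2 * (\<theta> - \<eta>) * real T)))"
      using c zt by (simp add: y_def mult_left_mono)
    also have "\<dots> = 4 * c * c * c * q * (exp (- (2 * (\<theta> + \<eta>) * (t + real T))) * exp (2 * (\<theta> - \<eta>) * real T))"
      by (simp only: mult_ac)
    also have "exp (- (2 * (\<theta> + \<eta>) * (t + real T))) * exp (2 * (\<theta> - \<eta>) * real T)
        = exp (- (2 * (\<theta> + \<eta>) * t)) * exp (- (4 * \<eta> * real T))"
      by (simp add: exp_add[symmetric] algebra_simps)
    finally show ?thesis by (simp only: mult.assoc)
  qed
  have "\<exists>w\<in>X. (\<lambda>T. Ed (y (T + j) (- real j)) w) \<longlonglongrightarrow> 0" for j :: nat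
  proof (rule complete)
    show "y (T + j) (- real j) \<in> X" for T by (intro yX) simp
    fix r :: real assume r: "0 < r"
    define B where "B = 4 * c * c * c * q * exp (- (2 * (\<theta> + \<eta>) * (- real j)))"
    have B: "0 \<le> B" using c q by (simp add: B_def)
    have "(\<lambda>n. B * exp (- (4 * \<eta> * real n))) \<longlonglongrightarrow> 0" using pos by (intro exp_decay_tendsto) simp
    then have "\<forall>\<^sub>F n in sequentially. B * exp (- (4 * \<eta> * real n)) < r" using r by (intro order_tendstoD(2)) auto
    then obtain M where M: "\<And>n. n \<ge> M \<Longrightarrow> B * exp (- (4 * \<eta> * real n)) < r" by (auto simp: eventually_sequentially)
    have "Ed (y (m + j) (- real j)) (y (n + j) (- real j)) < r" if "M \<le> m" "m \<le> n" for m n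
      using cauchy[of "m + j" "n + j" "- real j"] M[of "m + j"] that by (simp add: B_def)
    then show "\<exists>M. \<forall>m\<ge>M. \<forall>n\<ge>m. Ed (y (m + j) (- real j)) (y (n + j) (- real j)) < r" by blast
  qed
  then obtain w where w: "\<And>j. w j \<in> X" "\<And>j. (\<lambda>T. Ed (y (T + j) (- real j)) (w j)) \<longlonglongrightarrow> 0" by metis
  have wlim: "(\<lambda>T. Ed (y T t) (S (t + real j) (w j))) \<longlonglongrightarrow> 0" if t: "- real j \<le> t" for t j
  proof -
    obtain B where B: "0 < B" "\<forall>x\<in>X. \<forall>y\<in>X. Ed (S (t + real j) x) (S (t + real j) y) \<le> B * Ed x y"
      using dependence[of "t + real j"] t by auto
    have "(\<lambda>T. Ed (y (T + j) t) (S (t + real j) (w j))) \<longlonglongrightarrow> 0"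
    proof (rule Lim_null_comparison)
      show "\<forall>\<^sub>F T in sequentially. norm (Ed (y (T + j) t) (S (t + real j) (w j))) \<le> B * Ed (y (T + j) (- real j)) (w j)"
      proof (intro always_eventually allI)
        fix T
        have yX': "y (T + j) (- real j) \<in> X" by (intro yX) simp
        have e: "S (t + real j) (y (T + j) (- real j)) = y (T + j) t" using t by (subst ySh) auto
        have "Ed (S (t + real j) (y (T + j) (- real j))) (S (t + real j) (w j)) \<le> B * Ed (y (T + j) (- real j)) (w j)"
          using B(2) yX' w(1) by blast
        moreover have "0 \<le> Ed (y (T + j) t) (S (t + real j) (w j))" using t w(1) by (intro Ed_nonneg yX S_in) auto
        ultimately show "norm (Ed (y (T + j) t) (S (t + real j) (w j))) \<le> B * Ed (y (T + j) (- real j)) (w j)"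
          unfolding e by simp
      qed
      show "(\<lambda>T. B * Ed (y (T + j) (- real j)) (w j)) \<longlonglongrightarrow> 0" by (rule tendsto_mult_right_zero[OF w(2)])
    qed
    then show ?thesis by (rule LIMSEQ_offset)
  qed
  have indep: "S (t + real i) (w i) = S (t + real j) (w j)" if t: "- real i \<le> t" "- real j \<le> t" for t i j
  proof (rule Ed_eq)
    show X: "S (t + real i) (w i) \<in> X" "S (t + real j) (w j) \<in> X" using t w(1) by (auto intro: S_in)
    have "(\<lambda>T. 2 * Ed (y T t) (S (t + real i) (w i)) + 2 * Ed (y T t) (S (t + real j) (w j))) \<longlonglongrightarrow> 2 * 0 + 2 * 0"
      by (intro tendsto_intros wlim t)
    then have "(\<lambda>T. 2 * Ed (y T t) (S (t + real i) (w i)) + 2 * Ed (y T t) (S (t + real j) (w j))) \<longlonglongrightarrow> 0" by simp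
    then show "Ed (S (t + real i) (w i)) (S (t + real j) (w j)) \<le> 0"
    proof (rule LIMSEQ_le_const)
      have "Ed (S (t + real i) (w i)) (S (t + real j) (w j)) \<le> 2 * Ed (y T t) (S (t + real i) (w i)) + 2 * Ed (y T t) (S (t + real j) (w j))"
        if "T \<ge> i" for T
        using Ed_triangle[OF X(1) yX[of t T] X(2)] Ed_sym[of "S (t + real i) (w i)" "y T t"] t that by simp
      then show "\<exists>M. \<forall>T\<ge>M. Ed (S (t + real i) (w i)) (S (t + real j) (w j)) \<le> 2 * Ed (y T t) (S (t + real i) (w i)) + 2 * Ed (y T t) (S (t + real j) (w j))"
        by blast
    qed
  qed
  (* The limit w j at time -j is followed forwards; by indep any j with -j \<le> t may be used. *)
  define \<xi> where "\<xi> t = S (t + real (nat \<lceil>\<bar>t\<bar>\<rceil>)) (w (nat \<lceil>\<bar>t\<bar>\<rceil>))" for t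
  have \<xi>: "\<xi> t = S (t + real j) (w j)" if "- real j \<le> t" for t j
    unfolding \<xi>_def by (rule indep) (use that in linarith)+
  have "ancient \<xi>"
    unfolding ancient_def
  proof (intro conjI allI impI)
    show "\<xi> t \<in> X" for t unfolding \<xi>_def by (intro S_in w) linarith
    show "S s (\<xi> t) = \<xi> (t + s)" if "0 \<le> s" for s t
    proof -
      define j where "j = nat \<lceil>\<bar>t\<bar>\<rceil>"
      have j: "- real j \<le> t" unfolding j_def by linarith
      then show ?thesis using \<xi>[OF j] \<xi>[of j "t + s"] that S_add[OF w(1)[of j], of "t + real j" s] by (simp add: algebra_simps)
    qed
    have "Ed (\<xi> t) orig \<le> 2 * (c * c * q) * exp (- (2 * \<theta> * t))" if t: "t \<le> 0" for t
    proof -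
      define j where "j = nat \<lceil>\<bar>t\<bar>\<rceil>"
      have j: "- real j \<le> t" unfolding j_def by linarith
      have X: "\<xi> t \<in> X" unfolding \<xi>[OF j] using j w(1) by (intro S_in) auto
      have "(\<lambda>T. 2 * Ed (y T t) (\<xi> t) + 2 * (c * c * q * exp (- (2 * (\<theta> - \<eta>) * t)))) \<longlonglongrightarrow> 2 * 0 + 2 * (c * c * q * exp (- (2 * (\<theta> - \<eta>) * t)))"
        unfolding \<xi>[OF j] by (intro tendsto_intros wlim j)
      moreover have "Ed (\<xi> t) orig \<le> 2 * Ed (y T t) (\<xi> t) + 2 * (c * c * q * exp (- (2 * (\<theta> - \<eta>) * t)))" if "T \<ge> j" for T
        using Ed_triangle[OF X yX[of t T] o_in] Ed_sym[of "\<xi> t" "y T t"] yE[of t T] that j t by simp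
      ultimately have "Ed (\<xi> t) orig \<le> 2 * 0 + 2 * (c * c * q * exp (- (2 * (\<theta> - \<eta>) * t)))"
        by (intro LIMSEQ_le_const) auto
      also have "\<dots> \<le> 2 * (c * c * q) * exp (- (2 * \<theta> * t))"
      proof -
        have "\<eta> * t \<le> 0" using pos t by (simp add: mult_nonneg_nonpos)
        then have "exp (- (2 * (\<theta> - \<eta>) * t)) \<le> exp (- (2 * \<theta> * t))" by (simp add: algebra_simps)
        then show ?thesis using c q by (simp add: mult_left_mono mult.assoc)
      qed
      finally show ?thesis .
    qed
    then show "\<exists>C. \<forall>t\<le>0. Ed (\<xi> t) orig \<le> C * exp (- (2 * \<theta> * t))" by blast
  qed
  moreover have "Pc (\<xi> 0) n = p n" if n: "n < N" for n
  proof -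
    have x0: "\<xi> 0 \<in> X" unfolding \<xi>_def by (intro S_in w) linarith
    have "(\<lambda>T. K * Ed (y T 0) (\<xi> 0)) \<longlonglongrightarrow> 0"
      using wlim[of 0 0] \<xi>[of 0 0] by (intro tendsto_mult_right_zero) simp
    moreover have "(p n - Pc (\<xi> 0) n)\<^sup>2 \<le> K * Ed (y T 0) (\<xi> 0)" for T
    proof -
      have "(Pc (y T 0) n - Pc (\<xi> 0) n)\<^sup>2 \<le> (\<Sum>n<N. (Pc (y T 0) n - Pc (\<xi> 0) n)\<^sup>2)"
        using n by (intro member_le_sum) auto
      then show ?thesis using P_bound[OF yX[of 0 T] x0] yP[OF n] by simp
    qed
    ultimately have "(p n - Pc (\<xi> 0) n)\<^sup>2 \<le> 0" by (intro LIMSEQ_le_const) auto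
    then show ?thesis by simp
  qed
  ultimately show ?thesis using that by blast
qed

text \<open>
  For every \<open>T\<close> an orbit in the manifold is chosen that has the slow coordinates of the given orbit
  at time \<open>T\<close>. Up to time \<open>T\<close> the difference decays at the rate \<open>\<theta> + \<eta>\<close>. At the
  smaller of two times \<open>T\<close> the corresponding orbits therefore differ by \<open>exp (- 2 (\<theta> + \<eta>) T)\<close> in
  energy. As their difference is in the negative cone, going back to time \<open>0\<close> costs only the factor
  \<open>exp (2 (\<theta> - \<eta>) T)\<close>, and a Cauchy sequence results. The limit tracks for all times. That the
  distance at time \<open>0\<close> is bounded by the energy of the given point, not merely by a constant, is
  obtained from \<open>V_comp\<close>.
\<close>

theorem exponential_tracking:
  obtains C where "0 < C" "\<And>x. x \<in> X \<Longrightarrow>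
    \<exists>\<xi>. ancient \<xi> \<and> (\<forall>t\<ge>0. Ed (S t x) (S t (\<xi> 0)) \<le> C * exp (- (2 * \<theta> * t)) * Ed x orig)"
proof -
  define c where "c = K / d"
  have c: "0 < c" using pos by (simp add: c_def)
  define C1 where "C1 = 2 + 4 * c"
  have C1: "0 < C1" using c by (simp add: C1_def)
  show ?thesis
  proof (rule that[of "2 * (c * C1)"])
    fix x assume x: "x \<in> X"
    have Ex: "0 \<le> Ed x orig" by (intro Ed_nonneg x o_in)
    have "\<exists>\<zeta>. ancient \<zeta> \<and> (\<forall>n<N. Pc (\<zeta> 0) n = Pc (S (real T) x) n)" for T :: nat
      using ancient_exists[of "Pc (S (real T) x)"] by metis
    then obtain \<zeta> where \<zeta>: "\<And>T. ancient (\<zeta> T)" "\<And>T n. n < N \<Longrightarrow> Pc (\<zeta> T 0) n = Pc (S (real T) x) n" by metis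
    define \<xi> where "\<xi> T t = \<zeta> T (t - real T)" for T t
    have \<xi>: "ancient (\<xi> T)" for T unfolding \<xi>_def using ancient_shift[OF \<zeta>(1)] by simp
    note X = ancientD(1)[OF \<xi>]
    have P: "Pc (S (real T) x) n = Pc (S (real T) (\<xi> T 0)) n" if "n < N" for T n
      using ancientD(2)[OF \<xi>, of "real T" T 0] \<zeta>(2)[OF that, of T] by (simp add: \<xi>_def)
    have bound: "Ed x (\<xi> T 0) \<le> C1 * Ed x orig" for T
    proof -
      have "d * Ed (S 0 x) (S 0 (\<xi> T 0)) \<le> Vd (S 0 x) (S 0 (\<xi> T 0))"
        by (rule cone_positive_preserved[OF x X _ _ P, of 0 "T"]) auto
      then have "0 \<le> Vd x (\<xi> T 0)" using Ed_nonneg[OF x X, of T 0] pos S_0[OF x] S_0[OF X]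
        by (metis (no_types, lifting) mult_nonneg_nonneg less_imp_le order_trans)
      also have "\<dots> \<le> Vd (\<xi> T 0) orig + d / 2 * Ed (\<xi> T 0) orig + K * Ed x orig" by (rule V_comp[OF x X])
      finally have "d / 2 * Ed (\<xi> T 0) orig \<le> K * Ed x orig"
        using ancient_negative[OF \<xi> ancient_o, of T 0] by simp
      then have "Ed (\<xi> T 0) orig \<le> 2 * c * Ed x orig" using pos by (simp add: c_def field_simps)
      then have "Ed x (\<xi> T 0) \<le> 2 * Ed x orig + 2 * (2 * c * Ed x orig)"
        using Ed_triangle[OF x o_in X[of T 0]] Ed_sym[of orig "\<xi> T 0"] by simp
      then show ?thesis by (simp add: C1_def algebra_simps)
    qed
    have decay: "Ed (S t x) (S t (\<xi> T 0)) \<le> c * C1 * exp (- (2 * (\<theta> + \<eta>) * t)) * Ed x orig" if "0 \<le> t" "t \<le> real T" for t T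
    proof -
      have "Ed (S t x) (S t (\<xi> T 0)) \<le> c * exp (- (2 * (\<theta> + \<eta>) * t)) * Ed x (\<xi> T 0)"
        unfolding c_def by (rule decay_if_P_meets[OF x X that P])
      also have "\<dots> \<le> c * exp (- (2 * (\<theta> + \<eta>) * t)) * (C1 * Ed x orig)" using c bound by (intro mult_left_mono) auto
      finally show ?thesis by (simp only: mult_ac)
    qed
    have cauchy: "Ed (\<xi> T 0) (\<xi> T' 0) \<le> 4 * c * c * C1 * Ed x orig * exp (- (4 * \<eta> * real T))" if T: "T \<le> T'" for T T'
    proof -
      have St: "S (real T) x \<in> X" "S (real T) (\<xi> T 0) \<in> X" "S (real T) (\<xi> T' 0) \<in> X" by (auto intro: S_in x X)
      have "Ed (\<xi> T 0) (\<xi> T' 0) \<le> c * exp (2 * (\<theta> - \<eta>) * real T) * Ed (S (real T) (\<xi> T 0)) (S (real T) (\<xi> T' 0))"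
        unfolding c_def by (intro growth_in_negative_cone X ancient_negative \<xi>) simp
      also have "Ed (S (real T) (\<xi> T 0)) (S (real T) (\<xi> T' 0)) \<le>
          4 * (c * C1 * exp (- (2 * (\<theta> + \<eta>) * real T)) * Ed x orig)"
        using Ed_triangle[OF St(2,1,3)] Ed_sym[of "S (real T) (\<xi> T 0)"] decay[of "real T" T] decay[of "real T" T'] T by simp
      finally have "Ed (\<xi> T 0) (\<xi> T' 0) \<le> c * exp (2 * (\<theta> - \<eta>) * real T) * (4 * (c * C1 * exp (- (2 * (\<theta> + \<eta>) * real T)) * Ed x orig))"
        using c by (simp add: mult_left_mono)
      also have "\<dots> = 4 * c * c * C1 * Ed x orig * (exp (2 * (\<theta> - \<eta>) * real T) * exp (- (2 * (\<theta> + \<eta>) * real T)))"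
        by (simp only: mult_ac)
      also have "exp (2 * (\<theta> - \<eta>) * real T) * exp (- (2 * (\<theta> + \<eta>) * real T)) = exp (- (4 * \<eta> * real T))"
        by (simp add: exp_add[symmetric] algebra_simps)
      finally show ?thesis .
    qed
    define B where "B = K * (4 * c * c * C1 * Ed x orig)"
    have "\<exists>l. (\<lambda>T. Pc (\<xi> T 0) n) \<longlonglongrightarrow> l" if n: "n < N" for n
    proof -
      have sq: "(Pc (\<xi> T 0) n - Pc (\<xi> T' 0) n)\<^sup>2 \<le> B * exp (- (4 * \<eta> * real T))" if "T \<le> T'" for T T'
      proof -
        have "(Pc (\<xi> T 0) n - Pc (\<xi> T' 0) n)\<^sup>2 \<le> (\<Sum>n<N. (Pc (\<xi> T 0) n - Pc (\<xi> T' 0) n)\<^sup>2)"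
          using n by (intro member_le_sum) auto
        also have "\<dots> \<le> K * Ed (\<xi> T 0) (\<xi> T' 0)" by (intro P_bound X)
        also have "\<dots> \<le> K * (4 * c * c * C1 * Ed x orig * exp (- (4 * \<eta> * real T)))"
          using pos cauchy[OF that] by (intro mult_left_mono) auto
        finally show ?thesis by (simp add: B_def mult.assoc)
      qed
      have "Cauchy (\<lambda>T. Pc (\<xi> T 0) n)"
      proof (rule CauchyI')
        fix r :: real assume r: "0 < r"
        have "(\<lambda>T. B * exp (- (4 * \<eta> * real T))) \<longlonglongrightarrow> 0" using pos by (intro exp_decay_tendsto) simp
        then have "\<forall>\<^sub>F T in sequentially. B * exp (- (4 * \<eta> * real T)) < r\<^sup>2" using r by (intro order_tendstoD(2)) auto
        then obtain M where M: "\<And>T. T \<ge> M \<Longrightarrow> B * exp (- (4 * \<eta> * real T)) < r\<^sup>2" by (auto simp: eventually_sequentially)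
        have "dist (Pc (\<xi> T 0) n) (Pc (\<xi> T' 0) n) < r" if "T \<ge> M" "T' > T" for T T'
        proof -
          have "(Pc (\<xi> T 0) n - Pc (\<xi> T' 0) n)\<^sup>2 < r\<^sup>2" using sq[of T T'] M[OF that(1)] that(2) by simp
          then have "\<bar>Pc (\<xi> T 0) n - Pc (\<xi> T' 0) n\<bar> < r"
            by (intro power2_less_imp_less[of "\<bar>_\<bar>"]) (use r in simp_all)
          then show ?thesis using r by (simp add: dist_real_def)
        qed
        then show "\<exists>M. \<forall>m\<ge>M. \<forall>n'>m. dist (Pc (\<xi> m 0) n) (Pc (\<xi> n' 0) n) < r" by blast
      qed
      then show ?thesis using Cauchy_convergent_iff convergent_def by blast
    qed
    then obtain p where p: "\<And>n. n < N \<Longrightarrow> (\<lambda>T. Pc (\<xi> T 0) n) \<longlonglongrightarrow> p n" by metis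
    obtain \<omega> where \<omega>: "ancient \<omega>" "\<And>n. n < N \<Longrightarrow> Pc (\<omega> 0) n = p n" using ancient_exists[of p] by metis
    note W = ancientD(1)[OF \<omega>(1)]
    have lim: "(\<lambda>T. Ed (\<xi> T 0) (\<omega> 0)) \<longlonglongrightarrow> 0"
    proof (rule Lim_null_comparison)
      show "\<forall>\<^sub>F T in sequentially. norm (Ed (\<xi> T 0) (\<omega> 0)) \<le> K / d * (\<Sum>n<N. (Pc (\<xi> T 0) n - p n)\<^sup>2)"
        using ancient_Lipschitz[OF \<xi> \<omega>(1), of _ 0] Ed_nonneg[OF X W] \<omega>(2) by (intro always_eventually allI) simp
      have "(\<lambda>T. K / d * (\<Sum>n<N. (Pc (\<xi> T 0) n - p n)\<^sup>2)) \<longlonglongrightarrow> K / d * (\<Sum>n<N. (p n - p n)\<^sup>2)"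
        by (intro tendsto_intros p) auto
      then show "(\<lambda>T. K / d * (\<Sum>n<N. (Pc (\<xi> T 0) n - p n)\<^sup>2)) \<longlonglongrightarrow> 0" by simp
    qed
    have "Ed (S t x) (S t (\<omega> 0)) \<le> 2 * (c * C1) * exp (- (2 * \<theta> * t)) * Ed x orig" if t: "0 \<le> t" for t
    proof -
      obtain D where D: "0 < D" "\<forall>x\<in>X. \<forall>y\<in>X. Ed (S t x) (S t y) \<le> D * Ed x y" using dependence[OF t] by blast
      define A where "A = c * C1 * exp (- (2 * (\<theta> + \<eta>) * t)) * Ed x orig"
      have l1: "(\<lambda>T. 2 * A + 2 * (D * Ed (\<xi> T 0) (\<omega> 0))) \<longlonglongrightarrow> 2 * A + 2 * (D * 0)" by (intro tendsto_intros lim)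
      have l2: "Ed (S t x) (S t (\<omega> 0)) \<le> 2 * A + 2 * (D * Ed (\<xi> T 0) (\<omega> 0))" if "T \<ge> nat \<lceil>t\<rceil>" for T
      proof -
        have "t \<le> real T" using that by linarith
        then have "Ed (S t x) (S t (\<xi> T 0)) \<le> A" using decay[OF t] by (simp add: A_def)
        moreover have "Ed (S t (\<xi> T 0)) (S t (\<omega> 0)) \<le> D * Ed (\<xi> T 0) (\<omega> 0)" using D(2) X W by blast
        moreover have "Ed (S t x) (S t (\<omega> 0)) \<le> 2 * Ed (S t x) (S t (\<xi> T 0)) + 2 * Ed (S t (\<xi> T 0)) (S t (\<omega> 0))"
          by (intro Ed_triangle S_in x X W t)
        ultimately show ?thesis by linarith
      qed
      have "Ed (S t x) (S t (\<omega> 0)) \<le> 2 * A + 2 * (D * 0)"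
        by (rule LIMSEQ_le_const[OF l1]) (use l2 in blast)
      also have "\<dots> \<le> 2 * (c * C1 * exp (- (2 * \<theta> * t)) * Ed x orig)"
      proof -
        have "0 \<le> \<eta> * t" using pos t by simp
        then have "exp (- (2 * (\<theta> + \<eta>) * t)) \<le> exp (- (2 * \<theta> * t))" by (simp add: algebra_simps)
        then show ?thesis using c C1 Ex by (simp add: A_def mult_left_mono mult_right_mono)
      qed
      finally show ?thesis by (simp only: mult_ac)
    qed
    then show "\<exists>\<xi>. ancient \<xi> \<and> (\<forall>t\<ge>0. Ed (S t x) (S t (\<xi> 0)) \<le> 2 * (c * C1) * exp (- (2 * \<theta> * t)) * Ed x orig)"
      using \<omega>(1) by blast
  qed (use c C1 in simp)
qed

end

section \<open>The inertial manifold for fixed parameter\<close>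

lemma quadratic_polarization:
  fixes A B C p q :: real
  assumes "p * q = 1"
  defines "Q \<equiv> \<lambda>u v. A * v\<^sup>2 + B * (u * v) + C * u\<^sup>2"
  shows "Q (u - u') (v - v') = Q u v + Q u' v'
    - (Q (p * u + q * u') (p * v + q * v') - Q (p * u - q * u') (p * v - q * v')) / 2"
proof -
  have "Q (p * u + q * u') (p * v + q * v') - Q (p * u - q * u') (p * v - q * v')
      = (p * q) * (4 * A * (v * v') + 2 * B * (u * v' + u' * v) + 4 * C * (u * u'))"
    unfolding Q_def by (simp add: power2_eq_square algebra_simps)
  then show ?thesis unfolding assms(1) Q_def by (simp add: power2_eq_square field_simps)
qed

lemma half_difference_le:
  fixes a b c x y z r :: real
  shows "a \<le> x \<Longrightarrow> - b \<le> y \<Longrightarrow> c \<le> z \<Longrightarrow> a + r - (b - c) / 2 \<le> x + r + (y + z) / 2"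
  unfolding diff_divide_distrib add_divide_distrib by linarith

lemma cone_form_quadratic:
  obtains A B C where "\<And>u v. cone_form eps \<mu> s l u v = A * v\<^sup>2 + B * (u * v) + C * u\<^sup>2"
proof -
  define \<theta> \<beta> where "\<theta> = slow_rate eps \<mu>" and "\<beta> = 1 - 2 * eps * \<theta>"
  have "cone_form eps \<mu> s l u v = (\<beta> * eps) * v\<^sup>2 + ((2 * \<beta> * \<theta> + 2 * s) * eps) * (u * v)
     + (eps * \<beta> * \<theta>\<^sup>2 + 2 * eps * s * \<theta> + \<beta> * (l - \<mu>)) * u\<^sup>2" for u v
    unfolding cone_form_def \<theta>_def[symmetric] \<beta>_def[symmetric]
    by (simp add: power2_eq_square algebra_simps)
  then show ?thesis by (rule that)
qed

lemma mode_energy_parallelogram: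
  "mode_energy eps l (p * u + q * u') (p * v + q * v') + mode_energy eps l (p * u - q * u') (p * v - q * v')
    = 2 * p\<^sup>2 * mode_energy eps l u v + 2 * q\<^sup>2 * mode_energy eps l u' v'"
  by (simp add: mode_energy_def power2_eq_square algebra_simps)

context semilinear begin

lemma E_zero_seq:
  assumes "0 \<le> eps" "\<And>n. fin_en eps (phase_diff (a n) y)" "\<And>r. 0 < r \<Longrightarrow> \<exists>M. \<forall>n\<ge>M. E eps (phase_diff (a n) y) \<le> r"
  shows "(\<lambda>n. E eps (phase_diff (a n) y)) \<longlonglongrightarrow> 0"
proof (rule LIMSEQ_I)
  fix r :: real assume "0 < r"
  then obtain M where M: "\<And>n. n \<ge> M \<Longrightarrow> E eps (phase_diff (a n) y) \<le> r / 2" using assms(3)[of "r / 2"] by auto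
  have "norm (E eps (phase_diff (a n) y) - 0) < r" if "n \<ge> M" for n
    using M[OF that] E_nonneg[OF assms(1) assms(2)[of n]] \<open>0 < r\<close> by simp
  then show "\<exists>M. \<forall>n\<ge>M. norm (E eps (phase_diff (a n) y) - 0) < r" by blast
qed

text \<open>
  Completeness of the phase space for the energy. For \<open>eps = 0\<close> the second component of the limit is
  not controlled by the energy but determined by the first.
\<close>

lemma X_complete:
  assumes eps: "0 \<le> eps" and X: "\<And>n. a n \<in> X eps"
    and C: "\<And>r. 0 < r \<Longrightarrow> \<exists>M. \<forall>m\<ge>M. \<forall>n\<ge>m. E eps (phase_diff (a m) (a n)) < r"
  shows "\<exists>y\<in>X eps. (\<lambda>n. E eps (phase_diff (a n) y)) \<longlonglongrightarrow> 0"
proof -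
  note fin = energy_spaceD(1)[OF eps X_subset[OF X]]
  note find = fin_en_diff(1)[OF eps fin fin]
  have "Cauchy (\<lambda>n. fst (a n))"
  proof (rule CauchyI')
    fix r :: real assume r: "0 < r"
    then have "0 < lam 0 * r\<^sup>2" using lam_pos by simp
    then obtain M where M: "\<And>m n. m \<ge> M \<Longrightarrow> n \<ge> m \<Longrightarrow> E eps (phase_diff (a m) (a n)) < lam 0 * r\<^sup>2" using C by meson
    have "dist (fst (a m)) (fst (a n)) < r" if "m \<ge> M" "n > m" for m n
    proof -
      have "lam 0 * (norm (fst (a m) - fst (a n)))\<^sup>2 < lam 0 * r\<^sup>2"
        using norm_sq_le_E[OF eps find, of m n] M[of m n] that by simp
      then have "(norm (fst (a m) - fst (a n)))\<^sup>2 < r\<^sup>2" using lam_pos by simp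
      then show ?thesis unfolding dist_norm by (rule power2_less_imp_less) (use r in simp)
    qed
    then show "\<exists>M. \<forall>m\<ge>M. \<forall>n>m. dist (fst (a m)) (fst (a n)) < r" by blast
  qed
  then obtain U where U: "(\<lambda>n. fst (a n)) \<longlonglongrightarrow> U" using Cauchy_convergent_iff convergent_def by blast
  have "\<exists>w. (\<lambda>n. eps * (snd (a n) k - w)\<^sup>2) \<longlonglongrightarrow> 0 \<and> (\<forall>m. (\<lambda>n. eps * (snd (a m) k - snd (a n) k)\<^sup>2) \<longlonglongrightarrow> eps * (snd (a m) k - w)\<^sup>2)
     \<and> (eps = 0 \<longrightarrow> w = F U \<bullet> e k - lam k * (U \<bullet> e k))" for k
  proof (cases "eps = 0")
    case True
    then show ?thesis by (intro exI[of _ "F U \<bullet> e k - lam k * (U \<bullet> e k)"]) simp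
  next
    case False
    then have e0: "0 < eps" using eps by simp
    have "Cauchy (\<lambda>n. snd (a n) k)"
    proof (rule CauchyI')
      fix r :: real assume r: "0 < r"
      then have "0 < eps * r\<^sup>2" using e0 by simp
      then obtain M where M: "\<And>m n. m \<ge> M \<Longrightarrow> n \<ge> m \<Longrightarrow> E eps (phase_diff (a m) (a n)) < eps * r\<^sup>2" using C by meson
      have "dist (snd (a m) k) (snd (a n) k) < r" if "m \<ge> M" "n > m" for m n
      proof -
        have "sum (en eps (phase_diff (a m) (a n))) {k} \<le> E eps (phase_diff (a m) (a n))"
          by (rule sum_en_le_E[OF eps find]) simp
        moreover have "eps * (snd (a m) k - snd (a n) k)\<^sup>2 \<le> en eps (phase_diff (a m) (a n)) k"
          using lam_gt0[of k] by (simp add: en_def mode_energy_def)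
        ultimately have "eps * (snd (a m) k - snd (a n) k)\<^sup>2 < eps * r\<^sup>2" using M[of m n] that by simp
        then have "(snd (a m) k - snd (a n) k)\<^sup>2 < r\<^sup>2" using e0 by simp
        then have "\<bar>snd (a m) k - snd (a n) k\<bar> < r"
          by (intro power2_less_imp_less[of "\<bar>_\<bar>"]) (use r in simp_all)
        then show ?thesis using r by (simp add: dist_real_def)
      qed
      then show "\<exists>M. \<forall>m\<ge>M. \<forall>n>m. dist (snd (a m) k) (snd (a n) k) < r" by blast
    qed
    then obtain w where w: "(\<lambda>n. snd (a n) k) \<longlonglongrightarrow> w" using Cauchy_convergent_iff convergent_def by blast
    have "(\<lambda>n. eps * (snd (a n) k - w)\<^sup>2) \<longlonglongrightarrow> eps * (w - w)\<^sup>2" by (intro tendsto_intros w)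
    then have "(\<lambda>n. eps * (snd (a n) k - w)\<^sup>2) \<longlonglongrightarrow> 0" by simp
    moreover have "(\<lambda>n. eps * (snd (a m) k - snd (a n) k)\<^sup>2) \<longlonglongrightarrow> eps * (snd (a m) k - w)\<^sup>2" for m
      by (intro tendsto_intros w)
    ultimately show ?thesis using False by blast
  qed
  then obtain w where w: "\<And>k m. (\<lambda>n. eps * (snd (a m) k - snd (a n) k)\<^sup>2) \<longlonglongrightarrow> eps * (snd (a m) k - w k)\<^sup>2"
    "\<And>k. eps = 0 \<Longrightarrow> w k = F U \<bullet> e k - lam k * (U \<bullet> e k)" by metis
  define y where "y = (U, w)"
  have part: "(\<Sum>k<J. en eps (phase_diff (a m) y) k) \<le> r"
    if M: "\<And>n. n \<ge> m \<Longrightarrow> E eps (phase_diff (a m) (a n)) < r" for m J r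
  proof -
    have "(\<lambda>n. \<Sum>k<J. en eps (phase_diff (a m) (a n)) k) \<longlonglongrightarrow> (\<Sum>k<J. en eps (phase_diff (a m) y) k)"
      unfolding en_def mode_energy_def fst_phase_diff snd_phase_diff y_def fst_conv snd_conv
      by (intro tendsto_intros w(1) U)
    moreover have "(\<Sum>k<J. en eps (phase_diff (a m) (a n)) k) \<le> r" if "n \<ge> m" for n
      using sum_en_le_E[OF eps find, of "{..<J}" m n] M[OF that] by simp
    ultimately show ?thesis by (intro LIMSEQ_le_const2) auto
  qed
  have lim: "fin_en eps (phase_diff (a m) y) \<and> E eps (phase_diff (a m) y) \<le> r"
    if M: "\<And>n. n \<ge> m \<Longrightarrow> E eps (phase_diff (a m) (a n)) < r" for m r
  proof -
    have s: "summable (en eps (phase_diff (a m) y))"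
      by (rule bounded_imp_summable[of _ r]) (use part[OF M, where J = "Suc _"] en_nonneg[OF eps] in \<open>auto simp: lessThan_Suc_atMost\<close>)
    then show ?thesis unfolding fin_en_def E_def using part[OF M] by (auto intro: suminf_le_const)
  qed
  obtain M where M: "\<And>m n. m \<ge> M \<Longrightarrow> n \<ge> m \<Longrightarrow> E eps (phase_diff (a m) (a n)) < 1" using C[of 1] by auto
  have fM: "fin_en eps (phase_diff (a M) y)" using lim[of M 1] M by blast
  have fy: "fin_en eps y"
  proof -
    have "fin_en eps (phase_diff y (a M))" using fM en_phase_diff_commute[of eps "a M" y] by (simp add: fin_en_def)
    then show ?thesis using fin_en_triangle(1)[OF eps, of y "a M" origin] fin[of M] by simp
  qed
  have "y \<in> X eps" by (rule in_X_if[OF eps fy]) (simp add: y_def w(2))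
  moreover have "(\<lambda>n. E eps (phase_diff (a n) y)) \<longlonglongrightarrow> 0"
  proof (rule E_zero_seq[OF eps])
    show "fin_en eps (phase_diff (a n) y)" for n by (intro fin_en_diff eps fin fy)
    show "\<exists>M. \<forall>n\<ge>M. E eps (phase_diff (a n) y) \<le> r" if r: "0 < r" for r
      using C[OF r] lim[of _ r] by meson
  qed
  ultimately show ?thesis by blast
qed

end

context cone_system begin

lemma P_sq_le:
  assumes eps: "eps \<in> Eps" "eps \<le> epsm" and f: "fin_en eps x"
  shows "(\<Sum>n<N. (P eps x n)\<^sup>2) \<le> (2 * epsm + 2 / lam 0) * E eps x"
proof -
  note e0 = Eps_nonneg[OF eps(1)]
  have "(P eps x n)\<^sup>2 \<le> (2 * epsm + 2 / lam 0) * en eps x n" if n: "n < N" for n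
  proof -
    define u v c where "u = fst x \<bullet> e n" and "v = snd x n" and "c = 1 - eps * slow_rate eps (lam n)"
    have s: "4 * eps * lam n < 1" "0 < slow_rate eps (lam n)" using slow_modes[OF eps(1) n] by auto
    have c: "0 \<le> c" "c \<le> 1"
    proof -
      have "2 * c = 1 + sqrt (1 - 4 * eps * lam n)"
        using slow_rate_beta[of eps "lam n"] s by (simp add: c_def algebra_simps)
      moreover have "0 \<le> sqrt (1 - 4 * eps * lam n)" using s by simp
      ultimately show "0 \<le> c" by linarith
      have "0 \<le> eps * slow_rate eps (lam n)" using s e0 by (intro mult_nonneg_nonneg) auto
      then show "c \<le> 1" by (simp add: c_def)
    qed
    have "(P eps x n)\<^sup>2 = (eps * v - (- (c * u)))\<^sup>2" by (simp add: P_def slow_coord_def u_def v_def c_def)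
    also have "\<dots> \<le> 2 * (eps * v)\<^sup>2 + 2 * (c * u)\<^sup>2" using sq_triangle[of "eps * v" "- (c * u)" 0] by simp
    also have "(eps * v)\<^sup>2 \<le> epsm * (eps * v\<^sup>2)"
      using mult_right_mono[OF eps(2), of "eps * v\<^sup>2"] e0 by (simp add: power2_eq_square mult_ac)
    also have "(c * u)\<^sup>2 \<le> 1 / lam 0 * (lam n * u\<^sup>2)"
    proof -
      have "c\<^sup>2 \<le> 1" using c by (simp add: power_le_one)
      then have "c\<^sup>2 * u\<^sup>2 \<le> 1 * u\<^sup>2" by (intro mult_right_mono) auto
      moreover have "lam 0 * u\<^sup>2 \<le> lam n * u\<^sup>2" by (intro mult_right_mono lam0_le) auto
      ultimately show ?thesis using lam_pos by (simp add: power_mult_distrib field_simps) (meson mult_left_mono order_trans less_imp_le)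
    qed
    finally have "(P eps x n)\<^sup>2 \<le> 2 * epsm * (eps * v\<^sup>2) + 2 / lam 0 * (lam n * u\<^sup>2)" by simp
    also have "\<dots> \<le> (2 * epsm + 2 / lam 0) * (eps * v\<^sup>2) + (2 * epsm + 2 / lam 0) * (lam n * u\<^sup>2)"
      using e0 eps(2) lam_pos lam_gt0[of n] by (intro add_mono mult_right_mono) auto
    also have "\<dots> = (2 * epsm + 2 / lam 0) * en eps x n"
      by (simp only: en_def mode_energy_def u_def v_def distrib_left)
    finally show ?thesis .
  qed
  then have "(\<Sum>n<N. (P eps x n)\<^sup>2) \<le> (\<Sum>n<N. (2 * epsm + 2 / lam 0) * en eps x n)" by (intro sum_mono) auto
  also have "\<dots> \<le> (2 * epsm + 2 / lam 0) * E eps x"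
    unfolding sum_distrib_left[symmetric] using e0 eps(2) lam_pos
    by (intro mult_left_mono sum_en_le_E f) auto
  finally show ?thesis .
qed

text \<open>
  A quadratic form at \<open>x - y\<close> is the one at \<open>y\<close> up to a mixed term, which Young's inequality, in the
  form of \<open>quadratic_polarization\<close> with the weights \<open>p\<close> and \<open>1 / p\<close>, splits into a small multiple of
  the energy of \<open>y\<close> and a large one of that of \<open>x\<close>.
\<close>

lemma V_compare:
  assumes eps: "eps \<in> Eps" and x: "fin_en eps x" and y: "fin_en eps y"
  shows "V eps (phase_diff x y) \<le> V eps y + d / 2 * E eps y + (K + 2 * K\<^sup>2 / d) * E eps x"
proof -
  (* The weight for which the multiple of the energy of y becomes d / 2. *)
  define p q where "p = sqrt (2 * K / d)" and "q = 1 / p"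
  have p: "0 < p" "p\<^sup>2 = 2 * K / d" using pos by (simp_all add: p_def)
  have q: "p * q = 1" "q\<^sup>2 = d / (2 * K)" using p pos by (simp_all add: q_def power_divide)
  have "cf eps (phase_diff x y) n \<le> cf eps y n + d / 2 * en eps y n + (K + 2 * K\<^sup>2 / d) * en eps x n" for n
  proof -
    define Q where "Q = cone_form eps \<mu> (s n) (lam n)"
    define m where "m = mode_energy eps (lam n)"
    define u v u' v' where "u = fst x \<bullet> e n" and "v = snd x n" and "u' = fst y \<bullet> e n" and "v' = snd y n"
    have bnd: "\<bar>Q a b\<bar> \<le> K * m a b" for a b
      using bounds[OF eps, of n] by (simp add: cone_bounds_def Q_def m_def)
    obtain A B C where ABC: "\<And>u v. Q u v = A * v\<^sup>2 + B * (u * v) + C * u\<^sup>2"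
      unfolding Q_def using cone_form_quadratic by metis
    have "Q (u - u') (v - v') = Q u v + Q u' v' - (Q (p * u + q * u') (p * v + q * v') - Q (p * u - q * u') (p * v - q * v')) / 2"
      unfolding ABC by (rule quadratic_polarization[OF q(1)])
    also have "\<dots> \<le> K * m u v + Q u' v' + (K * m (p * u + q * u') (p * v + q * v') + K * m (p * u - q * u') (p * v - q * v')) / 2"
    proof -
      have "Q u v \<le> K * m u v" by (rule abs_le_D1[OF bnd])
      moreover have "- Q (p * u + q * u') (p * v + q * v') \<le> K * m (p * u + q * u') (p * v + q * v')" by (rule abs_le_D2[OF bnd])
      moreover have "Q (p * u - q * u') (p * v - q * v') \<le> K * m (p * u - q * u') (p * v - q * v')" by (rule abs_le_D1[OF bnd])
      ultimately show ?thesis by (rule half_difference_le)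
    qed
    also have "K * m (p * u + q * u') (p * v + q * v') + K * m (p * u - q * u') (p * v - q * v')
        = K * (2 * p\<^sup>2 * m u v + 2 * q\<^sup>2 * m u' v')"
      unfolding m_def mode_energy_parallelogram[symmetric] by (rule distrib_left[symmetric])
    also have "K * (2 * p\<^sup>2 * m u v + 2 * q\<^sup>2 * m u' v') / 2 = 2 * K\<^sup>2 / d * m u v + d / 2 * m u' v'"
      unfolding p(2) q(2) using pos by (simp add: field_simps power2_eq_square)
    finally have "Q (u - u') (v - v') \<le> Q u' v' + d / 2 * m u' v' + (K + 2 * K\<^sup>2 / d) * m u v"
      by (simp add: distrib_right)
    then show ?thesis by (simp add: cf_def en_def Q_def m_def u_def v_def u'_def v'_def inner_diff_left)
  qed
  note le = this
  have sm: "(\<lambda>n. cf eps y n + d / 2 * en eps y n + (K + 2 * K\<^sup>2 / d) * en eps x n) sums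
      (V eps y + d / 2 * E eps y + (K + 2 * K\<^sup>2 / d) * E eps x)"
    unfolding V_def E_def using cf_summable[OF eps y] x y
    by (intro sums_add sums_mult summable_sums) (auto simp: fin_en_def)
  show ?thesis
    unfolding V_def[of eps "phase_diff x y"]
    by (rule sums_le[OF le summable_sums[OF cf_summable[OF eps fin_en_diff(1)[OF Eps_nonneg[OF eps] x y]]] sm])
qed

end

locale slow_manifold = cone_system e lam F L Eps N \<mu> \<Lambda> \<eta> \<delta> d K k s
  for e :: "nat \<Rightarrow> 'a::{real_inner,complete_space}" and lam F L Eps N \<mu> \<Lambda> \<eta> \<delta> d K k s +
  fixes epsm :: real
  assumes Eps_le: "eps \<in> Eps \<Longrightarrow> eps \<le> epsm"
    and flow: "eps \<in> Eps \<Longrightarrow> semilinear_flow e lam F L eps"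
    and rate: "eps \<in> Eps \<Longrightarrow> \<eta> < slow_rate eps \<mu>"
begin

definition Kc :: real where "Kc = K + 2 * K\<^sup>2 / d + (2 * \<bar>epsm\<bar> + 2 / lam 0)"

lemma Kc: "K \<le> Kc" "K + 2 * K\<^sup>2 / d \<le> Kc" "2 * \<bar>epsm\<bar> + 2 / lam 0 \<le> Kc" "0 < Kc"
  using pos lam_pos by (auto simp: Kc_def add_pos_nonneg)

abbreviation Ed :: "real \<Rightarrow> 'a \<times> (nat \<Rightarrow> real) \<Rightarrow> 'a \<times> (nat \<Rightarrow> real) \<Rightarrow> real" where
  "Ed eps \<equiv> \<lambda>x y. E eps (phase_diff x y)"

lemma P_bound:
  assumes eps: "eps \<in> Eps" and f: "fin_en eps (phase_diff x y)"
  shows "(\<Sum>n<N. (P eps x n - P eps y n)\<^sup>2) \<le> Kc * E eps (phase_diff x y)"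
proof -
  have "(\<Sum>n<N. (P eps x n - P eps y n)\<^sup>2) \<le> (2 * \<bar>epsm\<bar> + 2 / lam 0) * E eps (phase_diff x y)"
    using P_sq_le[OF eps _ f, of "\<bar>epsm\<bar>"] Eps_le[OF eps] by (simp add: P_diff)
  also have "\<dots> \<le> Kc * E eps (phase_diff x y)"
    using E_nonneg[OF Eps_nonneg[OF eps] f] Kc by (intro mult_right_mono) auto
  finally show ?thesis .
qed

text \<open>
  The single constant \<open>Kc\<close> replaces all upper bounds; it does not depend on \<open>eps\<close>.
\<close>

lemma cone_semiflow:
  assumes eps: "eps \<in> Eps"
  shows "cone_semiflow (X eps) (semiflow e lam F eps) (Ed eps) (\<lambda>x y. V eps (phase_diff x y)) (P eps) origin N
    (slow_rate eps \<mu>) \<eta> d Kc"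
proof -
  interpret fl: semilinear_flow e lam F L eps by (rule flow[OF eps])
  note e0 = Eps_nonneg[OF eps]
  have fin: "fin_en eps x" if "x \<in> X eps" for x by (rule energy_spaceD(1)[OF e0 X_subset[OF that]])
  have find: "fin_en eps (phase_diff x y)" if "x \<in> X eps" "y \<in> X eps" for x y
    by (intro fin_en_diff e0 fin that)
  have Enn: "0 \<le> Ed eps x y" if "x \<in> X eps" "y \<in> X eps" for x y by (intro E_nonneg e0 find that)
  show ?thesis
  proof
    fix x y z :: "'a \<times> (nat \<Rightarrow> real)" and t s \<theta>' c :: real and p :: "nat \<Rightarrow> real"
    show "origin \<in> X eps" by (rule fl.origin_in)
    show "0 < \<eta>" "0 < d" "0 < Kc" "\<eta> < slow_rate eps \<mu>" using pos Kc rate[OF eps] by auto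
    show "Ed eps x x = 0" by simp
    show "Ed eps x y = Ed eps y x" by (rule E_phase_diff_commute)
    { assume t: "0 \<le> t"
      show "semiflow e lam F eps t origin = origin" by (rule fl.semiflow_origin[OF t])
      obtain C \<kappa> where C: "0 < C" "\<And>x y t. x \<in> X eps \<Longrightarrow> y \<in> X eps \<Longrightarrow> 0 \<le> t \<Longrightarrow>
        Ed eps (semiflow e lam F eps t x) (semiflow e lam F eps t y) \<le> C * exp (\<kappa> * t) * Ed eps x y"
        using fl.semiflow_dependence by blast
      show "\<exists>C>0. \<forall>x\<in>X eps. \<forall>y\<in>X eps. Ed eps (semiflow e lam F eps t x) (semiflow e lam F eps t y) \<le> C * Ed eps x y"
        using C t by (intro exI[of _ "C * exp (\<kappa> * t)"]) auto
      obtain \<xi> where \<xi>: "orbit_on eps {0..t} \<xi>" "bc eps 0 t origin p \<xi>"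
        using nonlinear_bvp[OF eps t fin[OF fl.origin_in]] by blast
      have x0: "\<xi> 0 \<in> X eps" using orbit_in_X[OF e0 \<xi>(1)] t by simp
      have "V eps (\<xi> 0) + d * E eps (\<xi> 0) \<le> 0"
        using \<xi>(2) by (intro bc_start[OF eps fin[OF x0]]) (auto simp: bc_def origin_def)
      moreover have "semiflow e lam F eps t (\<xi> 0) = \<xi> t" using fl.semiflow_interval[OF \<xi>(1) t] by simp
      ultimately show "\<exists>x\<in>X eps. V eps (phase_diff x origin) + d * Ed eps x origin \<le> 0 \<and>
          (\<forall>n<N. P eps (semiflow e lam F eps t x) n = p n)"
        using x0 \<xi>(2) by (intro bexI[of _ "\<xi> 0"]) (auto simp: bc_def)
    }
    { assume x: "x \<in> X eps"
      show "semiflow e lam F eps 0 x = x" by (rule fl.semiflow_orbit(2)[OF x])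
      show "semiflow e lam F eps t x \<in> X eps" if "0 \<le> t" by (rule fl.semiflow_in[OF x that])
      show "semiflow e lam F eps (s + t) x = semiflow e lam F eps t (semiflow e lam F eps s x)" if "0 \<le> s" "0 \<le> t"
        by (rule fl.semiflow_add[OF x that])
      assume y: "y \<in> X eps"
      note f = find[OF x y]
      show "0 \<le> Ed eps x y" by (rule Enn[OF x y])
      show "x = y" if "Ed eps x y \<le> 0" by (rule X_eqI[OF e0 x y that])
      show "\<bar>V eps (phase_diff x y)\<bar> \<le> Kc * Ed eps x y"
        using V_abs_le[OF eps f] mult_right_mono[OF Kc(1) Enn[OF x y]] by linarith
      show "d * Ed eps x y - Kc * (\<Sum>n<N. (P eps x n - P eps y n)\<^sup>2) \<le> V eps (phase_diff x y)"
        using V_lower[OF eps f] mult_right_mono[OF Kc(1), of "\<Sum>n<N. (P eps x n - P eps y n)\<^sup>2"]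
        by (simp add: P_diff sum_nonneg)
      show "(\<Sum>n<N. (P eps x n - P eps y n)\<^sup>2) \<le> Kc * Ed eps x y" by (rule P_bound[OF eps f])
      have "V eps (phase_diff x y) \<le> V eps y + d / 2 * E eps y + (K + 2 * K\<^sup>2 / d) * E eps x"
        by (rule V_compare[OF eps fin[OF x] fin[OF y]])
      moreover have "(K + 2 * K\<^sup>2 / d) * E eps x \<le> Kc * E eps x"
        by (intro mult_right_mono Kc E_nonneg e0 fin x)
      ultimately show "V eps (phase_diff x y) \<le> V eps (phase_diff y origin) + d / 2 * Ed eps y origin + Kc * Ed eps x origin"
        by simp
      show "exp (2 * \<theta>' * t) * (V eps (phase_diff (semiflow e lam F eps t x) (semiflow e lam F eps t y))
          + c * Ed eps (semiflow e lam F eps t x) (semiflow e lam F eps t y)) \<le> V eps (phase_diff x y) + c * Ed eps x y"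
        if t: "0 \<le> t" and \<theta>: "\<bar>\<theta>' - slow_rate eps \<mu>\<bar> \<le> \<eta>" and c: "\<bar>c\<bar> \<le> d"
        using cone_monotone[OF eps t traj_subset[OF fl.semiflow_orbit(1)[OF x]] traj_subset[OF fl.semiflow_orbit(1)[OF y]] \<theta> c]
          fl.semiflow_orbit(2)[OF x] fl.semiflow_orbit(2)[OF y] by simp
      show "Ed eps x z \<le> 2 * Ed eps x y + 2 * Ed eps y z" if z: "z \<in> X eps"
        by (rule fin_en_triangle(2)[OF e0 find[OF x y] find[OF y z]])
    }
  next
    fix a :: "nat \<Rightarrow> 'a \<times> (nat \<Rightarrow> real)"
    assume "\<And>n. a n \<in> X eps" "\<And>r. 0 < r \<Longrightarrow> \<exists>M. \<forall>m\<ge>M. \<forall>n\<ge>m. Ed eps (a m) (a n) < r"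
    then show "\<exists>y\<in>X eps. (\<lambda>n. Ed eps (a n) y) \<longlonglongrightarrow> 0" by (rule X_complete[OF e0])
  qed
qed

definition ancient :: "real \<Rightarrow> (real \<Rightarrow> 'a \<times> (nat \<Rightarrow> real)) \<Rightarrow> bool" where
  "ancient eps = cone_semiflow.ancient (X eps) (semiflow e lam F eps) (Ed eps) origin (slow_rate eps \<mu>)"

definition manifold :: "real \<Rightarrow> ('a \<times> (nat \<Rightarrow> real)) set" where
  "manifold eps = {\<xi> 0 |\<xi>. ancient eps \<xi>}"

definition orb :: "real \<Rightarrow> 'a \<Rightarrow> real \<Rightarrow> 'a \<times> (nat \<Rightarrow> real)" where
  "orb eps p = (SOME \<xi>. ancient eps \<xi> \<and> (\<forall>n<N. P eps (\<xi> 0) n = p \<bullet> e n))"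

definition param :: "real \<Rightarrow> 'a \<Rightarrow> 'a \<times> (nat \<Rightarrow> real)" where
  "param eps p = orb eps p 0"

lemma orb:
  assumes "eps \<in> Eps" shows "ancient eps (orb eps p)" "n < N \<Longrightarrow> P eps (orb eps p 0) n = p \<bullet> e n"
proof -
  have "\<exists>\<xi>. ancient eps \<xi> \<and> (\<forall>n<N. P eps (\<xi> 0) n = p \<bullet> e n)"
    unfolding ancient_def
    by (rule cone_semiflow.ancient_exists[OF cone_semiflow[OF assms], of "\<lambda>n. p \<bullet> e n"]) blast
  then have "ancient eps (orb eps p) \<and> (\<forall>n<N. P eps (orb eps p 0) n = p \<bullet> e n)"
    unfolding orb_def by (rule someI_ex)
  then show "ancient eps (orb eps p)" "n < N \<Longrightarrow> P eps (orb eps p 0) n = p \<bullet> e n" by auto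
qed

lemmas ancientD = cone_semiflow.ancientD[OF cone_semiflow, folded ancient_def]
lemmas ancient_Lipschitz = cone_semiflow.ancient_Lipschitz[OF cone_semiflow, folded ancient_def]
lemmas ancient_growth = cone_semiflow.ancient_growth[OF cone_semiflow, folded ancient_def]
lemmas ancient_shift = cone_semiflow.ancient_shift[OF cone_semiflow, folded ancient_def]
lemmas ancient_shift_forward = cone_semiflow.ancient_shift_forward[OF cone_semiflow, folded ancient_def]
lemmas ancient_origin = cone_semiflow.ancient_o[OF cone_semiflow, folded ancient_def]
lemmas exponential_tracking = cone_semiflow.exponential_tracking[OF cone_semiflow, folded ancient_def]

lemma sum_coeff_le:
  "(\<Sum>n<N. (p \<bullet> e n - q \<bullet> e n)\<^sup>2) \<le> (norm (p - q))\<^sup>2"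
  using bessel[of "p - q" N] by (simp add: inner_diff_left)

lemma param_Lipschitz:
  assumes eps: "eps \<in> Eps"
  shows "Ed eps (param eps p) (param eps q) \<le> Kc / d * (\<Sum>n<N. (p \<bullet> e n - q \<bullet> e n)\<^sup>2)"
  using ancient_Lipschitz[OF eps orb(1)[OF eps] orb(1)[OF eps], of p 0 q] by (simp add: param_def orb(2)[OF eps])

lemma proj_id: "p \<in> range (proj e N) \<Longrightarrow> proj e N p = p"
  by (rule eq_if_coeff_eq) (auto simp: inner_proj)

text \<open>
  The left inverse is the map to the slow coordinates, extended to the whole energy space.
\<close>

lemma lipschitz_param:
  assumes eps: "eps \<in> Eps" shows "lipschitz_param e lam F N eps (param eps)"
proof -
  note e0 = Eps_nonneg[OF eps]
  obtain C where C: "0 < C" "\<And>x y. x \<in> X eps \<Longrightarrow> y \<in> X eps \<Longrightarrow>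
    (energy_dist e lam eps x y)\<^sup>2 \<le> C * E eps (phase_diff x y)" using energy_dist_le[OF e0] by blast
  have pX: "param eps p \<in> X eps" for p unfolding param_def by (rule ancientD(1)[OF eps orb(1)[OF eps]])
  define R where "R \<xi> = (\<Sum>n<N. P eps \<xi> n *\<^sub>R e n)" for \<xi>
  have R: "R (param eps p) = p" if "p \<in> range (proj e N)" for p
  proof -
    have "R (param eps p) = proj e N p" by (simp add: R_def proj_def param_def orb(2)[OF eps])
    then show ?thesis using proj_id[OF that] by simp
  qed
  have Rr: "R \<xi> \<in> range (proj e N)" for \<xi>
  proof -
    have "R \<xi> = proj e N (R \<xi>)"
      by (rule eq_if_coeff_eq) (simp add: inner_proj, simp add: R_def inner_sum_left inner_basis if_distrib cong: if_cong)
    then show ?thesis by (rule range_eqI)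
  qed
  have L1: "energy_dist e lam eps (param eps p) (param eps q) \<le> sqrt (C * (Kc / d)) * norm (p - q)"
for p q
  proof (rule power2_le_imp_le)
    have "(energy_dist e lam eps (param eps p) (param eps q))\<^sup>2 \<le> C * (Kc / d * (\<Sum>n<N. (p \<bullet> e n - q \<bullet> e n)\<^sup>2))"
      using C(2)[OF pX pX] param_Lipschitz[OF eps] C(1) by (meson mult_left_mono order_trans less_imp_le)
    also have "\<dots> \<le> C * (Kc / d * (norm (p - q))\<^sup>2)"
      using C(1) Kc(4) pos by (intro mult_left_mono sum_coeff_le) auto
    also have "\<dots> = (sqrt (C * (Kc / d)) * norm (p - q))\<^sup>2"
      using C(1) Kc(4) pos by (simp add: power_mult_distrib)
    finally show "(energy_dist e lam eps (param eps p) (param eps q))\<^sup>2 \<le> (sqrt (C * (Kc / d)) * norm (p - q))\<^sup>2" .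
  qed (use C(1) Kc(4) pos in simp)
  have L2: "norm (R x - R y) \<le> sqrt Kc * energy_dist e lam eps x y"
    if x: "x \<in> energy_space e lam eps" and y: "y \<in> energy_space e lam eps" for x y
  proof (rule power2_le_imp_le)
    note D = energy_space_diff[OF e0 x y]
    have "R x - R y = (\<Sum>n<N. (P eps x n - P eps y n) *\<^sub>R e n)"
      by (simp add: R_def sum_subtractf scaleR_diff_left)
    then have "(norm (R x - R y))\<^sup>2 = (\<Sum>n<N. (P eps x n - P eps y n)\<^sup>2)" by (simp add: norm_sum_basis)
    also have "\<dots> \<le> Kc * E eps (phase_diff x y)" by (rule P_bound[OF eps energy_spaceD(1)[OF e0 D]])
    also have "\<dots> \<le> Kc * (energy_dist e lam eps x y)\<^sup>2"
      unfolding energy_dist_def using Kc(4) by (intro mult_left_mono E_le_energy_norm_sq e0 D) auto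
    also have "\<dots> = (sqrt Kc * energy_dist e lam eps x y)\<^sup>2" using Kc(4) by (simp add: power_mult_distrib)
    finally show "(norm (R x - R y))\<^sup>2 \<le> (sqrt Kc * energy_dist e lam eps x y)\<^sup>2" .
  qed (use Kc(4) energy_dist_nonneg[OF e0] in simp)
  show ?thesis
    unfolding lipschitz_param_def
  proof (intro conjI)
    show "param eps ` range (proj e N) \<subseteq> X eps" using pX by blast
    show "inj_on (param eps) (range (proj e N))" by (rule inj_on_inverseI[of _ R]) (rule R)
    show "\<exists>K. \<forall>p\<in>range (proj e N). \<forall>q\<in>range (proj e N).
        energy_dist e lam eps (param eps p) (param eps q) \<le> K * norm (p - q)" using L1 by blast
    show "\<exists>R K. R ` energy_space e lam eps \<subseteq> range (proj e N) \<and>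
        (\<forall>\<xi>\<in>energy_space e lam eps. \<forall>\<eta>\<in>energy_space e lam eps.
           norm (R \<xi> - R \<eta>) \<le> K * energy_dist e lam eps \<xi> \<eta>) \<and>
        (\<forall>p\<in>range (proj e N). R (param eps p) = p)"
      using L2 R Rr by (intro exI[of _ R] exI[of _ "sqrt Kc"]) blast
  qed
qed

lemma manifold_eq:
  assumes eps: "eps \<in> Eps" shows "manifold eps = param eps ` range (proj e N)"
proof
  show "param eps ` range (proj e N) \<subseteq> manifold eps"
    unfolding manifold_def param_def using orb(1)[OF eps] by blast
  show "manifold eps \<subseteq> param eps ` range (proj e N)"
  proof
    fix x assume "x \<in> manifold eps"
    then obtain \<xi> where \<xi>: "ancient eps \<xi>" "x = \<xi> 0" by (auto simp: manifold_def)
    define p where "p = (\<Sum>n<N. P eps x n *\<^sub>R e n)"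
    have pe: "p \<bullet> e n = (if n < N then P eps x n else 0)" for n
      by (simp add: p_def inner_sum_left inner_basis if_distrib cong: if_cong)
    have "p = proj e N p" by (rule eq_if_coeff_eq) (simp add: inner_proj pe)
    then have "p \<in> range (proj e N)" by (rule range_eqI)
    moreover have "x = param eps p"
    proof (rule X_eqI[OF Eps_nonneg[OF eps]])
      show "x \<in> X eps" "param eps p \<in> X eps"
        unfolding param_def \<xi>(2) by (rule ancientD(1)[OF eps \<xi>(1)] ancientD(1)[OF eps orb(1)[OF eps]])+
      show "E eps (phase_diff x (param eps p)) \<le> 0"
        using ancient_Lipschitz[OF eps \<xi>(1) orb(1)[OF eps], of 0 p] by (simp add: param_def \<xi>(2)[symmetric] orb(2)[OF eps] pe)
    qed
    ultimately show "x \<in> param eps ` range (proj e N)" by blast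
  qed
qed

text \<open>
  Invariance holds since time shifts in both directions preserve ancient orbits.
\<close>

theorem manifold_inertial:
  assumes eps: "eps \<in> Eps" shows "inertial_manifold e lam F N eps (manifold eps)"
  unfolding inertial_manifold_def
proof (intro conjI allI impI)
  note e0 = Eps_nonneg[OF eps]
  show "\<exists>m. lipschitz_param e lam F N eps m \<and> manifold eps = m ` range (proj e N)"
    using lipschitz_param[OF eps] manifold_eq[OF eps] by blast
  show "semiflow e lam F eps t ` manifold eps = manifold eps" if t: "0 \<le> t" for t
  proof
    show "semiflow e lam F eps t ` manifold eps \<subseteq> manifold eps"
    proof
      fix y assume "y \<in> semiflow e lam F eps t ` manifold eps"
      then obtain \<xi> where \<xi>: "ancient eps \<xi>" "y = semiflow e lam F eps t (\<xi> 0)" by (auto simp: manifold_def)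
      have "y = (\<lambda>\<tau>. \<xi> (\<tau> + t)) 0" using ancientD(2)[OF eps \<xi>(1) t, of 0] \<xi>(2) by simp
      then show "y \<in> manifold eps" unfolding manifold_def
        by (intro CollectI exI[of _ "\<lambda>\<tau>. \<xi> (\<tau> + t)"] conjI ancient_shift_forward[OF eps \<xi>(1) t])
    qed
    show "manifold eps \<subseteq> semiflow e lam F eps t ` manifold eps"
    proof
      fix y assume "y \<in> manifold eps"
      then obtain \<xi> where \<xi>: "ancient eps \<xi>" "y = \<xi> 0" by (auto simp: manifold_def)
      have "y = semiflow e lam F eps t ((\<lambda>\<tau>. \<xi> (\<tau> - t)) 0)" using ancientD(2)[OF eps \<xi>(1) t, of "- t"] \<xi>(2) by simp
      moreover have "(\<lambda>\<tau>. \<xi> (\<tau> - t)) 0 \<in> manifold eps" unfolding manifold_def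
        by (intro CollectI exI[of _ "\<lambda>\<tau>. \<xi> (\<tau> - t)"] conjI refl ancient_shift[OF eps \<xi>(1) t])
      ultimately show "y \<in> semiflow e lam F eps t ` manifold eps" by blast
    qed
  qed
  define \<theta> where "\<theta> = slow_rate eps \<mu>"
  interpret fl: semilinear_flow e lam F L eps by (rule flow[OF eps])
  have \<theta>: "0 < \<theta>" using rate[OF eps] pos by (simp add: \<theta>_def)
  obtain C where C: "0 < C" "\<And>x y. x \<in> X eps \<Longrightarrow> y \<in> X eps \<Longrightarrow>
    (energy_dist e lam eps x y)\<^sup>2 \<le> C * E eps (phase_diff x y)" using energy_dist_le[OF e0] by blast
  obtain B where B: "0 < B" "\<And>x. x \<in> X eps \<Longrightarrow> \<exists>\<xi>. ancient eps \<xi> \<and>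
     (\<forall>t\<ge>0. Ed eps (semiflow e lam F eps t x) (semiflow e lam F eps t (\<xi> 0)) \<le> B * exp (- (2 * \<theta> * t)) * Ed eps x origin)"
    unfolding \<theta>_def using exponential_tracking[OF eps] by blast
  show "\<exists>C>0. \<exists>\<theta>>0. \<forall>\<xi>0\<in>X eps. \<exists>\<eta>0\<in>manifold eps. \<forall>t\<ge>0.
        energy_dist e lam eps (semiflow e lam F eps t \<xi>0) (semiflow e lam F eps t \<eta>0)
          \<le> C * energy_norm e lam eps \<xi>0 * exp (- \<theta> * t)"
  proof (rule exI[of _ "sqrt (C * B)"], rule conjI, use C(1) B(1) in simp, rule exI[of _ \<theta>], intro conjI ballI, rule \<theta>)
    fix x assume x: "x \<in> X eps"
    then obtain \<xi> where \<xi>: "ancient eps \<xi>"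
      "\<And>t. 0 \<le> t \<Longrightarrow> Ed eps (semiflow e lam F eps t x) (semiflow e lam F eps t (\<xi> 0)) \<le> B * exp (- (2 * \<theta> * t)) * Ed eps x origin"
      using B(2) by blast
    have "energy_dist e lam eps (semiflow e lam F eps t x) (semiflow e lam F eps t (\<xi> 0))
          \<le> sqrt (C * B) * energy_norm e lam eps x * exp (- \<theta> * t)" if t: "0 \<le> t" for t
    proof (rule power2_le_imp_le)
      have xi0: "\<xi> 0 \<in> X eps" by (rule ancientD(1)[OF eps \<xi>(1)])
      have "(energy_dist e lam eps (semiflow e lam F eps t x) (semiflow e lam F eps t (\<xi> 0)))\<^sup>2
          \<le> C * Ed eps (semiflow e lam F eps t x) (semiflow e lam F eps t (\<xi> 0))"
        by (intro C(2) fl.semiflow_in x xi0 t)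
      also have "\<dots> \<le> C * (B * exp (- (2 * \<theta> * t)) * E eps x)"
        using \<xi>(2)[OF t] C(1) by (intro mult_left_mono) auto
      also have "\<dots> \<le> C * (B * exp (- (2 * \<theta> * t)) * (energy_norm e lam eps x)\<^sup>2)"
        using C(1) B(1) by (intro mult_left_mono E_le_energy_norm_sq e0 X_subset x) auto
      also have "exp (- (2 * \<theta> * t)) = (exp (- \<theta> * t))\<^sup>2" by (simp add: power2_eq_square exp_add[symmetric])
      also have "C * (B * (exp (- \<theta> * t))\<^sup>2 * (energy_norm e lam eps x)\<^sup>2) = (sqrt (C * B) * energy_norm e lam eps x * exp (- \<theta> * t))\<^sup>2"
        using C(1) B(1) by (simp add: power_mult_distrib)
      finally show "(energy_dist e lam eps (semiflow e lam F eps t x) (semiflow e lam F eps t (\<xi> 0)))\<^sup>2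
          \<le> (sqrt (C * B) * energy_norm e lam eps x * exp (- \<theta> * t))\<^sup>2" .
    qed (use C(1) B(1) energy_dist_nonneg[OF e0] in simp)
    moreover have "\<xi> 0 \<in> manifold eps" unfolding manifold_def using \<xi>(1) by blast
    ultimately show "\<exists>\<eta>0\<in>manifold eps. \<forall>t\<ge>0.
        energy_dist e lam eps (semiflow e lam F eps t x) (semiflow e lam F eps t \<eta>0)
          \<le> sqrt (C * B) * energy_norm e lam eps x * exp (- \<theta> * t)" by blast
  qed
qed

end

section \<open>Dependence on the relaxation parameter\<close>

text \<open>
  Difference quotients are taken along this sequence of time steps, and to the left, so that only
  times up to \<open>0\<close> occur.
\<close>

definition step :: "nat \<Rightarrow> real" where "step j = 1 / (real j + 1)"

lemma step: "0 < step j" "step j \<le> 1" by (simp_all add: step_def)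

lemma left_quotient_tendsto:
  fixes f :: "real \<Rightarrow> real"
  assumes "(f has_real_derivative D) (at t within {t - 1..t})"
  shows "(\<lambda>j. (f t - f (t - step j)) / step j) \<longlonglongrightarrow> D"
proof -
  have "((\<lambda>y. (f y - f t) / (y - t)) \<longlongrightarrow> D) (at t within {t - 1..t})"
    using assms by (simp add: has_field_derivative_iff)
  moreover have "filterlim (\<lambda>j. t - step j) (at t within {t - 1..t}) sequentially"
    unfolding filterlim_at
  proof (intro conjI always_eventually allI)
    have "step \<longlonglongrightarrow> 0" unfolding step_def[abs_def] using lim_inverse_n' LIMSEQ_Suc[OF lim_1_over_n]
      by (simp add: add.commute)
    then have "(\<lambda>j. t - step j) \<longlonglongrightarrow> t - 0" by (intro tendsto_intros)
    then show "(\<lambda>j. t - step j) \<longlonglongrightarrow> t" by simp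
  qed (use step in \<open>auto simp: less_imp_le\<close>, use step(1) in \<open>metis less_irrefl\<close>)
  ultimately have "(\<lambda>j. (f (t - step j) - f t) / (t - step j - t)) \<longlonglongrightarrow> D"
    by (rule filterlim_compose)
  moreover have "(f (t - step j) - f t) / (t - step j - t) = (f t - f (t - step j)) / step j" for j
    using step(1)[of j] by (simp add: field_simps)
  ultimately show ?thesis by simp
qed

lemma increment_bound:
  fixes f :: "real \<Rightarrow> real"
  assumes "a < b" "\<And>t. t \<in> {a..b} \<Longrightarrow> (f has_real_derivative f' t) (at t within {a..b})"
  obtains t where "a < t" "t < b" "f b - f a = (b - a) * f' t"
proof -
  have "continuous_on {a..b} f" using assms(2) by (intro DERIV_continuous_on) auto
  moreover have "(f has_derivative (*) (f' t)) (at t)" if "a < t" "t < b" for t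
    using assms(2)[of t] that at_within_Icc_at[of a t b] by (simp add: has_field_derivative_def)
  ultimately show ?thesis
    using mvt[OF assms(1), of f "\<lambda>t. (*) (f' t)"] that by (metis mult.commute)
qed

context semilinear begin

lemma energy_dist_from_partial:
  assumes eps: "0 \<le> eps"
    and B: "\<And>m. (\<Sum>n<m. en eps (phase_diff x y) n + (snd x n - snd y n)\<^sup>2 / lam n) \<le> B"
  shows "phase_diff x y \<in> energy_space e lam eps" "(energy_dist e lam eps x y)\<^sup>2 \<le> B"
proof -
  let ?D = "phase_diff x y"
  define g where "g n = en eps ?D n + (snd x n - snd y n)\<^sup>2 / lam n" for n
  have nn: "0 \<le> en eps ?D n" "0 \<le> (snd x n - snd y n)\<^sup>2 / lam n" for n
    using lam_gt0[of n] en_nonneg[OF eps] by auto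
  have g: "summable g"
    by (rule bounded_imp_summable[of _ B]) (use nn B[of "Suc _"] in \<open>auto simp: g_def lessThan_Suc_atMost\<close>)
  have s1: "summable (en eps ?D)"
    by (rule summable_comparison_test'[OF g, of 0]) (use nn in \<open>simp add: g_def\<close>)
  have s2: "summable (\<lambda>n. (snd x n - snd y n)\<^sup>2 / lam n)"
    by (rule summable_comparison_test'[OF g, of 0]) (simp only: real_norm_def abs_of_nonneg nn g_def le_add_same_cancel2)
  show mem: "?D \<in> energy_space e lam eps"
    unfolding energy_space_iff[OF eps] using s1 s2 by (simp add: fin_en_def Hs_iff)
  have "(energy_dist e lam eps x y)\<^sup>2 = (\<Sum>n. g n)"
    unfolding energy_dist_def energy_norm_sq[OF eps mem] E_def dual_sq_def g_def
    using s1 s2 by (simp add: suminf_add)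
  also have "\<dots> \<le> B" using B by (intro suminf_le_const g) (simp only: g_def)
  finally show "(energy_dist e lam eps x y)\<^sup>2 \<le> B" .
qed

lemma force_diff_coeff_sq:
  assumes "0 \<le> eps" "fin_en eps (phase_diff x y)"
  shows "(\<Sum>n<m. ((F (fst x) - F (fst y)) \<bullet> e n)\<^sup>2) \<le> L\<^sup>2 / lam 0 * E eps (phase_diff x y)"
proof -
  have "(\<Sum>n<m. ((F (fst x) - F (fst y)) \<bullet> e n)\<^sup>2) \<le> (norm (F (fst x) - F (fst y)))\<^sup>2" by (rule bessel)
  also have "\<dots> \<le> (L * norm (fst (phase_diff x y)))\<^sup>2" unfolding fst_phase_diff by (intro power_mono F_diff) auto
  also have "\<dots> = L\<^sup>2 / lam 0 * (lam 0 * (norm (fst (phase_diff x y)))\<^sup>2)" using lam_pos by (simp add: power_mult_distrib)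
  also have "\<dots> \<le> L\<^sup>2 / lam 0 * E eps (phase_diff x y)" using lam_pos by (intro mult_left_mono norm_sq_le_E assms) auto
  finally show ?thesis .
qed

text \<open>
  The second derivative \<open>u''\<close> for \<open>eps > 0\<close>, read off from the equation.
\<close>

definition acc :: "real \<Rightarrow> (real \<Rightarrow> 'a \<times> (nat \<Rightarrow> real)) \<Rightarrow> nat \<Rightarrow> real \<Rightarrow> real" where
  "acc eps \<xi> n t = (F (fst (\<xi> t)) \<bullet> e n - snd (\<xi> t) n - lam n * (fst (\<xi> t) \<bullet> e n)) / eps"

lemma acc_deriv:
  assumes "0 < eps" "orbit_on eps I \<xi>" "t \<in> I"
  shows "((\<lambda>\<tau>. snd (\<xi> \<tau>) n) has_real_derivative acc eps \<xi> n t) (at t within I)"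
proof -
  have "((\<lambda>\<tau>. eps * snd (\<xi> \<tau>) n / eps) has_real_derivative acc eps \<xi> n t) (at t within I)"
    unfolding acc_def by (intro DERIV_cdivide mode_eqD(2)[OF trajD(3)[OF assms(2)] assms(3)])
  then show ?thesis using assms(1) by simp
qed

lemma acc_continuous:
  assumes "0 < eps" "orbit_on eps I \<xi>" shows "continuous_on I (acc eps \<xi> n)"
proof -
  have "continuous_on I (\<lambda>t. snd (\<xi> t) n)" using acc_deriv[OF assms] by (intro DERIV_continuous_on) auto
  then show ?thesis unfolding acc_def[abs_def]
    using assms(1) by (intro continuous_intros orbit_force_continuous[OF assms(2)] trajD(1)[OF assms(2)]) auto
qed

end

text \<open>
  For the comparison \<open>0 \<in> Eps\<close>, and \<open>\<mu> > 0\<close> makes \<open>\<theta>\<close> comparable to \<open>\<mu>\<close>.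
\<close>

locale slow_manifold_family = slow_manifold e lam F L Eps N \<mu> \<Lambda> \<eta> \<delta> d K k s epsm
  for e :: "nat \<Rightarrow> 'a::{real_inner,complete_space}" and lam F L Eps N \<mu> \<Lambda> \<eta> \<delta> d K k s epsm +
  assumes mu: "0 < \<mu>" and zero_Eps: "0 \<in> Eps" and Eps_mu: "eps \<in> Eps \<Longrightarrow> 4 * eps * \<mu> \<le> 1"
begin

text \<open>
  The rate of backward growth from \<open>ancient_growth\<close>, which is better than the rate \<open>\<theta>\<close> in the
  definition of ancient orbits.
\<close>

definition al :: "real \<Rightarrow> real" where "al eps = slow_rate eps \<mu> - \<eta>"

lemma al: "eps \<in> Eps \<Longrightarrow> 0 < al eps" "eps \<in> Eps \<Longrightarrow> al eps \<le> 2 * \<mu>"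
  using rate[of eps] abs_slow_rate[OF Eps_mu, of eps] mu pos by (auto simp: al_def)

definition psq :: "real \<Rightarrow> (real \<Rightarrow> 'a \<times> (nat \<Rightarrow> real)) \<Rightarrow> real" where
  "psq eps \<xi> = (\<Sum>n<N. (P eps (\<xi> 0) n)\<^sup>2)"

lemma psq_nonneg: "0 \<le> psq eps \<xi>" by (simp add: psq_def sum_nonneg)

lemma P_origin [simp]: "P eps origin n = 0"
  by (simp add: P_def slow_coord_def origin_def)

lemma ancient_fin:
  assumes "eps \<in> Eps" "ancient eps \<xi>" shows "fin_en eps (\<xi> t)"
  by (rule energy_spaceD(1)[OF Eps_nonneg[OF assms(1)] X_subset[OF ancientD(1)[OF assms]]])

lemma ancient_orbit:
  assumes eps: "eps \<in> Eps" and \<xi>: "ancient eps \<xi>" shows "orbit_on eps {a..b} \<xi>"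
proof -
  interpret fl: semilinear_flow e lam F L eps by (rule flow[OF eps])
  have "(\<lambda>t. t + - a) ` {a..b} \<subseteq> {0..}" by auto
  then have "orbit_on eps ((\<lambda>t. t + - a) ` {a..b}) (\<lambda>t. semiflow e lam F eps t (\<xi> a))"
    by (rule traj_subset[OF fl.semiflow_orbit(1)[OF ancientD(1)[OF eps \<xi>]]])
  then have "orbit_on eps {a..b} (\<lambda>t. semiflow e lam F eps (t + - a) (\<xi> a))" by (rule orbit_shift)
  then show ?thesis by (rule orbit_cong) (use ancientD(2)[OF eps \<xi>] in auto)
qed

lemma ancient_energy_0:
  assumes eps: "eps \<in> Eps" and \<xi>: "ancient eps \<xi>"
  shows "E eps (\<xi> 0) \<le> Kc / d * psq eps \<xi>"
  using ancient_Lipschitz[OF eps \<xi> ancient_origin[OF eps], of 0] by (simp add: psq_def)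

lemma ancient_energy:
  assumes eps: "eps \<in> Eps" and \<xi>: "ancient eps \<xi>" and t: "t \<le> 0"
  shows "E eps (\<xi> t) \<le> (Kc / d)\<^sup>2 * exp (- (2 * al eps * t)) * psq eps \<xi>"
proof -
  have c: "0 < Kc / d" using Kc pos by simp
  have "E eps (\<xi> t) \<le> Kc / d * exp (- (2 * al eps * t)) * E eps (\<xi> 0)"
    using ancient_growth[OF eps \<xi> ancient_origin[OF eps] t] by (simp add: al_def)
  also have "\<dots> \<le> Kc / d * exp (- (2 * al eps * t)) * (Kc / d * psq eps \<xi>)"
    by (intro mult_left_mono ancient_energy_0 eps \<xi> mult_nonneg_nonneg less_imp_le[OF c]) simp
  also have "\<dots> = (Kc / d)\<^sup>2 * exp (- (2 * al eps * t)) * psq eps \<xi>"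
    by (simp only: power2_eq_square mult_ac)
  finally show ?thesis .
qed

lemma P_deriv:
  assumes eps: "eps \<in> Eps" and \<xi>: "orbit_on eps I \<xi>" and t: "t \<in> I" and n: "n < N"
  shows "((\<lambda>t. P eps (\<xi> t) n) has_real_derivative
    F (fst (\<xi> t)) \<bullet> e n - slow_rate eps (lam n) * P eps (\<xi> t) n) (at t within I)"
proof -
  define \<nu> where "\<nu> = slow_rate eps (lam n)"
  have l: "lam n = \<nu> - eps * \<nu>\<^sup>2"
    using slow_modes[OF eps n] slow_rate_eq[of eps "lam n"] by (simp add: \<nu>_def)
  note m = mode_eqD[OF trajD(3)[OF \<xi>, of n] t]
  have eq: "P eps (\<xi> t) n = eps * snd (\<xi> t) n + (1 - eps * \<nu>) * (fst (\<xi> t) \<bullet> e n)" for t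
    by (simp add: P_def slow_coord_def \<nu>_def)
  show ?thesis unfolding eq \<nu>_def[symmetric]
    by (rule DERIV_cong[OF DERIV_add[OF m(2) DERIV_cmult[OF m(1)]]])
      (simp add: l power2_eq_square algebra_simps)
qed

text \<open>
  Here and below the constants depend on the locale parameters only. That they are independent of
  \<open>eps\<close> is the point of all estimates of this section.
\<close>

definition CP :: real where
  "CP = 2 * (L\<^sup>2 / lam 0 + (2 * lam N)\<^sup>2 * Kc) * ((Kc / d)\<^sup>2 * exp (4 * \<mu>))"
definition Cz :: real where "Cz = Kc / d * (real N * CP)"

lemma CP_nonneg: "0 \<le> CP" "0 \<le> Cz"
  using lam_pos Kc pos by (auto simp: CP_def Cz_def)

text \<open>
  The slow coordinate satisfies \<open>p' = f - \<nu> p\<close>, whose right-hand side is bounded by the energy.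
\<close>

lemma P_increment:
  assumes eps: "eps \<in> Eps" and \<xi>: "ancient eps \<xi>" and n: "n < N" and t: "t \<le> 0" and h: "0 < h" "h \<le> 1"
  shows "(P eps (\<xi> t) n - P eps (\<xi> (t - h)) n)\<^sup>2 \<le> h\<^sup>2 * (CP * exp (- (2 * al eps * t)) * psq eps \<xi>)"
proof -
  define \<nu> where "\<nu> = slow_rate eps (lam n)"
  have tt: "t - h < t" using h by simp
  obtain \<tau> where \<tau>: "t - h < \<tau>" "\<tau> < t"
    "P eps (\<xi> t) n - P eps (\<xi> (t - h)) n = (t - (t - h)) * (F (fst (\<xi> \<tau>)) \<bullet> e n - \<nu> * P eps (\<xi> \<tau>) n)"
    by (rule increment_bound[OF tt, of "\<lambda>t. P eps (\<xi> t) n" "\<lambda>\<tau>. F (fst (\<xi> \<tau>)) \<bullet> e n - \<nu> * P eps (\<xi> \<tau>) n"])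
      (auto simp: \<nu>_def intro!: P_deriv[OF eps ancient_orbit[OF eps \<xi>] _ n])
  define f p where "f = F (fst (\<xi> \<tau>)) \<bullet> e n" and "p = P eps (\<xi> \<tau>) n"
  note fin = ancient_fin[OF eps \<xi>] and e0 = Eps_nonneg[OF eps]
  have E0: "0 \<le> E eps (\<xi> \<tau>)" by (rule E_nonneg[OF e0 fin])
  have f2: "f\<^sup>2 \<le> L\<^sup>2 / lam 0 * E eps (\<xi> \<tau>)"
  proof -
    have "f\<^sup>2 \<le> (\<Sum>k<Suc n. (F (fst (\<xi> \<tau>)) \<bullet> e k)\<^sup>2)" unfolding f_def by (intro member_le_sum) auto
    also have "\<dots> \<le> L\<^sup>2 / lam 0 * E eps (\<xi> \<tau>)"
      using force_diff_coeff_sq[OF e0, of "\<xi> \<tau>" origin "Suc n"] fin by (simp add: origin_def F_zero phase_diff_def)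
    finally show ?thesis .
  qed
  have p2: "(\<nu> * p)\<^sup>2 \<le> (2 * lam N)\<^sup>2 * Kc * E eps (\<xi> \<tau>)"
  proof -
    have "\<bar>\<nu>\<bar> \<le> 2 * \<bar>lam n\<bar>" unfolding \<nu>_def using slow_modes[OF eps n] by (intro abs_slow_rate) simp
    also have "\<dots> \<le> 2 * lam N" using lam_mono n lam_gt0[of n] by (auto simp: mono_def)
    finally have "\<nu>\<^sup>2 \<le> (2 * lam N)\<^sup>2" using power_mono[of "\<bar>\<nu>\<bar>" "2 * lam N" 2] by simp
    moreover have "p\<^sup>2 \<le> Kc * E eps (\<xi> \<tau>)"
    proof -
      have "p\<^sup>2 \<le> (\<Sum>n<N. (P eps (\<xi> \<tau>) n - P eps origin n)\<^sup>2)"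
        unfolding p_def using n member_le_sum[of n "{..<N}" "\<lambda>n. (P eps (\<xi> \<tau>) n)\<^sup>2"] by simp
      also have "\<dots> \<le> Kc * E eps (\<xi> \<tau>)" using P_bound[OF eps, of "\<xi> \<tau>" origin] fin by simp
      finally show ?thesis .
    qed
    ultimately have "\<nu>\<^sup>2 * p\<^sup>2 \<le> (2 * lam N)\<^sup>2 * (Kc * E eps (\<xi> \<tau>))" by (intro mult_mono) auto
    then show ?thesis by (simp only: power_mult_distrib mult.assoc)
  qed
  have "(f - \<nu> * p)\<^sup>2 \<le> 2 * f\<^sup>2 + 2 * (\<nu> * p)\<^sup>2" using sq_triangle[of f "\<nu> * p" 0] by simp
  also have "\<dots> \<le> 2 * (L\<^sup>2 / lam 0 * E eps (\<xi> \<tau>)) + 2 * ((2 * lam N)\<^sup>2 * Kc * E eps (\<xi> \<tau>))"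
    using f2 p2 by (intro add_mono mult_left_mono) auto
  also have "\<dots> = 2 * (L\<^sup>2 / lam 0 + (2 * lam N)\<^sup>2 * Kc) * E eps (\<xi> \<tau>)" by (simp only: distrib_left distrib_right mult.assoc)
  also have "\<dots> \<le> 2 * (L\<^sup>2 / lam 0 + (2 * lam N)\<^sup>2 * Kc) * ((Kc / d)\<^sup>2 * exp (4 * \<mu>) * exp (- (2 * al eps * t)) * psq eps \<xi>)"
  proof (intro mult_left_mono)
    have "E eps (\<xi> \<tau>) \<le> (Kc / d)\<^sup>2 * exp (- (2 * al eps * \<tau>)) * psq eps \<xi>"
      using \<tau> t by (intro ancient_energy eps \<xi>) simp
    also have "\<dots> \<le> (Kc / d)\<^sup>2 * (exp (4 * \<mu>) * exp (- (2 * al eps * t))) * psq eps \<xi>"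
    proof (intro mult_right_mono mult_left_mono psq_nonneg)
      have "al eps * (t - \<tau>) \<le> al eps * 1" using al(1)[OF eps] \<tau> h by (intro mult_left_mono) auto
      then have "- (2 * al eps * \<tau>) \<le> 4 * \<mu> + - (2 * al eps * t)" using al(2)[OF eps] by (simp add: algebra_simps)
      then show "exp (- (2 * al eps * \<tau>)) \<le> exp (4 * \<mu>) * exp (- (2 * al eps * t))" by (simp only: exp_add[symmetric] exp_le_cancel_iff)
    qed auto
    finally show "E eps (\<xi> \<tau>) \<le> (Kc / d)\<^sup>2 * exp (4 * \<mu>) * exp (- (2 * al eps * t)) * psq eps \<xi>" by (simp only: mult.assoc)
  qed (use lam_pos Kc in auto)
  finally have "(f - \<nu> * p)\<^sup>2 \<le> CP * exp (- (2 * al eps * t)) * psq eps \<xi>" by (simp only: CP_def mult.assoc)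
  then have "h\<^sup>2 * (f - \<nu> * p)\<^sup>2 \<le> h\<^sup>2 * (CP * exp (- (2 * al eps * t)) * psq eps \<xi>)" by (intro mult_left_mono) auto
  moreover have "(P eps (\<xi> t) n - P eps (\<xi> (t - h)) n)\<^sup>2 = h\<^sup>2 * (f - \<nu> * p)\<^sup>2"
    using \<tau>(3) by (simp add: f_def p_def power_mult_distrib)
  ultimately show ?thesis by simp
qed

text \<open>
  An ancient orbit and its time shift are two ancient orbits, so their distance is bounded by that
  of their slow coordinates.
\<close>

lemma increment:
  assumes eps: "eps \<in> Eps" and \<xi>: "ancient eps \<xi>" and t: "t \<le> 0" and h: "0 < h" "h \<le> 1"
  shows "E eps (phase_diff (\<xi> t) (\<xi> (t - h))) \<le> h\<^sup>2 * (Cz * exp (- (2 * al eps * t)) * psq eps \<xi>)"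
proof -
  have sh: "ancient eps (\<lambda>t. \<xi> (t - h))" using h by (intro ancient_shift[OF eps \<xi>]) simp
  have "E eps (phase_diff (\<xi> t) (\<xi> (t - h))) \<le> Kc / d * (\<Sum>n<N. (P eps (\<xi> t) n - P eps (\<xi> (t - h)) n)\<^sup>2)"
    by (rule ancient_Lipschitz[OF eps \<xi> sh])
  also have "\<dots> \<le> Kc / d * (\<Sum>n<N. h\<^sup>2 * (CP * exp (- (2 * al eps * t)) * psq eps \<xi>))"
    using Kc pos by (intro mult_left_mono sum_mono P_increment eps \<xi> t h) auto
  also have "\<dots> = h\<^sup>2 * (Cz * exp (- (2 * al eps * t)) * psq eps \<xi>)"
    by (simp add: Cz_def)
  finally show ?thesis .
qed

lemma fin_increment:
  assumes eps: "eps \<in> Eps" and \<xi>: "ancient eps \<xi>"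
  shows "fin_en eps (phase_diff (\<xi> t) (\<xi> t'))"
  by (intro fin_en_diff Eps_nonneg eps ancient_fin[OF eps \<xi>])

text \<open>
  The limit of the difference quotients: the velocity is bounded in \<open>H\<^sup>1\<close>, that is, one
  order better than the phase space suggests.
\<close>

lemma velocity_bound:
  assumes eps: "eps \<in> Eps" and \<xi>: "ancient eps \<xi>"
  shows "(\<Sum>n<m. lam n * (snd (\<xi> 0) n)\<^sup>2) \<le> Cz * psq eps \<xi>"
proof -
  have lim: "(\<lambda>j. \<Sum>n<m. lam n * ((fst (\<xi> 0) \<bullet> e n - fst (\<xi> (0 - step j)) \<bullet> e n) / step j)\<^sup>2)
      \<longlonglongrightarrow> (\<Sum>n<m. lam n * (snd (\<xi> 0) n)\<^sup>2)"
    by (intro tendsto_intros left_quotient_tendsto[of "\<lambda>t. fst (\<xi> t) \<bullet> e _" _ 0]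
        mode_eqD(1)[OF trajD(3)[OF ancient_orbit[OF eps \<xi>]]]) auto
  have "(\<Sum>n<m. lam n * ((fst (\<xi> 0) \<bullet> e n - fst (\<xi> (0 - step j)) \<bullet> e n) / step j)\<^sup>2) \<le> Cz * psq eps \<xi>" for j
  proof -
    let ?D = "phase_diff (\<xi> 0) (\<xi> (0 - step j))"
    have "(step j)\<^sup>2 * (\<Sum>n<m. lam n * ((fst (\<xi> 0) \<bullet> e n - fst (\<xi> (0 - step j)) \<bullet> e n) / step j)\<^sup>2)
        = (\<Sum>n<m. lam n * (fst ?D \<bullet> e n)\<^sup>2)"
      unfolding sum_distrib_left using step(1)[of j] by (intro sum.cong) (auto simp: power_divide inner_diff_left)
    also have "\<dots> \<le> (\<Sum>n<m. en eps ?D n)"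
      using Eps_nonneg[OF eps] by (intro sum_mono) (simp add: en_def mode_energy_def)
    also have "\<dots> \<le> E eps ?D" by (intro sum_en_le_E Eps_nonneg eps fin_increment[OF eps \<xi>]) auto
    also have "\<dots> \<le> (step j)\<^sup>2 * (Cz * psq eps \<xi>)" using increment[OF eps \<xi> _ step, of 0 j] by simp
    finally show ?thesis using step(1)[of j] by simp
  qed
  then show ?thesis by (intro LIMSEQ_le_const2[OF lim]) auto
qed

definition Ce :: real where "Ce = 2 * K * Cz / \<delta>"

text \<open>
  The term with the square of the velocity in the cone inequality, applied to an orbit and its shift
  and divided by the square of the step, bounds the difference quotients of the velocity. The rate is
  lowered by \<open>\<eta> / 2\<close> only, so that the weight still beats the growth of the boundary term at \<open>a\<close>.
\<close>

lemma acceleration_integral_bound: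
  assumes eps: "eps \<in> Eps" "0 < eps" and \<xi>: "ancient eps \<xi>" and a: "a \<le> 0"
  defines "\<theta> \<equiv> slow_rate eps \<mu> - \<eta> / 2"
  shows "integral {a..0} (\<lambda>t. exp (2 * \<theta> * t) * (\<Sum>n<M. (acc eps \<xi> n t)\<^sup>2)) \<le> Ce * psq eps \<xi>"
proof -
  define q where "q = psq eps \<xi>"
  have orb: "orbit_on eps {a'..b'} \<xi>" for a' b' by (rule ancient_orbit[OF eps(1) \<xi>])
  define D where "D j n t = (snd (\<xi> t) n - snd (\<xi> (t - step j)) n) / step j" for j n t
  define G where "G j t = exp (2 * \<theta> * t) * (\<Sum>n<M. (D j n t)\<^sup>2)" for j t
  have sh: "ancient eps (\<lambda>t. \<xi> (t - step j))" for j using step(1)[of j] by (intro ancient_shift[OF eps(1) \<xi>]) simp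
  have vc: "continuous_on {a'..b'} (\<lambda>t. snd (\<xi> t) n)" for a' b' n
    using acc_deriv[OF eps(2) orb] by (intro DERIV_continuous_on) auto
  have Dc: "continuous_on {a..0} (D j n)" for j n
    unfolding D_def[abs_def] using step(1)[of j]
    by (intro continuous_intros vc continuous_on_compose2[OF vc[of "a - 1" 0 n], of "{a..0}" "\<lambda>t. t - step j"])
      (use step[of j] in auto)
  have Gc: "G j integrable_on {a..0}" for j
    unfolding G_def[abs_def] by (intro integrable_continuous_interval continuous_intros Dc)
  have bound: "integral {a..0} (G j) \<le> Ce * q" for j
  proof -
    define w where "w t = phase_diff (\<xi> t) (\<xi> (t - step j))" for t
    have fin: "fin_en eps (w t)" for t unfolding w_def by (rule fin_increment[OF eps(1) \<xi>])
    have "\<bar>\<theta> - slow_rate eps \<mu>\<bar> \<le> \<eta>" using pos by (simp add: \<theta>_def)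
    then have "exp (2 * \<theta> * 0) * (V eps (w 0) + 0 * E eps (w 0))
        + \<delta> * integral {a..0} (\<lambda>t. exp (2 * \<theta> * t) * (\<Sum>n<M. (snd (w t) n)\<^sup>2))
        \<le> exp (2 * \<theta> * a) * (V eps (w a) + 0 * E eps (w a))"
      unfolding w_def using pos
      by (intro cone_inequality_orbits[OF eps(1) a orb ancient_orbit[OF eps(1) sh]]) auto
    moreover have "integral {a..0} (\<lambda>t. exp (2 * \<theta> * t) * (\<Sum>n<M. (snd (w t) n)\<^sup>2)) = (step j)\<^sup>2 * integral {a..0} (G j)"
    proof -
      have "exp (2 * \<theta> * t) * (\<Sum>n<M. (snd (w t) n)\<^sup>2) = (step j)\<^sup>2 * G j t" for t
        using step(1)[of j] by (simp add: G_def D_def w_def power_divide sum_divide_distrib[symmetric])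
      then show ?thesis by simp
    qed
    ultimately have 1: "\<delta> * ((step j)\<^sup>2 * integral {a..0} (G j)) \<le> exp (2 * \<theta> * a) * V eps (w a) - V eps (w 0)" by simp
    have 2: "- V eps (w 0) \<le> K * ((step j)\<^sup>2 * (Cz * q))"
    proof -
      have "E eps (w 0) \<le> (step j)\<^sup>2 * (Cz * q)" using increment[OF eps(1) \<xi> _ step, of 0 j] by (simp add: w_def q_def)
      then have "K * E eps (w 0) \<le> K * ((step j)\<^sup>2 * (Cz * q))" using pos by (intro mult_left_mono) auto
      then show ?thesis using V_abs_le[OF eps(1) fin, of 0] by linarith
    qed
    have 3: "exp (2 * \<theta> * a) * V eps (w a) \<le> K * ((step j)\<^sup>2 * (Cz * q))"
    proof -
      have "V eps (w a) \<le> K * E eps (w a)" using V_abs_le[OF eps(1) fin, of a] by linarith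
      also have "\<dots> \<le> K * ((step j)\<^sup>2 * (Cz * exp (- (2 * al eps * a)) * q))"
        using increment[OF eps(1) \<xi> a step, of j] pos unfolding w_def q_def by (intro mult_left_mono) auto
      finally have "exp (2 * \<theta> * a) * V eps (w a) \<le> exp (2 * \<theta> * a) * (K * ((step j)\<^sup>2 * (Cz * exp (- (2 * al eps * a)) * q)))"
        by (intro mult_left_mono) auto
      also have "\<dots> = (exp (2 * \<theta> * a) * exp (- (2 * al eps * a))) * (K * ((step j)\<^sup>2 * (Cz * q)))" by (simp only: mult_ac)
      also have "\<dots> \<le> 1 * (K * ((step j)\<^sup>2 * (Cz * q)))"
      proof (rule mult_right_mono)
        have "2 * \<theta> * a + - (2 * al eps * a) = \<eta> * a" by (simp add: \<theta>_def al_def algebra_simps)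
        moreover have "\<eta> * a \<le> 0" using pos a by (simp add: mult_nonneg_nonpos)
        ultimately show "exp (2 * \<theta> * a) * exp (- (2 * al eps * a)) \<le> 1" by (simp add: exp_add[symmetric])
        show "0 \<le> K * ((step j)\<^sup>2 * (Cz * q))" using pos CP_nonneg psq_nonneg by (simp add: q_def)
      qed
      finally show ?thesis by simp
    qed
    have "(step j)\<^sup>2 * (\<delta> * integral {a..0} (G j)) \<le> (step j)\<^sup>2 * (2 * K * (Cz * q))"
      using 1 2 3 by (simp add: mult_ac)
    then have "\<delta> * integral {a..0} (G j) \<le> 2 * K * (Cz * q)" using step(1)[of j] by simp
    then show ?thesis using pos by (simp add: Ce_def field_simps)
  qed
  have "\<exists>B. \<forall>t\<in>{a - 1..0}. \<bar>acc eps \<xi> n t\<bar> \<le> B" for n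
  proof -
    have "compact (acc eps \<xi> n ` {a - 1..0})" by (intro compact_continuous_image acc_continuous[OF eps(2) orb] compact_Icc)
    then have "bounded (acc eps \<xi> n ` {a - 1..0})" by (rule compact_imp_bounded)
    then show ?thesis unfolding bounded_iff by auto
  qed
  then obtain B where B: "\<And>n t. t \<in> {a - 1..0} \<Longrightarrow> \<bar>acc eps \<xi> n t\<bar> \<le> B n" by metis
  have DB: "(D j n t)\<^sup>2 \<le> (B n)\<^sup>2" if t: "t \<in> {a..0}" for j n t
  proof -
    have tt: "t - step j < t" using step(1)[of j] by simp
    obtain \<tau> where \<tau>: "t - step j < \<tau>" "\<tau> < t" "snd (\<xi> t) n - snd (\<xi> (t - step j)) n = (t - (t - step j)) * acc eps \<xi> n \<tau>"
      by (rule increment_bound[OF tt, of "\<lambda>t. snd (\<xi> t) n" "acc eps \<xi> n"]) (auto intro: acc_deriv[OF eps(2) orb])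
    then have "D j n t = acc eps \<xi> n \<tau>" using step(1)[of j] by (simp add: D_def)
    moreover have "\<tau> \<in> {a - 1..0}" using \<tau> t step(2)[of j] by auto
    ultimately have "\<bar>D j n t\<bar> \<le> B n" using B by simp
    then show ?thesis using power_mono[of "\<bar>D j n t\<bar>" "B n" 2] by simp
  qed
  have "(\<lambda>j. integral {a..0} (G j)) \<longlonglongrightarrow> integral {a..0} (\<lambda>t. exp (2 * \<theta> * t) * (\<Sum>n<M. (acc eps \<xi> n t)\<^sup>2))"
  proof (rule dominated_convergence(2)[where h = "\<lambda>t. exp (2 * \<theta> * t) * (\<Sum>n<M. (B n)\<^sup>2)"])
    show "G j integrable_on {a..0}" for j by (rule Gc)
    show "(\<lambda>t. exp (2 * \<theta> * t) * (\<Sum>n<M. (B n)\<^sup>2)) integrable_on {a..0}"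
      by (intro integrable_continuous_interval continuous_intros)
    show "norm (G j t) \<le> exp (2 * \<theta> * t) * (\<Sum>n<M. (B n)\<^sup>2)" if "t \<in> {a..0}" for j t
    proof -
      have "(\<Sum>n<M. (D j n t)\<^sup>2) \<le> (\<Sum>n<M. (B n)\<^sup>2)" by (intro sum_mono DB that)
      moreover have "0 \<le> (\<Sum>n<M. (D j n t)\<^sup>2)" by (simp add: sum_nonneg)
      ultimately show ?thesis unfolding G_def by (simp add: abs_mult)
    qed
    show "(\<lambda>j. G j t) \<longlonglongrightarrow> exp (2 * \<theta> * t) * (\<Sum>n<M. (acc eps \<xi> n t)\<^sup>2)" if "t \<in> {a..0}" for t
      unfolding G_def D_def
      by (intro tendsto_intros left_quotient_tendsto[of "\<lambda>t. snd (\<xi> t) _"] acc_deriv[OF eps(2) orb]) auto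
  qed
  then show ?thesis using bound unfolding q_def by (intro LIMSEQ_le_const2) auto
qed

definition Cr :: real where "Cr = 2 * L\<^sup>2 / (lam 0)\<^sup>2 + 2"
definition Cf :: real where "Cf = 2 * Cr * Cz"

text \<open>
  A pointwise bound in \<open>H\<^sup>-\<^sup>1\<close>. Increments \<open>w\<close> of the velocity satisfy
  \<open>eps w' + w = \<rho>\<close>, a stiff relaxation equation, with a right-hand side that is controlled by the
  energy. Over an infinite past, \<open>w\<close> is bounded by \<open>\<rho>\<close> as soon as \<open>1 / eps\<close> exceeds the growth
  rate of \<open>\<rho>\<close>; here \<open>eps\<close> has to be small.
\<close>

lemma acceleration_dual_bound:
  assumes eps: "eps \<in> Eps" "0 < eps" "16 * eps * \<mu> \<le> 1" and \<xi>: "ancient eps \<xi>"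
  shows "(\<Sum>n<m. (acc eps \<xi> n 0)\<^sup>2 / lam n) \<le> Cf * psq eps \<xi>"
proof -
  define q where "q = psq eps \<xi>"
  have q: "0 \<le> q" unfolding q_def by (rule psq_nonneg)
  have orb: "orbit_on eps {a'..b'} \<xi>" for a' b' by (rule ancient_orbit[OF eps(1) \<xi>])
  have sh: "ancient eps (\<lambda>t. \<xi> (t - step j))" for j using step(1)[of j] by (intro ancient_shift[OF eps(1) \<xi>]) simp
  have ea: "2 * eps * al eps \<le> 1 / 4"
  proof -
    have "eps * al eps \<le> eps * (2 * \<mu>)" using eps al(2)[OF eps(1)] by (intro mult_left_mono) auto
    then show ?thesis using eps(3) by simp
  qed
  have main: "(\<Sum>n<m. (snd (\<xi> 0) n - snd (\<xi> (0 - step j)) n)\<^sup>2 / lam n) \<le> (step j)\<^sup>2 * (Cf * q)" for j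
  proof -
    define w where "w t = phase_diff (\<xi> t) (\<xi> (t - step j))" for t
    define g where "g t = F (fst (\<xi> t)) - F (fst (\<xi> (t - step j)))" for t
    define Y where "Y t = (\<Sum>n<m. (snd (w t) n)\<^sup>2 / lam n)" for t
    define G where "G = Cr * ((step j)\<^sup>2 * (Cz * q))"
    have Cr: "0 \<le> Cr" by (simp add: Cr_def)
    have G: "0 \<le> G" using Cr CP_nonneg q by (simp add: G_def)
    have fin: "fin_en eps (w t)" for t unfolding w_def by (rule fin_increment[OF eps(1) \<xi>])
    note e0 = Eps_nonneg[OF eps(1)]
    define \<rho> where "\<rho> n t = g t \<bullet> e n - lam n * (fst (w t) \<bullet> e n)" for n t
    have yd: "((\<lambda>t. snd (w t) n) has_real_derivative (\<rho> n t - snd (w t) n) / eps) (at t within {a..0})" if "t \<in> {a..0}" for n t a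
    proof -
      have "((\<lambda>t. snd (w t) n) has_real_derivative (acc eps \<xi> n t - acc eps (\<lambda>t. \<xi> (t - step j)) n t)) (at t within {a..0})"
        unfolding w_def snd_phase_diff
        by (intro DERIV_diff acc_deriv[OF eps(2) orb] acc_deriv[OF eps(2) ancient_orbit[OF eps(1) sh]] that)
      then show ?thesis
        by (simp add: acc_def \<rho>_def w_def g_def inner_diff_left diff_divide_distrib[symmetric] algebra_simps)
    qed
    have rho: "(\<Sum>n<m. (\<rho> n t)\<^sup>2 / lam n) \<le> Cr * E eps (w t)" for t
    proof -
      have "(\<Sum>n<m. (\<rho> n t)\<^sup>2 / lam n) \<le> (\<Sum>n<m. 2 / lam 0 * (g t \<bullet> e n)\<^sup>2 + 2 * en eps (w t) n)"
      proof (rule sum_mono)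
        fix n
        define z where "z = lam n * (fst (w t) \<bullet> e n)"
        have "(g t \<bullet> e n - z)\<^sup>2 \<le> 2 * (g t \<bullet> e n)\<^sup>2 + 2 * z\<^sup>2" using sq_triangle[of "g t \<bullet> e n" z 0] by simp
        then have "(g t \<bullet> e n - z)\<^sup>2 / lam n \<le> (2 * (g t \<bullet> e n)\<^sup>2 + 2 * z\<^sup>2) / lam n"
          using lam_gt0[of n] by (intro divide_right_mono) auto
        also have "\<dots> = 2 * ((g t \<bullet> e n)\<^sup>2 / lam n) + 2 * (z\<^sup>2 / lam n)" by (simp add: add_divide_distrib)
        also have "z\<^sup>2 / lam n = lam n * (fst (w t) \<bullet> e n)\<^sup>2"
          using lam_gt0[of n] by (simp add: z_def power2_eq_square)
        also have "2 * \<dots> \<le> 2 * en eps (w t) n" using e0 by (simp add: en_def mode_energy_def)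
        also have "2 * ((g t \<bullet> e n)\<^sup>2 / lam n) \<le> 2 / lam 0 * (g t \<bullet> e n)\<^sup>2" using dual_le[of "g t \<bullet> e n" n] by simp
        finally show "(\<rho> n t)\<^sup>2 / lam n \<le> 2 / lam 0 * (g t \<bullet> e n)\<^sup>2 + 2 * en eps (w t) n" by (simp add: \<rho>_def z_def)
      qed
      also have "\<dots> = 2 / lam 0 * (\<Sum>n<m. (g t \<bullet> e n)\<^sup>2) + 2 * (\<Sum>n<m. en eps (w t) n)"
        by (simp only: sum.distrib sum_distrib_left)
      also have "\<dots> \<le> 2 / lam 0 * (L\<^sup>2 / lam 0 * E eps (w t)) + 2 * E eps (w t)"
      proof (intro add_mono mult_left_mono)
        show "(\<Sum>n<m. (g t \<bullet> e n)\<^sup>2) \<le> L\<^sup>2 / lam 0 * E eps (w t)"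
          unfolding g_def w_def by (rule force_diff_coeff_sq[OF e0 fin_increment[OF eps(1) \<xi>]])
      qed (use lam_pos in \<open>auto intro: sum_en_le_E e0 fin\<close>)
      also have "\<dots> = Cr * E eps (w t)" by (simp add: Cr_def power2_eq_square distrib_right)
      finally show ?thesis .
    qed
    define \<gamma> where "\<gamma> = 1 / eps - 2 * al eps"
    have \<gamma>: "0 < \<gamma>" "1 / eps \<le> 2 * \<gamma>"
    proof -
      have "2 * al eps \<le> 1 / 4 / eps" using ea eps(2) by (simp add: field_simps)
      moreover have "1 / 4 / eps = (1 / eps) / 4" by simp
      moreover have "0 < 1 / eps" using eps(2) by simp
      moreover have "2 * \<gamma> = 2 * (1 / eps) - 4 * al eps" by (simp add: \<gamma>_def)
      ultimately show "0 < \<gamma>" "1 / eps \<le> 2 * \<gamma>" by linarith+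
    qed
    (* Gronwall for Y with the integrating factor exp (t / eps). *)
    have est: "Y 0 \<le> 2 * G + exp (a / eps) * Y a" if a: "a \<le> 0" for a
    proof -
      define \<phi> where "\<phi> t = exp (t / eps) * Y t - 2 * G * exp (\<gamma> * t)" for t
      have "\<phi> 0 \<le> \<phi> a"
      proof (rule nonincreasing_within[OF a])
        fix t assume t: "t \<in> {a..0}"
        define S where "S = (\<Sum>n<m. 2 * (snd (w t) n * ((\<rho> n t - snd (w t) n) / eps)) / lam n)"
        have Yd: "(Y has_real_derivative S) (at t within {a..0})"
          unfolding Y_def S_def
        proof (intro DERIV_sum DERIV_cdivide)
          show "((\<lambda>t. (snd (w t) n)\<^sup>2) has_real_derivative 2 * (snd (w t) n * ((\<rho> n t - snd (w t) n) / eps))) (at t within {a..0})" for n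
            by (rule DERIV_cong[OF DERIV_power[OF yd[OF t]]]) simp
        qed
        have ed: "((\<lambda>t. exp (t / eps)) has_real_derivative exp (t / eps) * (1 / eps)) (at t within {a..0})"
          "((\<lambda>t. 2 * G * exp (\<gamma> * t)) has_real_derivative 2 * G * (\<gamma> * exp (\<gamma> * t))) (at t within {a..0})"
          using eps(2) by (auto intro!: derivative_eq_intros)
        show "(\<phi> has_real_derivative (exp (t / eps) * (1 / eps) * Y t + S * exp (t / eps)) - 2 * G * (\<gamma> * exp (\<gamma> * t))) (at t within {a..0})"
          unfolding \<phi>_def by (intro DERIV_diff DERIV_mult ed Yd)
        have "S \<le> (\<Sum>n<m. 1 / eps * ((\<rho> n t)\<^sup>2 / lam n) - 1 / eps * ((snd (w t) n)\<^sup>2 / lam n))"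
          unfolding S_def
        proof (rule sum_mono)
          fix n
          define y r where "y = snd (w t) n" and "r = \<rho> n t"
          have "2 * (y * (r - y)) \<le> r\<^sup>2 - y\<^sup>2"
            using zero_le_power2[of "r - y"] by (simp add: power2_eq_square algebra_simps)
          then have "2 * (y * (r - y)) / (eps * lam n) \<le> (r\<^sup>2 - y\<^sup>2) / (eps * lam n)"
            using eps(2) lam_gt0[of n] by (intro divide_right_mono) auto
          then show "2 * (snd (w t) n * ((\<rho> n t - snd (w t) n) / eps)) / lam n \<le>
              1 / eps * ((\<rho> n t)\<^sup>2 / lam n) - 1 / eps * ((snd (w t) n)\<^sup>2 / lam n)"
            by (simp add: y_def r_def diff_divide_distrib[symmetric])
        qed
        also have "\<dots> = 1 / eps * (\<Sum>n<m. (\<rho> n t)\<^sup>2 / lam n) - 1 / eps * Y t"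
          by (simp only: sum_subtractf sum_distrib_left Y_def)
        also have "\<dots> \<le> 1 / eps * (G * exp (- (2 * al eps * t))) - 1 / eps * Y t"
        proof (intro diff_right_mono mult_left_mono)
          have "(\<Sum>n<m. (\<rho> n t)\<^sup>2 / lam n) \<le> Cr * E eps (w t)" by (rule rho)
          also have "\<dots> \<le> Cr * ((step j)\<^sup>2 * (Cz * exp (- (2 * al eps * t)) * q))"
            using Cr increment[OF eps(1) \<xi> _ step, of t j] t unfolding w_def q_def by (intro mult_left_mono) auto
          also have "\<dots> = G * exp (- (2 * al eps * t))" by (simp only: G_def mult_ac)
          finally show "(\<Sum>n<m. (\<rho> n t)\<^sup>2 / lam n) \<le> G * exp (- (2 * al eps * t))" .
        qed (use eps(2) in simp)
        finally have "exp (t / eps) * S \<le> exp (t / eps) * (1 / eps * (G * exp (- (2 * al eps * t))) - 1 / eps * Y t)"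
          by (intro mult_left_mono) auto
        also have "\<dots> = (exp (t / eps) * exp (- (2 * al eps * t))) * (1 / eps * G) - exp (t / eps) * (1 / eps) * Y t"
          by (simp only: right_diff_distrib mult_ac)
        also have "exp (t / eps) * exp (- (2 * al eps * t)) = exp (\<gamma> * t)"
          by (simp add: exp_add[symmetric] \<gamma>_def algebra_simps)
        finally have 1: "exp (t / eps) * S \<le> exp (\<gamma> * t) * (1 / eps * G) - exp (t / eps) * (1 / eps) * Y t" .
        have "1 / eps * G \<le> 2 * \<gamma> * G" using G \<gamma> by (intro mult_right_mono) auto
        then have "exp (\<gamma> * t) * (1 / eps * G) \<le> exp (\<gamma> * t) * (2 * \<gamma> * G)" by (intro mult_left_mono) auto
        moreover have "exp (\<gamma> * t) * (2 * \<gamma> * G) = 2 * G * (\<gamma> * exp (\<gamma> * t))" by (simp only: mult_ac)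
        moreover have "S * exp (t / eps) = exp (t / eps) * S" by (rule mult.commute)
        ultimately show "(exp (t / eps) * (1 / eps) * Y t + S * exp (t / eps)) - 2 * G * (\<gamma> * exp (\<gamma> * t)) \<le> 0"
          using 1 by linarith
      qed
      moreover have "0 \<le> 2 * G * exp (\<gamma> * a)" using G by simp
      ultimately show ?thesis by (simp add: \<phi>_def)
    qed
    have "Y 0 \<le> 2 * G"
    proof (rule le_if_exp_decay[where M = 0 and q = \<gamma> and c = "(step j)\<^sup>2 * (Cz * q) / (eps * lam 0)", OF \<gamma>(1)])
      fix n :: nat
      have "Y (- real n) \<le> E eps (w (- real n)) / (eps * lam 0)"
      proof -
        have "Y (- real n) \<le> (\<Sum>k<m. en eps (w (- real n)) k / (eps * lam 0))"
          unfolding Y_def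
        proof (rule sum_mono)
          fix k
          have "(snd (w (- real n)) k)\<^sup>2 / lam k \<le> (snd (w (- real n)) k)\<^sup>2 / lam 0" by (rule dual_le)
          also have "\<dots> = (eps * (snd (w (- real n)) k)\<^sup>2) / (eps * lam 0)" using eps(2) by simp
          also have "\<dots> \<le> en eps (w (- real n)) k / (eps * lam 0)"
            using eps(2) lam_pos lam_gt0[of k] by (intro divide_right_mono) (auto simp: en_def mode_energy_def)
          finally show "(snd (w (- real n)) k)\<^sup>2 / lam k \<le> en eps (w (- real n)) k / (eps * lam 0)" .
        qed
        also have "\<dots> \<le> E eps (w (- real n)) / (eps * lam 0)"
          unfolding sum_divide_distrib[symmetric] using eps(2) lam_pos
          by (intro divide_right_mono sum_en_le_E e0 fin) auto
        finally show ?thesis .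
      qed
      also have "\<dots> \<le> (step j)\<^sup>2 * (Cz * exp (- (2 * al eps * (- real n))) * q) / (eps * lam 0)"
        using increment[OF eps(1) \<xi> _ step, of "- real n" j] eps(2) lam_pos unfolding w_def q_def
        by (intro divide_right_mono) auto
      finally have "exp (- real n / eps) * Y (- real n) \<le>
          exp (- real n / eps) * ((step j)\<^sup>2 * (Cz * exp (- (2 * al eps * (- real n))) * q) / (eps * lam 0))"
        by (intro mult_left_mono) auto
      also have "\<dots> = (step j)\<^sup>2 * (Cz * q) / (eps * lam 0) * (exp (- real n / eps) * exp (- (2 * al eps * (- real n))))"
        by simp
      also have "exp (- real n / eps) * exp (- (2 * al eps * (- real n))) = exp (- (\<gamma> * real n))"
        by (simp add: exp_add[symmetric] \<gamma>_def algebra_simps)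
      finally show "Y 0 \<le> 2 * G + (step j)\<^sup>2 * (Cz * q) / (eps * lam 0) * exp (- (\<gamma> * real n))"
        using est[of "- real n"] by simp
    qed
    moreover have "2 * G = (step j)\<^sup>2 * (Cf * q)" by (simp add: G_def Cf_def)
    ultimately show ?thesis by (simp add: Y_def w_def)
  qed
  have lim: "(\<lambda>j. \<Sum>n<m. ((snd (\<xi> 0) n - snd (\<xi> (0 - step j)) n) / step j)\<^sup>2 / lam n) \<longlonglongrightarrow> (\<Sum>n<m. (acc eps \<xi> n 0)\<^sup>2 / lam n)"
    by (intro tendsto_intros left_quotient_tendsto[of "\<lambda>t. snd (\<xi> t) _" _ 0] acc_deriv[OF eps(2) orb]
        less_imp_neq[OF lam_gt0, symmetric]) auto
  have "(\<Sum>n<m. ((snd (\<xi> 0) n - snd (\<xi> (0 - step j)) n) / step j)\<^sup>2 / lam n) \<le> Cf * q" for j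
  proof -
    have "(step j)\<^sup>2 * (\<Sum>n<m. ((snd (\<xi> 0) n - snd (\<xi> (0 - step j)) n) / step j)\<^sup>2 / lam n)
        = (\<Sum>n<m. (snd (\<xi> 0) n - snd (\<xi> (0 - step j)) n)\<^sup>2 / lam n)"
      unfolding sum_distrib_left using step(1)[of j] by (intro sum.cong) (auto simp: power_divide)
    then have "(step j)\<^sup>2 * (\<Sum>n<m. ((snd (\<xi> 0) n - snd (\<xi> (0 - step j)) n) / step j)\<^sup>2 / lam n) \<le> (step j)\<^sup>2 * (Cf * q)"
      using main[of j] by simp
    then show ?thesis using step(1)[of j] by simp
  qed
  then show ?thesis unfolding q_def by (intro LIMSEQ_le_const2[OF lim]) auto
qed

end

lemma young_sq:
  fixes a b \<tau> :: real
  assumes "0 < \<tau>" shows "(a - b)\<^sup>2 \<le> (1 + \<tau>) * a\<^sup>2 + (1 + 1 / \<tau>) * b\<^sup>2"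
proof -
  have "(1 + \<tau>) * a\<^sup>2 + (1 + 1 / \<tau>) * b\<^sup>2 - (a - b)\<^sup>2 = (\<tau> * a + b)\<^sup>2 / \<tau>"
    using assms by (simp add: power2_eq_square field_simps)
  moreover have "0 \<le> (\<tau> * a + b)\<^sup>2 / \<tau>" using assms by simp
  ultimately show ?thesis by linarith
qed

lemma slow_rate_close:
  assumes "0 \<le> eps" "4 * eps * x \<le> 1" shows "slow_rate eps x \<le> x + 4 * eps * x\<^sup>2"
proof -
  have "(slow_rate eps x)\<^sup>2 \<le> (2 * x)\<^sup>2" using power_mono[OF abs_slow_rate[OF assms(2)], of 2] by (simp add: power_mult_distrib)
  then have "eps * (slow_rate eps x)\<^sup>2 \<le> eps * (2 * x)\<^sup>2" using assms(1) by (rule mult_left_mono)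
  moreover have "eps * (2 * x)\<^sup>2 = 4 * eps * x\<^sup>2" by (simp add: power_mult_distrib)
  ultimately show ?thesis using slow_rate_eq[OF assms(2)] by linarith
qed

lemma slow_rate_ge:
  assumes "0 \<le> eps" "0 \<le> x" "4 * eps * x \<le> 1" shows "x \<le> slow_rate eps x"
proof -
  have "0 \<le> eps * (slow_rate eps x)\<^sup>2" using assms by simp
  then show ?thesis using slow_rate_eq[OF assms(3)] by linarith
qed

context semilinear begin

lemma fin_en_zero:
  assumes "0 \<le> eps" "fin_en eps x" shows "fin_en 0 x" "E 0 x \<le> E eps x"
proof -
  have le: "en 0 x n \<le> en eps x n" for n using assms(1) by (simp add: en_def mode_energy_def)
  show f: "fin_en 0 x" unfolding fin_en_def
    by (rule summable_comparison_test'[OF assms(2)[unfolded fin_en_def], of 0]) (simp add: le en_nonneg)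
  show "E 0 x \<le> E eps x" unfolding E_def using f assms(2) by (intro suminf_le le) (auto simp: fin_en_def)
qed

text \<open>
  The difference of an orbit for \<open>eps\<close> and one for \<open>0\<close> solves the parabolic equation with the
  additional force \<open>- eps u''\<close>.
\<close>

lemma relaxed_orbit_forced:
  assumes eps: "0 < eps" and \<xi>: "orbit_on eps I \<xi>" and \<zeta>: "orbit_on 0 I \<zeta>"
  shows "mode_eq 0 (lam n) I (\<lambda>t. fst (phase_diff (\<xi> t) (\<zeta> t)) \<bullet> e n) (\<lambda>t. snd (phase_diff (\<xi> t) (\<zeta> t)) n)
    (\<lambda>t. (F (fst (\<xi> t)) - F (fst (\<zeta> t))) \<bullet> e n - eps * acc eps \<xi> n t)"
  unfolding mode_eq_def
proof (intro ballI conjI impI)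
  fix t assume t: "t \<in> I"
  note m1 = mode_eqD[OF trajD(3)[OF \<xi>, of n] t] and m2 = mode_eqD[OF trajD(3)[OF \<zeta>, of n] t]
  show "((\<lambda>t. fst (phase_diff (\<xi> t) (\<zeta> t)) \<bullet> e n) has_real_derivative snd (phase_diff (\<xi> t) (\<zeta> t)) n) (at t within I)"
    unfolding fst_phase_diff snd_phase_diff inner_diff_left by (intro DERIV_diff m1(1) m2(1))
  show z: "(F (fst (\<xi> t)) - F (fst (\<zeta> t))) \<bullet> e n - eps * acc eps \<xi> n t - snd (phase_diff (\<xi> t) (\<zeta> t)) n
      - lam n * (fst (phase_diff (\<xi> t) (\<zeta> t)) \<bullet> e n) = 0"
  proof -
    have "eps * acc eps \<xi> n t = F (fst (\<xi> t)) \<bullet> e n - snd (\<xi> t) n - lam n * (fst (\<xi> t) \<bullet> e n)"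
      using eps by (simp add: acc_def)
    then show ?thesis using m2(3) by (simp add: inner_diff_left algebra_simps)
  qed
  show "((\<lambda>\<tau>. 0 * snd (phase_diff (\<xi> \<tau>) (\<zeta> \<tau>)) n) has_real_derivative
      (F (fst (\<xi> t)) - F (fst (\<zeta> t))) \<bullet> e n - eps * acc eps \<xi> n t - snd (phase_diff (\<xi> t) (\<zeta> t)) n
      - lam n * (fst (phase_diff (\<xi> t) (\<zeta> t)) \<bullet> e n)) (at t within I)"
    unfolding z by simp
qed

end

context slow_manifold_family begin

text \<open>
  The two bounds are what \<open>acceleration_dual_bound\<close> and \<open>zero_energy_comparison\<close> require; the latter
  needs \<open>slow_rate eps \<mu> \<le> \<mu> + \<eta> / 2\<close>.
\<close>

definition eps0 :: real where "eps0 = min (1 / (16 * \<mu>)) (\<eta> / (8 * \<mu>\<^sup>2))"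

lemma eps0: "0 < eps0" "eps \<le> eps0 \<Longrightarrow> 16 * eps * \<mu> \<le> 1" "eps \<le> eps0 \<Longrightarrow> 8 * eps * \<mu>\<^sup>2 \<le> \<eta>"
proof -
  show "0 < eps0" using mu pos by (simp add: eps0_def)
  show "16 * eps * \<mu> \<le> 1" if "eps \<le> eps0"
  proof -
    have "eps \<le> 1 / (16 * \<mu>)" using that by (simp add: eps0_def)
    then show ?thesis using mu by (simp add: pos_le_divide_eq mult_ac)
  qed
  show "8 * eps * \<mu>\<^sup>2 \<le> \<eta>" if "eps \<le> eps0"
  proof -
    have "eps \<le> \<eta> / (8 * \<mu>\<^sup>2)" using that by (simp add: eps0_def)
    then show ?thesis using mu by (simp add: pos_le_divide_eq mult_ac)
  qed
qed

text \<open>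
  The weight in Young's inequality with which \<open>L\<close> may be enlarged to \<open>\<Lambda>\<close> at the expense of a
  factor \<open>Ct\<close> in front of the force \<open>- eps u''\<close>.
\<close>

definition \<tau>0 :: real where "\<tau>0 = (\<Lambda>\<^sup>2 - L\<^sup>2) / (L\<^sup>2 + 1)"

lemma \<tau>0: "0 < \<tau>0" "(1 + \<tau>0) * L\<^sup>2 \<le> \<Lambda>\<^sup>2"
proof -
  have "L\<^sup>2 < \<Lambda>\<^sup>2" using L_nonneg L_less by (intro power_strict_mono) auto
  then have g: "0 < \<Lambda>\<^sup>2 - L\<^sup>2" by simp
  have p: "0 < L\<^sup>2 + 1" by (simp add: add_nonneg_pos)
  show t: "0 < \<tau>0" unfolding \<tau>0_def by (rule divide_pos_pos[OF g p])
  have "\<tau>0 * (L\<^sup>2 + 1) = \<Lambda>\<^sup>2 - L\<^sup>2" using p by (simp add: \<tau>0_def)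
  then show "(1 + \<tau>0) * L\<^sup>2 \<le> \<Lambda>\<^sup>2" using t by (simp add: distrib_left distrib_right)
qed

definition Ct :: real where "Ct = 1 + 1 / \<tau>0"
definition Cs :: real where "Cs = 2 * ((2 * lam N)\<^sup>2 / lam 0 * (Kc / d) + Cz / lam 0)"
definition Cg :: real where "Cg = (k * (Ct * Ce) + K * Cs) / d"

definition Ch :: real where "Ch = 3 / lam 0 * (L\<^sup>2 / lam 0 * Cg) + 3 * Cg + 3 * Cf"
definition Cfar :: real where "Cfar = (\<bar>epsm\<bar> / lam 0 + 1 / (lam 0)\<^sup>2) * (4 * Cz) + 4 * (Kc / d)"

lemma constants_nonneg: "0 \<le> Ct" "0 \<le> Cs" "0 \<le> Ce" "0 \<le> Cg" "0 \<le> Cf"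
proof -
  show t: "0 \<le> Ct" unfolding Ct_def using \<tau>0(1) by simp
  show s: "0 \<le> Cs" unfolding Cs_def using CP_nonneg Kc pos lam_pos by simp
  show e: "0 \<le> Ce" unfolding Ce_def using CP_nonneg pos by simp
  show "0 \<le> Cg" unfolding Cg_def using t s e pos by simp
  show "0 \<le> Cf" unfolding Cf_def Cr_def using CP_nonneg by simp
qed

text \<open>
  The slow coordinates for \<open>eps\<close> and for \<open>0\<close> differ by \<open>eps (\<nu> u - v)\<close>. So points with equal
  coordinates, each for its own \<open>eps\<close>, need not have equal coordinates for \<open>eps = 0\<close>.
\<close>

lemma initial_slow_coord_defect:
  assumes eps: "eps \<in> Eps" and \<xi>: "ancient eps \<xi>"
  shows "(\<Sum>n<N. (P 0 (\<xi> 0) n - P eps (\<xi> 0) n)\<^sup>2) \<le> eps\<^sup>2 * (Cs * psq eps \<xi>)"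
proof -
  note e0 = Eps_nonneg[OF eps] and fin = ancient_fin[OF eps \<xi>]
  define A where "A = (2 * lam N)\<^sup>2 / lam 0"
  have A: "0 \<le> A" using lam_pos by (simp add: A_def)
  have "(P 0 (\<xi> 0) n - P eps (\<xi> 0) n)\<^sup>2 \<le> 2 * eps\<^sup>2 * (A * en eps (\<xi> 0) n + 1 / lam 0 * (lam n * (snd (\<xi> 0) n)\<^sup>2))"
    if n: "n < N" for n
  proof -
    define \<nu> u v where "\<nu> = slow_rate eps (lam n)" and "u = fst (\<xi> 0) \<bullet> e n" and "v = snd (\<xi> 0) n"
    have "\<bar>\<nu>\<bar> \<le> 2 * \<bar>lam n\<bar>" unfolding \<nu>_def using slow_modes[OF eps n] by (intro abs_slow_rate) simp
    also have "\<dots> \<le> 2 * lam N" using lam_mono n lam_gt0[of n] by (auto simp: mono_def)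
    finally have nu: "\<nu>\<^sup>2 \<le> (2 * lam N)\<^sup>2" using power_mono[of "\<bar>\<nu>\<bar>" "2 * lam N" 2] by simp
    have "P 0 (\<xi> 0) n - P eps (\<xi> 0) n = eps * (\<nu> * u - v)"
      by (simp add: P_def slow_coord_def \<nu>_def u_def v_def algebra_simps)
    then have "(P 0 (\<xi> 0) n - P eps (\<xi> 0) n)\<^sup>2 = eps\<^sup>2 * (\<nu> * u - v)\<^sup>2" by (simp add: power_mult_distrib)
    also have "\<dots> \<le> eps\<^sup>2 * (2 * (\<nu> * u)\<^sup>2 + 2 * v\<^sup>2)"
      using sq_triangle[of "\<nu> * u" v 0] by (intro mult_left_mono) auto
    also have "\<dots> \<le> eps\<^sup>2 * (2 * (A * en eps (\<xi> 0) n) + 2 * (1 / lam 0 * (lam n * v\<^sup>2)))"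
    proof (intro mult_left_mono add_mono)
      have u2: "lam 0 * u\<^sup>2 \<le> en eps (\<xi> 0) n"
      proof -
        have "lam 0 * u\<^sup>2 \<le> lam n * u\<^sup>2" by (intro mult_right_mono lam0_le) auto
        then show ?thesis using e0 by (simp add: en_def mode_energy_def u_def add_increasing)
      qed
      have "(\<nu> * u)\<^sup>2 \<le> (2 * lam N)\<^sup>2 * u\<^sup>2" unfolding power_mult_distrib[of \<nu>] by (intro mult_right_mono nu) auto
      also have "\<dots> = A * (lam 0 * u\<^sup>2)" using lam_pos by (simp add: A_def)
      also have "\<dots> \<le> A * en eps (\<xi> 0) n" by (intro mult_left_mono u2 A)
      finally show "(\<nu> * u)\<^sup>2 \<le> A * en eps (\<xi> 0) n" .
      have "lam 0 * v\<^sup>2 \<le> lam n * v\<^sup>2" by (intro mult_right_mono lam0_le) auto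
      then show "v\<^sup>2 \<le> 1 / lam 0 * (lam n * v\<^sup>2)" using lam_pos by (simp add: pos_le_divide_eq mult.commute)
    qed auto
    also have "\<dots> = 2 * eps\<^sup>2 * (A * en eps (\<xi> 0) n + 1 / lam 0 * (lam n * v\<^sup>2))" by (simp only: distrib_left mult_ac)
    finally show ?thesis by (simp add: v_def)
  qed
  then have "(\<Sum>n<N. (P 0 (\<xi> 0) n - P eps (\<xi> 0) n)\<^sup>2) \<le>
      (\<Sum>n<N. 2 * eps\<^sup>2 * (A * en eps (\<xi> 0) n + 1 / lam 0 * (lam n * (snd (\<xi> 0) n)\<^sup>2)))" by (intro sum_mono) auto
  also have "\<dots> = 2 * eps\<^sup>2 * (A * (\<Sum>n<N. en eps (\<xi> 0) n) + 1 / lam 0 * (\<Sum>n<N. lam n * (snd (\<xi> 0) n)\<^sup>2))"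
    by (simp only: sum_distrib_left[symmetric] sum.distrib)
  also have "\<dots> \<le> 2 * eps\<^sup>2 * (A * (Kc / d * psq eps \<xi>) + 1 / lam 0 * (Cz * psq eps \<xi>))"
  proof (intro mult_left_mono add_mono A velocity_bound[OF eps \<xi>])
    have "(\<Sum>n<N. en eps (\<xi> 0) n) \<le> E eps (\<xi> 0)" by (intro sum_en_le_E e0 fin) auto
    also have "\<dots> \<le> Kc / d * psq eps \<xi>" by (rule ancient_energy_0[OF eps \<xi>])
    finally show "(\<Sum>n<N. en eps (\<xi> 0) n) \<le> Kc / d * psq eps \<xi>" .
  qed (use lam_pos in auto)
  also have "\<dots> = eps\<^sup>2 * (Cs * psq eps \<xi>)" by (simp add: Cs_def A_def algebra_simps)
  finally show ?thesis .
qed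

context
  fixes eps \<xi> \<zeta>
  assumes eps: "eps \<in> Eps" "0 < eps" and \<xi>: "ancient eps \<xi>" and \<zeta>: "ancient 0 \<zeta>"
    and P_eq: "\<And>n. n < N \<Longrightarrow> P eps (\<xi> 0) n = P 0 (\<zeta> 0) n"
begin

lemma psq_eq: "psq 0 \<zeta> = psq eps \<xi>"
  using P_eq by (simp add: psq_def)

lemma fin_zero: "fin_en 0 (\<xi> t)" "fin_en 0 (\<zeta> t)" "fin_en 0 (phase_diff (\<xi> t) (\<zeta> t))"
proof -
  show f: "fin_en 0 (\<xi> t)" "fin_en 0 (\<zeta> t)"
    by (rule fin_en_zero(1)[OF Eps_nonneg[OF eps(1)] ancient_fin[OF eps(1) \<xi>]], rule ancient_fin[OF zero_Eps \<zeta>])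
  show "fin_en 0 (phase_diff (\<xi> t) (\<zeta> t))" by (rule fin_en_diff(1)[OF order_refl f])
qed

lemma zero_energy_diff_le: "E 0 (phase_diff (\<xi> t) (\<zeta> t)) \<le> 2 * E eps (\<xi> t) + 2 * E 0 (\<zeta> t)"
  using fin_en_diff(2)[OF order_refl fin_zero(1,2)[of t]]
    fin_en_zero(2)[OF Eps_nonneg[OF eps(1)] ancient_fin[OF eps(1) \<xi>], of t] by linarith

text \<open>
  The cone inequality for \<open>eps = 0\<close> on \<open>[a, 0]\<close> with rate \<open>\<mu>\<close>. The boundary term at \<open>a\<close> vanishes as
  \<open>a\<close> tends to \<open>-\<infinity>\<close>, since both orbits grow more slowly; the additional force contributes
  \<open>eps\<^sup>2\<close> times \<open>acceleration_integral_bound\<close>; and at time \<open>0\<close> the defect of the slow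
  coordinates is of order \<open>eps\<close> as well.
\<close>

lemma zero_energy_comparison:
  assumes small: "eps \<le> eps0"
  shows "E 0 (phase_diff (\<xi> 0) (\<zeta> 0)) \<le> Cg * (eps\<^sup>2 * psq eps \<xi>)"
proof -
  define q w g where "q = psq eps \<xi>" and "w = (\<lambda>t. phase_diff (\<xi> t) (\<zeta> t))"
    and "g = (\<lambda>t. F (fst (\<xi> t)) - F (fst (\<zeta> t)))"
  have q: "0 \<le> q" unfolding q_def by (rule psq_nonneg)
  have o1: "orbit_on eps {a..b} \<xi>" and o2: "orbit_on 0 {a..b} \<zeta>" for a b
    by (rule ancient_orbit[OF eps(1) \<xi>], rule ancient_orbit[OF zero_Eps \<zeta>])
  define H where "H m t = \<Lambda>\<^sup>2 * (norm (fst (w t)))\<^sup>2 + Ct * eps\<^sup>2 * (\<Sum>n<m. (acc eps \<xi> n t)\<^sup>2)" for m t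
  define B where "B = Ct * eps\<^sup>2 * (Ce * q)"
  have close: "slow_rate eps \<mu> - \<eta> / 2 \<le> \<mu>"
    using slow_rate_close[OF Eps_nonneg[OF eps(1)] Eps_mu[OF eps(1)]] eps0(3)[OF small] by linarith
  have Hbound: "(\<Sum>n<m. (g t \<bullet> e n - eps * acc eps \<xi> n t)\<^sup>2) \<le> H m t" for m t
  proof -
    have "(\<Sum>n<m. (g t \<bullet> e n - eps * acc eps \<xi> n t)\<^sup>2)
        \<le> (\<Sum>n<m. (1 + \<tau>0) * (g t \<bullet> e n)\<^sup>2 + Ct * eps\<^sup>2 * (acc eps \<xi> n t)\<^sup>2)"
    proof (rule sum_mono)
      show "(g t \<bullet> e n - eps * acc eps \<xi> n t)\<^sup>2 \<le> (1 + \<tau>0) * (g t \<bullet> e n)\<^sup>2 + Ct * eps\<^sup>2 * (acc eps \<xi> n t)\<^sup>2" for n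
        using young_sq[OF \<tau>0(1), of "g t \<bullet> e n" "eps * acc eps \<xi> n t"]
        unfolding Ct_def[symmetric] power_mult_distrib by (simp only: mult.assoc)
    qed
    also have "\<dots> = (1 + \<tau>0) * (\<Sum>n<m. (g t \<bullet> e n)\<^sup>2) + Ct * eps\<^sup>2 * (\<Sum>n<m. (acc eps \<xi> n t)\<^sup>2)"
      by (simp only: sum_distrib_left sum.distrib)
    also have "(1 + \<tau>0) * (\<Sum>n<m. (g t \<bullet> e n)\<^sup>2) \<le> (1 + \<tau>0) * (L * norm (fst (w t)))\<^sup>2"
    proof (rule mult_left_mono)
      have "(\<Sum>n<m. (g t \<bullet> e n)\<^sup>2) \<le> (norm (g t))\<^sup>2" by (rule bessel)
      also have "\<dots> \<le> (L * norm (fst (w t)))\<^sup>2" unfolding g_def w_def fst_phase_diff by (intro power_mono F_diff) auto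
      finally show "(\<Sum>n<m. (g t \<bullet> e n)\<^sup>2) \<le> (L * norm (fst (w t)))\<^sup>2" .
    qed (use \<tau>0(1) in simp)
    also have "(1 + \<tau>0) * (L * norm (fst (w t)))\<^sup>2 = ((1 + \<tau>0) * L\<^sup>2) * (norm (fst (w t)))\<^sup>2"
      by (simp only: power_mult_distrib mult.assoc)
    also have "\<dots> \<le> \<Lambda>\<^sup>2 * (norm (fst (w t)))\<^sup>2" by (intro mult_right_mono \<tau>0) auto
    finally show ?thesis by (simp add: H_def)
  qed
  have wc: "continuous_on {a..0} (\<lambda>t. fst (w t))" for a
    unfolding w_def fst_phase_diff by (intro continuous_intros trajD(1)[OF o1] trajD(1)[OF o2])
  have Hc: "continuous_on {a..0} (H m)" for a m
    unfolding H_def[abs_def] by (intro continuous_intros wc acc_continuous[OF eps(2) o1])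
  have Bbound: "integral {a..0} (\<lambda>t. exp (2 * \<mu> * t) * (H m t - \<Lambda>\<^sup>2 * (norm (fst (w t)))\<^sup>2)) \<le> B" if a: "a \<le> 0" for a m
  proof -
    define \<theta> where "\<theta> = slow_rate eps \<mu> - \<eta> / 2"
    define Z where "Z t = (\<Sum>n<m. (acc eps \<xi> n t)\<^sup>2)" for t
    have Zc: "continuous_on {a..0} Z" unfolding Z_def[abs_def] by (intro continuous_intros acc_continuous[OF eps(2) o1])
    have "integral {a..0} (\<lambda>t. exp (2 * \<mu> * t) * (H m t - \<Lambda>\<^sup>2 * (norm (fst (w t)))\<^sup>2))
        \<le> integral {a..0} (\<lambda>t. Ct * eps\<^sup>2 * (exp (2 * \<theta> * t) * Z t))"
    proof (rule integral_le)
      show "(\<lambda>t. exp (2 * \<mu> * t) * (H m t - \<Lambda>\<^sup>2 * (norm (fst (w t)))\<^sup>2)) integrable_on {a..0}"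
        "(\<lambda>t. Ct * eps\<^sup>2 * (exp (2 * \<theta> * t) * Z t)) integrable_on {a..0}"
        by (intro integrable_continuous_interval continuous_on_mult continuous_on_diff continuous_on_power
            continuous_on_norm continuous_on_exp continuous_on_const continuous_on_id Hc wc Zc)+
      fix t assume t: "t \<in> {a..0}"
      have "\<mu> * t \<le> \<theta> * t" using close t by (intro mult_right_mono_neg) (auto simp: \<theta>_def)
      then have "exp (2 * \<mu> * t) \<le> exp (2 * \<theta> * t)" by simp
      moreover have "0 \<le> Ct * eps\<^sup>2 * Z t" using constants_nonneg by (simp add: Z_def sum_nonneg)
      ultimately have "exp (2 * \<mu> * t) * (Ct * eps\<^sup>2 * Z t) \<le> exp (2 * \<theta> * t) * (Ct * eps\<^sup>2 * Z t)" by (rule mult_right_mono)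
      also have "\<dots> = Ct * eps\<^sup>2 * (exp (2 * \<theta> * t) * Z t)" by (simp only: mult_ac)
      finally show "exp (2 * \<mu> * t) * (H m t - \<Lambda>\<^sup>2 * (norm (fst (w t)))\<^sup>2) \<le> Ct * eps\<^sup>2 * (exp (2 * \<theta> * t) * Z t)"
        by (simp add: H_def Z_def)
    qed
    also have "\<dots> = Ct * eps\<^sup>2 * integral {a..0} (\<lambda>t. exp (2 * \<theta> * t) * Z t)" by simp
    also have "\<dots> \<le> B" unfolding B_def Z_def \<theta>_def q_def using constants_nonneg
      by (intro mult_left_mono acceleration_integral_bound eps \<xi> a) auto
    finally show ?thesis .
  qed
  have Vstep: "V 0 (w 0) \<le> k * B + exp (2 * \<mu> * a) * V 0 (w a)" if a: "a \<le> 0" for a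
  proof -
    have "exp (2 * \<mu> * 0) * (V 0 (w 0) + 0 * E 0 (w 0))
        + \<delta> * integral {a..0} (\<lambda>t. exp (2 * \<mu> * t) * (\<Sum>n<0. (snd (w t) n)\<^sup>2))
        \<le> exp (2 * \<mu> * a) * (V 0 (w a) + 0 * E 0 (w a)) + k * B"
    proof (rule cone_inequality[where h = "\<lambda>t n. g t \<bullet> e n - eps * acc eps \<xi> n t" and H = H, OF zero_Eps a])
      show "mode_eq 0 (lam n) {a..0} (\<lambda>t. fst (w t) \<bullet> e n) (\<lambda>t. snd (w t) n) (\<lambda>t. g t \<bullet> e n - eps * acc eps \<xi> n t)" for n
        unfolding w_def g_def by (rule relaxed_orbit_forced[OF eps(2) o1 o2])
      show "continuous_on {a..0} (\<lambda>t. fst (w t))" by (rule wc)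
      show "fin_en 0 (w a)" "fin_en 0 (w 0)" unfolding w_def by (rule fin_zero(3))+
      show "\<bar>\<mu> - slow_rate 0 \<mu>\<bar> \<le> \<eta>" "\<bar>0\<bar> \<le> d" using pos by simp_all
      show "(\<Sum>n<m. (g t \<bullet> e n - eps * acc eps \<xi> n t)\<^sup>2) \<le> H m t" for m t by (rule Hbound)
      show "continuous_on {a..0} (H m)" for m by (rule Hc)
      show "integral {a..0} (\<lambda>t. exp (2 * \<mu> * t) * (H m t - \<Lambda>\<^sup>2 * (norm (fst (w t)))\<^sup>2)) \<le> B" for m by (rule Bbound[OF a])
    qed simp
    then show ?thesis by simp
  qed
  have decay: "exp (2 * \<mu> * a) * V 0 (w a) \<le> K * (4 * (Kc / d)\<^sup>2 * q) * exp (\<eta> * a)" if a: "a \<le> 0" for a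
  proof -
    define c where "c = (Kc / d)\<^sup>2 * q"
    have c: "0 \<le> c" using q by (simp add: c_def)
    have r1: "exp (2 * \<mu> * a) * exp (- (2 * al eps * a)) \<le> exp (\<eta> * a)"
    proof -
      have "(2 * \<mu> - 2 * al eps) * a \<le> \<eta> * a" using close a by (intro mult_right_mono_neg) (auto simp: al_def)
      then show ?thesis by (simp add: exp_add[symmetric] algebra_simps)
    qed
    have r2: "exp (2 * \<mu> * a) * exp (- (2 * al 0 * a)) \<le> exp (\<eta> * a)"
    proof -
      have "(2 * \<mu> - 2 * al 0) * a \<le> \<eta> * a" using a pos by (intro mult_right_mono_neg) (auto simp: al_def)
      then show ?thesis by (simp add: exp_add[symmetric] algebra_simps)
    qed
    have "V 0 (w a) \<le> K * E 0 (w a)"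
      using V_abs_le[OF zero_Eps fin_zero(3)[of a]] unfolding w_def by linarith
    also have "\<dots> \<le> K * (2 * (c * exp (- (2 * al eps * a))) + 2 * (c * exp (- (2 * al 0 * a))))"
    proof (rule mult_left_mono)
      have "E eps (\<xi> a) \<le> c * exp (- (2 * al eps * a))"
        using ancient_energy[OF eps(1) \<xi> a] by (simp add: c_def q_def mult_ac)
      moreover have "E 0 (\<zeta> a) \<le> c * exp (- (2 * al 0 * a))"
        using ancient_energy[OF zero_Eps \<zeta> a] by (simp add: c_def q_def psq_eq mult_ac)
      ultimately show "E 0 (w a) \<le> 2 * (c * exp (- (2 * al eps * a))) + 2 * (c * exp (- (2 * al 0 * a)))"
        using zero_energy_diff_le[of a] unfolding w_def by linarith
    qed (use pos in simp)
    finally have "exp (2 * \<mu> * a) * V 0 (w a) \<le>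
        exp (2 * \<mu> * a) * (K * (2 * (c * exp (- (2 * al eps * a))) + 2 * (c * exp (- (2 * al 0 * a)))))"
      by (intro mult_left_mono) auto
    also have "\<dots> = 2 * K * c * (exp (2 * \<mu> * a) * exp (- (2 * al eps * a))) + 2 * K * c * (exp (2 * \<mu> * a) * exp (- (2 * al 0 * a)))"
      by (simp only: distrib_left mult_ac)
    also have "\<dots> \<le> 2 * K * c * exp (\<eta> * a) + 2 * K * c * exp (\<eta> * a)"
      using c pos by (intro add_mono mult_left_mono r1 r2) auto
    also have "\<dots> = K * (4 * (Kc / d)\<^sup>2 * q) * exp (\<eta> * a)" by (simp add: c_def)
    finally show ?thesis .
  qed
  have "V 0 (w 0) \<le> k * B"
  proof (rule le_if_exp_decay[OF pos(1)])
    show "V 0 (w 0) \<le> k * B + K * (4 * (Kc / d)\<^sup>2 * q) * exp (- (\<eta> * real n))" for n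
      using Vstep[of "- real n"] decay[of "- real n"] by simp
  qed
  moreover have "d * E 0 (w 0) - K * (\<Sum>n<N. (P 0 (w 0) n)\<^sup>2) \<le> V 0 (w 0)"
    unfolding w_def by (rule V_lower[OF zero_Eps fin_zero(3)])
  moreover have "K * (\<Sum>n<N. (P 0 (w 0) n)\<^sup>2) \<le> K * (eps\<^sup>2 * (Cs * q))"
    using initial_slow_coord_defect[OF eps(1) \<xi>] pos unfolding w_def q_def
    by (intro mult_left_mono) (simp_all add: P_diff P_eq)
  ultimately have "d * E 0 (w 0) \<le> k * B + K * (eps\<^sup>2 * (Cs * q))" by linarith
  also have "\<dots> = (k * (Ct * Ce) + K * Cs) * (eps\<^sup>2 * q)" unfolding B_def by algebra
  also have "\<dots> = d * (Cg * (eps\<^sup>2 * q))" using pos by (simp add: Cg_def)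
  finally show ?thesis using pos by (simp add: w_def q_def)
qed

lemma velocity_diff_bound: "(\<Sum>n<m. lam n * (snd (\<xi> 0) n - snd (\<zeta> 0) n)\<^sup>2) \<le> 4 * Cz * psq eps \<xi>"
proof -
  have "(\<Sum>n<m. lam n * (snd (\<xi> 0) n - snd (\<zeta> 0) n)\<^sup>2)
      \<le> (\<Sum>n<m. 2 * (lam n * (snd (\<xi> 0) n)\<^sup>2) + 2 * (lam n * (snd (\<zeta> 0) n)\<^sup>2))"
  proof (rule sum_mono)
    fix n
    have "lam n * (snd (\<xi> 0) n - snd (\<zeta> 0) n)\<^sup>2 \<le> lam n * (2 * (snd (\<xi> 0) n)\<^sup>2 + 2 * (snd (\<zeta> 0) n)\<^sup>2)"
      using lam_gt0[of n] sq_triangle[of "snd (\<xi> 0) n" "snd (\<zeta> 0) n" 0] by (intro mult_left_mono) auto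
    then show "lam n * (snd (\<xi> 0) n - snd (\<zeta> 0) n)\<^sup>2 \<le> 2 * (lam n * (snd (\<xi> 0) n)\<^sup>2) + 2 * (lam n * (snd (\<zeta> 0) n)\<^sup>2)"
      by (simp add: algebra_simps)
  qed
  also have "\<dots> = 2 * (\<Sum>n<m. lam n * (snd (\<xi> 0) n)\<^sup>2) + 2 * (\<Sum>n<m. lam n * (snd (\<zeta> 0) n)\<^sup>2)"
    by (simp only: sum_distrib_left sum.distrib)
  also have "\<dots> \<le> 4 * Cz * psq eps \<xi>"
    using velocity_bound[OF eps(1) \<xi>, of m] velocity_bound[OF zero_Eps \<zeta>, of m] unfolding psq_eq by linarith
  finally show ?thesis .
qed

text \<open>
  Equation and force bound the difference of the velocities in \<open>H\<^sup>-\<^sup>1\<close>.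
\<close>

lemma velocity_dual_comparison:
  assumes small: "eps \<le> eps0"
  shows "(\<Sum>n<m. (snd (\<xi> 0) n - snd (\<zeta> 0) n)\<^sup>2 / lam n) \<le> Ch * (eps\<^sup>2 * psq eps \<xi>)"
proof -
  define w g where "w = phase_diff (\<xi> 0) (\<zeta> 0)" and "g = F (fst (\<xi> 0)) - F (fst (\<zeta> 0))"
  define q where "q = psq eps \<xi>"
  have o1: "orbit_on eps {0..0} \<xi>" and o2: "orbit_on 0 {0..0} \<zeta>"
    by (rule ancient_orbit[OF eps(1) \<xi>], rule ancient_orbit[OF zero_Eps \<zeta>])
  note fin = fin_zero(3)[of 0]
  have E0: "E 0 w \<le> Cg * (eps\<^sup>2 * q)" unfolding w_def q_def by (rule zero_energy_comparison[OF small])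
  have "(snd (\<xi> 0) n - snd (\<zeta> 0) n)\<^sup>2 / lam n \<le>
      3 / lam 0 * (g \<bullet> e n)\<^sup>2 + 3 * en 0 w n + 3 * eps\<^sup>2 * ((acc eps \<xi> n 0)\<^sup>2 / lam n)" for n
  proof -
    define z r where "z = lam n * (fst w \<bullet> e n)" and "r = eps * acc eps \<xi> n 0"
    have "snd (\<xi> 0) n - snd (\<zeta> 0) n = g \<bullet> e n - z - r"
      using mode_eqD(3)[OF relaxed_orbit_forced[OF eps(2) o1 o2], of 0 n] by (simp add: z_def r_def g_def w_def)
    then have "(snd (\<xi> 0) n - snd (\<zeta> 0) n)\<^sup>2 \<le> 3 * (g \<bullet> e n)\<^sup>2 + 3 * z\<^sup>2 + 3 * r\<^sup>2"
      using sq_combination[of 1 "g \<bullet> e n" z r] by simp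
    then have "(snd (\<xi> 0) n - snd (\<zeta> 0) n)\<^sup>2 / lam n \<le> (3 * (g \<bullet> e n)\<^sup>2 + 3 * z\<^sup>2 + 3 * r\<^sup>2) / lam n"
      using lam_gt0[of n] by (intro divide_right_mono) auto
    also have "\<dots> = 3 * ((g \<bullet> e n)\<^sup>2 / lam n) + 3 * (z\<^sup>2 / lam n) + 3 * (r\<^sup>2 / lam n)" by (simp add: add_divide_distrib)
    also have "z\<^sup>2 / lam n = en 0 w n" using lam_gt0[of n] by (simp add: z_def en_def mode_energy_def power2_eq_square)
    also have "r\<^sup>2 / lam n = eps\<^sup>2 * ((acc eps \<xi> n 0)\<^sup>2 / lam n)" by (simp add: r_def power_mult_distrib)
    also have "3 * ((g \<bullet> e n)\<^sup>2 / lam n) \<le> 3 / lam 0 * (g \<bullet> e n)\<^sup>2" using dual_le[of "g \<bullet> e n" n] by simp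
    finally show ?thesis by simp
  qed
  then have "(\<Sum>n<m. (snd (\<xi> 0) n - snd (\<zeta> 0) n)\<^sup>2 / lam n) \<le>
      (\<Sum>n<m. 3 / lam 0 * (g \<bullet> e n)\<^sup>2 + 3 * en 0 w n + 3 * eps\<^sup>2 * ((acc eps \<xi> n 0)\<^sup>2 / lam n))" by (rule sum_mono)
  also have "\<dots> = 3 / lam 0 * (\<Sum>n<m. (g \<bullet> e n)\<^sup>2) + 3 * (\<Sum>n<m. en 0 w n) + 3 * eps\<^sup>2 * (\<Sum>n<m. (acc eps \<xi> n 0)\<^sup>2 / lam n)"
    by (simp only: sum_distrib_left sum.distrib)
  also have "\<dots> \<le> 3 / lam 0 * (L\<^sup>2 / lam 0 * (Cg * (eps\<^sup>2 * q))) + 3 * (Cg * (eps\<^sup>2 * q)) + 3 * eps\<^sup>2 * (Cf * q)"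
  proof (intro add_mono mult_left_mono)
    have "(\<Sum>n<m. (g \<bullet> e n)\<^sup>2) \<le> L\<^sup>2 / lam 0 * E 0 w"
      unfolding g_def w_def by (rule force_diff_coeff_sq[OF order_refl fin])
    also have "\<dots> \<le> L\<^sup>2 / lam 0 * (Cg * (eps\<^sup>2 * q))" using lam_pos by (intro mult_left_mono E0) auto
    finally show "(\<Sum>n<m. (g \<bullet> e n)\<^sup>2) \<le> L\<^sup>2 / lam 0 * (Cg * (eps\<^sup>2 * q))" .
    have "(\<Sum>n<m. en 0 w n) \<le> E 0 w" unfolding w_def by (intro sum_en_le_E order_refl fin) auto
    then show "(\<Sum>n<m. en 0 w n) \<le> Cg * (eps\<^sup>2 * q)" using E0 by (rule order_trans)
    show "(\<Sum>n<m. (acc eps \<xi> n 0)\<^sup>2 / lam n) \<le> Cf * q"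
      unfolding q_def by (rule acceleration_dual_bound[OF eps eps0(2)[OF small] \<xi>])
  qed (use lam_pos in auto)
  also have "\<dots> = Ch * (eps\<^sup>2 * q)" by (simp add: Ch_def algebra_simps)
  finally show ?thesis by (simp add: q_def)
qed

text \<open>
  The term \<open>eps |v|\<^sup>2\<close> is interpolated: \<open>eps \<le> eps\<^sup>2 l + 1 / l\<close>, where \<open>l v\<^sup>2\<close> is bounded
  and \<open>v\<^sup>2 / l\<close> has just been shown to be of order \<open>eps\<^sup>2\<close>.
\<close>

lemma comparison_near:
  assumes small: "eps \<le> eps0"
  shows "(\<Sum>n<m. en eps (phase_diff (\<xi> 0) (\<zeta> 0)) n + (snd (\<xi> 0) n - snd (\<zeta> 0) n)\<^sup>2 / lam n)
    \<le> (4 * Cz + 2 * Ch + Cg) * (eps\<^sup>2 * psq eps \<xi>)"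
proof -
  define w v where "w = phase_diff (\<xi> 0) (\<zeta> 0)" and "v n = snd (\<xi> 0) n - snd (\<zeta> 0) n" for n
  have "en eps w n + (v n)\<^sup>2 / lam n \<le> eps\<^sup>2 * (lam n * (v n)\<^sup>2) + 2 * ((v n)\<^sup>2 / lam n) + en 0 w n" for n
  proof -
    have l: "0 < lam n" by (rule lam_gt0)
    have "eps \<le> eps\<^sup>2 * lam n + 1 / lam n"
    proof -
      have "0 \<le> (eps * lam n - 1)\<^sup>2 + eps * lam n" using l eps(2) by simp
      then have "eps * lam n \<le> (eps\<^sup>2 * lam n + 1 / lam n) * lam n"
        using l by (simp add: power2_eq_square algebra_simps)
      then show ?thesis using l by (rule mult_right_le_imp_le)
    qed
    then have "eps * (v n)\<^sup>2 \<le> (eps\<^sup>2 * lam n + 1 / lam n) * (v n)\<^sup>2" by (intro mult_right_mono) auto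
    then show ?thesis by (simp add: en_def mode_energy_def w_def v_def distrib_right mult.assoc)
  qed
  then have "(\<Sum>n<m. en eps w n + (v n)\<^sup>2 / lam n) \<le> (\<Sum>n<m. eps\<^sup>2 * (lam n * (v n)\<^sup>2) + 2 * ((v n)\<^sup>2 / lam n) + en 0 w n)"
    by (rule sum_mono)
  also have "\<dots> = eps\<^sup>2 * (\<Sum>n<m. lam n * (v n)\<^sup>2) + 2 * (\<Sum>n<m. (v n)\<^sup>2 / lam n) + (\<Sum>n<m. en 0 w n)"
    by (simp only: sum_distrib_left sum.distrib)
  also have "\<dots> \<le> eps\<^sup>2 * (4 * Cz * psq eps \<xi>) + 2 * (Ch * (eps\<^sup>2 * psq eps \<xi>)) + Cg * (eps\<^sup>2 * psq eps \<xi>)"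
  proof (intro add_mono mult_left_mono)
    show "(\<Sum>n<m. lam n * (v n)\<^sup>2) \<le> 4 * Cz * psq eps \<xi>" unfolding v_def by (rule velocity_diff_bound)
    show "(\<Sum>n<m. (v n)\<^sup>2 / lam n) \<le> Ch * (eps\<^sup>2 * psq eps \<xi>)" unfolding v_def by (rule velocity_dual_comparison[OF small])
    have "(\<Sum>n<m. en 0 w n) \<le> E 0 w" unfolding w_def by (intro sum_en_le_E order_refl fin_zero) auto
    then show "(\<Sum>n<m. en 0 w n) \<le> Cg * (eps\<^sup>2 * psq eps \<xi>)"
      unfolding w_def by (rule order_trans) (rule zero_energy_comparison[OF small])
  qed auto
  also have "\<dots> = (4 * Cz + 2 * Ch + Cg) * (eps\<^sup>2 * psq eps \<xi>)" by (simp add: algebra_simps)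
  finally show ?thesis by (simp only: w_def v_def)
qed

text \<open>
  A bound without a power of \<open>eps\<close>, which suffices for \<open>eps\<close> bounded away from \<open>0\<close>.
\<close>

lemma comparison_far:
  "(\<Sum>n<m. en eps (phase_diff (\<xi> 0) (\<zeta> 0)) n + (snd (\<xi> 0) n - snd (\<zeta> 0) n)\<^sup>2 / lam n) \<le> Cfar * psq eps \<xi>"
proof -
  define w v where "w = phase_diff (\<xi> 0) (\<zeta> 0)" and "v n = snd (\<xi> 0) n - snd (\<zeta> 0) n" for n
  define A where "A = \<bar>epsm\<bar> / lam 0 + 1 / (lam 0)\<^sup>2"
  have A: "0 \<le> A" using lam_pos by (simp add: A_def)
  have "en eps w n + (v n)\<^sup>2 / lam n \<le> A * (lam n * (v n)\<^sup>2) + en 0 w n" for n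
  proof -
    have v: "(v n)\<^sup>2 \<le> lam n * (v n)\<^sup>2 / lam 0"
    proof -
      have "lam 0 * (v n)\<^sup>2 \<le> lam n * (v n)\<^sup>2" by (intro mult_right_mono lam0_le) auto
      then show ?thesis using lam_pos by (simp add: pos_le_divide_eq mult.commute)
    qed
    have "eps * (v n)\<^sup>2 \<le> \<bar>epsm\<bar> * (lam n * (v n)\<^sup>2 / lam 0)"
      using v Eps_le[OF eps(1)] eps(2) by (intro mult_mono) auto
    moreover have "(v n)\<^sup>2 / lam n \<le> (lam n * (v n)\<^sup>2 / lam 0) / lam 0"
      using dual_le[of "v n" n] divide_right_mono[OF v, of "lam 0"] lam_pos by simp
    ultimately have "eps * (v n)\<^sup>2 + (v n)\<^sup>2 / lam n \<le> A * (lam n * (v n)\<^sup>2)"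
      by (simp add: A_def distrib_right power2_eq_square)
    then show ?thesis by (simp add: en_def mode_energy_def w_def v_def)
  qed
  then have "(\<Sum>n<m. en eps w n + (v n)\<^sup>2 / lam n) \<le> (\<Sum>n<m. A * (lam n * (v n)\<^sup>2) + en 0 w n)"
    by (rule sum_mono)
  also have "\<dots> = A * (\<Sum>n<m. lam n * (v n)\<^sup>2) + (\<Sum>n<m. en 0 w n)"
    by (simp only: sum_distrib_left sum.distrib)
  also have "\<dots> \<le> A * (4 * Cz * psq eps \<xi>) + 4 * (Kc / d) * psq eps \<xi>"
  proof (intro add_mono mult_left_mono A)
    show "(\<Sum>n<m. lam n * (v n)\<^sup>2) \<le> 4 * Cz * psq eps \<xi>" unfolding v_def by (rule velocity_diff_bound)
    have "(\<Sum>n<m. en 0 w n) \<le> E 0 w" unfolding w_def by (intro sum_en_le_E order_refl fin_zero) auto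
    moreover have "E 0 (\<zeta> 0) \<le> Kc / d * psq eps \<xi>" using ancient_energy_0[OF zero_Eps \<zeta>] unfolding psq_eq .
    ultimately show "(\<Sum>n<m. en 0 w n) \<le> 4 * (Kc / d) * psq eps \<xi>"
      using zero_energy_diff_le[of 0] ancient_energy_0[OF eps(1) \<xi>] unfolding w_def by linarith
  qed
  also have "\<dots> = Cfar * psq eps \<xi>" by (simp add: Cfar_def A_def algebra_simps)
  finally show ?thesis by (simp only: w_def v_def)
qed

end

theorem manifold_lipschitz_at_zero: "lipschitz_at_zero e lam F N Eps manifold"
proof -
  define C where "C = (4 * Cz + 2 * Ch + Cg) + Cfar / eps0\<^sup>2"
  have nn: "0 \<le> 4 * Cz + 2 * Ch + Cg" "0 \<le> Cfar"
    using CP_nonneg constants_nonneg lam_pos Kc pos by (simp_all add: Ch_def Cfar_def)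
  have C: "0 \<le> C" using nn by (simp add: C_def)
  have main: "phase_diff (param eps p) (param 0 p) \<in> energy_space e lam eps \<and>
      energy_dist e lam eps (param eps p) (param 0 p) \<le> sqrt C * eps * norm p" if eps: "eps \<in> Eps" for eps p
  proof -
    note e0 = Eps_nonneg[OF eps]
    have le: "(\<Sum>n<m. en eps (phase_diff (param eps p) (param 0 p)) n + (snd (param eps p) n - snd (param 0 p) n)\<^sup>2 / lam n)
        \<le> C * (eps\<^sup>2 * (norm p)\<^sup>2)" for m
    proof (cases "eps = 0")
      case True
      then show ?thesis by (simp add: en_def mode_energy_def)
    next
      case False
      then have eps': "0 < eps" using e0 by simp
      note o1 = orb(1)[OF eps, of p] and o2 = orb(1)[OF zero_Eps, of p]
      define S where "S = (\<Sum>n<m. en eps (phase_diff (param eps p) (param 0 p)) n + (snd (param eps p) n - snd (param 0 p) n)\<^sup>2 / lam n)"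
      define q where "q = psq eps (orb eps p)"
      have eq: "P eps (orb eps p 0) n = P 0 (orb 0 p 0) n" if "n < N" for n
        using orb(2)[OF eps that] orb(2)[OF zero_Eps that] by simp
      have q: "0 \<le> q" "q \<le> (norm p)\<^sup>2"
        unfolding q_def using bessel[of p N] by (simp_all add: psq_def orb(2)[OF eps] sum_nonneg)
      have "S \<le> C * (eps\<^sup>2 * q)"
      proof (cases "eps \<le> eps0")
        case True
        have "S \<le> (4 * Cz + 2 * Ch + Cg) * (eps\<^sup>2 * q)"
          unfolding S_def q_def param_def by (rule comparison_near[OF eps eps' o1 o2 eq True])
        also have "\<dots> \<le> C * (eps\<^sup>2 * q)" using q nn by (intro mult_right_mono) (auto simp: C_def)
        finally show ?thesis .
      next
        case False
        have "S \<le> Cfar * q" unfolding S_def q_def param_def by (rule comparison_far[OF eps eps' o1 o2 eq])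
        also have "\<dots> = Cfar / eps0\<^sup>2 * (eps0\<^sup>2 * q)" using eps0(1) by simp
        also have "\<dots> \<le> Cfar / eps0\<^sup>2 * (eps\<^sup>2 * q)"
          using False eps0(1) q nn by (intro mult_left_mono mult_right_mono power_mono) auto
        also have "\<dots> \<le> C * (eps\<^sup>2 * q)" using q nn by (intro mult_right_mono) (auto simp: C_def)
        finally show ?thesis .
      qed
      also have "\<dots> \<le> C * (eps\<^sup>2 * (norm p)\<^sup>2)" using C q by (intro mult_left_mono) auto
      finally show ?thesis unfolding S_def .
    qed
    have "energy_dist e lam eps (param eps p) (param 0 p) \<le> sqrt C * eps * norm p"
    proof (rule power2_le_imp_le)
      show "(energy_dist e lam eps (param eps p) (param 0 p))\<^sup>2 \<le> (sqrt C * eps * norm p)\<^sup>2"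
        using energy_dist_from_partial(2)[OF e0 le] C by (simp add: power_mult_distrib mult.assoc)
      show "0 \<le> sqrt C * eps * norm p" using C e0 by simp
    qed
    then show ?thesis using energy_dist_from_partial(1)[OF e0 le] by blast
  qed
  show ?thesis unfolding lipschitz_at_zero_def
    by (intro exI[of _ param] exI[of _ "sqrt C"] ballI conjI lipschitz_param manifold_eq) (auto simp: main)
qed

end

section \<open>The spectral gap condition\<close>

lemma cone_bounds_smaller_rate:
  "cone_bounds L \<mu> \<eta> \<delta> d K k eps l s \<Longrightarrow> \<eta>' \<le> \<eta> \<Longrightarrow> cone_bounds L \<mu> \<eta>' \<delta> d K k eps l s"
  unfolding cone_bounds_def by (meson order_trans)

lemma cone_system_exists:
  fixes Eps :: "real set"
  assumes sl: "semilinear e lam F L" and cp: "cone_params \<Lambda> \<sigma> \<kappa> l0 epsm b0" and L: "L < \<Lambda>" and r: "0 < r"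
    and adm: "\<And>eps n. eps \<in> Eps \<Longrightarrow> cone_params.admissible \<mu> \<sigma> \<kappa> l0 epsm b0 eps (lam n) (s n)"
    and nonneg: "\<And>eps. eps \<in> Eps \<Longrightarrow> 0 \<le> eps"
    and sgn: "\<And>n. n < N \<Longrightarrow> s n < 0" "\<And>n. N \<le> n \<Longrightarrow> 0 < s n"
  shows "\<exists>\<eta> \<delta> d K k. \<eta> \<le> r \<and> cone_system e lam F L Eps N \<mu> \<Lambda> \<eta> \<delta> d K k s"
proof -
  obtain \<eta> \<delta> d K k where c: "0 < \<eta>" "0 < \<delta>" "0 < d" "0 < K" "0 < k"
    "\<And>eps l s. cone_params.admissible \<mu> \<sigma> \<kappa> l0 epsm b0 eps l s \<Longrightarrow> cone_bounds \<Lambda> \<mu> \<eta> \<delta> d K k eps l s"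
    by (rule cone_params.cone_bounds_uniform[OF cp]) (rule that)
  define \<eta>' where "\<eta>' = min \<eta> r"
  have "cone_bounds \<Lambda> \<mu> \<eta>' \<delta> d K k eps (lam n) (s n)" if "eps \<in> Eps" for eps n
    by (rule cone_bounds_smaller_rate[OF c(6)[OF adm[OF that]]]) (simp add: \<eta>'_def)
  then have "cone_system e lam F L Eps N \<mu> \<Lambda> \<eta>' \<delta> d K k s"
    using c r L nonneg sgn by (intro cone_system.intro[OF sl] cone_system_axioms.intro) (auto simp: \<eta>'_def)
  moreover have "\<eta>' \<le> r" by (simp add: \<eta>'_def)
  ultimately show ?thesis by blast
qed

text \<open>
  The cone parameters around \<open>\<mu> = - (L + 3)\<close>: all eigenvalues lie above \<open>\<mu> + \<kappa>\<close>, and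
  \<open>1 - 4 eps \<mu> - 2 eps \<sigma> \<ge> 1\<close> for every \<open>eps\<close>.
\<close>

lemma semilinear_flow_exists:
  assumes sl: "semilinear e lam F L" and eps: "0 \<le> eps"
  shows "semilinear_flow e lam F L eps"
proof -
  interpret semilinear e lam F L by (rule sl)
  note L0 = L_nonneg
  have cp: "cone_params (L + 1) (L + 2) (L + 3) (lam 0) eps 1"
    using L0 lam_pos eps by unfold_locales auto
  have "\<exists>\<eta> \<delta> d K k. \<eta> \<le> 1 \<and> cone_system e lam F L {eps} 0 (- (L + 3)) (L + 1) \<eta> \<delta> d K k (\<lambda>_. L + 2)"
  proof (rule cone_system_exists[OF sl cp])
    fix eps' n assume "eps' \<in> {eps}"
    moreover have "0 \<le> eps * (2 * L + 8)" using L0 eps by simp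
    ultimately show "cone_params.admissible (- (L + 3)) (L + 2) (L + 3) (lam 0) eps 1 eps' (lam n) (L + 2)"
      using eps lam0_le[of n] lam_gt0[of n] by (simp add: cone_params.admissible_def[OF cp] algebra_simps)
  qed (use L0 eps in auto)
  then obtain \<eta> \<delta> d K k where "cone_system e lam F L {eps} 0 (- (L + 3)) (L + 1) \<eta> \<delta> d K k (\<lambda>_. L + 2)" by blast
  then show ?thesis by (rule cone_system.flow_if_no_slow_modes) auto
qed

theorem theorem1p1:
  fixes A F :: "'a::{real_inner, complete_space} \<Rightarrow> 'a" and D :: "'a set"
    and e :: "nat \<Rightarrow> 'a" and lam :: "nat \<Rightarrow> real" and L :: real and N :: nat
  assumes "self_adjoint_on D A" and "positive_on D A" and "has_compact_inverse D A"
    and "eigensystem D A e lam"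
    and "L-lipschitz_on UNIV F" and "F 0 = 0"
    and "N \<ge> 1"
    and "lam N - lam (N - 1) > 2 * L"
  defines "E \<equiv> {\<epsilon>::real. \<epsilon> = 0 \<or> (\<epsilon> > 0 \<and> 1 / \<epsilon> \<ge> 3 * lam N + lam (N - 1))}"
  shows "\<exists>M :: real \<Rightarrow> ('a \<times> (nat \<Rightarrow> real)) set.
           (\<forall>\<epsilon>\<in>E. inertial_manifold e lam F N \<epsilon> (M \<epsilon>)) \<and>
           lipschitz_at_zero e lam F N E M"
proof -
  have co: "complete_orthonormal e" and ev: "e n \<in> D" "A (e n) = lam n *\<^sub>R e n" and mono: "mono lam" for n
    using assms(4) by (auto simp: eigensystem_def)
  have e1: "e 0 \<bullet> e 0 = 1" using co by (simp add: complete_orthonormal_def)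
  then have "e 0 \<noteq> 0" by auto
  then have "A (e 0) \<bullet> e 0 > 0" using assms(2) ev(1) by (auto simp: positive_on_def)
  then have lam0: "0 < lam 0" using ev(2) e1 by simp
  have sl: "semilinear e lam F L" by unfold_locales (use co mono lam0 assms(5,6) in auto)
  note lam_gt0 = semilinear.lam_gt0[OF sl] and lam0_le = semilinear.lam0_le[OF sl]
    and L_nonneg = semilinear.L_nonneg[OF sl]
  define lo up where "lo = lam (N - 1)" and "up = lam N"
  define \<mu> \<kappa> where "\<mu> = (up + lo) / 2" and "\<kappa> = (up - lo) / 2"
  (* The numbers L < \<Lambda> < \<sigma> < \<kappa> are equally spaced. *)
  define \<Lambda> \<sigma> Q where "\<Lambda> = (2 * L + \<kappa>) / 3" and "\<sigma> = (L + 2 * \<kappa>) / 3" and "Q = 3 * up + lo"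
  have lo: "0 < lo" "lo \<le> up" using lam_gt0 mono by (auto simp: lo_def up_def mono_def)
  have L\<kappa>: "L < \<kappa>" "0 \<le> L" using assms(8) L_nonneg by (auto simp: \<kappa>_def lo_def up_def)
  have order: "0 < \<Lambda>" "L < \<Lambda>" "\<Lambda> < \<sigma>" "\<sigma> < \<kappa>" using L\<kappa> by (auto simp: \<Lambda>_def \<sigma>_def)
  have mu: "0 < \<mu>" using lo by (simp add: \<mu>_def)
  have Q: "Q = 4 * \<mu> + 2 * \<kappa>" "0 < Q" using lo by (auto simp: Q_def \<mu>_def \<kappa>_def field_simps)
  (* As \<epsilon> \<le> 1 / Q and Q = 4 \<mu> + 2 \<kappa>, the margin 1 - \<epsilon> (4 \<mu> + 2 \<sigma>) is smallest
     at \<epsilon> = 1 / Q, where it equals b0. *)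
  define b0 s where "b0 = 2 * (\<kappa> - \<sigma>) / Q" and "s n = (if n < N then - \<sigma> else \<sigma>)" for n :: nat
  have E: "0 \<le> \<epsilon>" "\<epsilon> \<le> 1 / Q" if "\<epsilon> \<in> E" for \<epsilon>
  proof -
    show "0 \<le> \<epsilon>" using that by (auto simp: E_def)
    show "\<epsilon> \<le> 1 / Q"
    proof (cases "\<epsilon> = 0")
      case False
      then have "0 < \<epsilon>" "Q \<le> 1 / \<epsilon>" using that by (auto simp: E_def Q_def lo_def up_def)
      then show ?thesis using Q(2) by (simp add: field_simps)
    qed (use Q(2) in simp)
  qed
  have cp: "cone_params \<Lambda> \<sigma> \<kappa> (lam 0) (1 / Q) b0"
    by unfold_locales (use order lam0 Q(2) in \<open>auto simp: b0_def\<close>)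
  have eb: "\<epsilon> * (4 * \<mu> + 2 * \<sigma>) \<le> 1 - b0" if "\<epsilon> \<in> E" for \<epsilon>
  proof -
    have "\<epsilon> * (4 * \<mu> + 2 * \<sigma>) \<le> 1 / Q * (4 * \<mu> + 2 * \<sigma>)" using E(2)[OF that] mu order by (intro mult_right_mono) auto
    also have "\<dots> = 1 / Q * (Q - 2 * (\<kappa> - \<sigma>))" by (simp add: Q(1))
    also have "\<dots> = 1 - b0" using Q(2) by (simp add: b0_def diff_divide_distrib)
    finally show ?thesis .
  qed
  have e\<mu>: "4 * \<epsilon> * \<mu> \<le> 1" if "\<epsilon> \<in> E" for \<epsilon>
  proof -
    have "0 \<le> \<epsilon> * \<sigma>" "0 < b0" using E(1)[OF that] order Q(2) by (auto simp: b0_def)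
    then show ?thesis using eb[OF that] by (simp add: distrib_left)
  qed
  have adm: "cone_params.admissible \<mu> \<sigma> \<kappa> (lam 0) (1 / Q) b0 \<epsilon> (lam n) (s n)" if "\<epsilon> \<in> E" for \<epsilon> n
  proof -
    have "b0 \<le> 1 - 4 * \<epsilon> * \<mu> - 2 * \<epsilon> * \<sigma>" using eb[OF that] by (simp add: algebra_simps)
    moreover have "s n = \<sigma> \<and> \<kappa> \<le> lam n - \<mu> \<or> s n = - \<sigma> \<and> \<kappa> \<le> \<mu> - lam n"
    proof (cases "n < N")
      case True
      then have "lam n \<le> lo" unfolding lo_def by (intro monoD[OF mono]) simp
      then show ?thesis using True by (simp add: s_def \<kappa>_def \<mu>_def field_simps)
    next
      case False
      then have "up \<le> lam n" unfolding up_def by (intro monoD[OF mono]) simp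
      then show ?thesis using False by (simp add: s_def \<kappa>_def \<mu>_def field_simps)
    qed
    ultimately show ?thesis unfolding cone_params.admissible_def[OF cp] using E[OF that] lam0_le by blast
  qed
  have "\<exists>\<eta> \<delta> d K k. \<eta> \<le> \<mu> / 2 \<and> cone_system e lam F L E N \<mu> \<Lambda> \<eta> \<delta> d K k s"
    by (rule cone_system_exists[OF sl cp order(2) _ adm E(1)]) (use mu order in \<open>auto simp: s_def\<close>)
  then obtain \<eta> \<delta> d K k where \<eta>: "\<eta> \<le> \<mu> / 2" and cs: "cone_system e lam F L E N \<mu> \<Lambda> \<eta> \<delta> d K k s" by blast
  have "slow_manifold_family e lam F L E N \<mu> \<Lambda> \<eta> \<delta> d K k s (1 / Q)"
  proof (intro slow_manifold_family.intro slow_manifold.intro cs slow_manifold_axioms.intro slow_manifold_family_axioms.intro mu)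
    show "\<epsilon> \<le> 1 / Q" if "\<epsilon> \<in> E" for \<epsilon> by (rule E(2)[OF that])
    show "semilinear_flow e lam F L \<epsilon>" if "\<epsilon> \<in> E" for \<epsilon> by (rule semilinear_flow_exists[OF sl E(1)[OF that]])
    show "\<eta> < slow_rate \<epsilon> \<mu>" if "\<epsilon> \<in> E" for \<epsilon>
      using slow_rate_ge[OF E(1)[OF that] less_imp_le[OF mu] e\<mu>[OF that]] \<eta> mu by linarith
    show "0 \<in> E" by (simp add: E_def)
    show "4 * \<epsilon> * \<mu> \<le> 1" if "\<epsilon> \<in> E" for \<epsilon> by (rule e\<mu>[OF that])
  qed
  note family = this
  show ?thesis
    by (rule exI, rule conjI[OF ballI[OF slow_manifold.manifold_inertial[OF slow_manifold_family.axioms(1)[OF family]]]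
          slow_manifold_family.manifold_lipschitz_at_zero[OF family]])
qed

end
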